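(* Let $k\ge2$, $w=k(k+1)/2$, $n=w(2w+1)$ and $\tau=\rho(2w-1)$. Then $$g\bigl(\rho(2w),\rho(2w),\tau^{\rho(k-1)}_{(k-1,1)}\bigr)\ge k-1 .$$
   Context: $\rho(j)=(j,j-1,\dots,2,1)$. For partitions, ${}^T$ denotes conjugation and sums are part by part. For $\tau=\rho(j)$ and partitions $\lambda,\mu$ with $\lambda^T_1+\mu_1\le j+1$, $\tau^\lambda_\mu=(\rho(j)+2\mu^T)^T+2\lambda$; here $j=2w-1$, $\lambda=\rho(k-1)$, $\mu=(k-1,1)$, and $\tau^\lambda_\mu$ is a partition of $n$. The Kronecker coefficient $g(\lambda,\mu,\nu)$, for partitions of $n$, is the multiplicity of the irreducible complex character $\chi^\nu$ of $\mathfrak S_n$ in $\chi^\lambda\chi^\mu$. *)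

theory Defs
  imports
    Complex_Main
    "HOL-Library.Function_Algebras"
    "HOL-Combinatorics.Permutations"
begin

section \<open>Partitions\<close>

text \<open>A partition is the weakly decreasing list of its positive parts.\<close>

definition is_partition :: "nat list \<Rightarrow> bool" where
  "is_partition p \<longleftrightarrow> sorted_wrt (\<ge>) p \<and> 0 \<notin> set p"

definition partitions_of :: "nat \<Rightarrow> nat list set" where
  "partitions_of n = {p. is_partition p \<and> sum_list p = n}"

definition part :: "nat list \<Rightarrow> nat \<Rightarrow> nat" where
  "part p i = (if i < length p then p ! i else 0)"

definition partition_add :: "nat list \<Rightarrow> nat list \<Rightarrow> nat list" where
  "partition_add p q = map (\<lambda>i. part p i + part q i) [0..<max (length p) (length q)]"

definition conjugate :: "nat list \<Rightarrow> nat list" where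
  "conjugate p = map (\<lambda>j. card {i. j < part p i}) [0..<part p 0]"

definition staircase :: "nat \<Rightarrow> nat list" where
  "staircase j = rev [1..<Suc j]"

text \<open>
  The partition \<open>\<tau>\<^sup>\<lambda>\<^sub>\<mu>\<close> for \<open>\<tau> = \<rho>(j)\<close>. It is only meant to be used when
  \<open>\<lambda>\<^sup>T\<^sub>1 + \<mu>\<^sub>1 \<le> j + 1\<close>.
\<close>

definition core_extension :: "nat \<Rightarrow> nat list \<Rightarrow> nat list \<Rightarrow> nat list" where
  "core_extension j l m =
     partition_add
       (conjugate (partition_add (staircase j) (map ((*) 2) (conjugate m))))
       (map ((*) 2) l)"

section \<open>Traces on spaces of complex-valued functions\<close>

definition cscale :: "complex \<Rightarrow> ('a \<Rightarrow> complex) \<Rightarrow> 'a \<Rightarrow> complex" where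
  "cscale c f = (\<lambda>x. c * f x)"

global_interpretation cfun: vector_space "cscale :: complex \<Rightarrow> ('a \<Rightarrow> complex) \<Rightarrow> 'a \<Rightarrow> complex"
  by unfold_locales (auto simp: cscale_def fun_eq_iff algebra_simps)

text \<open>
  The trace of a linear map on an invariant finite-dimensional subspace \<open>V\<close>, computed
  in an arbitrarily chosen basis of \<open>V\<close>.
\<close>

definition trace_on ::
    "('a \<Rightarrow> complex) set \<Rightarrow> (('a \<Rightarrow> complex) \<Rightarrow> ('a \<Rightarrow> complex)) \<Rightarrow> complex" where
  "trace_on V F =
     (let B = (SOME B. cfun.independent B \<and> cfun.span B = V)
      in \<Sum>b\<in>B. cfun.representation B (F b) b)"

section \<open>Specht modules and irreducible characters of symmetric groups\<close>

text \<open>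
  The symmetric group \<open>S\<^sub>n\<close> consists of all \<open>s\<close> with \<open>s permutes {..<n}\<close>, and tableaux have
  entries in \<open>{..<n}\<close>. A tabloid is the list of the sets of entries of the rows of a tableau.
\<close>

definition cells :: "nat list \<Rightarrow> (nat \<times> nat) set" where
  "cells p = {(i, j). i < length p \<and> j < p ! i}"

definition tableaux :: "nat list \<Rightarrow> (nat \<times> nat \<Rightarrow> nat) set" where
  "tableaux p = {t. bij_betw t (cells p) {..<sum_list p}}"

definition tabloid :: "nat list \<Rightarrow> (nat \<times> nat \<Rightarrow> nat) \<Rightarrow> nat set list" where
  "tabloid p t = map (\<lambda>i. t ` {c \<in> cells p. fst c = i}) [0..<length p]"

definition column_stabilizer :: "nat list \<Rightarrow> (nat \<times> nat \<Rightarrow> nat) \<Rightarrow> (nat \<Rightarrow> nat) set" where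
  "column_stabilizer p t =
     {s. s permutes {..<sum_list p} \<and>
         (\<forall>j. s ` t ` {c \<in> cells p. snd c = j} = t ` {c \<in> cells p. snd c = j})}"

text \<open>
  A formal complex linear combination of tabloids is the function giving its coefficients.
  In these terms the polytabloid of \<open>t\<close> is \<open>\<Sum>s. sign s \<cdot> s{t}\<close>, with \<open>s\<close> ranging
  over the column stabilizer of \<open>t\<close>.
\<close>

definition polytabloid :: "nat list \<Rightarrow> (nat \<times> nat \<Rightarrow> nat) \<Rightarrow> nat set list \<Rightarrow> complex" where
  "polytabloid p t = (\<lambda>T. \<Sum>s\<in>column_stabilizer p t.
     of_int (sign s) * (if T = map (image s) (tabloid p t) then 1 else 0))"

definition specht :: "nat list \<Rightarrow> (nat set list \<Rightarrow> complex) set" where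
  "specht p = cfun.span (polytabloid p ` tableaux p)"

text \<open>The linear extension of the action \<open>T \<mapsto> sT\<close> on tabloids.\<close>

definition tabloid_action ::
    "(nat \<Rightarrow> nat) \<Rightarrow> (nat set list \<Rightarrow> complex) \<Rightarrow> nat set list \<Rightarrow> complex" where
  "tabloid_action s f = (\<lambda>T. f (map (image (inv s)) T))"

text \<open>
  As \<open>p\<close> runs through the partitions of \<open>n\<close>, the \<open>irr_char p\<close> are the irreducible complex
  characters of \<open>S\<^sub>n\<close>, each occurring once; \<open>irr_char [n]\<close> is the trivial character.
\<close>

definition irr_char :: "nat list \<Rightarrow> (nat \<Rightarrow> nat) \<Rightarrow> complex" where
  "irr_char p s = trace_on (specht p) (tabloid_action s)"

text \<open>
  For a character \<open>\<phi>\<close> of \<open>S\<^sub>n\<close>, the function \<open>m\<close> below gives the multiplicities of the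
  irreducible characters in the (unique) decomposition of \<open>\<phi>\<close>.
\<close>

definition multiplicity_in :: "nat \<Rightarrow> nat list \<Rightarrow> ((nat \<Rightarrow> nat) \<Rightarrow> complex) \<Rightarrow> nat" where
  "multiplicity_in n q \<phi> =
     (THE m :: nat list \<Rightarrow> nat.
        (\<forall>p. p \<notin> partitions_of n \<longrightarrow> m p = 0) \<and>
        (\<forall>s. s permutes {..<n} \<longrightarrow>
           \<phi> s = (\<Sum>p\<in>partitions_of n. of_nat (m p) * irr_char p s))) q"

definition kronecker :: "nat \<Rightarrow> nat list \<Rightarrow> nat list \<Rightarrow> nat list \<Rightarrow> nat" where
  "kronecker n l m q = multiplicity_in n q (\<lambda>s. irr_char l s * irr_char m s)"

end

theory Submission
  imports Defs "HOL-Combinatorics.Orbits"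
begin

text \<open>
  Let \<open>m p\<close> be the multiplicity of \<open>\<chi>\<^sup>p\<close> in the square of the character of \<open>\<rho>(2w)\<close>. A staircase has
  no hook of even length, so by the Murnaghan--Nakayama rule this square vanishes on every permutation
  with an even cycle. Dually, if \<open>m\<close> is indexed by bead vectors and extended antisymmetrically, then
  for every bead vector and every \<open>s \<ge> 1\<close> the sum of the values of \<open>m\<close> over all ways to move one bead
  by \<open>2s\<close> is \<open>0\<close>.

  On the abacus of \<open>\<rho>(2w - 1)\<close> these are relations between power sums in the shifts of the odd and of
  the even beads. By Newton's identities a complete homogeneous sum over the even beads equals, up to
  sign, an elementary symmetric sum over the odd ones. Up to sign this rewrites \<open>m\<close> at
  \<open>\<tau>\<^sup>\<lambda>\<^sub>\<mu>\<close> with \<open>\<lambda> = \<rho>(k - 1)\<close>, \<open>\<mu> = (k - 1, 1)\<close> as the sum over all ways to add first a vertical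
  strip of size \<open>k - 1\<close> and then a box to \<open>\<rho>(k - 1)\<close>, minus the sum over vertical strips of size \<open>k\<close>.
  Each strip of size \<open>k\<close> arises from at least one such pair, and the strip leading to \<open>\<rho>(k)\<close> from
  \<open>k\<close> of them, so the value is at least \<open>(k - 1) m \<nu>\<close> with \<open>\<nu> = \<rho>(2w - 1) + 2 \<rho>(k)\<close>.

  Finally \<open>m \<nu> \<ge> 1\<close>: a column-strict filling of \<open>\<nu>\<close> with content \<open>\<rho>(2w)\<close> yields a non-zero invariant of
  the triple tensor product of Specht modules, because a staircase tableau whose rows and columns all
  carry initial segments of labels is constant on diagonals, which leaves a single term.
\<close>

section \<open>Traces of linear maps\<close>

text \<open>Moves by 2s preserve the parity of a bead, so each relation splits into a power sum over
  the odd beads and one over the even beads. The value of w makes \<nu> a partition of n: \<rho>(2w)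
  has 2w = k(k + 1) boxes more than \<rho>(2w - 1), which is the size of 2\<rho>(k). The
  Murnaghan--Nakayama rule is not derived inside Specht modules. It is immediate for a Jacobi--Trudi
  determinant of permutation characters, because an invariant colouring gives one colour to a whole
  cycle. The determinant is identified with the Specht character by inner products, which only needs
  the triangularity of Kostka numbers: for Specht modules it comes from symmetrised polytabloids,
  for determinants from a sign-reversing involution. Bead vectors with integer entries replace
  partitions so that hooks and their signs are absorbed by antisymmetry. The dual relation rests on
  the independence of the irreducible characters, and the existence of multiplicities on their
  completeness; so both are proved.\<close>

definition lin :: "(('a \<Rightarrow> complex) \<Rightarrow> ('b \<Rightarrow> complex)) \<Rightarrow> bool" where
  "lin F \<longleftrightarrow> (\<forall>f g. F (f + g) = F f + F g) \<and> (\<forall>c f. F (cscale c f) = cscale c (F f))"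

lemma lin_zero: "lin F \<Longrightarrow> F 0 = 0"
proof -
  assume "lin F"
  then have "F (cscale 0 0) = cscale 0 (F 0)" unfolding lin_def by blast
  then show ?thesis by simp
qed

lemma lin_add: "lin F \<Longrightarrow> F (f + g) = F f + F g"
  and lin_scale: "lin F \<Longrightarrow> F (cscale c f) = cscale c (F f)"
  by (simp_all add: lin_def)

lemma lin_sum: "lin F \<Longrightarrow> F (\<Sum>i\<in>I. f i) = (\<Sum>i\<in>I. F (f i))"
  by (induction I rule: infinite_finite_induct) (auto simp: lin_zero lin_add)

lemma sum_fun_apply: "(\<Sum>i\<in>I. f i) x = (\<Sum>i\<in>I. f i x)"
  by (induction I rule: infinite_finite_induct) auto

text \<open>Tabloids range over an infinite type, so the ambient function space is
  infinite-dimensional and finiteness has to be recorded for each subspace.\<close>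

definition fin_dim :: "('a \<Rightarrow> complex) set \<Rightarrow> bool" where
  "fin_dim V \<longleftrightarrow> (\<exists>S. finite S \<and> V \<subseteq> cfun.span S)"

lemma fin_dim_independent_finite:
  "fin_dim V \<Longrightarrow> cfun.independent B \<Longrightarrow> B \<subseteq> V \<Longrightarrow> finite B"
  unfolding fin_dim_def using cfun.independent_span_bound by blast

lemma fin_dim_mono: "fin_dim W \<Longrightarrow> V \<subseteq> W \<Longrightarrow> fin_dim V"
  unfolding fin_dim_def by blast

lemma fin_dim_basis:
  assumes "fin_dim V"
  obtains B where "B \<subseteq> V" "finite B" "cfun.independent B" "V \<subseteq> cfun.span B" "card B = cfun.dim V"
  using cfun.basis_exists[of V] fin_dim_independent_finite[OF assms] by metis

lemma dim_pos:
  assumes "fin_dim V" "f \<in> V" "f \<noteq> 0"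
  shows "cfun.dim V \<ge> 1"
proof -
  obtain B where B: "B \<subseteq> V" "finite B" "cfun.independent B" "V \<subseteq> cfun.span B" "card B = cfun.dim V"
    using fin_dim_basis[OF assms(1)] .
  have "B \<noteq> {}" using B(4) assms(2,3) by auto
  with B(2,5) show ?thesis by (metis Suc_leI card_gt_0_iff One_nat_def)
qed

text \<open>The basis chosen by \<open>trace_on\<close> depends on V alone, so one B serves all maps
  F. This makes the trace additive in F.\<close>

lemma trace_on_obtain:
  assumes "cfun.subspace V" "fin_dim V"
  obtains B where "cfun.independent B" "finite B" "cfun.span B = V"
    "\<And>F. trace_on V F = (\<Sum>b\<in>B. cfun.representation B (F b) b)"
proof -
  let ?B = "SOME B. cfun.independent B \<and> cfun.span B = V"
  obtain B where "B \<subseteq> V" "cfun.independent B" "V \<subseteq> cfun.span B"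
    using cfun.maximal_independent_subset[of V] by blast
  then have "cfun.independent B \<and> cfun.span B = V"
    using cfun.span_subspace assms(1) by blast
  then have *: "cfun.independent ?B \<and> cfun.span ?B = V" by (rule someI)
  have "finite ?B"
    using fin_dim_independent_finite[OF assms(2)] * cfun.span_superset by blast
  then show ?thesis
    using * by (intro that[of ?B]) (auto simp: trace_on_def Let_def)
qed

text \<open>Facts \<open>1\<close> and \<open>2\<close> write the diagonal entries of F by
  coefficients of each basis in the other; \<open>3\<close> says that the two transition matrices
  are inverse, which collapses the triple sum to the trace over C.\<close>

lemma trace_basis_change:
  assumes B: "cfun.independent B" "finite B" and C: "cfun.independent C" "finite C"
    and eq: "cfun.span B = cfun.span C"
    and F: "lin F" "\<And>f. f \<in> cfun.span B \<Longrightarrow> F f \<in> cfun.span B"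
  shows "(\<Sum>b\<in>B. cfun.representation B (F b) b) = (\<Sum>c\<in>C. cfun.representation C (F c) c)"
proof -
  let ?r = "cfun.representation B" and ?q = "cfun.representation C"
  have Fs: "F f \<in> cfun.span C" if "f \<in> cfun.span C" for f using F(2) that eq by auto
  have expC: "(\<Sum>c\<in>C. cscale (?q f c) c) = f" if "f \<in> cfun.span C" for f
    by (rule cfun.sum_representation_eq[OF C(1) that C(2)]) simp
  have expB: "(\<Sum>b\<in>B. cscale (?r f b) b) = f" if "f \<in> cfun.span C" for f
    by (rule cfun.sum_representation_eq[OF B(1)]) (use that eq B in auto)
  have inC: "c \<in> cfun.span C" if "c \<in> C" for c using that by (rule cfun.span_base)
  have inB: "b \<in> cfun.span C" if "b \<in> B" for b using that cfun.span_base eq by blast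
  have linr: "?r (\<Sum>c\<in>C. cscale (a c) (g c)) b = (\<Sum>c\<in>C. a c * ?r (g c) b)"
    if "\<And>c. c \<in> C \<Longrightarrow> g c \<in> cfun.span C" for a g b
    using that eq B(1)
    by (subst cfun.representation_sum) (auto intro!: cfun.span_scale simp: cfun.representation_scale)
  have linq: "?q (\<Sum>i\<in>I. cscale (a i) (g i)) c = (\<Sum>i\<in>I. a i * ?q (g i) c)"
    if "\<And>i. i \<in> I \<Longrightarrow> g i \<in> cfun.span C" for a g c and I :: "('a \<Rightarrow> complex) set"
    using that C(1)
    by (subst cfun.representation_sum) (auto intro!: cfun.span_scale simp: cfun.representation_scale)
  have 1: "?r (F b) b = (\<Sum>c\<in>C. ?q (F b) c * ?r c b)" if "b \<in> B" for b
    using linr[of "\<lambda>c. c" "?q (F b)" b, OF inC] expC[OF Fs[OF inB[OF that]]] by simp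
  have 2: "?q (F b) c = (\<Sum>d\<in>C. ?q b d * ?q (F d) c)" if "b \<in> B" for b c
  proof -
    have "F b = F (\<Sum>d\<in>C. cscale (?q b d) d)" using expC[OF inB[OF that]] by simp
    also have "\<dots> = (\<Sum>d\<in>C. cscale (?q b d) (F d))"
      using F(1) by (simp add: lin_sum) (simp add: lin_def)
    finally show ?thesis using linq[of C F "?q b" c] Fs inC by simp
  qed
  have 3: "(\<Sum>b\<in>B. ?r c b * ?q b d) = (if d = c then 1 else 0)" if "c \<in> C" for c d
    using linq[of B "\<lambda>b. b" "?r c" d, OF inB] expB[OF inC[OF that]]
    by (simp add: cfun.representation_basis[OF C(1) that])
  have "(\<Sum>b\<in>B. ?r (F b) b) = (\<Sum>b\<in>B. \<Sum>c\<in>C. \<Sum>d\<in>C. ?q (F d) c * (?r c b * ?q b d))"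
    by (intro sum.cong refl) (simp add: 1 2 sum_distrib_left sum_distrib_right mult_ac)
  also have "\<dots> = (\<Sum>c\<in>C. \<Sum>d\<in>C. \<Sum>b\<in>B. ?q (F d) c * (?r c b * ?q b d))"
  proof -
    have "(\<Sum>b\<in>B. \<Sum>c\<in>C. \<Sum>d\<in>C. ?q (F d) c * (?r c b * ?q b d)) =
          (\<Sum>c\<in>C. \<Sum>b\<in>B. \<Sum>d\<in>C. ?q (F d) c * (?r c b * ?q b d))" by (rule sum.swap)
    also have "\<dots> = (\<Sum>c\<in>C. \<Sum>d\<in>C. \<Sum>b\<in>B. ?q (F d) c * (?r c b * ?q b d))"
      by (intro sum.cong refl sum.swap)
    finally show ?thesis .
  qed
  also have "\<dots> = (\<Sum>c\<in>C. \<Sum>d\<in>C. if d = c then ?q (F d) c else 0)"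
    by (intro sum.cong refl) (simp add: sum_distrib_left[symmetric] 3)
  also have "\<dots> = (\<Sum>c\<in>C. ?q (F c) c)" using C(2) by simp
  finally show ?thesis .
qed

lemma trace_on_eq:
  assumes "fin_dim V" "cfun.independent B" "cfun.span B = V"
    and "lin F" "\<And>f. f \<in> V \<Longrightarrow> F f \<in> V"
  shows "trace_on V F = (\<Sum>b\<in>B. cfun.representation B (F b) b)"
proof -
  have sV: "cfun.subspace V" using assms(3) cfun.subspace_span by blast
  obtain C where C: "cfun.independent C" "finite C" "cfun.span C = V"
    "\<And>F. trace_on V F = (\<Sum>b\<in>C. cfun.representation C (F b) b)"
    using trace_on_obtain[OF sV assms(1)] by metis
  have "finite B"
    using fin_dim_independent_finite[OF assms(1,2)] assms(3) cfun.span_superset by blast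
  then show ?thesis
    using trace_basis_change[of C B F] C assms by simp
qed

text \<open>A basis C of the fixed vectors is extended to a basis of V. Every image P b lies in the
  span of C, so basis vectors outside C contribute 0 to the trace and those in C contribute
  1.\<close>

lemma trace_projection:
  assumes V: "cfun.subspace V" "fin_dim V" and P: "lin P" "\<And>f. f \<in> V \<Longrightarrow> P f \<in> V"
    "\<And>f. f \<in> V \<Longrightarrow> P (P f) = P f"
  shows "trace_on V P = of_nat (cfun.dim {f \<in> V. P f = f})"
proof -
  let ?W = "{f \<in> V. P f = f}"
  obtain C where C: "C \<subseteq> ?W" "cfun.independent C" "?W \<subseteq> cfun.span C"
    using cfun.maximal_independent_subset[of ?W] by blast
  obtain B where B: "C \<subseteq> B" "B \<subseteq> V" "cfun.independent B" "V \<subseteq> cfun.span B"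
    using cfun.maximal_independent_subset_extend[of C V] C by blast
  have span: "cfun.span B = V" using cfun.span_subspace B V(1) by blast
  have finB: "finite B" using fin_dim_independent_finite[OF V(2) B(3,2)] .
  have "trace_on V P = (\<Sum>b\<in>B. cfun.representation B (P b) b)"
    by (rule trace_on_eq[OF V(2) B(3) span P(1,2)])
  also have "\<dots> = (\<Sum>b\<in>B. if b \<in> C then 1 else 0)"
  proof (intro sum.cong refl)
    fix b assume b: "b \<in> B"
    show "cfun.representation B (P b) b = (if b \<in> C then 1 else 0)"
    proof (cases "b \<in> C")
      case True
      then have "P b = b" using C by auto
      with True show ?thesis using cfun.representation_basis[OF B(3) b] by simp
    next
      case False
      have "P b \<in> cfun.span C" using C(3) P b B(2) by auto
      then have "cfun.representation B (P b) = cfun.representation C (P b)"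
        using cfun.representation_extend[OF B(3) _ B(1)] by blast
      then show ?thesis using False cfun.representation_ne_zero[of C "P b" b] by auto
    qed
  qed
  also have "\<dots> = of_nat (card C)"
    using finB B(1) by (simp add: sum.If_cases Int_absorb1)
  also have "card C = cfun.dim ?W" using cfun.basis_card_eq_dim C by blast
  finally show ?thesis .
qed

section \<open>Group actions on functions\<close>

definition perm_group :: "('b \<Rightarrow> 'b) set \<Rightarrow> bool" where
  "perm_group H \<longleftrightarrow> finite H \<and> id \<in> H \<and> (\<forall>g\<in>H. bij g) \<and> (\<forall>g\<in>H. \<forall>h\<in>H. g \<circ> h \<in> H)"

lemma perm_group_left:
  assumes "perm_group H" "h \<in> H"
  shows "bij_betw (\<lambda>g. h \<circ> g) H H"
proof -
  have "inj_on (\<lambda>g. h \<circ> g) H"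
  proof (rule inj_onI)
    fix g g' assume eq: "h \<circ> g = h \<circ> g'"
    have "inj h" using assms by (auto simp: perm_group_def bij_is_inj)
    then show "g = g'" using eq by (auto simp: fun_eq_iff inj_eq)
  qed
  moreover have "(\<lambda>g. h \<circ> g) ` H \<subseteq> H" using assms by (auto simp: perm_group_def)
  moreover have "finite H" using assms by (simp add: perm_group_def)
  ultimately show ?thesis by (simp add: bij_betw_def endo_inj_surj)
qed

lemma perm_group_right:
  assumes "perm_group H" "h \<in> H"
  shows "bij_betw (\<lambda>g. g \<circ> h) H H"
proof -
  have "inj_on (\<lambda>g. g \<circ> h) H"
  proof (rule inj_onI)
    fix g g' assume eq: "g \<circ> h = g' \<circ> h"
    have "surj h" using assms by (auto simp: perm_group_def bij_is_surj)
    then show "g = g'" using eq by (metis comp_assoc comp_id surj_iff)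
  qed
  moreover have "(\<lambda>g. g \<circ> h) ` H \<subseteq> H" using assms by (auto simp: perm_group_def)
  moreover have "finite H" using assms by (simp add: perm_group_def)
  ultimately show ?thesis by (simp add: bij_betw_def endo_inj_surj)
qed

lemma perm_group_sum_left:
  "perm_group H \<Longrightarrow> h \<in> H \<Longrightarrow> (\<Sum>g\<in>H. F (h \<circ> g)) = (\<Sum>g\<in>H. F g)"
  using sum.reindex_bij_betw[OF perm_group_left, of H h F] by simp

lemma perm_group_sum_right:
  "perm_group H \<Longrightarrow> h \<in> H \<Longrightarrow> (\<Sum>g\<in>H. F (g \<circ> h)) = (\<Sum>g\<in>H. F g)"
  using sum.reindex_bij_betw[OF perm_group_right, of H h F] by simp

text \<open>Left multiplication by h is an injective map of the finite set H into itself, so it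
  takes the value \<open>id\<close>.\<close>

lemma perm_group_inv:
  assumes "perm_group H" "h \<in> H" shows "inv h \<in> H"
proof -
  obtain g where g: "g \<in> H" "h \<circ> g = id"
    using perm_group_left[OF assms] assms(1) unfolding bij_betw_def perm_group_def
    by (metis (no_types, lifting) imageE)
  have "bij h" using assms by (auto simp: perm_group_def)
  then have "g x = inv h x" for x
    using g(2) by (metis bij_inv_eq_iff comp_apply id_apply)
  then have "g = inv h" by auto
  with g show ?thesis by simp
qed

definition perm_action :: "(('b \<Rightarrow> 'b) \<Rightarrow> 'a \<Rightarrow> 'a) \<Rightarrow> bool" where
  "perm_action act \<longleftrightarrow> act id = id \<and> (\<forall>g h. act (g \<circ> h) = act g \<circ> act h)"

definition lift :: "(('b \<Rightarrow> 'b) \<Rightarrow> 'a \<Rightarrow> 'a) \<Rightarrow> ('b \<Rightarrow> 'b) \<Rightarrow> ('a \<Rightarrow> complex) \<Rightarrow> 'a \<Rightarrow> complex" where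
  "lift act g f = (\<lambda>x. f (act (inv g) x))"

lemma lin_lift: "lin (lift act g)"
  by (auto simp: lin_def lift_def cscale_def fun_eq_iff)

lemma lift_comp:
  "perm_action act \<Longrightarrow> bij g \<Longrightarrow> bij h \<Longrightarrow> lift act (g \<circ> h) f = lift act g (lift act h f)"
  by (simp add: lift_def perm_action_def o_inv_distrib)

definition fixed_space ::
  "('b \<Rightarrow> 'b) set \<Rightarrow> (('b \<Rightarrow> 'b) \<Rightarrow> 'a \<Rightarrow> 'a) \<Rightarrow> ('a \<Rightarrow> complex) set \<Rightarrow> ('a \<Rightarrow> complex) set" where
  "fixed_space H act V = {f \<in> V. \<forall>g\<in>H. lift act g f = f}"

lemma lift_sum_fixed:
  assumes "perm_group H" "perm_action act" "g \<in> H"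
  shows "lift act g (\<Sum>h\<in>H. lift act h f) = (\<Sum>h\<in>H. lift act h f)"
proof -
  have "lift act g (\<Sum>h\<in>H. lift act h f) = (\<Sum>h\<in>H. lift act (g \<circ> h) f)"
    using assms by (simp add: lin_sum[OF lin_lift] perm_group_def lift_comp)
  also have "\<dots> = (\<Sum>h\<in>H. lift act h f)" by (rule perm_group_sum_left[OF assms(1,3)])
  finally show ?thesis .
qed

text \<open>The average over H is a projection onto the invariants. Its trace is the dimension of
  its image and also the average of the traces.\<close>

theorem sum_trace_lift:
  assumes H: "perm_group H" and act: "perm_action act"
    and V: "cfun.subspace V" "fin_dim V" "\<And>g f. g \<in> H \<Longrightarrow> f \<in> V \<Longrightarrow> lift act g f \<in> V"
  shows "(\<Sum>g\<in>H. trace_on V (lift act g)) = of_nat (card H) * of_nat (cfun.dim (fixed_space H act V))"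
proof -
  define c where "c = (of_nat (card H) :: complex)"
  have c: "c \<noteq> 0" using H by (auto simp: c_def perm_group_def card_eq_0_iff)
  define P where "P f = cscale (1/c) (\<Sum>g\<in>H. lift act g f)" for f
  have linP: "lin P"
    unfolding lin_def P_def lift_def cscale_def
    by (auto simp: fun_eq_iff sum_fun_apply sum.distrib ring_distribs sum_distrib_left mult.left_commute
        simp del: sum_divide_distrib)
  have PV: "P f \<in> V" if "f \<in> V" for f
    unfolding P_def using V that by (auto intro!: cfun.subspace_scale cfun.subspace_sum)
  have fixP: "lift act g (P f) = P f" if "g \<in> H" for g f
  proof -
    have "lift act g (P f) = cscale (1/c) (lift act g (\<Sum>g\<in>H. lift act g f))"
      unfolding P_def by (rule lin_scale[OF lin_lift])
    then show ?thesis using lift_sum_fixed[OF H act that] by (simp add: P_def)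
  qed
  have Pfix: "P f = f" if "\<And>g. g \<in> H \<Longrightarrow> lift act g f = f" for f
  proof -
    have "(\<Sum>g\<in>H. lift act g f) = (\<Sum>g\<in>H. f)" by (rule sum.cong) (use that in auto)
    then show ?thesis using c by (simp add: P_def c_def cscale_def fun_eq_iff sum_fun_apply)
  qed
  have "{f \<in> V. P f = f} = fixed_space H act V"
    unfolding fixed_space_def
  proof (intro Collect_cong conj_cong refl iffI ballI)
    fix f g assume "P f = f" "g \<in> H"
    then show "lift act g f = f" using fixP[of g f] by simp
  next
    fix f assume "\<forall>g\<in>H. lift act g f = f"
    then show "P f = f" by (intro Pfix) simp
  qed
  moreover have "P (P f) = P f" for f by (intro Pfix fixP)
  ultimately have 1: "trace_on V P = of_nat (cfun.dim (fixed_space H act V))"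
    using trace_projection[OF V(1,2) linP PV] by simp
  obtain B where B: "cfun.independent B" "finite B" "cfun.span B = V"
    "\<And>F. trace_on V F = (\<Sum>b\<in>B. cfun.representation B (F b) b)"
    using trace_on_obtain[OF V(1,2)] by metis
  have inV: "lift act g b \<in> V" if "g \<in> H" "b \<in> B" for g b
    using that V(3) B(3) cfun.span_base by blast
  have "trace_on V P = (\<Sum>b\<in>B. (1/c) * (\<Sum>g\<in>H. cfun.representation B (lift act g b) b))"
    unfolding B(4) P_def
  proof (intro sum.cong refl)
    fix b assume "b \<in> B"
    then have "lift act g b \<in> cfun.span B" if "g \<in> H" for g using inV that B(3) by simp
    then show "cfun.representation B (cscale (1 / c) (\<Sum>g\<in>H. lift act g b)) b =
        1 / c * (\<Sum>g\<in>H. cfun.representation B (lift act g b) b)"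
      using B(1) by (simp add: cfun.representation_scale cfun.span_sum cfun.representation_sum)
  qed
  also have "\<dots> = (1/c) * (\<Sum>g\<in>H. trace_on V (lift act g))"
    unfolding B(4) sum_distrib_left by (rule sum.swap)
  finally have *: "trace_on V P = (1/c) * (\<Sum>g\<in>H. trace_on V (lift act g))" .
  have "(\<Sum>g\<in>H. trace_on V (lift act g)) = c * trace_on V P"
    unfolding * using c by (simp only: mult.assoc[symmetric]) simp
  also have "c * trace_on V P = of_nat (card H) * of_nat (cfun.dim (fixed_space H act V))"
    unfolding 1 c_def by (rule refl)
  finally show ?thesis .
qed

section \<open>Tensor products\<close>

definition tp :: "('a \<Rightarrow> complex) \<Rightarrow> ('b \<Rightarrow> complex) \<Rightarrow> 'a \<times> 'b \<Rightarrow> complex" where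
  "tp f g = (\<lambda>(x, y). f x * g y)"

definition tens :: "('a \<Rightarrow> complex) set \<Rightarrow> ('b \<Rightarrow> complex) set \<Rightarrow> ('a \<times> 'b \<Rightarrow> complex) set" where
  "tens V W = cfun.span (case_prod tp ` (V \<times> W))"

lemma tp_in_tens: "f \<in> V \<Longrightarrow> g \<in> W \<Longrightarrow> tp f g \<in> tens V W"
  unfolding tens_def by (rule cfun.span_base) auto

lemma subspace_tens: "cfun.subspace (tens V W)"
  by (simp add: tens_def)

lemma tp_sums:
  "tp (\<Sum>b\<in>B. cscale (r b) b) (\<Sum>c\<in>C. cscale (q c) c) =
   (\<Sum>(b, c)\<in>B \<times> C. cscale (r b * q c) (tp b c))"
  by (auto simp: fun_eq_iff tp_def sum_fun_apply cscale_def sum_product sum.cartesian_product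
      case_prod_unfold mult_ac intro!: sum.cong)

text \<open>A linear relation evaluated at a fixed second argument y is a relation over B, so its
  coefficients vanish; as y varies, these coefficients form a relation over C.\<close>

lemma tens_basis:
  assumes B: "cfun.independent B" "finite B" "cfun.span B = V"
    and C: "cfun.independent C" "finite C" "cfun.span C = W"
  shows "inj_on (case_prod tp) (B \<times> C)" "cfun.independent (case_prod tp ` (B \<times> C))"
    "cfun.span (case_prod tp ` (B \<times> C)) = tens V W"
proof -
  have zero: "a b c = 0"
    if "(\<Sum>(b, c)\<in>B \<times> C. cscale (a b c) (tp b c)) = 0" "b \<in> B" "c \<in> C" for a b c
  proof -
    have *: "(\<Sum>b\<in>B. cscale (\<Sum>c\<in>C. a b c * c y) b) = 0" for y
    proof
      fix x
      have "(\<Sum>b\<in>B. cscale (\<Sum>c\<in>C. a b c * c y) b) x =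
            (\<Sum>(b, c)\<in>B \<times> C. cscale (a b c) (tp b c)) (x, y)"
        by (simp add: sum_fun_apply cscale_def tp_def sum_distrib_left sum_distrib_right
            sum.cartesian_product case_prod_unfold mult_ac)
      then show "(\<Sum>b\<in>B. cscale (\<Sum>c\<in>C. a b c * c y) b) x = 0 x" using that(1) by simp
    qed
    have "(\<Sum>c\<in>C. a b c * c y) = 0" for y
      by (rule cfun.independentD[OF B(1,2) order_refl *[of y] that(2)])
    then have "(\<Sum>c\<in>C. cscale (a b c) c) = 0"
      by (auto simp: fun_eq_iff sum_fun_apply cscale_def)
    then show ?thesis by (rule cfun.independentD[OF C(1,2) order_refl _ that(3)])
  qed
  show inj: "inj_on (case_prod tp) (B \<times> C)"
  proof (rule inj_onI, rule ccontr)
    fix u v assume u: "u \<in> B \<times> C" and v: "v \<in> B \<times> C" and eq: "case_prod tp u = case_prod tp v"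
      and ne: "u \<noteq> v"
    \<comment> \<open>Two pairs with the same product would give a relation with coefficients 1 and
      -1.\<close>
    let ?a = "\<lambda>b c. (if (b, c) = u then 1 else 0) - (if (b, c) = v then 1 else (0::complex))"
    have "(\<Sum>(b, c)\<in>B \<times> C. cscale (?a b c) (tp b c)) =
        (\<Sum>x\<in>B \<times> C. (if x = u then case_prod tp u else 0) - (if x = v then case_prod tp v else 0))"
      by (intro sum.cong refl) (auto simp: cscale_def fun_eq_iff)
    also have "\<dots> = 0" using u v eq B(2) C(2) by (simp add: sum_subtractf)
    finally have z: "(\<Sum>(b, c)\<in>B \<times> C. cscale (?a b c) (tp b c)) = 0" .
    have "?a (fst u) (snd u) = 0" by (rule zero[OF z]) (use u in auto)
    then show False using ne by (simp split: if_splits)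
  qed
  show "cfun.independent (case_prod tp ` (B \<times> C))"
  proof (rule cfun.independent_if_scalars_zero)
    show "finite (case_prod tp ` (B \<times> C))" using B C by simp
    fix f x assume s: "(\<Sum>x\<in>case_prod tp ` (B \<times> C). cscale (f x) x) = 0"
      and x: "x \<in> case_prod tp ` (B \<times> C)"
    obtain b c where bc: "b \<in> B" "c \<in> C" "x = tp b c" using x by auto
    have "(\<Sum>(b, c)\<in>B \<times> C. cscale (f (tp b c)) (tp b c)) = 0"
      using s by (subst (asm) sum.reindex[OF inj]) (simp add: case_prod_unfold comp_def)
    from zero[OF this bc(1,2)] bc(3) show "f x = 0" by simp
  qed
  have tpin: "tp f g \<in> cfun.span (case_prod tp ` (B \<times> C))" if "f \<in> V" "g \<in> W" for f g
  proof -
    have f: "(\<Sum>b\<in>B. cscale (cfun.representation B f b) b) = f"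
      by (rule cfun.sum_representation_eq) (use B that in auto)
    have g: "(\<Sum>c\<in>C. cscale (cfun.representation C g c) c) = g"
      by (rule cfun.sum_representation_eq) (use C that in auto)
    have "tp f g = (\<Sum>(b, c)\<in>B \<times> C.
        cscale (cfun.representation B f b * cfun.representation C g c) (tp b c))"
      using tp_sums[of "cfun.representation B f" B "cfun.representation C g" C] unfolding f g .
    also have "\<dots> \<in> cfun.span (case_prod tp ` (B \<times> C))"
      by (rule cfun.span_sum, clarsimp, rule cfun.span_scale, rule cfun.span_base, force)
    finally show ?thesis .
  qed
  show "cfun.span (case_prod tp ` (B \<times> C)) = tens V W"
    unfolding tens_def
  proof (rule antisym)
    show "cfun.span (case_prod tp ` (B \<times> C)) \<subseteq> cfun.span (case_prod tp ` (V \<times> W))"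
      using cfun.span_superset[of B] cfun.span_superset[of C] unfolding B(3) C(3)
      by (intro cfun.span_mono image_mono Sigma_mono)
    show "cfun.span (case_prod tp ` (V \<times> W)) \<subseteq> cfun.span (case_prod tp ` (B \<times> C))"
    proof (rule cfun.span_minimal[OF _ cfun.subspace_span], rule image_subsetI)
      fix x assume "x \<in> V \<times> W"
      then show "case_prod tp x \<in> cfun.span (case_prod tp ` (B \<times> C))"
        using tpin[of "fst x" "snd x"] by (simp add: case_prod_unfold mem_Times_iff)
    qed
  qed
qed

lemma fin_dim_obtain:
  assumes "cfun.subspace V" "fin_dim V"
  obtains B where "cfun.independent B" "finite B" "cfun.span B = V"
  using trace_on_obtain[OF assms] by metis

lemma fin_dim_tens:
  assumes "cfun.subspace V" "fin_dim V" "cfun.subspace W" "fin_dim W"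
  shows "fin_dim (tens V W)"
proof -
  obtain B where B: "cfun.independent B" "finite B" "cfun.span B = V"
    using fin_dim_obtain[OF assms(1,2)] .
  obtain C where C: "cfun.independent C" "finite C" "cfun.span C = W"
    using fin_dim_obtain[OF assms(3,4)] .
  show ?thesis unfolding fin_dim_def tens_basis(3)[OF B C, symmetric]
    by (intro exI[of _ "case_prod tp ` (B \<times> C)"]) (simp add: B C)
qed

lemma tens_closed:
  assumes "lin FF" "\<And>f g. f \<in> V \<Longrightarrow> g \<in> W \<Longrightarrow> FF (tp f g) \<in> tens V W" "h \<in> tens V W"
  shows "FF h \<in> tens V W"
  using assms(3) unfolding tens_def
proof (induction rule: cfun.span_induct_alt)
  case base
  show ?case unfolding lin_zero[OF assms(1)] by (rule cfun.span_zero)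
next
  case (step c x y)
  obtain f g where fg: "x = tp f g" "f \<in> V" "g \<in> W" using step.hyps by auto
  have eq: "FF (cscale c x + y) = cscale c (FF x) + FF y" using assms(1) by (simp only: lin_def)
  have "FF x \<in> cfun.span (case_prod tp ` (V \<times> W))" 
    unfolding fg(1) tens_def[symmetric] by (rule assms(2)[OF fg(2,3)])
  then show ?case unfolding eq using step.IH by (intro cfun.span_add cfun.span_scale)
qed

lemma trace_tens:
  assumes V: "cfun.subspace V" "fin_dim V" "\<And>f. f \<in> V \<Longrightarrow> F f \<in> V"
    and W: "cfun.subspace W" "fin_dim W" "\<And>f. f \<in> W \<Longrightarrow> F' f \<in> W"
    and FF: "lin FF" "\<And>f g. FF (tp f g) = tp (F f) (F' g)"
  shows "trace_on (tens V W) FF = trace_on V F * trace_on W F'"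
proof -
  obtain B where B: "cfun.independent B" "finite B" "cfun.span B = V"
    "\<And>F. trace_on V F = (\<Sum>b\<in>B. cfun.representation B (F b) b)"
    using trace_on_obtain[OF V(1,2)] by metis
  obtain C where C: "cfun.independent C" "finite C" "cfun.span C = W"
    "\<And>F. trace_on W F = (\<Sum>b\<in>C. cfun.representation C (F b) b)"
    using trace_on_obtain[OF W(1,2)] by metis
  let ?BC = "case_prod tp ` (B \<times> C)"
  note bas = tens_basis[OF B(1-3) C(1-3)]
  have closed: "FF h \<in> tens V W" if "h \<in> tens V W" for h
    by (rule tens_closed[OF FF(1) _ that], unfold FF(2), intro tp_in_tens V(3) W(3))
  have rep: "cfun.representation ?BC (FF (tp b c)) (tp b c) =
      cfun.representation B (F b) b * cfun.representation C (F' c) c" if bc: "b \<in> B" "c \<in> C" for b c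
  proof -
    let ?r = "cfun.representation B (F b)" and ?q = "cfun.representation C (F' c)"
    have "F b \<in> V" "F' c \<in> W" using bc V(3) W(3) B(3) C(3) cfun.span_base by blast+
    then have eF: "(\<Sum>x\<in>B. cscale (?r x) x) = F b" "(\<Sum>x\<in>C. cscale (?q x) x) = F' c"
      using B C by (auto intro!: cfun.sum_representation_eq)
    have "FF (tp b c) = (\<Sum>x\<in>B \<times> C. cscale (?r (fst x) * ?q (snd x)) (case_prod tp x))"
      unfolding FF(2) using tp_sums[of ?r B ?q C] unfolding eF by (simp add: case_prod_unfold)
    then have "cfun.representation ?BC (FF (tp b c)) (tp b c) =
      (\<Sum>x\<in>B \<times> C. ?r (fst x) * ?q (snd x) * cfun.representation ?BC (case_prod tp x) (tp b c))"
      using bas(2)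
      by (simp add: cfun.representation_sum cfun.representation_scale cfun.span_scale cfun.span_base)
    also have "\<dots> = (\<Sum>x\<in>B \<times> C. if x = (b, c) then ?r b * ?q c else 0)"
    proof (intro sum.cong refl)
      fix x assume x: "x \<in> B \<times> C"
      have "tp b c = case_prod tp x \<longleftrightarrow> x = (b, c)"
        using inj_onD[OF bas(1), of x "(b, c)"] x bc by auto
      then show "?r (fst x) * ?q (snd x) * cfun.representation ?BC (case_prod tp x) (tp b c) =
          (if x = (b, c) then ?r b * ?q c else 0)"
        using cfun.representation_basis[OF bas(2), of "case_prod tp x"] x by auto
    qed
    also have "\<dots> = ?r b * ?q c" using B(2) C(2) bc by simp
    finally show ?thesis .
  qed
  have "trace_on (tens V W) FF = (\<Sum>x\<in>?BC. cfun.representation ?BC (FF x) x)"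
    by (rule trace_on_eq[OF fin_dim_tens[OF V(1,2) W(1,2)] bas(2,3) FF(1) closed])
  also have "\<dots> = (\<Sum>x\<in>B \<times> C. cfun.representation B (F (fst x)) (fst x) * cfun.representation C (F' (snd x)) (snd x))"
    by (subst sum.reindex[OF bas(1)]) (auto intro!: sum.cong simp: rep)
  also have "\<dots> = trace_on V F * trace_on W F'"
    unfolding B(4) C(4) by (simp add: sum_product sum.cartesian_product case_prod_unfold)
  finally show ?thesis .
qed

definition pact :: "(('b \<Rightarrow> 'b) \<Rightarrow> 'a \<Rightarrow> 'a) \<Rightarrow> (('b \<Rightarrow> 'b) \<Rightarrow> 'c \<Rightarrow> 'c) \<Rightarrow> ('b \<Rightarrow> 'b) \<Rightarrow> 'a \<times> 'c \<Rightarrow> 'a \<times> 'c" where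
  "pact act act' g = map_prod (act g) (act' g)"

lemma perm_action_pact: "perm_action act \<Longrightarrow> perm_action act' \<Longrightarrow> perm_action (pact act act')"
  by (auto simp: perm_action_def pact_def fun_eq_iff)

lemma lift_tp: "lift (pact act act') g (tp f f') = tp (lift act g f) (lift act' g f')"
  by (auto simp: lift_def pact_def tp_def fun_eq_iff)

lemma fin_dim_support:
  assumes "finite S"
  shows "fin_dim {f. \<forall>x. x \<notin> S \<longrightarrow> f x = 0}"
proof -
  let ?d = "\<lambda>x y. if y = x then 1 else (0::complex)"
  have "f \<in> cfun.span (?d ` S)" if f: "\<forall>x. x \<notin> S \<longrightarrow> f x = 0" for f
  proof -
    have "f = (\<Sum>x\<in>S. cscale (f x) (?d x))"
      using assms f by (auto simp: fun_eq_iff sum_fun_apply cscale_def if_distrib cong: if_cong)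
    also have "\<dots> \<in> cfun.span (?d ` S)"
      by (rule cfun.span_sum, rule cfun.span_scale, rule cfun.span_base) (rule imageI)
    finally show ?thesis .
  qed
  then show ?thesis unfolding fin_dim_def using assms by (intro exI[of _ "?d ` S"]) auto
qed

lemma trace_on_cong:
  assumes "cfun.subspace V" "fin_dim V" "\<And>f. f \<in> V \<Longrightarrow> F f = G f"
  shows "trace_on V F = trace_on V G"
proof -
  obtain B where B: "cfun.independent B" "finite B" "cfun.span B = V"
    "\<And>F. trace_on V F = (\<Sum>b\<in>B. cfun.representation B (F b) b)"
    using trace_on_obtain[OF assms(1,2)] by metis
  show ?thesis unfolding B(4)
  proof (intro sum.cong refl)
    fix b assume "b \<in> B"
    then have "b \<in> V" using cfun.span_base B(3) by auto
    then show "cfun.representation B (F b) b = cfun.representation B (G b) b"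
      by (simp only: assms(3))
  qed
qed

text \<open>In coordinates both sides are one double sum with the two indices exchanged. Invariance
  of characters under conjugation rests on this.\<close>

lemma trace_on_commute:
  assumes V: "cfun.subspace V" "fin_dim V"
    and F: "lin F" "\<And>f. f \<in> V \<Longrightarrow> F f \<in> V" and G: "lin G" "\<And>f. f \<in> V \<Longrightarrow> G f \<in> V"
  shows "trace_on V (\<lambda>f. F (G f)) = trace_on V (\<lambda>f. G (F f))"
proof -
  obtain B where B: "cfun.independent B" "finite B" "cfun.span B = V"
    "\<And>F. trace_on V F = (\<Sum>b\<in>B. cfun.representation B (F b) b)"
    using trace_on_obtain[OF V] by metis
  have comp: "cfun.representation B (X (Y b)) b =
      (\<Sum>c\<in>B. cfun.representation B (X c) b * cfun.representation B (Y b) c)"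
    if b: "b \<in> B" and X: "lin X" "\<And>f. f \<in> V \<Longrightarrow> X f \<in> V" and Y: "\<And>f. f \<in> V \<Longrightarrow> Y f \<in> V"
    for X Y :: "('a \<Rightarrow> complex) \<Rightarrow> 'a \<Rightarrow> complex" and b
  proof -
    have inV: "c \<in> V" if "c \<in> B" for c using cfun.span_base[OF that] B(3) by simp
    have sp: "Y b \<in> cfun.span B" unfolding B(3) by (intro Y inV b)
    have "Y b = (\<Sum>c\<in>B. cscale (cfun.representation B (Y b) c) c)"
      by (rule cfun.sum_representation_eq[OF B(1) sp B(2) order_refl, symmetric])
    then have "X (Y b) = X (\<Sum>c\<in>B. cscale (cfun.representation B (Y b) c) c)" by simp
    also have "\<dots> = (\<Sum>c\<in>B. cscale (cfun.representation B (Y b) c) (X c))"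
      unfolding lin_sum[OF X(1)] lin_scale[OF X(1)] by (rule refl)
    finally have "X (Y b) = (\<Sum>c\<in>B. cscale (cfun.representation B (Y b) c) (X c))" .
    moreover have "X c \<in> cfun.span B" if "c \<in> B" for c unfolding B(3) by (intro X(2) inV that)
    ultimately show ?thesis
      by (simp add: cfun.representation_sum[OF B(1)] cfun.span_scale
          cfun.representation_scale[OF B(1)] mult.commute)
  qed
  have "trace_on V (\<lambda>f. F (G f)) =
      (\<Sum>b\<in>B. \<Sum>c\<in>B. cfun.representation B (F c) b * cfun.representation B (G b) c)"
    unfolding B(4) by (intro sum.cong refl comp F G)
  also have "\<dots> = (\<Sum>b\<in>B. \<Sum>c\<in>B. cfun.representation B (G c) b * cfun.representation B (F b) c)"
    by (subst sum.swap) (simp only: mult.commute)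
  also have "\<dots> = trace_on V (\<lambda>f. G (F f))"
    unfolding B(4) by (intro sum.cong refl comp[symmetric] F G)
  finally show ?thesis .
qed

section \<open>Specht modules\<close>

abbreviation Sym :: "nat \<Rightarrow> (nat \<Rightarrow> nat) set" where
  "Sym n \<equiv> {s. s permutes {..<n}}"

lemma perm_group_Sym: "perm_group (Sym n)"
  by (auto simp: perm_group_def finite_permutations permutes_compose permutes_bij)

lemma card_Sym: "card (Sym n) = fact n"
  by (rule card_permutations) auto

definition tab_act :: "(nat \<Rightarrow> nat) \<Rightarrow> nat set list \<Rightarrow> nat set list" where
  "tab_act g = map (image g)"

lemma perm_action_tab_act: "perm_action tab_act"
  by (auto simp: perm_action_def tab_act_def fun_eq_iff image_comp)

lemma tabloid_action_lift: "tabloid_action g = lift tab_act g"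
  by (auto simp: tabloid_action_def lift_def tab_act_def fun_eq_iff)

lemma tab_act_comp: "tab_act (g \<circ> h) T = tab_act g (tab_act h T)"
  by (simp add: tab_act_def image_comp)

lemma tab_act_id: "tab_act id T = T"
  by (simp add: tab_act_def)

lemma tab_act_inv_eq: "bij g \<Longrightarrow> tab_act (inv g) T = X \<longleftrightarrow> T = tab_act g X"
  using tab_act_comp[of g "inv g"] tab_act_comp[of "inv g" g]
  by (metis bij_is_inj bij_is_surj inv_o_cancel surj_iff tab_act_id)

section \<open>Cells and tableaux\<close>

lemma finite_cells: "finite (cells p)"
proof (rule finite_subset)
  show "cells p \<subseteq> (\<Union>i<length p. {i} \<times> {..<p ! i})" by (auto simp: cells_def)
qed auto

lemma card_row_cells: "card {c \<in> cells p. fst c = i} = part p i"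
proof -
  have "{c \<in> cells p. fst c = i} = Pair i ` {..<part p i}" by (auto simp: cells_def part_def)
  then show ?thesis by (simp add: card_image inj_on_def)
qed

lemma card_cells_less: "card {c \<in> cells p. fst c < K} = (\<Sum>i<K. part p i)"
proof -
  have "{c \<in> cells p. fst c < K} = (\<Union>i<K. {c \<in> cells p. fst c = i})" by auto
  then have "card {c \<in> cells p. fst c < K} = (\<Sum>i<K. card {c \<in> cells p. fst c = i})"
    by (simp add: card_UN_disjoint finite_cells disjoint_iff)
  then show ?thesis by (simp add: card_row_cells)
qed

lemma cells_up:
  assumes "is_partition p" "(i, j) \<in> cells p" "i' \<le> i"
  shows "(i', j) \<in> cells p"
proof -
  have "p ! i \<le> p ! i'" if "i' < i"
    using assms that sorted_wrt_nth_less[of "(\<ge>)" p i' i] by (auto simp: is_partition_def cells_def)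
  then show ?thesis using assms by (cases "i' = i") (auto simp: cells_def)
qed

lemma tableaux_comp: "t \<in> tableaux p \<Longrightarrow> g permutes {..<sum_list p} \<Longrightarrow> g \<circ> t \<in> tableaux p"
  unfolding tableaux_def by (auto intro: bij_betw_trans permutes_imp_bij)

lemma tableau_eq_iff:
  "t \<in> tableaux p \<Longrightarrow> c \<in> cells p \<Longrightarrow> d \<in> cells p \<Longrightarrow> t c = t d \<longleftrightarrow> c = d"
  unfolding tableaux_def bij_betw_def by (auto dest: inj_onD)

lemma tableau_less: "t \<in> tableaux p \<Longrightarrow> c \<in> cells p \<Longrightarrow> t c < sum_list p"
  unfolding tableaux_def bij_betw_def by auto

lemma tableau_cell: "t \<in> tableaux p \<Longrightarrow> x < sum_list p \<Longrightarrow> \<exists>c\<in>cells p. x = t c"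
  unfolding tableaux_def bij_betw_def by (metis (mono_tags) imageE lessThan_iff mem_Collect_eq)

lemma tableaux_transitive:
  assumes "t \<in> tableaux p" "u \<in> tableaux p"
  obtains g where "g permutes {..<sum_list p}" "\<And>c. c \<in> cells p \<Longrightarrow> u c = g (t c)"
proof
  let ?g = "\<lambda>x. if x < sum_list p then u (inv_into (cells p) t x) else x"
  have t: "bij_betw t (cells p) {..<sum_list p}" and u: "bij_betw u (cells p) {..<sum_list p}"
    using assms by (auto simp: tableaux_def)
  have "bij_betw (u \<circ> inv_into (cells p) t) {..<sum_list p} {..<sum_list p}"
    using bij_betw_trans[OF bij_betw_inv_into[OF t] u] .
  then have "bij_betw ?g {..<sum_list p} {..<sum_list p}"
    by (subst bij_betw_cong[where g = "u \<circ> inv_into (cells p) t"]) auto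
  then show "?g permutes {..<sum_list p}" by (rule bij_imp_permutes) auto
  show "u c = ?g (t c)" if "c \<in> cells p" for c
    using that t tableau_less[OF assms(1) that] by (simp add: bij_betw_inv_into_left)
qed

lemma tabloid_cong: "(\<And>c. c \<in> cells p \<Longrightarrow> t c = u c) \<Longrightarrow> tabloid p t = tabloid p u"
  by (auto simp: tabloid_def intro!: image_cong)

lemma tabloid_comp: "tabloid p (g \<circ> t) = tab_act g (tabloid p t)"
  by (simp add: tabloid_def tab_act_def image_comp)

section \<open>Column stabilizers and polytabloids\<close>

lemma column_stabilizer_iff:
  assumes "t \<in> tableaux p"
  shows "s \<in> column_stabilizer p t \<longleftrightarrow> s permutes {..<sum_list p} \<and>
    (\<forall>i j. (i, j) \<in> cells p \<longrightarrow> (\<exists>i'. (i', j) \<in> cells p \<and> s (t (i, j)) = t (i', j)))"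
    (is "?L \<longleftrightarrow> ?R")
proof
  assume L: ?L
  have "\<exists>i'. (i', j) \<in> cells p \<and> s (t (i, j)) = t (i', j)" if "(i, j) \<in> cells p" for i j
  proof -
    have "s (t (i, j)) \<in> s ` t ` {c \<in> cells p. snd c = j}" using that by auto
    also have "\<dots> = t ` {c \<in> cells p. snd c = j}" using L by (auto simp: column_stabilizer_def)
    finally show ?thesis by auto
  qed
  then show ?R using L by (auto simp: column_stabilizer_def)
next
  assume R: ?R
  have "s ` t ` {c \<in> cells p. snd c = j} = t ` {c \<in> cells p. snd c = j}" for j
  proof (rule card_subset_eq)
    show "finite (t ` {c \<in> cells p. snd c = j})" by (simp add: finite_cells)
    show "s ` t ` {c \<in> cells p. snd c = j} \<subseteq> t ` {c \<in> cells p. snd c = j}" using R by force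
    show "card (s ` t ` {c \<in> cells p. snd c = j}) = card (t ` {c \<in> cells p. snd c = j})"
      using R by (intro card_image) (auto intro: permutes_inj_on)
  qed
  then show ?L using R by (auto simp: column_stabilizer_def)
qed

lemma perm_group_column_stabilizer: "perm_group (column_stabilizer p t)"
proof -
  have "column_stabilizer p t \<subseteq> Sym (sum_list p)" by (auto simp: column_stabilizer_def)
  then have "finite (column_stabilizer p t)"
    by (rule finite_subset) (simp add: finite_permutations)
  moreover have "s \<circ> s' \<in> column_stabilizer p t"
    if "s \<in> column_stabilizer p t" "s' \<in> column_stabilizer p t" for s s'
  proof -
    have "(s \<circ> s') ` X = s ` s' ` X" for X by (rule image_comp[symmetric])
    then show ?thesis using that by (auto simp: column_stabilizer_def permutes_compose)
  qed
  moreover have "id \<in> column_stabilizer p t" by (simp add: column_stabilizer_def permutes_id)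
  moreover have "bij s" if "s \<in> column_stabilizer p t" for s
    using that by (auto simp: column_stabilizer_def permutes_bij)
  ultimately show ?thesis unfolding perm_group_def by blast
qed

lemma column_stabilizer_permutes: "s \<in> column_stabilizer p t \<Longrightarrow> s permutes {..<sum_list p}"
  by (simp add: column_stabilizer_def)

lemma column_stabilizer_comp_tableau:
  assumes "s \<in> column_stabilizer p t"
  shows "column_stabilizer p (s \<circ> t) = column_stabilizer p t"
proof -
  have "(s \<circ> t) ` {c \<in> cells p. snd c = j} = t ` {c \<in> cells p. snd c = j}" for j
    using assms unfolding column_stabilizer_def image_comp[symmetric] by blast
  then show ?thesis unfolding column_stabilizer_def by presburger
qed

lemma permutes_permutation: "s permutes {..<n::nat} \<Longrightarrow> permutation s"
  by (auto simp: permutation_permutes)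

lemma conj_column_stabilizer:
  assumes g: "g permutes {..<sum_list p}"
  shows "bij_betw (\<lambda>s. g \<circ> s \<circ> inv g) (column_stabilizer p t) (column_stabilizer p (g \<circ> t))"
proof (rule bij_betw_byWitness[where f' = "\<lambda>s. inv g \<circ> s \<circ> g"])
  have gi: "g \<circ> inv g = id" "inv g \<circ> g = id" using permutes_inv_o[OF g] by auto
  have [simp]: "inv g (g x) = x" "g (inv g x) = x" for x using permutes_inverses[OF g] by auto
  show "\<forall>s\<in>column_stabilizer p t. inv g \<circ> (g \<circ> s \<circ> inv g) \<circ> g = s" by (auto simp: fun_eq_iff)
  show "\<forall>s\<in>column_stabilizer p (g \<circ> t). g \<circ> (inv g \<circ> s \<circ> g) \<circ> inv g = s" by (auto simp: fun_eq_iff)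
  show "(\<lambda>s. g \<circ> s \<circ> inv g) ` column_stabilizer p t \<subseteq> column_stabilizer p (g \<circ> t)"
  proof
    fix x assume "x \<in> (\<lambda>s. g \<circ> s \<circ> inv g) ` column_stabilizer p t"
    then obtain s where s: "s \<in> column_stabilizer p t" "x = g \<circ> s \<circ> inv g" by auto
    have "x ` (g \<circ> t) ` X = g ` s ` t ` X" for X
      unfolding s(2) by (simp add: image_comp comp_def)
    moreover have "s ` t ` {c \<in> cells p. snd c = j} = t ` {c \<in> cells p. snd c = j}" for j
      using s(1) unfolding column_stabilizer_def by blast
    moreover have "(g \<circ> t) ` X = g ` t ` X" for X by (rule image_comp[symmetric])
    moreover have "x permutes {..<sum_list p}"
      unfolding s(2) by (intro permutes_compose permutes_inv g column_stabilizer_permutes[OF s(1)])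
    ultimately show "x \<in> column_stabilizer p (g \<circ> t)" unfolding column_stabilizer_def by auto
  qed
  show "(\<lambda>s. inv g \<circ> s \<circ> g) ` column_stabilizer p (g \<circ> t) \<subseteq> column_stabilizer p t"
  proof
    fix x assume "x \<in> (\<lambda>s. inv g \<circ> s \<circ> g) ` column_stabilizer p (g \<circ> t)"
    then obtain s where s: "s \<in> column_stabilizer p (g \<circ> t)" "x = inv g \<circ> s \<circ> g" by auto
    have "x ` t ` X = inv g ` s ` (g \<circ> t) ` X" for X
      unfolding s(2) by (simp add: image_comp comp_def)
    moreover have "inv g ` (g \<circ> t) ` X = t ` X" for X by (simp add: image_comp comp_def)
    ultimately show "x \<in> column_stabilizer p t"
      using s(1) g unfolding column_stabilizer_def s(2)
      by (simp add: permutes_compose permutes_inv)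
  qed
qed

lemma polytabloid_tab_act:
  "polytabloid p t = (\<lambda>T. \<Sum>s\<in>column_stabilizer p t.
     of_int (sign s) * (if T = tab_act s (tabloid p t) then 1 else 0))"
  by (simp add: polytabloid_def tab_act_def)

lemma lift_polytabloid:
  assumes g: "g permutes {..<sum_list p}"
  shows "lift tab_act g (polytabloid p t) = polytabloid p (g \<circ> t)"
proof
  fix T
  have sgn: "sign (g \<circ> s \<circ> inv g) = sign s" if "s \<in> column_stabilizer p t" for s
  proof -
    have p: "permutation s" "permutation g" "permutation (inv g)"
      using column_stabilizer_permutes[OF that] g permutes_inv[OF g] by (auto simp: permutes_permutation)
    then have "sign (g \<circ> s \<circ> inv g) = sign g * sign s * sign g"
      by (simp add: sign_compose permutation_compose sign_inverse)
    then show ?thesis by (simp add: mult.commute mult.left_commute)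
  qed
  have act: "tab_act (g \<circ> s \<circ> inv g) (tabloid p (g \<circ> t)) = tab_act g (tab_act s (tabloid p t))" for s
    using permutes_inv_o(2)[OF g]
    by (simp add: tabloid_comp flip: tab_act_comp) (simp add: comp_assoc)
  have "polytabloid p (g \<circ> t) T = (\<Sum>s\<in>column_stabilizer p t. of_int (sign (g \<circ> s \<circ> inv g)) *
      (if T = tab_act (g \<circ> s \<circ> inv g) (tabloid p (g \<circ> t)) then 1 else 0))"
    unfolding polytabloid_tab_act
    by (rule sum.reindex_bij_betw[OF conj_column_stabilizer[OF g], symmetric])
  also have "\<dots> = (\<Sum>s\<in>column_stabilizer p t. of_int (sign s) *
      (if tab_act (inv g) T = tab_act s (tabloid p t) then 1 else 0))"
    by (intro sum.cong refl) (simp add: sgn act tab_act_inv_eq permutes_bij[OF g])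
  also have "\<dots> = lift tab_act g (polytabloid p t) T"
    by (simp add: lift_def polytabloid_tab_act)
  finally show "lift tab_act g (polytabloid p t) T = polytabloid p (g \<circ> t) T" ..
qed

lemma polytabloid_column:
  assumes s: "s \<in> column_stabilizer p t"
  shows "polytabloid p (s \<circ> t) = cscale (of_int (sign s)) (polytabloid p t)"
proof
  fix T
  have ps: "permutation s" using s column_stabilizer_permutes permutes_permutation by blast
  let ?F = "\<lambda>x. of_int (sign s) * (of_int (sign x) * (if T = tab_act x (tabloid p t) then 1 else (0::complex)))"
  have "polytabloid p (s \<circ> t) T = (\<Sum>x\<in>column_stabilizer p t. ?F (x \<circ> s))"
    unfolding polytabloid_tab_act column_stabilizer_comp_tableau[OF s]
  proof (intro sum.cong refl)
    fix x assume x: "x \<in> column_stabilizer p t"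
    have "permutation x" using column_stabilizer_permutes[OF x] by (rule permutes_permutation)
    then have "sign s * sign (x \<circ> s) = sign x"
      using ps by (simp add: sign_compose mult.left_commute)
    then have "of_int (sign s) * (of_int (sign (x \<circ> s)) :: complex) = of_int (sign x)"
      by (metis of_int_mult)
    then show "of_int (sign x) * (if T = tab_act x (tabloid p (s \<circ> t)) then 1 else 0) = ?F (x \<circ> s)"
      by (simp add: tabloid_comp tab_act_comp mult.assoc[symmetric])
  qed
  also have "\<dots> = (\<Sum>x\<in>column_stabilizer p t. ?F x)"
    by (rule perm_group_sum_right[OF perm_group_column_stabilizer s])
  finally show "polytabloid p (s \<circ> t) T = cscale (of_int (sign s)) (polytabloid p t) T"
    by (simp add: polytabloid_tab_act cscale_def sum_distrib_left)
qed

lemma subspace_specht: "cfun.subspace (specht p)"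
  by (simp add: specht_def)

lemma polytabloid_in_specht: "t \<in> tableaux p \<Longrightarrow> polytabloid p t \<in> specht p"
  unfolding specht_def by (rule cfun.span_base) (rule imageI)

lemma specht_induct:
  assumes "f \<in> specht p" "cfun.subspace {f. Q f}" "\<And>t. t \<in> tableaux p \<Longrightarrow> Q (polytabloid p t)"
  shows "Q f"
proof -
  have "specht p \<subseteq> {f. Q f}"
    unfolding specht_def using assms(2,3) by (intro cfun.span_minimal) auto
  then show ?thesis using assms(1) by auto
qed

lemma polytabloid_support:
  assumes "t \<in> tableaux p" "polytabloid p t T \<noteq> 0"
  obtains s where "s \<in> column_stabilizer p t" "T = tabloid p (s \<circ> t)"
proof -
  obtain s where "s \<in> column_stabilizer p t"
    "of_int (sign s) * (if T = tab_act s (tabloid p t) then 1 else 0) \<noteq> (0::complex)"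
    using assms(2) unfolding polytabloid_tab_act by (metis (no_types, lifting) sum.neutral)
  then show ?thesis by (intro that[of s]) (auto simp: tabloid_comp split: if_splits)
qed

lemma specht_support:
  assumes "f \<in> specht p" "f T \<noteq> 0"
  shows "T \<in> tabloid p ` tableaux p"
proof -
  have "T \<notin> tabloid p ` tableaux p \<longrightarrow> f T = 0"
  proof (rule specht_induct[OF assms(1)])
    show "cfun.subspace {f. T \<notin> tabloid p ` tableaux p \<longrightarrow> f T = 0}"
      by (auto simp: cfun.subspace_def cscale_def)
    fix t assume "t \<in> tableaux p"
    then show "T \<notin> tabloid p ` tableaux p \<longrightarrow> polytabloid p t T = 0"
      using polytabloid_support tableaux_comp column_stabilizer_permutes by (metis imageI)
  qed
  then show ?thesis using assms(2) by blast
qed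

lemma fin_dim_specht: "fin_dim (specht p)"
proof -
  let ?S = "{T :: nat set list. set T \<subseteq> Pow {..<sum_list p} \<and> length T = length p}"
  have "tabloid p t \<in> ?S" if "t \<in> tableaux p" for t
    using tableau_less[OF that] by (auto simp: tabloid_def)
  then have "specht p \<subseteq> {f. \<forall>x. x \<notin> ?S \<longrightarrow> f x = 0}"
    using specht_support by blast
  moreover have "finite ?S" by (rule finite_lists_length_eq) simp
  ultimately show ?thesis using fin_dim_mono[OF fin_dim_support] by blast
qed

lemma specht_stable:
  assumes "f \<in> specht p" "g permutes {..<sum_list p}"
  shows "lift tab_act g f \<in> specht p"
proof (rule specht_induct[OF assms(1)])
  show "cfun.subspace {f. lift tab_act g f \<in> specht p}"
    using subspace_specht[of p]
    by (auto simp: cfun.subspace_def lin_add[OF lin_lift] lin_scale[OF lin_lift] lin_zero[OF lin_lift])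
  show "lift tab_act g (polytabloid p t) \<in> specht p" if "t \<in> tableaux p" for t
    unfolding lift_polytabloid[OF assms(2)] by (intro polytabloid_in_specht tableaux_comp that assms(2))
qed

section \<open>Characters as real class functions\<close>

lemma irr_char_lift: "irr_char p g = trace_on (specht p) (lift tab_act g)"
  by (simp add: irr_char_def tabloid_action_lift)

lemma irr_char_conj:
  assumes g: "g permutes {..<sum_list p}" and h: "h permutes {..<sum_list p}"
  shows "irr_char p (h \<circ> g \<circ> inv h) = irr_char p g"
proof -
  let ?l = "lift tab_act"
  note b = permutes_bij[OF g] permutes_bij[OF h] permutes_bij[OF permutes_inv[OF h]]
  note st = specht_stable[OF _ g] specht_stable[OF _ h] specht_stable[OF _ permutes_inv[OF h]]
  have "irr_char p (h \<circ> g \<circ> inv h) = trace_on (specht p) (\<lambda>f. ?l h (?l (g \<circ> inv h) f))"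
    unfolding irr_char_lift comp_assoc using b
    by (intro trace_on_cong subspace_specht fin_dim_specht lift_comp perm_action_tab_act bij_comp)
  also have "\<dots> = trace_on (specht p) (\<lambda>f. ?l (g \<circ> inv h) (?l h f))"
    by (intro trace_on_commute subspace_specht fin_dim_specht lin_lift specht_stable
        permutes_compose permutes_inv g h)
  also have "\<dots> = trace_on (specht p) (?l g)"
  proof (intro trace_on_cong subspace_specht fin_dim_specht)
    fix f assume "f \<in> specht p"
    have "?l (g \<circ> inv h) (?l h f) = ?l (g \<circ> inv h \<circ> h) f"
      using b by (intro lift_comp[symmetric] perm_action_tab_act bij_comp)
    also have "g \<circ> inv h \<circ> h = g" using permutes_inv_o(2)[OF h] by (simp add: comp_assoc)
    finally show "?l (g \<circ> inv h) (?l h f) = ?l g f" .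
  qed
  finally show ?thesis by (simp add: irr_char_lift)
qed

text \<open>Conjugated coordinates of a real vector in a real basis are again its coordinates.
  Through \<open>cnj_irr_char\<close> this makes characters real, so that a vanishing sum of squares
  of their values forces these values to vanish.\<close>

lemma cnj_representation:
  assumes B: "cfun.independent B" "finite B" "\<And>b x. b \<in> B \<Longrightarrow> cnj (b x) = b x"
    and f: "f \<in> cfun.span B" "\<And>x. cnj (f x) = f x" and b: "b \<in> B"
  shows "cnj (cfun.representation B f b) = cfun.representation B f b"
proof -
  let ?r = "cfun.representation B f"
  have e: "(\<Sum>b\<in>B. cscale (?r b) b) = f"
    by (rule cfun.sum_representation_eq[OF B(1) f(1) B(2) order_refl])
  have "(\<Sum>b\<in>B. cscale (cnj (?r b) - ?r b) b) = 0"
  proof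
    fix x
    have fx: "(\<Sum>b\<in>B. ?r b * b x) = f x" using fun_cong[OF e, of x] by (simp add: sum_fun_apply cscale_def)
    have "(\<Sum>b\<in>B. cnj (?r b) * b x) = cnj (\<Sum>b\<in>B. ?r b * b x)" by (simp add: B(3))
    also have "\<dots> = f x" unfolding fx by (rule f(2))
    finally have "(\<Sum>b\<in>B. cnj (?r b) * b x) = f x" .
    with fx show "(\<Sum>b\<in>B. cscale (cnj (?r b) - ?r b) b) x = 0 x"
      by (simp add: sum_fun_apply cscale_def left_diff_distrib sum_subtractf)
  qed
  from cfun.independentD[OF B(1,2) order_refl this b] show ?thesis by simp
qed

lemma cnj_polytabloid: "cnj (polytabloid p t T) = polytabloid p t T"
  unfolding polytabloid_def cnj_sum by (intro sum.cong refl) simp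

lemma cnj_irr_char:
  assumes g: "g permutes {..<sum_list p}"
  shows "cnj (irr_char p g) = irr_char p g"
proof -
  let ?P = "polytabloid p ` tableaux p"
  \<comment> \<open>The basis is taken among the polytabloids because their coefficients are
    real.\<close>
  obtain B where B: "B \<subseteq> ?P" "cfun.independent B" "?P \<subseteq> cfun.span B"
    using cfun.maximal_independent_subset[of ?P] by metis
  have span: "cfun.span B = specht p"
    unfolding specht_def
    by (rule antisym[OF cfun.span_mono[OF B(1)] cfun.span_minimal[OF B(3) cfun.subspace_span]])
  have fin: "finite B"
    using fin_dim_independent_finite[OF fin_dim_specht B(2), of p] cfun.span_superset[of B] span by simp
  have tr: "irr_char p g = (\<Sum>b\<in>B. cfun.representation B (lift tab_act g b) b)"
    unfolding irr_char_lift
    by (rule trace_on_eq[OF fin_dim_specht B(2) span lin_lift specht_stable[OF _ g]])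
  have "cnj (cfun.representation B (lift tab_act g b) b) = cfun.representation B (lift tab_act g b) b"
    if b: "b \<in> B" for b
  proof (rule cnj_representation[OF B(2) fin _ _ _ b])
    show "cnj (c x) = c x" if "c \<in> B" for c x using that B(1) cnj_polytabloid by auto
    then show "cnj (lift tab_act g b x) = lift tab_act g b x" for x using b by (simp add: lift_def)
    have "b \<in> specht p" using cfun.span_base[OF b] span by simp
    then show "lift tab_act g b \<in> cfun.span B" unfolding span by (rule specht_stable[OF _ g])
  qed
  then show ?thesis unfolding tr cnj_sum by (intro sum.cong refl)
qed

section \<open>Invariants of Young subgroups in Specht modules\<close>

definition stab :: "nat \<Rightarrow> (nat \<Rightarrow> 'c) \<Rightarrow> (nat \<Rightarrow> nat) set" where
  "stab n c = {g. g permutes {..<n} \<and> (\<forall>x<n. c (g x) = c x)}"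

lemma permutes_less: "g permutes {..<n::nat} \<Longrightarrow> g x < n \<longleftrightarrow> x < n"
  using permutes_in_image[of g "{..<n}" x] by simp

lemma perm_group_stab: "perm_group (stab n c)"
proof -
  have "finite (stab n c)"
    by (rule finite_subset[of _ "Sym n"]) (auto simp: stab_def finite_permutations)
  then show ?thesis
    by (auto simp: perm_group_def stab_def permutes_compose permutes_bij permutes_less)
qed

lemma stab_pos: "card (stab n c) > 0"
  using perm_group_stab[of n c] by (auto simp: perm_group_def card_gt_0_iff)

text \<open>\<open>c\<close> composed with \<open>t\<close> is a filling of the diagram. Here and in
  \<open>colstrict\<close> only the columns are constrained, because tabloids ignore the order
  within rows.\<close>

definition coldist :: "nat list \<Rightarrow> (nat \<times> nat \<Rightarrow> nat) \<Rightarrow> (nat \<Rightarrow> 'c) \<Rightarrow> bool" where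
  "coldist p t c \<longleftrightarrow> (\<forall>i i' j. (i, j) \<in> cells p \<longrightarrow> (i', j) \<in> cells p \<longrightarrow> c (t (i, j)) = c (t (i', j)) \<longrightarrow> i = i')"

definition colstrict :: "nat list \<Rightarrow> (nat \<times> nat \<Rightarrow> nat) \<Rightarrow> (nat \<Rightarrow> nat) \<Rightarrow> bool" where
  "colstrict p t c \<longleftrightarrow> (\<forall>i j. (Suc i, j) \<in> cells p \<longrightarrow> c (t (i, j)) < c (t (Suc i, j)))"

lemma colstrict_less:
  assumes p: "is_partition p" and c: "colstrict p t c"
  shows "(i', j) \<in> cells p \<Longrightarrow> i < i' \<Longrightarrow> c (t (i, j)) < c (t (i', j))"
proof (induction i')
  case (Suc i')
  have "c (t (i', j)) < c (t (Suc i', j))" using c Suc.prems by (simp add: colstrict_def)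
  moreover have "(i', j) \<in> cells p" using cells_up[OF p Suc.prems(1)] by simp
  ultimately show ?case using Suc by (cases "i = i'") auto
qed simp

lemma colstrict_ge:
  assumes p: "is_partition p" and c: "colstrict p t c"
  shows "(i, j) \<in> cells p \<Longrightarrow> i \<le> c (t (i, j))"
proof (induction i)
  case (Suc i)
  then show ?case using colstrict_less[OF p c, of "Suc i" j i] cells_up[OF p, of "Suc i" j i] by simp
qed simp

lemma transpose_column_stabilizer:
  assumes t: "t \<in> tableaux p" and c: "(i, j) \<in> cells p" "(i', j) \<in> cells p"
  shows "transpose (t (i, j)) (t (i', j)) \<in> column_stabilizer p t"
  unfolding column_stabilizer_iff[OF t]
proof (intro conjI allI impI)
  show "transpose (t (i, j)) (t (i', j)) permutes {..<sum_list p}"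
    by (rule permutes_swap_id) (use tableau_less[OF t] c in auto)
  fix a b assume ab: "(a, b) \<in> cells p"
  have "transpose (t (i, j)) (t (i', j)) (t (a, b)) =
      (if (a, b) = (i, j) then t (i', j) else if (a, b) = (i', j) then t (i, j) else t (a, b))"
    using tableau_eq_iff[OF t ab c(1)] tableau_eq_iff[OF t ab c(2)] by (auto simp: transpose_def)
  then show "\<exists>i''. (i'', b) \<in> cells p \<and> transpose (t (i, j)) (t (i', j)) (t (a, b)) = t (i'', b)"
    using c ab by (auto split: if_splits)
qed

text \<open>The transposition of two equally labelled entries of one column lies in both groups. It
  multiplies the polytabloid by -1, yet the sum over the stabilizer absorbs it on the right.\<close>

lemma sum_lift_zero:
  assumes t: "t \<in> tableaux p" and nd: "\<not> coldist p t c"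
  shows "(\<Sum>h\<in>stab (sum_list p) c. lift tab_act h (polytabloid p t)) = 0"
proof -
  let ?H = "stab (sum_list p) c" and ?e = "polytabloid p t"
  obtain i i' j where c: "(i, j) \<in> cells p" "(i', j) \<in> cells p" "c (t (i, j)) = c (t (i', j))" "i \<noteq> i'"
    using nd by (auto simp: coldist_def)
  define \<tau> where "\<tau> = transpose (t (i, j)) (t (i', j))"
  have \<tau>C: "\<tau> \<in> column_stabilizer p t"
    unfolding \<tau>_def by (rule transpose_column_stabilizer[OF t c(1,2)])
  then have perm: "\<tau> permutes {..<sum_list p}" by (rule column_stabilizer_permutes)
  have \<tau>H: "\<tau> \<in> ?H" using perm c(3) by (auto simp: stab_def \<tau>_def transpose_def)
  have "t (i, j) \<noteq> t (i', j)" using tableau_eq_iff[OF t c(1,2)] c(4) by simp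
  then have "sign \<tau> = -1" by (simp add: \<tau>_def sign_swap_id)
  then have e: "lift tab_act \<tau> ?e = cscale (-1) ?e"
    using polytabloid_column[OF \<tau>C] lift_polytabloid[OF perm, of t] by simp
  have "(\<Sum>h\<in>?H. lift tab_act h ?e) = (\<Sum>h\<in>?H. lift tab_act (h \<circ> \<tau>) ?e)"
    by (rule perm_group_sum_right[OF perm_group_stab \<tau>H, symmetric])
  also have "\<dots> = (\<Sum>h\<in>?H. cscale (-1) (lift tab_act h ?e))"
  proof (intro sum.cong refl)
    fix h assume "h \<in> ?H"
    then have "bij h" by (auto simp: stab_def permutes_bij)
    then have "lift tab_act (h \<circ> \<tau>) ?e = lift tab_act h (cscale (-1) ?e)"
      unfolding e[symmetric] by (rule lift_comp[OF perm_action_tab_act _ permutes_bij[OF perm]])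
    also have "\<dots> = cscale (-1) (lift tab_act h ?e)" by (rule lin_scale[OF lin_lift])
    finally show "lift tab_act (h \<circ> \<tau>) ?e = cscale (-1) (lift tab_act h ?e)" .
  qed
  finally have eq: "(\<Sum>h\<in>?H. lift tab_act h ?e) = (\<Sum>h\<in>?H. cscale (-1) (lift tab_act h ?e))" .
  show ?thesis
  proof
    fix T
    show "(\<Sum>h\<in>?H. lift tab_act h ?e) T = 0 T"
      using fun_cong[OF eq, of T] by (simp add: sum_fun_apply cscale_def sum_negf)
  qed
qed

text \<open>Among the column permutations of \<open>t\<close> the one that maximises \<open>\<Sum> i \<cdot> c(t(i, j))\<close>
  sorts the labels, as otherwise swapping two neighbours would increase that sum.\<close>

lemma sort_columns:
  fixes c :: "nat \<Rightarrow> nat"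
  assumes p: "is_partition p" and t: "t \<in> tableaux p" and d: "coldist p t c"
  obtains s where "s \<in> column_stabilizer p t" "colstrict p (s \<circ> t) c"
proof -
  define f where "f s = (\<Sum>x\<in>cells p. fst x * c (s (t x)))" for s
  let ?C = "column_stabilizer p t"
  have grp: "perm_group ?C" by (rule perm_group_column_stabilizer)
  have "finite (f ` ?C)" "f ` ?C \<noteq> {}" using grp by (auto simp: perm_group_def)
  then obtain s where s: "s \<in> ?C" "f s = Max (f ` ?C)" using Max_in by (metis (no_types, lifting) imageE)
  have le: "f s' \<le> f s" if "s' \<in> ?C" for s'
    unfolding s(2) by (rule Max_ge) (use \<open>finite (f ` ?C)\<close> that in auto)
  have u: "s \<circ> t \<in> tableaux p" by (rule tableaux_comp[OF t column_stabilizer_permutes[OF s(1)]])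
  have "c (s (t (i, j))) < c (s (t (Suc i, j)))" if b: "(Suc i, j) \<in> cells p" for i j
  proof (rule ccontr)
    assume nl: "\<not> c (s (t (i, j))) < c (s (t (Suc i, j)))"
    have a: "(i, j) \<in> cells p" using cells_up[OF p b] by simp
    obtain i1 where i1: "(i1, j) \<in> cells p" "s (t (i, j)) = t (i1, j)"
      using s(1) a column_stabilizer_iff[OF t] by blast
    obtain i2 where i2: "(i2, j) \<in> cells p" "s (t (Suc i, j)) = t (i2, j)"
      using s(1) b column_stabilizer_iff[OF t] by blast
    have "i1 \<noteq> i2" using i1 i2 tableau_eq_iff[OF u a b] by auto
    then have "c (s (t (i, j))) \<noteq> c (s (t (Suc i, j)))"
      using d i1 i2 by (auto simp: coldist_def)
    with nl have gt: "c (s (t (Suc i, j))) < c (s (t (i, j)))" by simp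
    define \<tau> where "\<tau> = transpose (t (i1, j)) (t (i2, j))"
    have "\<tau> \<in> ?C" unfolding \<tau>_def by (rule transpose_column_stabilizer[OF t i1(1) i2(1)])
    then have "\<tau> \<circ> s \<in> ?C" using grp s(1) by (simp add: perm_group_def)
    from le[OF this] have fle: "f (\<tau> \<circ> s) \<le> f s" .
    let ?R = "cells p - {(i, j), (Suc i, j)}"
    have split: "(\<Sum>x\<in>cells p. F x) = F (i, j) + F (Suc i, j) + (\<Sum>x\<in>?R. F x)" for F :: "nat \<times> nat \<Rightarrow> nat"
    proof -
      have "cells p = insert (i, j) (insert (Suc i, j) ?R)" using a b by auto
      then have "(\<Sum>x\<in>cells p. F x) = (\<Sum>x\<in>insert (i, j) (insert (Suc i, j) ?R). F x)" by simp
      also have "\<dots> = F (i, j) + (F (Suc i, j) + (\<Sum>x\<in>?R. F x))"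
        using finite_cells by (subst sum.insert; simp)+
      finally show ?thesis by simp
    qed
    have rest: "\<tau> (s (t x)) = s (t x)" if "x \<in> ?R" for x
    proof -
      have "s (t x) \<noteq> s (t (i, j))" "s (t x) \<noteq> s (t (Suc i, j))"
        using tableau_eq_iff[OF u _ a, of x] tableau_eq_iff[OF u _ b, of x] that by auto
      then show ?thesis using i1 i2 by (simp add: \<tau>_def transpose_def)
    qed
    have "f (\<tau> \<circ> s) = i * c (s (t (Suc i, j))) + Suc i * c (s (t (i, j))) + (\<Sum>x\<in>?R. fst x * c (s (t x)))"
    proof -
      have "\<tau> (t (i1, j)) = t (i2, j)" "\<tau> (t (i2, j)) = t (i1, j)" by (simp_all add: \<tau>_def)
      moreover have "(\<Sum>x\<in>?R. fst x * c (\<tau> (s (t x)))) = (\<Sum>x\<in>?R. fst x * c (s (t x)))"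
        by (intro sum.cong refl) (simp only: rest)
      ultimately show ?thesis unfolding f_def split comp_def by (simp add: i1(2) i2(2))
    qed
    moreover have "f s = i * c (s (t (i, j))) + Suc i * c (s (t (Suc i, j))) + (\<Sum>x\<in>?R. fst x * c (s (t x)))"
      unfolding f_def split by simp
    ultimately have "f (\<tau> \<circ> s) > f s" using gt by simp
    with fle show False by simp
  qed
  then have "colstrict p (s \<circ> t) c" by (simp add: colstrict_def)
  with s(1) show ?thesis by (rule that)
qed

lemma sum_labels:
  assumes t: "t \<in> tableaux p"
  shows "(\<Sum>x\<in>cells p. F (t x)) = (\<Sum>x<sum_list p. F x)"
  using sum.reindex_bij_betw[of t "cells p" "{..<sum_list p}" F] t by (simp add: tableaux_def)

lemma nth_tabloid: "i < length p \<Longrightarrow> tabloid p t ! i = t ` {c \<in> cells p. fst c = i}"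
  by (simp add: tabloid_def)

text \<open>A column permutation that preserves the label sums of all rows of a tableau with strictly
  increasing columns is trivial: in the first row that it changes, it could only increase labels.\<close>

lemma colstrict_rigid:
  assumes p: "is_partition p" and t: "t \<in> tableaux p" and st: "colstrict p t c"
    and s: "s \<in> column_stabilizer p t" and h: "h \<in> stab (sum_list p) c"
    and eq: "tab_act (h \<circ> s) (tabloid p t) = tabloid p t"
  shows "s = id"
proof -
  note sp = column_stabilizer_permutes[OF s]
  have "\<forall>j. (i, j) \<in> cells p \<longrightarrow> s (t (i, j)) = t (i, j)" for i
  proof (induction i rule: less_induct)
    case (less i)
    show ?case
    proof (cases "i < length p")
      case True
      let ?R = "{x \<in> cells p. fst x = i}"
      have inj: "inj_on t ?R" using tableau_eq_iff[OF t] by (auto simp: inj_on_def)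
      have row: "(h \<circ> s) ` t ` ?R = t ` ?R"
        using arg_cong[OF eq, of "\<lambda>T. T ! i"] True by (simp add: tab_act_def nth_tabloid) (simp add: tabloid_def)
      have bij: "bij h" "bij s" using h s by (auto simp: stab_def column_stabilizer_def permutes_bij)
      have "(\<Sum>x\<in>?R. c (s (t x))) = (\<Sum>y\<in>t ` ?R. c (s y))" using inj by (simp add: sum.reindex)
      also have "\<dots> = (\<Sum>y\<in>t ` ?R. c ((h \<circ> s) y))"
      proof (intro sum.cong refl)
        fix y assume "y \<in> t ` ?R"
        then have "y < sum_list p" using tableau_less[OF t] by auto
        then have "s y < sum_list p" using permutes_less[OF sp] by simp
        then show "c (s y) = c ((h \<circ> s) y)" using h by (simp add: stab_def)
      qed
      also have "\<dots> = (\<Sum>y\<in>(h \<circ> s) ` t ` ?R. c y)"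
        using bij by (subst sum.reindex[of "h \<circ> s"]) (auto intro!: inj_on_subset[OF bij_is_inj[OF bij_comp]])
      also have "\<dots> = (\<Sum>x\<in>?R. c (t x))" unfolding row using inj by (simp add: sum.reindex)
      finally have sums: "(\<Sum>x\<in>?R. c (t x)) = (\<Sum>x\<in>?R. c (s (t x)))" ..
      have ge: "c (t x) \<le> c (s (t x)) \<and> (c (t x) = c (s (t x)) \<longrightarrow> s (t x) = t x)" if x: "x \<in> ?R" for x
      proof -
        obtain j where j: "x = (i, j)" "(i, j) \<in> cells p" using x by (cases x) auto
        obtain i' where i': "(i', j) \<in> cells p" "s (t (i, j)) = t (i', j)"
          using s j(2) column_stabilizer_iff[OF t] by blast
        \<comment> \<open>The entries of the rows above are fixed by s, so no entry of row i can be
          moved onto one of them.\<close>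
        have "\<not> i' < i"
        proof
          assume "i' < i"
          then have "s (t (i', j)) = s (t (i, j))" using less.IH i' by simp
          then have "t (i', j) = t (i, j)" using bij(2) by (simp add: bij_is_inj inj_eq)
          then show False using tableau_eq_iff[OF t i'(1) j(2)] \<open>i' < i\<close> by simp
        qed
        then show ?thesis using i' j colstrict_less[OF p st i'(1), of i] by (cases "i' = i") auto
      qed
      have "c (t x) = c (s (t x))" if "x \<in> ?R" for x
        by (rule sum_mono_inv[OF sums _ that]) (use ge finite_cells in auto)
      then show ?thesis using ge by auto
    qed (simp add: cells_def)
  qed
  then have "s x = x" if "x < sum_list p" for x
    using tableau_cell[OF t that] by auto
  then show ?thesis using permutes_not_in[OF sp] by (metis eq_id_iff lessThan_iff)
qed

text \<open>At the tabloid of t itself rigidity leaves only s = id in each summand, so the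
  coefficient counts the h that fix this tabloid, and nothing cancels.\<close>

lemma sum_lift_nonzero:
  assumes p: "is_partition p" and t: "t \<in> tableaux p" and st: "colstrict p t c"
  shows "(\<Sum>h\<in>stab (sum_list p) c. lift tab_act h (polytabloid p t)) (tabloid p t) \<noteq> 0"
proof -
  let ?H = "stab (sum_list p) c" and ?C = "column_stabilizer p t" and ?T = "tabloid p t"
  have finH: "finite ?H" and idH: "id \<in> ?H" using perm_group_stab by (auto simp: perm_group_def)
  have finC: "finite ?C" and idC: "id \<in> ?C"
    using perm_group_column_stabilizer by (auto simp: perm_group_def)
  have coeff: "lift tab_act h (polytabloid p t) ?T = (if tab_act h ?T = ?T then 1 else 0)" if h: "h \<in> ?H" for h
  proof -
    have b: "bij h" using h by (auto simp: stab_def permutes_bij)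
    have "lift tab_act h (polytabloid p t) ?T =
        (\<Sum>s\<in>?C. of_int (sign s) * (if ?T = tab_act (h \<circ> s) ?T then 1 else 0))"
      by (simp add: lift_def polytabloid_tab_act tab_act_inv_eq[OF b] tab_act_comp)
    also have "\<dots> = (\<Sum>s\<in>?C. if s = id then (if tab_act h ?T = ?T then 1 else 0) else 0)"
    proof (intro sum.cong refl)
      fix s assume "s \<in> ?C"
      then show "of_int (sign s) * (if ?T = tab_act (h \<circ> s) ?T then 1 else (0::complex)) =
          (if s = id then if tab_act h ?T = ?T then 1 else 0 else 0)"
        using colstrict_rigid[OF p t st _ h, of s] by (auto simp: sign_id)
    qed
    also have "\<dots> = (if tab_act h ?T = ?T then 1 else 0)" using finC idC by simp
    finally show ?thesis .
  qed
  have "(\<Sum>h\<in>?H. lift tab_act h (polytabloid p t)) ?T = of_nat (card {h \<in> ?H. tab_act h ?T = ?T})"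
    using finH by (simp add: sum_fun_apply coeff sum.If_cases Int_def)
  moreover have "id \<in> {h \<in> ?H. tab_act h ?T = ?T}" using idH by (simp add: tab_act_id)
  ultimately show ?thesis using finH by (auto simp: card_eq_0_iff)
qed

lemma fixed_space_sum:
  assumes "f \<in> fixed_space H act V"
  shows "(\<Sum>h\<in>H. lift act h f) = cscale (of_nat (card H)) f"
proof -
  have "(\<Sum>h\<in>H. lift act h f) = (\<Sum>h\<in>H. f)" using assms by (intro sum.cong) (auto simp: fixed_space_def)
  then show ?thesis by (auto simp: fun_eq_iff sum_fun_apply cscale_def)
qed

text \<open>A fixed vector is, up to the order of the group, the sum of its own translates, and by
  linearity such sums need only be examined for polytabloids.\<close>

lemma fixed_space_subset:
  assumes S: "cfun.subspace S"
    and gen: "\<And>t. t \<in> tableaux p \<Longrightarrow> (\<Sum>h\<in>stab n c. lift tab_act h (polytabloid p t)) \<in> S"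
  shows "fixed_space (stab n c) tab_act (specht p) \<subseteq> S"
proof
  fix f assume f: "f \<in> fixed_space (stab n c) tab_act (specht p)"
  let ?P = "\<lambda>f. \<Sum>h\<in>stab n c. lift tab_act h f"
  have "?P f \<in> S"
  proof (rule specht_induct[of f p "\<lambda>f. ?P f \<in> S"])
    show "f \<in> specht p" using f by (simp add: fixed_space_def)
    have P: "?P 0 = 0" "?P (f + g) = ?P f + ?P g" "?P (cscale a f) = cscale a (?P f)" for f g a
      by (simp_all only: lin_add[OF lin_lift] lin_scale[OF lin_lift] lin_zero[OF lin_lift]
          sum.distrib cfun.scale_sum_right sum.neutral_const)
    show "cfun.subspace {f. ?P f \<in> S}"
      by (rule cfun.subspaceI; unfold mem_Collect_eq P)
        (intro cfun.subspace_0[OF S] cfun.subspace_add[OF S] cfun.subspace_scale[OF S]; assumption)+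
  qed (rule gen)
  then have "cscale (1 / of_nat (card (stab n c))) (cscale (of_nat (card (stab n c))) f) \<in> S"
    unfolding fixed_space_sum[OF f] by (rule cfun.subspace_scale[OF S])
  then show "f \<in> S" using stab_pos[of n c] by (simp add: cscale_def)
qed

text \<open>Once the columns are sorted, row i carries only labels at least i, so the labels below K
  fit into the first K rows. This is the dominance condition for nonzero Kostka numbers.\<close>

lemma card_labels_less:
  fixes c :: "nat \<Rightarrow> nat"
  assumes p: "is_partition p" and t: "t \<in> tableaux p" and d: "coldist p t c"
  shows "card {x. x < sum_list p \<and> c x < K} \<le> (\<Sum>i<K. part p i)"
proof -
  obtain s where s: "s \<in> column_stabilizer p t" "colstrict p (s \<circ> t) c"
    using sort_columns[OF assms] .
  have u: "s \<circ> t \<in> tableaux p" by (rule tableaux_comp[OF t column_stabilizer_permutes[OF s(1)]])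
  have "{x. x < sum_list p \<and> c x < K} \<subseteq> (s \<circ> t) ` {x \<in> cells p. fst x < K}"
  proof
    fix x assume x: "x \<in> {x. x < sum_list p \<and> c x < K}"
    then obtain i j where y: "(i, j) \<in> cells p" "x = (s \<circ> t) (i, j)" using tableau_cell[OF u, of x] by auto
    then show "x \<in> (s \<circ> t) ` {x \<in> cells p. fst x < K}"
      using colstrict_ge[OF p s(2) y(1)] x by (auto intro!: image_eqI[of _ _ "(i, j)"])
  qed
  then have "card {x. x < sum_list p \<and> c x < K} \<le> card {x \<in> cells p. fst x < K}"
    by (intro surj_card_le) (simp_all add: finite_cells)
  then show ?thesis by (simp add: card_cells_less)
qed

lemma fixed_specht_zero:
  fixes c :: "nat \<Rightarrow> nat"
  assumes p: "is_partition p" and K: "(\<Sum>i<K. part p i) < card {x. x < sum_list p \<and> c x < K}"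
  shows "fixed_space (stab (sum_list p) c) tab_act (specht p) \<subseteq> {0}"
proof (rule fixed_space_subset[OF cfun.subspace_single_0])
  fix t assume t: "t \<in> tableaux p"
  then have "\<not> coldist p t c" using card_labels_less[OF p t, of c K] K by auto
  from sum_lift_zero[OF t this]
  show "(\<Sum>h\<in>stab (sum_list p) c. lift tab_act h (polytabloid p t)) \<in> {0}" by simp
qed

text \<open>Sorted columns give each cell of row i a label at least i, and the total of all labels
  is already reached with equality everywhere.\<close>

lemma colstrict_row_labels:
  assumes p: "is_partition p" and t: "t \<in> tableaux p" and t0: "t0 \<in> tableaux p"
    and c0: "\<And>i j. (i, j) \<in> cells p \<Longrightarrow> c (t0 (i, j)) = i" and st: "colstrict p t c"
    and ij: "(i, j) \<in> cells p"
  shows "c (t (i, j)) = i"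
proof -
  have "(\<Sum>x\<in>cells p. fst x) = (\<Sum>x\<in>cells p. c (t0 x))"
    by (intro sum.cong refl) (use c0 in force)
  also have "\<dots> = (\<Sum>x\<in>cells p. c (t x))" by (simp only: sum_labels[OF t, of c] sum_labels[OF t0, of c])
  finally have s: "(\<Sum>x\<in>cells p. fst x) = (\<Sum>x\<in>cells p. c (t x))" .
  have "fst (i, j) = c (t (i, j))"
    by (rule sum_mono_inv[OF s _ ij finite_cells]) (use colstrict_ge[OF p st] in force)
  then show ?thesis by simp
qed

text \<open>The Kostka number of a shape with itself. A tableau with sorted columns has label i
  throughout row i, so it is g \<circ> t0 on the cells with g in the stabilizer, and symmetrising
  its polytabloid gives v. Unsorted tableaux give v up to sign, or 0.\<close>

lemma fixed_specht_one:
  fixes c :: "nat \<Rightarrow> nat"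
  assumes p: "is_partition p" and t0: "t0 \<in> tableaux p"
    and c0: "\<And>i j. (i, j) \<in> cells p \<Longrightarrow> c (t0 (i, j)) = i"
  defines "v \<equiv> \<Sum>h\<in>stab (sum_list p) c. lift tab_act h (polytabloid p t0)"
  shows "fixed_space (stab (sum_list p) c) tab_act (specht p) \<subseteq> cfun.span {v}"
    and "cfun.dim (fixed_space (stab (sum_list p) c) tab_act (specht p)) = 1"
proof -
  let ?H = "stab (sum_list p) c"
  have Hbij: "bij h" if "h \<in> ?H" for h using that by (auto simp: stab_def permutes_bij)
  show sub: "fixed_space ?H tab_act (specht p) \<subseteq> cfun.span {v}"
  proof (rule fixed_space_subset[OF cfun.subspace_span])
    fix t assume t: "t \<in> tableaux p"
    show "(\<Sum>h\<in>?H. lift tab_act h (polytabloid p t)) \<in> cfun.span {v}"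
    proof (cases "coldist p t c")
      case False
      show ?thesis unfolding sum_lift_zero[OF t False] by (rule cfun.span_zero)
    next
      case True
      obtain s where s: "s \<in> column_stabilizer p t" "colstrict p (s \<circ> t) c"
        using sort_columns[OF p t True] .
      have u: "s \<circ> t \<in> tableaux p" by (rule tableaux_comp[OF t column_stabilizer_permutes[OF s(1)]])
      obtain g where g: "g permutes {..<sum_list p}" "\<And>x. x \<in> cells p \<Longrightarrow> (s \<circ> t) x = g (t0 x)"
        using tableaux_transitive[OF t0 u] by metis
      have gH: "g \<in> ?H"
      proof -
        have "c (g x) = c x" if x: "x < sum_list p" for x
        proof -
          obtain i j where y: "(i, j) \<in> cells p" "x = t0 (i, j)" using tableau_cell[OF t0 x] by auto
          then have "c (g x) = c ((s \<circ> t) (i, j))" using g(2)[OF y(1)] by simp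
          also have "\<dots> = i" by (rule colstrict_row_labels[OF p u t0 c0 s(2) y(1)])
          finally show ?thesis using c0 y by simp
        qed
        then show ?thesis using g(1) by (simp add: stab_def)
      qed
      have cs: "column_stabilizer p (s \<circ> t) = column_stabilizer p (g \<circ> t0)"
      proof -
        have "(s \<circ> t) ` {x \<in> cells p. snd x = j} = (g \<circ> t0) ` {x \<in> cells p. snd x = j}" for j
          by (intro image_cong refl) (use g(2) in auto)
        then show ?thesis unfolding column_stabilizer_def by presburger
      qed
      have "polytabloid p (s \<circ> t) = polytabloid p (g \<circ> t0)"
        unfolding polytabloid_def cs using tabloid_cong[of p "s \<circ> t" "g \<circ> t0"] g(2) by simp
      then have e: "cscale (of_int (sign s)) (polytabloid p t) = lift tab_act g (polytabloid p t0)"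
        using polytabloid_column[OF s(1)] lift_polytabloid[OF g(1)] by simp
      have "polytabloid p t = cscale (of_int (sign s)) (lift tab_act g (polytabloid p t0))"
        unfolding e[symmetric] by (simp add: of_int_mult[symmetric] del: of_int_mult)
      then have "(\<Sum>h\<in>?H. lift tab_act h (polytabloid p t)) =
          (\<Sum>h\<in>?H. cscale (of_int (sign s)) (lift tab_act (h \<circ> g) (polytabloid p t0)))"
        by (intro sum.cong refl)
          (simp only: lin_scale[OF lin_lift] lift_comp[OF perm_action_tab_act Hbij Hbij[OF gH]])
      also have "\<dots> = cscale (of_int (sign s)) (\<Sum>h\<in>?H. lift tab_act (h \<circ> g) (polytabloid p t0))"
        by (simp only: cfun.scale_sum_right)
      also have "(\<Sum>h\<in>?H. lift tab_act (h \<circ> g) (polytabloid p t0)) = v"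
        unfolding v_def by (rule perm_group_sum_right[OF perm_group_stab gH])
      finally show ?thesis using cfun.span_scale[OF cfun.span_base[of v "{v}"]] by simp
    qed
  qed
  have "colstrict p t0 c" unfolding colstrict_def using c0 cells_up[OF p] by (metis le_add2 lessI plus_1_eq_Suc)
  from sum_lift_nonzero[OF p t0 this] have v0: "v \<noteq> 0" by (auto simp: v_def)
  have "v \<in> specht p" unfolding v_def
    by (intro cfun.subspace_sum[OF subspace_specht] specht_stable polytabloid_in_specht t0)
      (auto simp: stab_def)
  then have vf: "v \<in> fixed_space ?H tab_act (specht p)"
    unfolding fixed_space_def v_def using lift_sum_fixed[OF perm_group_stab perm_action_tab_act] by blast
  have "fin_dim (fixed_space ?H tab_act (specht p))"
    by (rule fin_dim_mono[OF fin_dim_specht[of p]]) (auto simp: fixed_space_def)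
  from dim_pos[OF this vf v0] cfun.dim_le_card[OF sub]
  show "cfun.dim (fixed_space ?H tab_act (specht p)) = 1" by simp
qed

lemma sum_irr_char_stab:
  assumes "n = sum_list p"
  shows "(\<Sum>g\<in>stab n c. irr_char p g) =
    of_nat (card (stab n c)) * of_nat (cfun.dim (fixed_space (stab n c) tab_act (specht p)))"
  unfolding irr_char_lift
  by (rule sum_trace_lift[OF perm_group_stab perm_action_tab_act subspace_specht fin_dim_specht])
    (use assms specht_stable in \<open>auto simp: stab_def\<close>)

lemma dim_zero_space: "V \<subseteq> {0} \<Longrightarrow> cfun.dim V = 0"
  using cfun.dim_le_card[of V "{}"] by simp

lemma sum_irr_char_stab_zero:
  assumes "p \<in> partitions_of n" and "(\<Sum>i<K. part p i) < card {x. x < n \<and> c x < K}"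
  shows "(\<Sum>g\<in>stab n c. irr_char p g) = 0"
proof -
  have p: "is_partition p" "n = sum_list p" using assms(1) by (auto simp: partitions_of_def)
  have "cfun.dim (fixed_space (stab n c) tab_act (specht p)) = 0"
    unfolding p(2) by (rule dim_zero_space[OF fixed_specht_zero[OF p(1) assms(2)[unfolded p(2)]]])
  then show ?thesis using sum_irr_char_stab[OF p(2), of c] by simp
qed

lemma card_cells: "card (cells p) = sum_list p"
proof -
  have "{x \<in> cells p. fst x < length p} = cells p" by (auto simp: cells_def)
  then have "card (cells p) = (\<Sum>i<length p. part p i)" using card_cells_less[of p "length p"] by simp
  also have "\<dots> = sum_list p" by (simp add: part_def sum_list_sum_nth atLeast0LessThan)
  finally show ?thesis .
qed

text \<open>Bijections between the cells and the points of each label are glued. The result is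
  injective because the label of a cell can be read off its image.\<close>

lemma exists_tableau:
  assumes "\<And>i. card {x. x < sum_list p \<and> c x = i} = card {y \<in> cells p. l y = i}"
  obtains t where "t \<in> tableaux p" "\<And>y. y \<in> cells p \<Longrightarrow> c (t y) = l y"
proof -
  have "\<exists>f. bij_betw f {y \<in> cells p. l y = i} {x. x < sum_list p \<and> c x = i}" for i
    by (rule finite_same_card_bij) (use assms finite_cells in auto)
  then obtain f where f: "\<And>i. bij_betw (f i) {y \<in> cells p. l y = i} {x. x < sum_list p \<and> c x = i}" by metis
  define t where "t y = f (l y) y" for y
  have t: "t y < sum_list p \<and> c (t y) = l y" if "y \<in> cells p" for y
  proof -
    have "f (l y) y \<in> {x. x < sum_list p \<and> c x = l y}" by (rule bij_betw_apply[OF f]) (use that in auto)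
    then show ?thesis by (simp add: t_def)
  qed
  have "bij_betw t (cells p) {..<sum_list p}" unfolding bij_betw_def
  proof
    show inj: "inj_on t (cells p)"
    proof (rule inj_onI)
      fix y z assume yz: "y \<in> cells p" "z \<in> cells p" "t y = t z"
      then have l: "l y = l z" using t by metis
      show "y = z" using f[of "l y"] yz l by (auto simp: t_def bij_betw_def dest: inj_onD)
    qed
    show "t ` cells p = {..<sum_list p}"
      by (rule card_subset_eq) (use t card_image[OF inj] card_cells in auto)
  qed
  then show ?thesis using that[of t] t by (simp add: tableaux_def)
qed

lemma tableaux_nonempty: obtains t where "t \<in> tableaux p"
  using exists_tableau[of p "\<lambda>_. ()" "\<lambda>_. ()"] card_cells[of p] by auto

lemma sum_irr_char_stab_one:
  assumes "p \<in> partitions_of n" and c: "\<And>i. card {x. x < n \<and> c x = i} = part p i"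
  shows "(\<Sum>g\<in>stab n c. irr_char p g) = of_nat (card (stab n c))"
proof -
  have p: "is_partition p" "n = sum_list p" using assms(1) by (auto simp: partitions_of_def)
  obtain t where t: "t \<in> tableaux p" "\<And>y. y \<in> cells p \<Longrightarrow> c (t y) = fst y"
    using exists_tableau[of p c fst] c p(2) card_row_cells by metis
  show ?thesis
    using sum_irr_char_stab[of n p c] fixed_specht_one(2)[OF p(1) t(1), of c] t(2) p(2) by simp
qed

section \<open>Orthogonality of the irreducible characters\<close>

lemma tens_slice_left:
  assumes "h \<in> tens V W" "cfun.subspace V"
  shows "(\<lambda>x. h (x, y)) \<in> V"
proof -
  have "tens V W \<subseteq> {h. (\<lambda>x. h (x, y)) \<in> V}"
    unfolding tens_def
  proof (rule cfun.span_minimal)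
    show "case_prod tp ` (V \<times> W) \<subseteq> {h. (\<lambda>x. h (x, y)) \<in> V}"
    proof clarify
      fix f g assume "f \<in> V" "g \<in> W"
      then have "cscale (g y) f \<in> V" using cfun.subspace_scale[OF assms(2)] by simp
      then show "(\<lambda>x. tp f g (x, y)) \<in> V" by (simp add: tp_def cscale_def mult.commute)
    qed
    have *: "(\<lambda>x. f (x, y) + g (x, y)) \<in> V" if "(\<lambda>x. f (x, y)) \<in> V" "(\<lambda>x. g (x, y)) \<in> V" for f g
      using cfun.subspace_add[OF assms(2) that] by (simp add: plus_fun_def)
    show "cfun.subspace {h. (\<lambda>x. h (x, y)) \<in> V}"
      unfolding cfun.subspace_def using cfun.subspace_0[OF assms(2)] cfun.subspace_scale[OF assms(2)] *
      by (auto simp: zero_fun_def cscale_def)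
  qed
  then show ?thesis using assms(1) by auto
qed

lemma tens_slice_right:
  assumes "h \<in> tens V W" "cfun.subspace W"
  shows "(\<lambda>y. h (x, y)) \<in> W"
proof -
  have "tens V W \<subseteq> {h. (\<lambda>y. h (x, y)) \<in> W}"
    unfolding tens_def
  proof (rule cfun.span_minimal)
    show "case_prod tp ` (V \<times> W) \<subseteq> {h. (\<lambda>y. h (x, y)) \<in> W}"
    proof clarify
      fix f g assume "f \<in> V" "g \<in> W"
      then have "cscale (f x) g \<in> W" using cfun.subspace_scale[OF assms(2)] by simp
      then show "(\<lambda>y. tp f g (x, y)) \<in> W" by (simp add: tp_def cscale_def)
    qed
    have *: "(\<lambda>y. f (x, y) + g (x, y)) \<in> W" if "(\<lambda>y. f (x, y)) \<in> W" "(\<lambda>y. g (x, y)) \<in> W" for f g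
      using cfun.subspace_add[OF assms(2) that] by (simp add: plus_fun_def)
    show "cfun.subspace {h. (\<lambda>y. h (x, y)) \<in> W}"
      unfolding cfun.subspace_def using cfun.subspace_0[OF assms(2)] cfun.subspace_scale[OF assms(2)] *
      by (auto simp: zero_fun_def cscale_def)
  qed
  then show ?thesis using assms(1) by auto
qed

lemma tens_stable:
  assumes "\<And>f. f \<in> V \<Longrightarrow> lift act g f \<in> V" "\<And>f. f \<in> W \<Longrightarrow> lift act' g f \<in> W" "h \<in> tens V W"
  shows "lift (pact act act') g h \<in> tens V W"
  by (rule tens_closed[OF lin_lift _ assms(3)], unfold lift_tp, intro tp_in_tens assms(1,2))

lemma sum_irr_char_product:
  assumes "sum_list p = n" "sum_list q = n"
  shows "(\<Sum>g\<in>Sym n. irr_char p g * irr_char q g) =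
    fact n * of_nat (cfun.dim (fixed_space (Sym n) (pact tab_act tab_act) (tens (specht p) (specht q))))"
proof -
  have "(\<Sum>g\<in>Sym n. irr_char p g * irr_char q g) =
      (\<Sum>g\<in>Sym n. trace_on (tens (specht p) (specht q)) (lift (pact tab_act tab_act) g))"
    unfolding irr_char_lift
    by (intro sum.cong refl trace_tens[symmetric] subspace_specht fin_dim_specht lin_lift lift_tp specht_stable)
      (use assms in auto)
  also have "\<dots> = of_nat (card (Sym n)) *
    of_nat (cfun.dim (fixed_space (Sym n) (pact tab_act tab_act) (tens (specht p) (specht q))))"
    by (intro sum_trace_lift perm_group_Sym perm_action_pact perm_action_tab_act subspace_tens
        fin_dim_tens subspace_specht fin_dim_specht tens_stable specht_stable) (use assms in auto)
  finally show ?thesis by (simp add: card_Sym)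
qed

lemma tabloid_stab:
  assumes t: "t \<in> tableaux q" and c: "\<And>y. y \<in> cells q \<Longrightarrow> c (t y) = fst y"
    and g: "g \<in> stab (sum_list q) c"
  shows "tab_act g (tabloid q t) = tabloid q t"
proof -
  have "tabloid q (g \<circ> t) ! i = tabloid q t ! i" if i: "i < length q" for i
  proof -
    let ?R = "{x \<in> cells q. fst x = i}"
    have gp: "g permutes {..<sum_list q}" using g by (simp add: stab_def)
    have "(g \<circ> t) ` ?R = t ` ?R"
    proof (rule card_subset_eq)
      show "finite (t ` ?R)" by (simp add: finite_cells)
      show "(g \<circ> t) ` ?R \<subseteq> t ` ?R"
      proof clarify
        fix a b assume ab: "(a, b) \<in> cells q" "i = fst (a, b)"
        have l: "t (a, b) < sum_list q" by (rule tableau_less[OF t ab(1)])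
        then obtain z where z: "z \<in> cells q" "g (t (a, b)) = t z"
          using tableau_cell[OF t, of "g (t (a, b))"] permutes_less[OF gp] by auto
        have "c (g (t (a, b))) = c (t (a, b))" using g l by (simp add: stab_def)
        then have "fst z = a" using c[OF z(1)] c[OF ab(1)] z(2) by simp
        then show "(g \<circ> t) (a, b) \<in> t ` {x \<in> cells q. fst x = fst (a, b)}" using z by auto
      qed
      have "card ((g \<circ> t) ` ?R) = card ?R" "card (t ` ?R) = card ?R"
        using tableau_eq_iff[OF t] tableau_eq_iff[OF tableaux_comp[OF t gp]]
        by (auto intro!: card_image simp: inj_on_def)
      then show "card ((g \<circ> t) ` ?R) = card (t ` ?R)" by simp
    qed
    then show ?thesis using i by (simp add: nth_tabloid)
  qed
  then show ?thesis unfolding tabloid_comp[symmetric]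
    by (intro nth_equalityI) (auto simp: tabloid_def)
qed

text \<open>An invariant of \<open>specht p \<otimes> specht q\<close> is determined by its restriction to one tabloid of
  shape \<open>q\<close>, which is fixed by the stabilizer of that tabloid.\<close>

lemma invariant_slice:
  assumes n: "sum_list p = n" "sum_list q = n"
    and t: "t \<in> tableaux q" and c: "\<And>y. y \<in> cells q \<Longrightarrow> c (t y) = fst y"
    and h: "h \<in> fixed_space (Sym n) (pact tab_act tab_act) (tens (specht p) (specht q))"
  shows "(\<lambda>x. h (x, tabloid q t)) \<in> fixed_space (stab n c) tab_act (specht p)"
    and "(\<lambda>x. h (x, tabloid q t)) = 0 \<Longrightarrow> h = 0"
proof -
  let ?T = "tabloid q t"
  have hin: "h \<in> tens (specht p) (specht q)" using h by (simp add: fixed_space_def)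
  have inv: "h (tab_act (inv g) x, tab_act (inv g) y) = h (x, y)" if "g permutes {..<n}" for g x y
  proof -
    have "lift (pact tab_act tab_act) g h = h" using h that by (simp add: fixed_space_def)
    from fun_cong[OF this, of "(x, y)"] show ?thesis by (simp add: lift_def pact_def)
  qed
  show "(\<lambda>x. h (x, ?T)) \<in> fixed_space (stab n c) tab_act (specht p)"
    unfolding fixed_space_def
  proof (intro CollectI conjI ballI)
    show "(\<lambda>x. h (x, ?T)) \<in> specht p" by (rule tens_slice_left[OF hin subspace_specht])
    fix g assume g: "g \<in> stab n c"
    then have gp: "g permutes {..<n}" by (simp add: stab_def)
    have "tab_act g ?T = ?T" using tabloid_stab[OF t c] g n(2) by simp
    then have gT: "tab_act (inv g) ?T = ?T" using tab_act_inv_eq[OF permutes_bij[OF gp], of ?T ?T] by simp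
    show "lift tab_act g (\<lambda>x. h (x, ?T)) = (\<lambda>x. h (x, ?T))"
    proof
      fix x
      show "lift tab_act g (\<lambda>x. h (x, ?T)) x = h (x, ?T)"
        using inv[OF gp, of x ?T] gT by (simp add: lift_def)
    qed
  qed
  assume z: "(\<lambda>x. h (x, ?T)) = 0"
  show "h = 0"
  proof
    fix xy :: "nat set list \<times> nat set list"
    obtain x y where xy: "xy = (x, y)" by (cases xy)
    show "h xy = 0 xy"
    proof (rule ccontr)
      assume nz: "h xy \<noteq> 0 xy"
      have "(\<lambda>y. h (x, y)) \<in> specht q" by (rule tens_slice_right[OF hin subspace_specht])
      from specht_support[OF this, of y] nz obtain u where u: "u \<in> tableaux q" "y = tabloid q u"
        using xy by auto
      obtain g where g: "g permutes {..<sum_list q}" "\<And>z. z \<in> cells q \<Longrightarrow> u z = g (t z)"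
        using tableaux_transitive[OF t u(1)] by metis
      have "y = tab_act g ?T" unfolding u(2) tabloid_comp[symmetric]
        by (rule tabloid_cong) (simp add: g(2))
      then have "tab_act (inv g) y = ?T" using tab_act_inv_eq[OF permutes_bij[OF g(1)]] by simp
      then have "h (x, y) = h (tab_act (inv g) x, ?T)" using inv[of g x y] g(1) n(2) by simp
      also have "\<dots> = 0" using fun_cong[OF z] by simp
      finally show False using nz xy by simp
    qed
  qed
qed

lemma row_labels:
  assumes t: "t \<in> tableaux q"
  obtains c where "\<And>y. y \<in> cells q \<Longrightarrow> c (t y) = fst y"
proof
  show "fst (inv_into (cells q) t (t y)) = fst y" if "y \<in> cells q" for y
    using t that by (simp add: tableaux_def bij_betw_def)
qed

lemma card_row_labels:
  assumes t: "t \<in> tableaux q" and c: "\<And>y. y \<in> cells q \<Longrightarrow> c (t y) = fst y"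
  shows "card {x. x < sum_list q \<and> c x < K} = (\<Sum>i<K. part q i)"
proof -
  have "{x. x < sum_list q \<and> c x < K} = t ` {y \<in> cells q. fst y < K}"
  proof
    show "{x. x < sum_list q \<and> c x < K} \<subseteq> t ` {y \<in> cells q. fst y < K}"
    proof clarify
      fix x assume x: "x < sum_list q" "c x < K"
      obtain y where "y \<in> cells q" "x = t y" using tableau_cell[OF t x(1)] by blast
      then show "x \<in> t ` {y \<in> cells q. fst y < K}" using x(2) c by auto
    qed
  qed (use tableau_less[OF t] c in auto)
  then show ?thesis
    using card_image[of t "{y \<in> cells q. fst y < K}"] tableau_eq_iff[OF t]
    by (simp add: inj_on_def card_cells_less)
qed

lemma part_eq_imp_eq:
  assumes p: "is_partition p" and q: "is_partition q" and eq: "\<And>i. part p i = part q i"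
  shows "p = q"
proof -
  have pos: "part r i > 0 \<longleftrightarrow> i < length r" if "is_partition r" for r i
    using that by (auto simp: part_def is_partition_def in_set_conv_nth)
  have "i < length p \<longleftrightarrow> i < length q" for i using pos[OF p, of i] pos[OF q, of i] eq by simp
  then have "length p = length q" by (metis linorder_neqE_nat nat_less_le)
  moreover have "p ! i = q ! i" if "i < length p" for i
    using eq[of i] that \<open>length p = length q\<close> by (simp add: part_def)
  ultimately show ?thesis by (intro nth_equalityI) auto
qed

text \<open>At the first difference k the labels of the rows 0 to k of q are too many for the same
  rows of p. So their stabilizer has no invariant in \<open>specht p\<close>, and every slice of an
  invariant tensor vanishes.\<close>

lemma irr_char_orthogonal_aux:
  assumes p: "p \<in> partitions_of n" and q: "q \<in> partitions_of n"
    and eq: "\<And>i. i < k \<Longrightarrow> part p i = part q i" and less: "part p k < part q k"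
  shows "(\<Sum>g\<in>Sym n. irr_char p g * irr_char q g) = 0"
proof -
  have n: "sum_list p = n" "sum_list q = n" and ip: "is_partition p"
    using p q by (auto simp: partitions_of_def)
  obtain t where t: "t \<in> tableaux q" using tableaux_nonempty .
  obtain c where c: "\<And>y. y \<in> cells q \<Longrightarrow> c (t y) = fst y" using row_labels[OF t] by metis
  have "(\<Sum>i<Suc k. part p i) < card {x. x < sum_list p \<and> c x < Suc k}"
    using card_row_labels[OF t c, of "Suc k"] n eq less by simp
  from fixed_specht_zero[OF ip this] invariant_slice[OF n t c]
  have "fixed_space (Sym n) (pact tab_act tab_act) (tens (specht p) (specht q)) \<subseteq> {0}"
    unfolding n by blast
  then show ?thesis unfolding sum_irr_char_product[OF n] by (simp add: dim_zero_space)
qed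

theorem irr_char_orthogonal:
  assumes p: "p \<in> partitions_of n" and q: "q \<in> partitions_of n" and ne: "p \<noteq> q"
  shows "(\<Sum>g\<in>Sym n. irr_char p g * irr_char q g) = 0"
proof -
  obtain i where "part p i \<noteq> part q i"
    using part_eq_imp_eq[of p q] p q ne by (auto simp: partitions_of_def)
  then obtain k where k: "part p k \<noteq> part q k" "\<And>i. i < k \<Longrightarrow> part p i = part q i"
    using exists_least_iff[of "\<lambda>i. part p i \<noteq> part q i"] by metis
  show ?thesis
  proof (cases "part p k < part q k")
    case True
    then show ?thesis using irr_char_orthogonal_aux[OF p q, of k] k by simp
  next
    case False
    then have "(\<Sum>g\<in>Sym n. irr_char q g * irr_char p g) = 0"
      using irr_char_orthogonal_aux[OF q p, of k] k by simp
    then show ?thesis by (simp add: mult.commute)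
  qed
qed

lemma real_sum_squares_eq_0:
  assumes "finite A" "\<And>x. x \<in> A \<Longrightarrow> cnj (f x) = f x" "(\<Sum>x\<in>A. f x * f x) = (0::complex)" "x \<in> A"
  shows "f x = 0"
proof -
  have r: "f x * f x = of_real ((Re (f x))\<^sup>2)" if "x \<in> A" for x
    using assms(2)[OF that] by (simp add: complex_eq_iff power2_eq_square)
  have "of_real (\<Sum>x\<in>A. (Re (f x))\<^sup>2) = (0::complex)" using assms(3) r by simp
  then have "(\<Sum>x\<in>A. (Re (f x))\<^sup>2) = 0" by (simp only: of_real_eq_0_iff)
  then have "(Re (f x))\<^sup>2 = 0" using assms(1,4) by (simp add: sum_nonneg_eq_0_iff)
  then show ?thesis using r[OF assms(4)] by simp
qed

text \<open>All slices at the tabloid of t are multiples of one vector v, and an invariant tensor is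
  determined by its slice; so the invariants have dimension at most 1.\<close>

theorem irr_char_norm:
  assumes p: "p \<in> partitions_of n"
  shows "(\<Sum>g\<in>Sym n. irr_char p g * irr_char p g) = fact n"
proof -
  have n: "sum_list p = n" and ip: "is_partition p" using p by (auto simp: partitions_of_def)
  obtain t where t: "t \<in> tableaux p" using tableaux_nonempty .
  obtain c where c: "\<And>y. y \<in> cells p \<Longrightarrow> c (t y) = fst y" using row_labels[OF t] by metis
  let ?F = "fixed_space (Sym n) (pact tab_act tab_act) (tens (specht p) (specht p))"
  let ?T = "tabloid p t"
  obtain v where v: "fixed_space (stab n c) tab_act (specht p) \<subseteq> cfun.span {v}"
    using fixed_specht_one(1)[OF ip t, of c] c n by auto
  have slice: "\<exists>a. (\<lambda>x. h (x, ?T)) = cscale a v" if "h \<in> ?F" for h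
    using invariant_slice(1)[OF n n t c that] v by (auto simp: cfun.span_singleton)
  have sF: "cfun.subspace ?F"
    unfolding fixed_space_def using subspace_tens[of "specht p" "specht p"]
    by (auto simp: cfun.subspace_def lin_add[OF lin_lift] lin_scale[OF lin_lift] lin_zero[OF lin_lift])
  have "cfun.dim ?F \<le> 1"
  proof (cases "?F \<subseteq> {0}")
    case True
    then show ?thesis by (simp add: dim_zero_space)
  next
    case False
    then obtain h where h: "h \<in> ?F" "h \<noteq> 0" by auto
    obtain a where a: "(\<lambda>x. h (x, ?T)) = cscale a v" using slice[OF h(1)] by blast
    have a0: "a \<noteq> 0"
    proof
      assume "a = 0"
      then have "(\<lambda>x. h (x, ?T)) = 0" using a by simp
      then show False using invariant_slice(2)[OF n n t c h(1)] h(2) by simp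
    qed
    have "h' \<in> cfun.span {h}" if h': "h' \<in> ?F" for h'
    proof -
      obtain b where b: "(\<lambda>x. h' (x, ?T)) = cscale b v" using slice[OF h'] by blast
      have d: "h' - cscale (b / a) h \<in> ?F"
        by (rule cfun.subspace_diff[OF sF h' cfun.subspace_scale[OF sF h(1)]])
      have "(h' - cscale (b / a) h) (x, ?T) = 0" for x
        using fun_cong[OF a, of x] fun_cong[OF b, of x] a0 by (simp add: cscale_def)
      then have "(\<lambda>x. (h' - cscale (b / a) h) (x, ?T)) = 0" by (simp add: fun_eq_iff)
      from invariant_slice(2)[OF n n t c d this] have "h' = cscale (b / a) h"
        by (simp only: right_minus_eq)
      then show ?thesis by (simp add: cfun.span_scale cfun.span_base)
    qed
    then have "?F \<subseteq> cfun.span {h}" by blast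
    from cfun.dim_le_card[OF this] show ?thesis by simp
  qed
  \<comment> \<open>In dimension 0 the squares of the real character values would sum to 0, so the
    character would vanish, although its sum over the Young subgroup does not.\<close>
  moreover have "cfun.dim ?F \<noteq> 0"
  proof
    assume "cfun.dim ?F = 0"
    then have z: "(\<Sum>g\<in>Sym n. irr_char p g * irr_char p g) = 0"
      unfolding sum_irr_char_product[OF n n] by simp
    have "irr_char p g = 0" if "g \<in> Sym n" for g
      by (rule real_sum_squares_eq_0[OF _ _ z that]) (use n cnj_irr_char in \<open>auto simp: finite_permutations\<close>)
    then have "(\<Sum>g\<in>stab n c. irr_char p g) = 0" by (intro sum.neutral) (auto simp: stab_def)
    moreover have "cfun.dim (fixed_space (stab n c) tab_act (specht p)) = 1"
      using fixed_specht_one(2)[OF ip t, of c] c n by auto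
    ultimately show False using sum_irr_char_stab[of n p c] n stab_pos[of n c] by simp
  qed
  ultimately have "cfun.dim ?F = 1" by linarith
  then show ?thesis unfolding sum_irr_char_product[OF n n] by simp
qed

section \<open>Colourings and the determinantal class functions\<close>

text \<open>Colourings of \<open>{..<n}\<close> with \<open>N\<close> colours stand for tabloids whose shape is any integer
  vector; they are \<open>0\<close> outside \<open>{..<n}\<close> so that they can be composed with permutations.\<close>

definition cols :: "nat \<Rightarrow> nat \<Rightarrow> (nat \<Rightarrow> int) \<Rightarrow> (nat \<Rightarrow> nat) set" where
  "cols n N \<gamma> = {c. (\<forall>x<n. c x < N) \<and> (\<forall>x\<ge>n. c x = 0) \<and> (\<forall>i<N. int (card {x. x < n \<and> c x = i}) = \<gamma> i)}"

definition pc :: "nat \<Rightarrow> nat \<Rightarrow> (nat \<Rightarrow> int) \<Rightarrow> (nat \<Rightarrow> nat) \<Rightarrow> nat" where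
  "pc n N \<gamma> g = card {c \<in> cols n N \<gamma>. c \<circ> g = c}"

text \<open>The vector \<delta> = (N - 1, ..., 1, 0). Its entries are integers so that contents
  obtained by subtracting it may become negative; these have no colouring.\<close>

definition dl :: "nat \<Rightarrow> nat \<Rightarrow> int" where
  "dl N i = int N - 1 - int i"

text \<open>The Jacobi--Trudi determinant, with permutation characters in place of products of complete
  symmetric functions.\<close>

definition omega :: "nat \<Rightarrow> nat \<Rightarrow> (nat \<Rightarrow> int) \<Rightarrow> (nat \<Rightarrow> nat) \<Rightarrow> complex" where
  "omega n N \<beta> g = (\<Sum>\<sigma>\<in>Sym N. of_int (sign \<sigma>) * of_nat (pc n N (\<lambda>i. \<beta> i - dl N (\<sigma> i)) g))"

text \<open>The bead positions (beta numbers) of p on an abacus with N beads.\<close>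

definition bt :: "nat \<Rightarrow> nat list \<Rightarrow> nat \<Rightarrow> int" where
  "bt N p i = int (part p i) + dl N i"

lemma finite_cols: "finite (cols n N \<gamma>)"
proof (rule finite_subset)
  show "cols n N \<gamma> \<subseteq> {c. \<forall>x. (x \<in> {..<n} \<longrightarrow> c x \<in> {..<N}) \<and> (x \<notin> {..<n} \<longrightarrow> c x = 0)}"
    by (auto simp: cols_def)
  show "finite {c. \<forall>x. (x \<in> {..<n} \<longrightarrow> c x \<in> {..<N}) \<and> (x \<notin> {..<n} \<longrightarrow> c x = 0)}"
    by (rule finite_set_of_finite_funs) auto
qed

lemma cols_cong: "(\<And>i. i < N \<Longrightarrow> \<gamma> i = \<gamma>' i) \<Longrightarrow> cols n N \<gamma> = cols n N \<gamma>'"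
  by (auto simp: cols_def)

lemma pc_cong: "(\<And>i. i < N \<Longrightarrow> \<gamma> i = \<gamma>' i) \<Longrightarrow> pc n N \<gamma> g = pc n N \<gamma>' g"
  unfolding pc_def using cols_cong[of N \<gamma> \<gamma>' n] by simp

lemma card_preimage:
  fixes n :: nat
  assumes g: "g permutes {..<n}"
  shows "card {x. x < n \<and> P (g x)} = card {x. x < n \<and> P x}"
proof -
  have "bij_betw g {x. x < n \<and> P (g x)} {x. x < n \<and> P x}"
  proof (rule bij_betw_imageI)
    show "inj_on g {x. x < n \<and> P (g x)}" by (rule permutes_inj_on[OF g])
    show "g ` {x. x < n \<and> P (g x)} = {x. x < n \<and> P x}"
    proof (intro set_eqI iffI)
      fix x assume "x \<in> {x. x < n \<and> P x}"
      then show "x \<in> g ` {x. x < n \<and> P (g x)}"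
        using permutes_less[OF permutes_inv[OF g], of x] permutes_inverses[OF g]
        by (intro image_eqI[of _ _ "inv g x"]) auto
    qed (use permutes_less[OF g] in auto)
  qed
  then show ?thesis by (rule bij_betw_same_card)
qed

lemma cols_comp:
  assumes "c \<in> cols n N \<gamma>" "g permutes {..<n}"
  shows "c \<circ> g \<in> cols n N \<gamma>"
  using assms permutes_less[OF assms(2)] card_preimage[OF assms(2), of "\<lambda>y. c y = i" for i]
    permutes_not_in[OF assms(2)]
  by (auto simp: cols_def)

lemma stab_cols: "c \<in> cols n N \<gamma> \<Longrightarrow> stab n c = {g \<in> Sym n. c \<circ> g = c}"
  by (auto simp: stab_def fun_eq_iff) (metis lessThan_iff not_less permutes_not_in cols_def)

lemma label_transitive:
  assumes "\<And>v. card {x. x < n \<and> l x = v} = card {x. x < (n::nat) \<and> l' x = v}"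
  obtains f where "f permutes {..<n}" "\<And>x. x < n \<Longrightarrow> l' x = l (f x)"
proof -
  have "\<exists>f. bij_betw f {x. x < n \<and> l' x = v} {x. x < n \<and> l x = v}" for v
    by (rule finite_same_card_bij) (use assms in auto)
  then obtain f where f: "\<And>v. bij_betw (f v) {x. x < n \<and> l' x = v} {x. x < n \<and> l x = v}" by metis
  define h where "h x = (if x < n then f (l' x) x else x)" for x
  have h: "h x < n \<and> l (h x) = l' x" if x: "x < n" for x
  proof -
    have "f (l' x) x \<in> {y. y < n \<and> l y = l' x}" by (rule bij_betw_apply[OF f]) (use x in auto)
    then show ?thesis using x by (simp add: h_def)
  qed
  have "inj_on h {..<n}"
  proof (rule inj_onI)
    fix x y assume xy: "x \<in> {..<n}" "y \<in> {..<n}" "h x = h y"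
    then have "l' x = l' y" using h by (metis lessThan_iff)
    then show "x = y" using f[of "l' x"] xy by (auto simp: h_def bij_betw_def dest: inj_onD)
  qed
  then have "h permutes {..<n}"
    by (rule inj_imp_permutes) (use h in \<open>auto simp: h_def\<close>)
  then show ?thesis using that[of h] h by simp
qed

lemma cols_transitive:
  assumes "c \<in> cols n N \<gamma>" "c' \<in> cols n N \<gamma>"
  obtains f where "f permutes {..<n}" "c' = c \<circ> f"
proof -
  have "card {x. x < n \<and> c x = v} = card {x. x < n \<and> c' x = v}" for v
  proof (cases "v < N")
    case True
    then have "int (card {x. x < n \<and> c x = v}) = int (card {x. x < n \<and> c' x = v})"
      using assms by (simp add: cols_def)
    then show ?thesis by simp
  next
    case False
    then have "{x. x < n \<and> c x = v} = {}" "{x. x < n \<and> c' x = v} = {}"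
      using assms by (auto simp: cols_def)
    then show ?thesis by (simp only: card.empty)
  qed
  then obtain f where f: "f permutes {..<n}" "\<And>x. x < n \<Longrightarrow> c' x = c (f x)"
    using label_transitive[of n c c'] by metis
  have "c' x = c (f x)" for x
    using f assms permutes_not_in[OF f(1), of x] by (cases "x < n") (auto simp: cols_def)
  then show ?thesis using f(1) by (intro that[of f]) auto
qed

lemma sum_pc:
  fixes \<Phi> :: "(nat \<Rightarrow> nat) \<Rightarrow> complex"
  assumes "H \<subseteq> Sym n"
  shows "(\<Sum>g\<in>H. \<Phi> g * of_nat (pc n N \<gamma> g)) = (\<Sum>c\<in>cols n N \<gamma>. \<Sum>g\<in>{g \<in> H. c \<circ> g = c}. \<Phi> g)"
proof -
  have fH: "finite H" by (rule finite_subset[OF assms]) (simp add: finite_permutations)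
  have "\<Phi> g * of_nat (pc n N \<gamma> g) = (\<Sum>c\<in>cols n N \<gamma>. if c \<circ> g = c then \<Phi> g else 0)" for g
    unfolding pc_def using finite_cols by (simp add: sum.If_cases Int_def mult.commute)
  then have "(\<Sum>g\<in>H. \<Phi> g * of_nat (pc n N \<gamma> g)) = (\<Sum>c\<in>cols n N \<gamma>. \<Sum>g\<in>H. if c \<circ> g = c then \<Phi> g else 0)"
    by (simp only:) (rule sum.swap)
  also have "\<dots> = (\<Sum>c\<in>cols n N \<gamma>. \<Sum>g\<in>{g \<in> H. c \<circ> g = c}. \<Phi> g)"
    by (intro sum.cong refl sum.inter_filter[symmetric] fH)
  finally show ?thesis .
qed

definition class_fun :: "nat \<Rightarrow> ((nat \<Rightarrow> nat) \<Rightarrow> complex) \<Rightarrow> bool" where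
  "class_fun n \<Phi> \<longleftrightarrow> (\<forall>g\<in>Sym n. \<forall>h\<in>Sym n. \<Phi> (h \<circ> g \<circ> inv h) = \<Phi> g)"

lemma sum_stab_conj:
  assumes \<Phi>: "class_fun n \<Phi>" and c: "c \<in> cols n N \<gamma>" and c': "c' \<in> cols n N \<gamma>"
  shows "(\<Sum>g\<in>stab n c. \<Phi> g) = (\<Sum>g\<in>stab n c'. \<Phi> g)"
proof -
  obtain f where f: "f permutes {..<n}" "c' = c \<circ> f" using cols_transitive[OF c c'] .
  have [simp]: "f (inv f x) = x" "inv f (f x) = x" for x using permutes_inverses[OF f(1)] by auto
  have fi: "inv f permutes {..<n}" by (rule permutes_inv[OF f(1)])
  have "bij_betw (\<lambda>g. f \<circ> g \<circ> inv f) (stab n c') (stab n c)"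
  proof (rule bij_betw_byWitness[where f' = "\<lambda>g. inv f \<circ> g \<circ> f"])
    show "\<forall>g\<in>stab n c'. inv f \<circ> (f \<circ> g \<circ> inv f) \<circ> f = g" by (auto simp: fun_eq_iff)
    show "\<forall>g\<in>stab n c. f \<circ> (inv f \<circ> g \<circ> f) \<circ> inv f = g" by (auto simp: fun_eq_iff)
    show "(\<lambda>g. f \<circ> g \<circ> inv f) ` stab n c' \<subseteq> stab n c"
    proof clarify
      fix g assume g: "g \<in> stab n c'"
      then have "f \<circ> g \<circ> inv f permutes {..<n}"
        using f(1) fi by (intro permutes_compose) (auto simp: stab_def)
      moreover have "c (f (g (inv f x))) = c x" if "x < n" for x
      proof -
        have "c' (g (inv f x)) = c' (inv f x)"
          using g permutes_less[OF fi, of x] that by (simp add: stab_def)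
        then show ?thesis by (simp add: f(2))
      qed
      ultimately show "f \<circ> g \<circ> inv f \<in> stab n c" by (simp add: stab_def)
    qed
    show "(\<lambda>g. inv f \<circ> g \<circ> f) ` stab n c \<subseteq> stab n c'"
    proof clarify
      fix g assume g: "g \<in> stab n c"
      then have "inv f \<circ> g \<circ> f permutes {..<n}"
        using f(1) fi by (intro permutes_compose) (auto simp: stab_def)
      moreover have "c (g (f x)) = c (f x)" if "x < n" for x
        using g permutes_less[OF f(1), of x] that by (simp add: stab_def)
      ultimately show "inv f \<circ> g \<circ> f \<in> stab n c'" by (simp add: stab_def f(2))
    qed
  qed
  then have "(\<Sum>g\<in>stab n c'. \<Phi> (f \<circ> g \<circ> inv f)) = (\<Sum>g\<in>stab n c. \<Phi> g)"
    by (rule sum.reindex_bij_betw)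
  moreover have "(\<Sum>g\<in>stab n c'. \<Phi> (f \<circ> g \<circ> inv f)) = (\<Sum>g\<in>stab n c'. \<Phi> g)"
    using \<Phi> f(1) by (intro sum.cong refl) (auto simp: class_fun_def stab_def)
  ultimately show ?thesis by simp
qed

text \<open>As many g fix c as carry a base point c0 to c, and the sets of the latter partition
  H.\<close>

lemma orbit_count:
  assumes H: "perm_group H" and X: "finite X" "X \<noteq> {}"
    and stable: "\<And>c g. c \<in> X \<Longrightarrow> g \<in> H \<Longrightarrow> c \<circ> g \<in> X"
    and trans: "\<And>c c'. c \<in> X \<Longrightarrow> c' \<in> X \<Longrightarrow> \<exists>g\<in>H. c' = c \<circ> g"
  shows "(\<Sum>c\<in>X. card {g \<in> H. c \<circ> g = c}) = card H"
proof -
  obtain c0 where c0: "c0 \<in> X" using X(2) by auto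
  have fH: "finite H" using H by (simp add: perm_group_def)
  have "card {g \<in> H. c \<circ> g = c} = card {g \<in> H. c0 \<circ> g = c}" if c: "c \<in> X" for c
  proof -
    obtain f where f: "f \<in> H" "c = c0 \<circ> f" using trans[OF c0 c] by blast
    have b: "bij f" using H f(1) by (simp add: perm_group_def)
    then have [simp]: "f (inv f x) = x" "inv f (f x) = x" for x
      by (simp_all add: bij_is_surj surj_f_inv_f bij_is_inj inv_f_f)
    have fi: "inv f \<in> H" by (rule perm_group_inv[OF H f(1)])
    have "bij_betw (\<lambda>g. f \<circ> g) {g \<in> H. c \<circ> g = c} {g \<in> H. c0 \<circ> g = c}"
      by (rule bij_betw_byWitness[where f' = "\<lambda>g. inv f \<circ> g"])
        (use H f fi in \<open>auto simp: perm_group_def fun_eq_iff\<close>)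
    then show ?thesis by (rule bij_betw_same_card)
  qed
  then have "(\<Sum>c\<in>X. card {g \<in> H. c \<circ> g = c}) = (\<Sum>c\<in>X. card {g \<in> H. c0 \<circ> g = c})" by simp
  also have "\<dots> = card (\<Union>c\<in>X. {g \<in> H. c0 \<circ> g = c})"
    using X fH by (intro card_UN_disjoint[symmetric]) auto
  also have "(\<Union>c\<in>X. {g \<in> H. c0 \<circ> g = c}) = H" using stable[OF c0] by auto
  finally show ?thesis .
qed

lemma card_cols_stab:
  assumes c: "c \<in> cols n N \<gamma>"
  shows "card (cols n N \<gamma>) * card (stab n c) = fact n"
proof -
  have one: "class_fun n (\<lambda>_. 1)" by (simp add: class_fun_def)
  have eq: "card (stab n c') = card (stab n c)" if "c' \<in> cols n N \<gamma>" for c'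
    using sum_stab_conj[OF one that c] by simp
  have "card (Sym n) = (\<Sum>c\<in>cols n N \<gamma>. card {g \<in> Sym n. c \<circ> g = c})"
    by (rule orbit_count[symmetric, OF perm_group_Sym finite_cols])
      (use c cols_comp cols_transitive in \<open>auto, metis\<close>)
  also have "\<dots> = (\<Sum>c'\<in>cols n N \<gamma>. card (stab n c))"
    by (intro sum.cong refl) (metis eq stab_cols)
  finally show ?thesis by (simp add: card_Sym)
qed

text \<open>Frobenius reciprocity for the permutation character on colourings, multiplied out by the
  order of the stabilizer.\<close>

lemma sum_class_fun_pc:
  assumes \<Phi>: "class_fun n \<Phi>" and c: "c \<in> cols n N \<gamma>"
  shows "(\<Sum>g\<in>Sym n. \<Phi> g * of_nat (pc n N \<gamma> g)) * of_nat (card (stab n c)) = fact n * (\<Sum>g\<in>stab n c. \<Phi> g)"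
proof -
  have "(\<Sum>g\<in>Sym n. \<Phi> g * of_nat (pc n N \<gamma> g)) = (\<Sum>c'\<in>cols n N \<gamma>. \<Sum>g\<in>stab n c'. \<Phi> g)"
    using sum_pc[of "Sym n" n \<Phi> N \<gamma>] stab_cols by (simp cong: sum.cong)
  also have "\<dots> = (\<Sum>c'\<in>cols n N \<gamma>. \<Sum>g\<in>stab n c. \<Phi> g)"
    by (intro sum.cong refl sum_stab_conj[OF \<Phi>, of _ N \<gamma>] c)
  also have "\<dots> = of_nat (card (cols n N \<gamma>)) * (\<Sum>g\<in>stab n c. \<Phi> g)" by simp
  finally have "(\<Sum>g\<in>Sym n. \<Phi> g * of_nat (pc n N \<gamma> g)) * of_nat (card (stab n c)) =
      of_nat (card (cols n N \<gamma>) * card (stab n c)) * (\<Sum>g\<in>stab n c. \<Phi> g)" by simp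
  then show ?thesis by (simp only: card_cols_stab[OF c] of_nat_fact)
qed

lemma sum_class_fun_pc_empty: "cols n N \<gamma> = {} \<Longrightarrow> (\<Sum>g\<in>Sym n. \<Phi> g * of_nat (pc n N \<gamma> g)) = 0"
  by (simp add: pc_def)

lemma pc_conj:
  assumes g: "g permutes {..<n}" and h: "h permutes {..<n}"
  shows "pc n N \<gamma> (h \<circ> g \<circ> inv h) = pc n N \<gamma> g"
proof -
  have [simp]: "h (inv h x) = x" "inv h (h x) = x" for x using permutes_inverses[OF h] by auto
  have "bij_betw (\<lambda>c. c \<circ> h) {c \<in> cols n N \<gamma>. c \<circ> (h \<circ> g \<circ> inv h) = c} {c \<in> cols n N \<gamma>. c \<circ> g = c}"
  proof (rule bij_betw_byWitness[where f' = "\<lambda>c. c \<circ> inv h"])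
    show "(\<lambda>c. c \<circ> h) ` {c \<in> cols n N \<gamma>. c \<circ> (h \<circ> g \<circ> inv h) = c} \<subseteq> {c \<in> cols n N \<gamma>. c \<circ> g = c}"
    proof clarify
      fix c assume c: "c \<in> cols n N \<gamma>" "c \<circ> (h \<circ> g \<circ> inv h) = c"
      have "c (h (g x)) = c (h x)" for x using fun_cong[OF c(2), of "h x"] by simp
      then show "c \<circ> h \<in> cols n N \<gamma> \<and> c \<circ> h \<circ> g = c \<circ> h" using cols_comp[OF c(1) h] by auto
    qed
    show "(\<lambda>c. c \<circ> inv h) ` {c \<in> cols n N \<gamma>. c \<circ> g = c} \<subseteq> {c \<in> cols n N \<gamma>. c \<circ> (h \<circ> g \<circ> inv h) = c}"
    proof clarify
      fix c assume c: "c \<in> cols n N \<gamma>" "c \<circ> g = c"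
      have "c (g x) = c x" for x using fun_cong[OF c(2), of x] by simp
      then show "c \<circ> inv h \<in> cols n N \<gamma> \<and> c \<circ> inv h \<circ> (h \<circ> g \<circ> inv h) = c \<circ> inv h"
        using cols_comp[OF c(1) permutes_inv[OF h]] by auto
    qed
  qed auto
  then show ?thesis unfolding pc_def by (rule bij_betw_same_card)
qed

lemma class_fun_omega: "class_fun n (omega n N \<beta>)"
  by (simp add: class_fun_def omega_def pc_conj)

lemma class_fun_irr_char: "sum_list p = n \<Longrightarrow> class_fun n (irr_char p)"
  by (simp add: class_fun_def irr_char_conj)

lemma cnj_omega: "cnj (omega n N \<beta> g) = omega n N \<beta> g"
  by (simp add: omega_def)

text \<open>Renaming the colours by \<tau> matches the invariant colourings. Beyond n the value is
  reset to 0, since \<tau> may move the colour 0.\<close>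

lemma pc_permute:
  assumes \<tau>: "\<tau> permutes {..<N}" and g: "g permutes {..<n}"
  shows "pc n N (\<gamma> \<circ> \<tau>) g = pc n N \<gamma> g"
proof -
  have main: "(\<lambda>x. if x < n then \<tau> (c x) else 0) \<in> {c \<in> cols n N \<gamma>. c \<circ> g = c}"
    if "\<tau> permutes {..<N}" "c \<in> cols n N (\<gamma> \<circ> \<tau>)" "c \<circ> g = c" "g permutes {..<n}" for \<tau> \<gamma> c
  proof -
    have "int (card {x. x < n \<and> \<tau> (c x) = i}) = \<gamma> i" if i: "i < N" for i
    proof -
      have "\<tau> (c x) = i \<longleftrightarrow> c x = inv \<tau> i" for x
        using permutes_inverses[OF \<open>\<tau> permutes {..<N}\<close>] by metis
      then have "int (card {x. x < n \<and> \<tau> (c x) = i}) = (\<gamma> \<circ> \<tau>) (inv \<tau> i)"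
        using \<open>c \<in> cols n N (\<gamma> \<circ> \<tau>)\<close> permutes_less[OF permutes_inv[OF \<open>\<tau> permutes {..<N}\<close>], of i] i
        by (simp add: cols_def)
      then show ?thesis using permutes_inverses[OF \<open>\<tau> permutes {..<N}\<close>] by simp
    qed
    moreover have "{x. x < n \<and> (if x < n then \<tau> (c x) else 0) = i} = {x. x < n \<and> \<tau> (c x) = i}" for i
      by auto
    moreover have "c (g x) = c x" for x using fun_cong[OF that(3), of x] by simp
    ultimately show ?thesis
      using that(2) permutes_less[OF that(1)] permutes_less[OF that(4)]
      by (auto simp: cols_def fun_eq_iff)
  qed
  have [simp]: "\<tau> (inv \<tau> x) = x" "inv \<tau> (\<tau> x) = x" for x using permutes_inverses[OF \<tau>] by auto
  have i: "\<gamma> = (\<gamma> \<circ> \<tau>) \<circ> inv \<tau>" by (auto simp: fun_eq_iff)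
  have "bij_betw (\<lambda>c x. if x < n then \<tau> (c x) else 0) {c \<in> cols n N (\<gamma> \<circ> \<tau>). c \<circ> g = c} {c \<in> cols n N \<gamma>. c \<circ> g = c}"
  proof (rule bij_betw_byWitness[where f' = "\<lambda>c x. if x < n then inv \<tau> (c x) else 0"])
    show "(\<lambda>c x. if x < n then \<tau> (c x) else 0) ` {c \<in> cols n N (\<gamma> \<circ> \<tau>). c \<circ> g = c} \<subseteq> {c \<in> cols n N \<gamma>. c \<circ> g = c}"
      using main[OF \<tau> _ _ g] by blast
    show "(\<lambda>c x. if x < n then inv \<tau> (c x) else 0) ` {c \<in> cols n N \<gamma>. c \<circ> g = c} \<subseteq> {c \<in> cols n N (\<gamma> \<circ> \<tau>). c \<circ> g = c}"
      using main[OF permutes_inv[OF \<tau>] _ _ g, of _ "\<gamma> \<circ> \<tau>"] i by auto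
  qed (auto simp: cols_def fun_eq_iff)
  then show ?thesis unfolding pc_def by (rule bij_betw_same_card)
qed

section \<open>Antisymmetry and vanishing of the determinants\<close>

lemma omega_cong: "(\<And>i. i < N \<Longrightarrow> \<beta> i = \<beta>' i) \<Longrightarrow> omega n N \<beta> g = omega n N \<beta>' g"
  unfolding omega_def by (intro sum.cong refl arg_cong2[of _ _ _ _ "(*)"] arg_cong[of _ _ of_nat] pc_cong) auto

lemma sign_comp_Sym: "\<sigma> \<in> Sym N \<Longrightarrow> \<tau> \<in> Sym N \<Longrightarrow> sign (\<sigma> \<circ> \<tau>) = sign \<sigma> * sign \<tau>"
  by (simp add: sign_compose permutes_permutation)

lemma omega_permute:
  assumes \<tau>: "\<tau> permutes {..<N}" and g: "g permutes {..<n}"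
  shows "omega n N (\<beta> \<circ> \<tau>) g = of_int (sign \<tau>) * omega n N \<beta> g"
proof -
  have "omega n N (\<beta> \<circ> \<tau>) g = (\<Sum>\<sigma>\<in>Sym N. of_int (sign (\<sigma> \<circ> \<tau>)) *
      of_nat (pc n N (\<lambda>i. (\<beta> \<circ> \<tau>) i - dl N ((\<sigma> \<circ> \<tau>) i)) g))"
    unfolding omega_def
    by (rule perm_group_sum_right[OF perm_group_Sym, symmetric,
        where F = "\<lambda>\<sigma>. of_int (sign \<sigma>) * of_nat (pc n N (\<lambda>i. (\<beta> \<circ> \<tau>) i - dl N (\<sigma> i)) g)"])
      (use \<tau> in simp)
  also have "\<dots> = (\<Sum>\<sigma>\<in>Sym N. of_int (sign \<tau>) * (of_int (sign \<sigma>) * of_nat (pc n N (\<lambda>i. \<beta> i - dl N (\<sigma> i)) g)))"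
  proof (intro sum.cong refl)
    fix \<sigma> assume \<sigma>: "\<sigma> \<in> Sym N"
    have "(\<lambda>i. (\<beta> \<circ> \<tau>) i - dl N ((\<sigma> \<circ> \<tau>) i)) = (\<lambda>i. \<beta> i - dl N (\<sigma> i)) \<circ> \<tau>" by auto
    then show "of_int (sign (\<sigma> \<circ> \<tau>)) * of_nat (pc n N (\<lambda>i. (\<beta> \<circ> \<tau>) i - dl N ((\<sigma> \<circ> \<tau>) i)) g) =
        of_int (sign \<tau>) * (of_int (sign \<sigma>) * (of_nat (pc n N (\<lambda>i. \<beta> i - dl N (\<sigma> i)) g) :: complex))"
      using \<sigma> \<tau> by (simp only: pc_permute[OF \<tau> g] sign_comp_Sym mem_Collect_eq of_int_mult) (simp add: mult_ac)
  qed
  finally show ?thesis by (simp add: omega_def sum_distrib_left)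
qed

lemma omega_repeated:
  assumes g: "g permutes {..<n}" and ab: "a < N" "b < N" "a \<noteq> b" "\<beta> a = \<beta> b"
  shows "omega n N \<beta> g = 0"
proof -
  have "transpose a b permutes {..<N}" using ab by (intro permutes_swap_id) auto
  from omega_permute[OF this g, of \<beta>] have "omega n N (\<beta> \<circ> transpose a b) g = - omega n N \<beta> g"
    using ab by (simp add: sign_swap_id)
  moreover have "\<beta> \<circ> transpose a b = \<beta>" using ab by (auto simp: fun_eq_iff transpose_def)
  ultimately show ?thesis by simp
qed

lemma dl_nonneg: "i < N \<Longrightarrow> dl N i \<ge> 0"
  by (simp add: dl_def)

lemma pc_negative: "i < N \<Longrightarrow> \<gamma> i < 0 \<Longrightarrow> pc n N \<gamma> g = 0"
proof -
  assume "i < N" "\<gamma> i < 0"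
  then have "cols n N \<gamma> = {}" unfolding cols_def by (auto intro!: exI[of _ i])
  then show ?thesis by (simp add: pc_def)
qed

lemma omega_negative:
  assumes "i < N" "\<beta> i < 0" shows "omega n N \<beta> g = 0"
  unfolding omega_def
proof (intro sum.neutral ballI)
  fix \<sigma> assume "\<sigma> \<in> Sym N"
  then have "dl N (\<sigma> i) \<ge> 0" using assms(1) permutes_less[of \<sigma> N i] by (simp add: dl_nonneg)
  then have "pc n N (\<lambda>i. \<beta> i - dl N (\<sigma> i)) g = 0" using assms by (intro pc_negative[of i]) auto
  then show "of_int (sign \<sigma>) * of_nat (pc n N (\<lambda>i. \<beta> i - dl N (\<sigma> i)) g) = (0::complex)" by simp
qed

lemma sum_content:
  assumes "c \<in> cols n N \<gamma>" shows "(\<Sum>i<N. \<gamma> i) = int n"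
proof -
  have "(\<Union>i<N. {x. x < n \<and> c x = i}) = {..<n}" using assms by (auto simp: cols_def)
  moreover have "card (\<Union>i<N. {x. x < n \<and> c x = i}) = (\<Sum>i<N. card {x. x < n \<and> c x = i})"
    by (rule card_UN_disjoint) auto
  ultimately have "card {..<n} = (\<Sum>i<N. card {x. x < n \<and> c x = i})" by simp
  from arg_cong[OF this, of int] have "int n = (\<Sum>i<N. int (card {x. x < n \<and> c x = i}))"
    unfolding card_lessThan of_nat_sum .
  also have "\<dots> = (\<Sum>i<N. \<gamma> i)" using assms by (intro sum.cong refl) (simp add: cols_def)
  finally show ?thesis ..
qed

lemma sum_permute_Sym: "\<sigma> permutes {..<N::nat} \<Longrightarrow> (\<Sum>i<N. f (\<sigma> i)) = (\<Sum>i<N. f i)"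
  using sum.permute[of \<sigma> "{..<N}" f] by (simp add: comp_def)

lemma omega_wrong_sum:
  assumes "(\<Sum>i<N. \<beta> i) \<noteq> int n + (\<Sum>i<N. dl N i)"
  shows "omega n N \<beta> g = 0"
  unfolding omega_def
proof (intro sum.neutral ballI)
  fix \<sigma> assume "\<sigma> \<in> Sym N"
  then have "(\<Sum>i<N. \<beta> i - dl N (\<sigma> i)) = (\<Sum>i<N. \<beta> i) - (\<Sum>i<N. dl N i)"
    by (simp add: sum_subtractf sum_permute_Sym)
  then have "cols n N (\<lambda>i. \<beta> i - dl N (\<sigma> i)) = {}" using sum_content[of _ n N] assms by fastforce
  then show "of_int (sign \<sigma>) * of_nat (pc n N (\<lambda>i. \<beta> i - dl N (\<sigma> i)) g) = (0::complex)"
    by (simp add: pc_def)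
qed

text \<open>The last \<open>r\<close> points form one cycle of \<open>g\<close>, so an invariant colouring is constant on them.\<close>

lemma pc_remove_cycle:
  assumes n: "n = n' + r" "r \<ge> 1"
    and g': "g' permutes {..<n'}" and g: "\<And>x. x < n' \<Longrightarrow> g x = g' x" "\<And>x. n' \<le> x \<Longrightarrow> x < n - 1 \<Longrightarrow> g x = Suc x"
      "g (n - 1) = n'" "g permutes {..<n}"
  shows "pc n N \<gamma> g = (\<Sum>i<N. pc n' N (\<gamma>(i := \<gamma> i - int r)) g')"
proof -
  let ?A = "\<lambda>i. {c \<in> cols n' N (\<gamma>(i := \<gamma> i - int r)). c \<circ> g' = c}"
  define e where "e i c = (\<lambda>x. if n' \<le> x \<and> x < n then i else c x)" for i :: nat and c :: "nat \<Rightarrow> nat"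
  have const: "c x = c n'" if c: "c \<circ> g = c" and x: "n' \<le> x" "x < n" for c :: "nat \<Rightarrow> nat" and x
    using x
  proof (induction x rule: dec_induct)
    case (step x)
    then have "g x = Suc x" using g(2)[of x] by simp
    then have "c (Suc x) = c x" using fun_cong[OF c, of x] by simp
    with step show ?case by simp
  qed simp
  have content: "int (card {x. x < n \<and> e i c x = l}) = int (card {x. x < n' \<and> c x = l}) + (if l = i then int r else 0)" for i l c
  proof -
    have "{x. x < n \<and> e i c x = l} = {x. x < n' \<and> c x = l} \<union> (if l = i then {n'..<n} else {})"
      using n by (auto simp: e_def)
    moreover have "card ({x. x < n' \<and> c x = l} \<union> (if l = i then {n'..<n} else {})) =
        card {x. x < n' \<and> c x = l} + card (if l = i then {n'..<n} else {})"
      by (rule card_Un_disjoint) auto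
    ultimately show ?thesis using n(1) by simp
  qed
  have img: "e i ` ?A i = {c \<in> cols n N \<gamma>. c \<circ> g = c \<and> c n' = i}" if i: "i < N" for i
  proof (intro equalityI subsetI)
    fix d assume "d \<in> e i ` ?A i"
    then obtain c where c: "c \<in> cols n' N (\<gamma>(i := \<gamma> i - int r))" "c \<circ> g' = c" "d = e i c" by auto
    have "int (card {x. x < n \<and> d x = l}) = \<gamma> l" if "l < N" for l
      using c(1) that unfolding c(3) content by (auto simp: cols_def)
    then have "d \<in> cols n N \<gamma>" using c(1) i n unfolding cols_def c(3) by (auto simp: e_def)
    moreover have "d (g x) = d x" for x
    proof -
      consider "x < n'" | "n' \<le> x" "x < n - 1" | "x = n - 1" | "n \<le> x" using n by linarith
      then show ?thesis
      proof cases
        case 1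
        then have "g' x < n'" using permutes_less[OF g'] by simp
        then show ?thesis using 1 g(1) fun_cong[OF c(2), of x] by (simp add: c(3) e_def)
      next
        case 4
        then show ?thesis using permutes_not_in[OF g(4), of x] by simp
      next
        case 2
        then have "x < n" "Suc x < n" by auto
        then show ?thesis using g(2)[OF 2] 2 by (simp add: c(3) e_def)
      next
        case 3
        have "n' \<le> n - 1" "n - 1 < n" "n' < n" using n by auto
        then show ?thesis using g(3) 3 by (simp add: c(3) e_def)
      qed
    qed
    moreover have "d n' = i" using n by (simp add: c(3) e_def)
    ultimately show "d \<in> {c \<in> cols n N \<gamma>. c \<circ> g = c \<and> c n' = i}" by auto
  next
    fix d assume d: "d \<in> {c \<in> cols n N \<gamma>. c \<circ> g = c \<and> c n' = i}"
    define c where "c x = (if x < n' then d x else 0)" for x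
    have de: "d = e i c"
    proof
      fix x show "d x = e i c x"
        using d const[of d x] n by (cases "x < n"; cases "x < n'") (auto simp: e_def c_def cols_def)
    qed
    have "int (card {x. x < n' \<and> c x = l}) = (\<gamma>(i := \<gamma> i - int r)) l" if "l < N" for l
    proof -
      have "int (card {x. x < n \<and> e i c x = l}) = \<gamma> l" using d that unfolding de by (simp add: cols_def)
      then show ?thesis unfolding content by (auto split: if_splits)
    qed
    moreover have "c x < N" if "x < n'" for x using d that n by (auto simp: c_def cols_def)
    ultimately have "c \<in> cols n' N (\<gamma>(i := \<gamma> i - int r))" by (simp add: cols_def) (simp add: c_def)
    moreover have "c \<circ> g' = c"
    proof
      fix x show "(c \<circ> g') x = c x"
      proof (cases "x < n'")
        case True
        moreover have "d (g x) = d x" using d by (auto simp: fun_eq_iff)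
        ultimately show ?thesis using g(1) permutes_less[OF g', of x] by (simp add: c_def)
      qed (use permutes_not_in[OF g', of x] in simp)
    qed
    ultimately show "d \<in> e i ` ?A i" using de by auto
  qed
  have inj: "inj_on (e i) (?A i)" for i
  proof (rule inj_onI)
    fix c c' assume c: "c \<in> ?A i" "c' \<in> ?A i" "e i c = e i c'"
    show "c = c'"
    proof
      fix x
      have "e i c x = e i c' x" using c(3) by simp
      then show "c x = c' x" using c(1,2) by (cases "x < n'") (simp_all add: e_def cols_def)
    qed
  qed
  have "{c \<in> cols n N \<gamma>. c \<circ> g = c} = (\<Union>i<N. {c \<in> cols n N \<gamma>. c \<circ> g = c \<and> c n' = i})"
    using n by (auto simp: cols_def)
  then have "pc n N \<gamma> g = (\<Sum>i<N. card {c \<in> cols n N \<gamma>. c \<circ> g = c \<and> c n' = i})"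
    unfolding pc_def by (simp only:) (rule card_UN_disjoint, auto intro: finite_subset[OF _ finite_cols])
  also have "\<dots> = (\<Sum>i<N. pc n' N (\<gamma>(i := \<gamma> i - int r)) g')"
    unfolding pc_def by (intro sum.cong refl) (metis (no_types, lifting) img inj card_image lessThan_iff)
  finally show ?thesis .
qed

text \<open>The Murnaghan--Nakayama rule in bead form: a cycle of length r lowers one bead by r. Rim
  hooks and their signs are hidden in the antisymmetry of \<open>omega\<close> in \<beta>.\<close>

lemma omega_remove_cycle:
  assumes n: "n = n' + r" "r \<ge> 1"
    and g': "g' permutes {..<n'}" and g: "\<And>x. x < n' \<Longrightarrow> g x = g' x" "\<And>x. n' \<le> x \<Longrightarrow> x < n - 1 \<Longrightarrow> g x = Suc x"
      "g (n - 1) = n'" "g permutes {..<n}"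
  shows "omega n N \<beta> g = (\<Sum>i<N. omega n' N (\<beta>(i := \<beta> i - int r)) g')"
proof -
  have pc: "pc n N (\<lambda>i. \<beta> i - dl N (\<sigma> i)) g =
      (\<Sum>i<N. pc n' N (\<lambda>j. (\<beta>(i := \<beta> i - int r)) j - dl N (\<sigma> j)) g')" for \<sigma>
    by (rule trans[OF pc_remove_cycle[OF assms] sum.cong[OF refl pc_cong]]) auto
  have "omega n N \<beta> g = (\<Sum>\<sigma>\<in>Sym N. \<Sum>i<N. of_int (sign \<sigma>) *
      of_nat (pc n' N (\<lambda>j. (\<beta>(i := \<beta> i - int r)) j - dl N (\<sigma> j)) g'))"
    unfolding omega_def pc of_nat_sum sum_distrib_left by (rule refl)
  also have "\<dots> = (\<Sum>i<N. omega n' N (\<beta>(i := \<beta> i - int r)) g')"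
    unfolding omega_def by (rule sum.swap)
  finally show ?thesis .
qed

section \<open>Nonnegative matrices with given margins\<close>

text \<open>Such a matrix records how two colourings overlap: \<open>E (l, i)\<close> is the number
  of points with colour l in the first and colour i in the second, and \<gamma> is the content of
  the first.\<close>

definition mats :: "nat \<Rightarrow> (nat \<Rightarrow> int) \<Rightarrow> (nat \<times> nat \<Rightarrow> nat) set" where
  "mats N \<gamma> = {E. (\<forall>l i. \<not> (l < N \<and> i < N) \<longrightarrow> E (l, i) = 0) \<and> (\<forall>l<N. int (\<Sum>i<N. E (l, i)) = \<gamma> l)}"

definition colsum :: "nat \<Rightarrow> (nat \<times> nat \<Rightarrow> nat) \<Rightarrow> nat \<Rightarrow> int" where
  "colsum N E i = int (\<Sum>l<N. E (l, i))"

lemma finite_mats: "finite (mats N \<gamma>)"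
proof (rule finite_subset)
  let ?M = "nat (\<Sum>l<N. \<bar>\<gamma> l\<bar>)"
  show "mats N \<gamma> \<subseteq> {E. \<forall>x. (x \<in> {..<N} \<times> {..<N} \<longrightarrow> E x \<in> {..?M}) \<and> (x \<notin> {..<N} \<times> {..<N} \<longrightarrow> E x = 0)}"
  proof
    fix E assume E: "E \<in> mats N \<gamma>"
    have "E (l, i) \<le> ?M" if "l < N" "i < N" for l i
    proof -
      have "E (l, i) \<le> (\<Sum>i<N. E (l, i))" using that by (intro member_le_sum) auto
      then have "int (E (l, i)) \<le> int (\<Sum>i<N. E (l, i))" by (simp only: of_nat_le_iff)
      also have "\<dots> = \<gamma> l" using E that unfolding mats_def by blast
      also have "\<dots> \<le> \<bar>\<gamma> l\<bar>" by simp
      also have "\<dots> \<le> (\<Sum>l<N. \<bar>\<gamma> l\<bar>)" by (rule member_le_sum) (use that in auto)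
      finally show ?thesis by simp
    qed
    then show "E \<in> {E. \<forall>x. (x \<in> {..<N} \<times> {..<N} \<longrightarrow> E x \<in> {..?M}) \<and> (x \<notin> {..<N} \<times> {..<N} \<longrightarrow> E x = 0)}"
      using E by (auto simp: mats_def)
  qed
  show "finite {E. \<forall>x. (x \<in> {..<N} \<times> {..<N} \<longrightarrow> E x \<in> {..?M}) \<and> (x \<notin> {..<N} \<times> {..<N} \<longrightarrow> E x = (0::nat))}"
    by (rule finite_set_of_finite_funs) auto
qed

lemma exists_colouring:
  "finite A \<Longrightarrow> card A = (\<Sum>i<(N::nat). e i) \<Longrightarrow>
    \<exists>f. (\<forall>x\<in>A. f x < N) \<and> (\<forall>i<N. card {x \<in> A. f x = i} = (e i :: nat))"
proof (induction N arbitrary: A)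
  case (Suc N)
  obtain B where B: "B \<subseteq> A" "card B = e N"
    using obtain_subset_with_card_n[of "e N" A] Suc.prems by auto
  have fB: "finite B" using B Suc.prems finite_subset by auto
  have "card (A - B) = (\<Sum>i<N. e i)" using Suc.prems B fB by (simp add: card_Diff_subset)
  then obtain f where f: "\<forall>x\<in>A - B. f x < N" "\<forall>i<N. card {x \<in> A - B. f x = i} = e i"
    using Suc.IH[of "A - B"] Suc.prems by auto
  let ?f = "\<lambda>x. if x \<in> B then N else f x"
  have "{x \<in> A. ?f x = i} = (if i = N then B else {x \<in> A - B. f x = i})" if "i < Suc N" for i
    using that B f(1) by auto
  then have "\<forall>i<Suc N. card {x \<in> A. ?f x = i} = e i" using f(2) B by (auto simp: less_Suc_eq)
  moreover have "\<forall>x\<in>A. ?f x < Suc N" using f(1) by (auto intro!: less_SucI)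
  ultimately show ?case by (intro exI[of _ ?f] conjI)
qed auto

text \<open>By \<open>orbit_count\<close> each orbit of the stabilizer on colourings contributes the
  order of the stabilizer. Two colourings lie in one orbit exactly if they have the same overlap
  matrix \<open>em\<close> with c0.\<close>

lemma sum_stab_pc:
  assumes c0: "c0 \<in> cols n N \<gamma>"
  shows "(\<Sum>g\<in>stab n c0. pc n N \<alpha> g) = card (stab n c0) * card {E \<in> mats N \<gamma>. \<forall>i<N. colsum N E i = \<alpha> i}"
proof -
  let ?H = "stab n c0" and ?X = "cols n N \<alpha>"
  define em where "em c = (\<lambda>(l, i). if l < N \<and> i < N then card {x. x < n \<and> c0 x = l \<and> c x = i} else 0)" for c :: "nat \<Rightarrow> nat"
  have HS: "?H \<subseteq> Sym n" by (auto simp: stab_def)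
  have "(of_nat (\<Sum>g\<in>?H. pc n N \<alpha> g) :: complex) = of_nat (\<Sum>c\<in>?X. card {g \<in> ?H. c \<circ> g = c})"
    using sum_pc[OF HS, of "\<lambda>_. 1" N \<alpha>] by simp
  then have "(\<Sum>g\<in>?H. pc n N \<alpha> g) = (\<Sum>c\<in>?X. card {g \<in> ?H. c \<circ> g = c})" by (simp only: of_nat_eq_iff)
  also have "\<dots> = (\<Sum>E\<in>em ` ?X. \<Sum>c\<in>{c \<in> ?X. em c = E}. card {g \<in> ?H. c \<circ> g = c})"
    by (rule sum.image_gen[OF finite_cols])
  also have "\<dots> = (\<Sum>E\<in>em ` ?X. card ?H)"
  proof (intro sum.cong refl orbit_count perm_group_stab)
    fix E assume E: "E \<in> em ` ?X"
    then show "{c \<in> ?X. em c = E} \<noteq> {}" by auto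
    show "finite {c \<in> ?X. em c = E}" by (simp add: finite_cols)
    show "c \<circ> g \<in> {c \<in> ?X. em c = E}" if c: "c \<in> {c \<in> ?X. em c = E}" and g: "g \<in> ?H" for c g
    proof -
      have gp: "g permutes {..<n}" using g by (simp add: stab_def)
      have "card {x. x < n \<and> c0 x = l \<and> c (g x) = i} = card {x. x < n \<and> c0 x = l \<and> c x = i}" for l i
      proof -
        have "{x. x < n \<and> c0 x = l \<and> c (g x) = i} = {x. x < n \<and> (c0 (g x) = l \<and> c (g x) = i)}"
          using g by (auto simp: stab_def)
        then show ?thesis using card_preimage[OF gp, of "\<lambda>y. c0 y = l \<and> c y = i"] by simp
      qed
      then have "em (c \<circ> g) = em c" by (auto simp: em_def fun_eq_iff)
      then show ?thesis using c cols_comp[OF _ gp] by auto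
    qed
    show "\<exists>g\<in>?H. c' = c \<circ> g" if c: "c \<in> {c \<in> ?X. em c = E}" and c': "c' \<in> {c \<in> ?X. em c = E}" for c c'
    proof -
      have "card {x. x < n \<and> (c0 x, c x) = v} = card {x. x < n \<and> (c0 x, c' x) = v}" for v
      proof (cases "fst v < N \<and> snd v < N")
        case True
        obtain l i where v: "v = (l, i)" by (cases v)
        have "em c v = em c' v" using c c' by simp
        then show ?thesis using True by (simp add: em_def v)
      next
        case False
        then have "{x. x < n \<and> (c0 x, c x) = v} = {}" "{x. x < n \<and> (c0 x, c' x) = v} = {}"
          using c c' c0 by (auto simp: cols_def)
        then show ?thesis by (simp only: card.empty)
      qed
      then obtain f where f: "f permutes {..<n}" "\<And>x. x < n \<Longrightarrow> (c0 x, c' x) = (c0 (f x), c (f x))"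
        using label_transitive[of n "\<lambda>x. (c0 x, c x)" "\<lambda>x. (c0 x, c' x)"] by metis
      have "c' x = c (f x)" for x
        using f c c' permutes_not_in[OF f(1), of x] by (cases "x < n") (auto simp: cols_def)
      then have "c' = c \<circ> f" by auto
      moreover have "f \<in> ?H" using f by (simp add: stab_def)
      ultimately show ?thesis by blast
    qed
  qed
  also have "\<dots> = card ?H * card (em ` ?X)" by simp
  also have "em ` ?X = {E \<in> mats N \<gamma>. \<forall>i<N. colsum N E i = \<alpha> i}"
  proof (intro equalityI subsetI)
    fix E assume "E \<in> em ` ?X"
    then obtain c where c: "c \<in> ?X" "E = em c" by auto
    have "(\<Sum>i<N. card {x. x < n \<and> c0 x = l \<and> c x = i}) = card {x. x < n \<and> c0 x = l}" for l
    proof -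
      have "(\<Union>i<N. {x. x < n \<and> c0 x = l \<and> c x = i}) = {x. x < n \<and> c0 x = l}"
        using c(1) by (auto simp: cols_def)
      then show ?thesis by (subst card_UN_disjoint[symmetric]) auto
    qed
    moreover have "(\<Sum>l<N. card {x. x < n \<and> c0 x = l \<and> c x = i}) = card {x. x < n \<and> c x = i}" for i
    proof -
      have "(\<Union>l<N. {x. x < n \<and> c0 x = l \<and> c x = i}) = {x. x < n \<and> c x = i}"
        using c0 by (auto simp: cols_def)
      then show ?thesis by (subst card_UN_disjoint[symmetric]) auto
    qed
    ultimately show "E \<in> {E \<in> mats N \<gamma>. \<forall>i<N. colsum N E i = \<alpha> i}"
      using c c0 by (auto simp: mats_def colsum_def em_def cols_def simp del: of_nat_sum)
  next
    fix E assume E: "E \<in> {E \<in> mats N \<gamma>. \<forall>i<N. colsum N E i = \<alpha> i}"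
    have "\<exists>f. (\<forall>x\<in>{x. x < n \<and> c0 x = l}. f x < N) \<and>
        (\<forall>i<N. card {x \<in> {x. x < n \<and> c0 x = l}. f x = i} = E (l, i))" if l: "l < N" for l
    proof (rule exists_colouring)
      have "int (card {x. x < n \<and> c0 x = l}) = int (\<Sum>i<N. E (l, i))"
        using c0 E l by (simp add: cols_def mats_def)
      then show "card {x. x < n \<and> c0 x = l} = (\<Sum>i<N. E (l, i))" by (simp only: of_nat_eq_iff)
    qed simp
    then have "\<forall>l. \<exists>f. l < N \<longrightarrow> (\<forall>x\<in>{x. x < n \<and> c0 x = l}. f x < N) \<and>
        (\<forall>i<N. card {x \<in> {x. x < n \<and> c0 x = l}. f x = i} = E (l, i))" by simp
    from choice[OF this]
    obtain f where f: "\<And>l. l < N \<Longrightarrow> (\<forall>x\<in>{x. x < n \<and> c0 x = l}. f l x < N) \<and>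
        (\<forall>i<N. card {x \<in> {x. x < n \<and> c0 x = l}. f l x = i} = E (l, i))" by auto
    define c where "c x = (if x < n then f (c0 x) x else 0)" for x
    have c0N: "c0 x < N" if "x < n" for x using c0 that by (simp add: cols_def)
    have cE: "card {x. x < n \<and> c0 x = l \<and> c x = i} = E (l, i)" if "l < N" "i < N" for l i
    proof -
      have "{x. x < n \<and> c0 x = l \<and> c x = i} = {x \<in> {x. x < n \<and> c0 x = l}. f l x = i}"
        by (auto simp: c_def)
      then show ?thesis using f that by simp
    qed
    have "card {x. x < n \<and> c x = i} = (\<Sum>l<N. E (l, i))" if i: "i < N" for i
    proof -
      have "{x. x < n \<and> c x = i} = (\<Union>l<N. {x. x < n \<and> c0 x = l \<and> c x = i})" using c0N by auto
      then have "card {x. x < n \<and> c x = i} = (\<Sum>l<N. card {x. x < n \<and> c0 x = l \<and> c x = i})"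
        by (simp only:) (rule card_UN_disjoint, auto)
      then show ?thesis using cE i by simp
    qed
    then have "c \<in> ?X" using E f c0N by (auto simp: cols_def c_def colsum_def)
    moreover have "em c = E" using E cE by (auto simp: em_def fun_eq_iff mats_def)
    ultimately show "E \<in> em ` ?X" by auto
  qed
  finally show ?thesis .
qed

text \<open>The coefficient of a_\<beta> in a_v, where a_v is the antisymmetrised monomial x^v. If
  \<beta> has distinct entries it is a sign when v is a rearrangement of \<beta>, and 0
  otherwise.\<close>

definition Gd :: "nat \<Rightarrow> (nat \<Rightarrow> int) \<Rightarrow> (nat \<Rightarrow> int) \<Rightarrow> int" where
  "Gd N \<beta> v = (\<Sum>\<tau>\<in>Sym N. sign \<tau> * (if \<forall>i<N. v (\<tau> i) = \<beta> i then 1 else 0))"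

lemma Gd_cong: "(\<And>i. i < N \<Longrightarrow> v i = v' i) \<Longrightarrow> Gd N \<beta> v = Gd N \<beta> v'"
  unfolding Gd_def by (intro sum.cong refl) (auto simp: permutes_less)

lemma Gd_permute:
  assumes "\<sigma> permutes {..<N}"
  shows "Gd N \<beta> (v \<circ> \<sigma>) = sign \<sigma> * Gd N \<beta> v"
proof -
  let ?F = "\<lambda>\<tau>. sign \<sigma> * (sign \<tau> * (if \<forall>i<N. v (\<tau> i) = \<beta> i then 1 else 0))"
  have "Gd N \<beta> (v \<circ> \<sigma>) = (\<Sum>\<tau>\<in>Sym N. ?F (\<sigma> \<circ> \<tau>))"
    unfolding Gd_def
  proof (intro sum.cong refl)
    fix \<tau> assume \<tau>: "\<tau> \<in> Sym N"
    have "sign \<sigma> * sign (\<sigma> \<circ> \<tau>) = sign \<tau>"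
      using sign_comp_Sym[of \<sigma> N \<tau>] assms \<tau> by (simp add: mult.assoc[symmetric])
    then show "sign \<tau> * (if \<forall>i<N. (v \<circ> \<sigma>) (\<tau> i) = \<beta> i then 1 else 0) = ?F (\<sigma> \<circ> \<tau>)"
      by (simp add: mult.assoc[symmetric])
  qed
  also have "\<dots> = (\<Sum>\<tau>\<in>Sym N. ?F \<tau>)" by (rule perm_group_sum_left[OF perm_group_Sym]) (use assms in simp)
  finally show ?thesis by (simp add: Gd_def sum_distrib_left)
qed

lemma Gd_repeated:
  assumes ab: "a < N" "b < N" "a \<noteq> b" "v a = v b"
  shows "Gd N \<beta> v = 0"
proof -
  have "transpose a b permutes {..<N}" using ab by (intro permutes_swap_id) auto
  from Gd_permute[OF this, of \<beta> v] have "Gd N \<beta> (v \<circ> transpose a b) = - Gd N \<beta> v"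
    using ab by (simp add: sign_swap_id)
  moreover have "v \<circ> transpose a b = v" using ab by (auto simp: fun_eq_iff transpose_def)
  ultimately show ?thesis by simp
qed

lemma Gd_nonzero:
  assumes "Gd N \<beta> v \<noteq> 0"
  obtains \<tau> where "\<tau> permutes {..<N}" "\<And>i. i < N \<Longrightarrow> v (\<tau> i) = \<beta> i"
proof -
  obtain \<tau> where \<tau>: "\<tau> \<in> Sym N" "sign \<tau> * (if \<forall>i<N. v (\<tau> i) = \<beta> i then 1 else 0) \<noteq> 0"
    using assms unfolding Gd_def by (rule sum.not_neutral_contains_not_neutral)
  then show ?thesis by (intro that[of \<tau>]) (auto split: if_splits)
qed

lemma Gd_self:
  assumes "inj_on \<beta> {..<N}"
  shows "Gd N \<beta> \<beta> = 1"
proof -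
  have "Gd N \<beta> \<beta> = (\<Sum>\<tau>\<in>Sym N. if \<tau> = id then 1 else 0)"
    unfolding Gd_def
  proof (intro sum.cong refl)
    fix \<tau> assume \<tau>: "\<tau> \<in> Sym N"
    have "\<tau> = id" if "\<forall>i<N. \<beta> (\<tau> i) = \<beta> i"
    proof
      fix i show "\<tau> i = id i"
        using that \<tau> inj_onD[OF assms, of "\<tau> i" i] permutes_less[of \<tau> N i] permutes_not_in[of \<tau> "{..<N}" i]
        by (cases "i < N") auto
    qed
    then show "sign \<tau> * (if \<forall>i<N. \<beta> (\<tau> i) = \<beta> i then 1 else 0) = (if \<tau> = id then 1 else 0)"
      by (auto simp: sign_id)
  qed
  then show ?thesis by (simp add: finite_permutations)
qed

definition strict :: "nat \<Rightarrow> (nat \<Rightarrow> int) \<Rightarrow> bool" where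
  "strict N b \<longleftrightarrow> (\<forall>i j. i < j \<longrightarrow> j < N \<longrightarrow> b j < b i)"

lemma strict_inj: "strict N b \<Longrightarrow> inj_on b {..<N}"
  unfolding strict_def by (rule linorder_inj_onI') fastforce

text \<open>The value at t is b j for some j. The values b i with i < t are taken at their own
  places and the entries of b are distinct, so j is at least t.\<close>

lemma rearrangement_le:
  assumes \<tau>: "\<tau> permutes {..<N}" "\<And>i. i < N \<Longrightarrow> v (\<tau> i) = b i" and b: "strict N b"
    and eq: "\<And>i. i < t \<Longrightarrow> v i = b i" and t: "t < N"
  shows "v t \<le> b t"
proof -
  define j where "j = inv \<tau> t"
  have j: "\<tau> j = t" "j < N"
    using permutes_inverses[OF \<tau>(1)] permutes_less[OF permutes_inv[OF \<tau>(1)]] t by (auto simp: j_def)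
  have vt: "v t = b j" using \<tau>(2)[OF j(2)] j(1) by simp
  have "\<not> j < t"
  proof
    assume jt: "j < t"
    define i where "i = inv \<tau> j"
    have i: "\<tau> i = j" "i < N"
      using permutes_inverses[OF \<tau>(1)] permutes_less[OF permutes_inv[OF \<tau>(1)]] j(2) by (auto simp: i_def)
    have "b i = b j" using \<tau>(2)[OF i(2)] i(1) eq[OF jt] by simp
    then have "i = j" using strict_inj[OF b] i(2) j(2) by (auto dest: inj_onD)
    then show False using i j jt by simp
  qed
  then show ?thesis using vt b j(2) by (cases "t = j") (auto simp: strict_def intro: less_imp_le)
qed

lemma rearrangement_eq:
  assumes \<tau>: "\<tau> permutes {..<N}" "\<And>i. i < N \<Longrightarrow> v (\<tau> i) = b i" and b: "strict N b"
    and ge: "\<And>i. i < t \<Longrightarrow> b i \<le> v i" and t: "t \<le> N"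
  shows "i < t \<Longrightarrow> v i = b i"
proof (induction i rule: less_induct)
  case (less i)
  have "v i \<le> b i" by (rule rearrangement_le[OF \<tau> b]) (use less t in auto)
  then show ?case using ge[OF less.prems] by simp
qed

section \<open>Evaluation of Kostka sums by Pieri cancellation\<close>

definition mats_diag :: "nat \<Rightarrow> (nat \<Rightarrow> int) \<Rightarrow> nat \<Rightarrow> (nat \<times> nat \<Rightarrow> nat) set" where
  "mats_diag N \<gamma> t = {E \<in> mats N \<gamma>. \<forall>l i. l < t \<longrightarrow> i \<noteq> l \<longrightarrow> E (l, i) = 0}"

abbreviation mval :: "nat \<Rightarrow> (nat \<times> nat \<Rightarrow> nat) \<Rightarrow> nat \<Rightarrow> int" where
  "mval N E i \<equiv> dl N i + colsum N E i"

text \<open>The sign-reversing involution of Pieri's rule: it acts at the last entry beyond the diagonal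
  in row \<open>t\<close> and exchanges the two neighbouring columns, up to the shift by \<open>dl\<close> in row \<open>t\<close>.\<close>

definition pieri_swap :: "nat \<Rightarrow> (nat \<times> nat \<Rightarrow> nat) \<Rightarrow> nat \<times> nat \<Rightarrow> nat" where
  "pieri_swap t E = (let m = Max {i. i > t \<and> E (t, i) \<noteq> 0} in (\<lambda>(l, i).
     if l = t then (if i = m - 1 then E (t, m) - 1 else if i = m then E (t, m - 1) + 1 else E (t, i))
     else E (l, transpose (m - 1) m i)))"

lemma sum_two_split:
  fixes f :: "nat \<Rightarrow> nat"
  assumes "a < N" "b < N" "a \<noteq> b"
  shows "(\<Sum>i<N. f i) = f a + f b + (\<Sum>i\<in>{..<N} - {a, b}. f i)"
proof -
  have "(\<Sum>i<N. f i) = f a + (f b + (\<Sum>i\<in>{..<N} - {a} - {b}. f i))"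
    using assms by (subst sum.remove[of _ a], simp, simp, subst sum.remove[of _ b]) auto
  moreover have "{..<N} - {a} - {b} = {..<N} - {a, b}" by auto
  ultimately show ?thesis by (simp only: add.assoc)
qed

lemma mats_support: "E \<in> mats N \<gamma> \<Longrightarrow> E (l, i) \<noteq> 0 \<Longrightarrow> l < N \<and> i < N"
proof (rule ccontr)
  assume "E \<in> mats N \<gamma>" "E (l, i) \<noteq> 0" "\<not> (l < N \<and> i < N)"
  then show False by (simp add: mats_def)
qed

lemma pieri_swap:
  assumes E: "E \<in> mats_diag N \<gamma> t" and t: "t < N" and ex: "\<exists>i>t. E (t, i) \<noteq> 0"
  defines "E' \<equiv> pieri_swap t E" and "m \<equiv> Max {i. i > t \<and> E (t, i) \<noteq> 0}"
  shows "E' \<in> mats_diag N \<gamma> t" "\<exists>i>t. E' (t, i) \<noteq> 0" "pieri_swap t E' = E"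
    "t < m" "m < N" "\<And>i. i < N \<Longrightarrow> mval N E' i = mval N E (transpose (m - 1) m i)"
proof -
  have Em: "E \<in> mats N \<gamma>" using E by (simp add: mats_diag_def)
  let ?S = "{i. i > t \<and> E (t, i) \<noteq> 0}"
  have SN: "?S \<subseteq> {..<N}" using mats_support[OF Em] by auto
  have finS: "finite ?S" using SN finite_subset by blast
  have "m \<in> ?S" unfolding m_def using ex finS by (intro Max_in) auto
  then show mt: "t < m" and mN: "m < N" using SN by auto
  have Em0: "E (t, m) \<noteq> 0" using \<open>m \<in> ?S\<close> by simp
  have above: "E (t, i) = 0" if "i > m" for i
    using Max_ge[OF finS, of i] that mt unfolding m_def[symmetric] by (cases "E (t, i) = 0") auto
  have E'_t: "E' (t, i) = (if i = m - 1 then E (t, m) - 1 else if i = m then E (t, m - 1) + 1 else E (t, i))" for i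
    by (simp add: E'_def pieri_swap_def Let_def m_def)
  have E'_l: "E' (l, i) = E (l, transpose (m - 1) m i)" if "l \<noteq> t" for l i
    using that by (simp add: E'_def pieri_swap_def Let_def m_def)
  have perm: "transpose (m - 1) m permutes {..<N}" using mN by (intro permutes_swap_id) auto
  have m1: "m - 1 \<noteq> m" "m - 1 < N" using mt mN by auto
  have row_t: "(\<Sum>i<N. E' (t, i)) = (\<Sum>i<N. E (t, i))"
  proof -
    have "(\<Sum>i\<in>{..<N} - {m - 1, m}. E' (t, i)) = (\<Sum>i\<in>{..<N} - {m - 1, m}. E (t, i))"
      by (intro sum.cong refl) (auto simp: E'_t)
    moreover have "E' (t, m - 1) + E' (t, m) = E (t, m - 1) + E (t, m)"
      using m1(1) Em0 unfolding E'_t by simp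
    ultimately show ?thesis
      unfolding sum_two_split[OF m1(2) mN m1(1), of "\<lambda>i. E' (t, i)"]
        sum_two_split[OF m1(2) mN m1(1), of "\<lambda>i. E (t, i)"] by (rule arg_cong2[rotated])
  qed
  have row: "(\<Sum>i<N. E' (l, i)) = (\<Sum>i<N. E (l, i))" for l
    using row_t E'_l sum_permute_Sym[OF perm, of "\<lambda>i. E (l, i)"] by (cases "l = t") auto
  have zero: "E' (l, i) = 0" if "\<not> (l < N \<and> i < N)" for l i
  proof (cases "l = t")
    case True
    then have i: "\<not> i < N" using that t by simp
    then have "E (t, i) = 0" using mats_support[OF Em, of t i] by auto
    then show ?thesis using True i mN m1(2) by (auto simp: E'_t)
  next
    case False
    have "\<not> (l < N \<and> transpose (m - 1) m i < N)" using that permutes_less[OF perm, of i] by simp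
    then have "E (l, transpose (m - 1) m i) = 0" using mats_support[OF Em] by blast
    then show ?thesis by (simp only: E'_l[OF False])
  qed
  have diag: "E' (l, i) = 0" if "l < t" "i \<noteq> l" for l i
  proof -
    have "transpose (m - 1) m i \<noteq> l" using that mt by (auto simp: transpose_def)
    then show ?thesis using E that E'_l[of l i] by (auto simp: mats_diag_def)
  qed
  show E'in: "E' \<in> mats_diag N \<gamma> t"
    using zero diag row Em by (simp add: mats_diag_def mats_def del: of_nat_sum)
  have E'm: "E' (t, m) \<noteq> 0" using m1 by (simp add: E'_t)
  then show "\<exists>i>t. E' (t, i) \<noteq> 0" using mt by blast
  have max': "Max {i. i > t \<and> E' (t, i) \<noteq> 0} = m"
  proof (rule Max_eqI)
    show "finite {i. i > t \<and> E' (t, i) \<noteq> 0}"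
    proof (rule finite_subset)
      show "{i. i > t \<and> E' (t, i) \<noteq> 0} \<subseteq> {..<N}"
        using mats_support[of E' N \<gamma> t] E'in by (auto simp: mats_diag_def)
    qed simp
    show "i \<le> m" if "i \<in> {i. i > t \<and> E' (t, i) \<noteq> 0}" for i
    proof (rule ccontr)
      assume "\<not> i \<le> m"
      then have "E (t, i) = 0" "i \<noteq> m" "i \<noteq> m - 1" using above[of i] by auto
      then show False using that by (simp add: E'_t)
    qed
    show "m \<in> {i. i > t \<and> E' (t, i) \<noteq> 0}" using E'm mt by simp
  qed
  show "pieri_swap t E' = E"
  proof
    fix x :: "nat \<times> nat"
    obtain l i where x: "x = (l, i)" by (cases x)
    have P: "pieri_swap t E' (l, i) = (if l = t then (if i = m - 1 then E' (t, m) - 1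
        else if i = m then E' (t, m - 1) + 1 else E' (t, i)) else E' (l, transpose (m - 1) m i))"
      unfolding pieri_swap_def[of t E'] max' Let_def by simp
    have a: "E' (t, m) = E (t, m - 1) + 1" using m1(1) unfolding E'_t by simp
    have b: "E' (t, m - 1) = E (t, m) - 1" unfolding E'_t by simp
    have c: "E' (t, i) = E (t, i)" if "i \<noteq> m - 1" "i \<noteq> m" using that unfolding E'_t by simp
    have d: "E' (l, transpose (m - 1) m i) = E (l, i)" if "l \<noteq> t"
      unfolding E'_l[OF that] by (simp only: transpose_involutory)
    show "pieri_swap t E' x = E x"
      unfolding x P using a b c d m1(1) Em0 by (cases "l = t"; cases "i = m - 1"; cases "i = m"; simp)
  qed
  show "mval N E' i = mval N E (transpose (m - 1) m i)" if i: "i < N" for i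
  proof -
    have split: "(\<Sum>l<N. F l) = F t + (\<Sum>l\<in>{..<N} - {t}. F l)" for F :: "nat \<Rightarrow> nat"
      using t by (subst sum.remove[of _ t]) auto
    have "(\<Sum>l\<in>{..<N} - {t}. E' (l, i)) = (\<Sum>l\<in>{..<N} - {t}. E (l, transpose (m - 1) m i))"
      by (intro sum.cong refl) (auto simp: E'_l)
    \<comment> \<open>Column m - 1 has the larger \<open>dl\<close>, by exactly 1; the changes by 1
      in row t compensate for this.\<close>
    moreover have "int (E' (t, i)) + dl N i = int (E (t, transpose (m - 1) m i)) + dl N (transpose (m - 1) m i)"
    proof -
      consider "i = m - 1" | "i = m" | "i \<noteq> m - 1" "i \<noteq> m" by blast
      then show ?thesis
      proof cases
        case 1
        then show ?thesis using mt Em0 unfolding E'_t by (simp add: dl_def of_nat_diff)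
      next
        case 2
        then show ?thesis using mt m1(1) unfolding E'_t by (simp add: dl_def of_nat_diff)
      next
        case 3
        then show ?thesis unfolding E'_t by (simp add: transpose_def)
      qed
    qed
    ultimately show ?thesis unfolding colsum_def split by simp
  qed
qed

text \<open>The involution \<open>pieri_swap\<close> cancels the matrices with an entry right of the
  diagonal in row t. In the others with nonzero \<open>Gd\<close>, \<open>rearrangement_eq\<close>
  gives each column i < t the sum p_i, which its diagonal entry already exhausts; so row t has
  nothing left of the diagonal either.\<close>

lemma sum_mats_diag_step:
  assumes p: "strict N (bt N p)" and t: "t < N" and \<gamma>: "\<And>l. l < t \<Longrightarrow> \<gamma> l = int (part p l)"
  shows "(\<Sum>E\<in>mats_diag N \<gamma> t. Gd N (bt N p) (mval N E)) =
    (\<Sum>E\<in>{E \<in> mats_diag N \<gamma> (Suc t). \<gamma> t \<le> int (part p t)}. Gd N (bt N p) (mval N E))"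
proof -
  let ?M = "mats_diag N \<gamma> t" and ?F = "\<lambda>E. Gd N (bt N p) (mval N E)"
  let ?A = "{E \<in> ?M. \<exists>i>t. E (t, i) \<noteq> 0}"
  let ?B = "{E \<in> mats_diag N \<gamma> (Suc t). \<gamma> t \<le> int (part p t)}"
  have fin: "finite ?M" by (rule finite_subset[OF _ finite_mats[of N \<gamma>]]) (auto simp: mats_diag_def)
  have neg: "?F (pieri_swap t E) = - ?F E" if "E \<in> ?A" for E
  proof -
    let ?m = "Max {i. i > t \<and> E (t, i) \<noteq> 0}"
    have E: "E \<in> ?M" "\<exists>i>t. E (t, i) \<noteq> 0" using that by auto
    note ps = pieri_swap[OF E(1) t E(2)]
    have perm: "transpose (?m - 1) ?m permutes {..<N}" using ps(5) by (intro permutes_swap_id) auto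
    have "?F (pieri_swap t E) = Gd N (bt N p) (mval N E \<circ> transpose (?m - 1) ?m)"
      by (rule Gd_cong) (use ps(6) in simp)
    also have "\<dots> = - ?F E"
    proof -
      have "?m - 1 \<noteq> ?m" using ps(4) by linarith
      then have "sign (transpose (?m - 1) ?m) = -1" by (simp only: sign_swap_id if_False)
      then show ?thesis using Gd_permute[OF perm, of "bt N p" "mval N E"] by simp
    qed
    finally show ?thesis .
  qed
  have "bij_betw (pieri_swap t) ?A ?A"
    by (rule bij_betw_byWitness[where f' = "pieri_swap t"]) (use pieri_swap[OF _ t] in blast)+
  then have "(\<Sum>E\<in>?A. ?F E) = (\<Sum>E\<in>?A. ?F (pieri_swap t E))" by (rule sum.reindex_bij_betw[symmetric])
  also have "\<dots> = - (\<Sum>E\<in>?A. ?F E)" using neg by (simp add: sum_negf)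
  finally have A: "(\<Sum>E\<in>?A. ?F E) = 0" by simp
  have B: "E \<in> ?B" if E: "E \<in> ?M - ?A" and nz: "?F E \<noteq> 0" for E
  proof -
    have Em: "E \<in> mats N \<gamma>" and off: "\<And>l i. l < t \<Longrightarrow> i \<noteq> l \<Longrightarrow> E (l, i) = 0"
      using E by (auto simp: mats_diag_def)
    have right: "E (t, i) = 0" if "i > t" for i using E that by auto
    have diag: "int (E (l, l)) = \<gamma> l" if "l < N" "\<And>i. i \<noteq> l \<Longrightarrow> E (l, i) = 0" for l
    proof -
      have "(\<Sum>i<N. E (l, i)) = (\<Sum>i<N. if i = l then E (l, l) else 0)"
        by (intro sum.cong refl) (use that in auto)
      also have "\<dots> = E (l, l)" using that(1) by simp
      finally show ?thesis using Em that(1) unfolding mats_def by (auto simp del: of_nat_sum)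
    qed
    have col: "colsum N E i \<ge> int (E (l, i))" if "l < N" for l i
      unfolding colsum_def using that by (intro of_nat_mono member_le_sum) auto
    obtain \<tau> where \<tau>: "\<tau> permutes {..<N}" "\<And>i. i < N \<Longrightarrow> mval N E (\<tau> i) = bt N p i"
      using Gd_nonzero[OF nz] by blast
    have eq: "mval N E i = bt N p i" if "i < t" for i
    proof (rule rearrangement_eq[OF \<tau> p _ _ that])
      show "bt N p l \<le> mval N E l" if "l < t" for l
        using col[of l l] diag[of l] off[OF that] \<gamma>[OF that] that t by (simp add: bt_def)
    qed (use t in auto)
    have left: "E (t, i) = 0" if i: "i < t" for i
    proof -
      have "(\<Sum>l\<in>{t, i}. E (l, i)) \<le> (\<Sum>l<N. E (l, i))" using i t by (intro sum_mono2) auto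
      then have "int (E (t, i)) + int (E (i, i)) \<le> colsum N E i"
        using i unfolding colsum_def by (simp add: of_nat_add[symmetric] del: of_nat_add of_nat_sum)
      moreover have "colsum N E i = int (part p i)" using eq[OF i] by (simp add: bt_def)
      moreover have "int (E (i, i)) = int (part p i)" using diag[of i] off[OF i] \<gamma>[OF i] i t by simp
      ultimately show ?thesis by simp
    qed
    have row_t: "E (t, i) = 0" if "i \<noteq> t" for i using that left right by (cases "i < t") auto
    have "mval N E t \<le> bt N p t" by (rule rearrangement_le[OF \<tau> p eq t])
    then have "\<gamma> t \<le> int (part p t)" using col[OF t, of t] diag[OF t row_t] by (simp add: bt_def)
    moreover have "E \<in> mats_diag N \<gamma> (Suc t)" using Em off row_t by (auto simp: mats_diag_def less_Suc_eq)
    ultimately show ?thesis by simp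
  qed
  have "(\<Sum>E\<in>?M. ?F E) = (\<Sum>E\<in>?A. ?F E) + (\<Sum>E\<in>?M - ?A. ?F E)"
    by (subst sum.subset_diff[of ?A ?M]) (auto simp: fin)
  also have "(\<Sum>E\<in>?M - ?A. ?F E) = (\<Sum>E\<in>?B. ?F E)"
  proof (rule sum.mono_neutral_right)
    show "?B \<subseteq> ?M - ?A" by (auto simp: mats_diag_def)
    show "\<forall>E\<in>?M - ?A - ?B. ?F E = 0" using B by blast
  qed (simp add: fin)
  finally show ?thesis using A by simp
qed

text \<open>The left-hand side is the coefficient of a_{p + \<delta>} in h_\<gamma> a_\<delta>, a
  Kostka number. Rows become diagonal one at a time as long as \<gamma> agrees with p, which is
  enough for triangularity.\<close>

lemma sum_mats_diag:
  assumes p: "strict N (bt N p)"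
  shows "t \<le> N \<Longrightarrow> (\<And>l. l < t \<Longrightarrow> \<gamma> l = int (part p l)) \<Longrightarrow>
    (\<Sum>E\<in>mats N \<gamma>. Gd N (bt N p) (mval N E)) = (\<Sum>E\<in>mats_diag N \<gamma> t. Gd N (bt N p) (mval N E))"
proof (induction t)
  case 0
  then show ?case by (simp add: mats_diag_def)
next
  case (Suc t)
  then show ?case using sum_mats_diag_step[OF p, of t \<gamma>] by simp
qed

text \<open>The matrices that survive the treatment of row t satisfy \<gamma> t \<le> p_t, which
  fails here.\<close>

lemma sum_mats_zero:
  assumes p: "strict N (bt N p)" and t: "t < N" "\<And>l. l < t \<Longrightarrow> \<gamma> l = int (part p l)"
    and gt: "\<gamma> t > int (part p t)"
  shows "(\<Sum>E\<in>mats N \<gamma>. Gd N (bt N p) (mval N E)) = 0"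
  using sum_mats_diag[OF p, of t \<gamma>] sum_mats_diag_step[OF p t(1), of \<gamma>] t gt by simp

lemma sum_mats_one:
  assumes p: "strict N (bt N p)" and \<gamma>: "\<And>l. l < N \<Longrightarrow> \<gamma> l = int (part p l)"
  shows "(\<Sum>E\<in>mats N \<gamma>. Gd N (bt N p) (mval N E)) = 1"
proof -
  define D where "D = (\<lambda>(l, i). if l < N \<and> i = l then part p l else 0)"
  have rowD: "(\<Sum>i<N. D (l, i)) = part p l" if "l < N" for l
  proof -
    have "(\<Sum>i<N. D (l, i)) = (\<Sum>i<N. if i = l then part p l else 0)"
      by (intro sum.cong refl) (use that in \<open>auto simp: D_def\<close>)
    then show ?thesis using that by simp
  qed
  have colD: "colsum N D i = int (part p i)" if "i < N" for i
  proof -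
    have "(\<Sum>l<N. D (l, i)) = (\<Sum>l<N. if l = i then part p i else 0)"
      by (intro sum.cong refl) (use that in \<open>auto simp: D_def\<close>)
    then show ?thesis using that by (simp add: colsum_def del: of_nat_sum)
  qed
  have "mats_diag N \<gamma> N = {D}"
  proof (intro equalityI subsetI)
    fix E assume E: "E \<in> mats_diag N \<gamma> N"
    have "E (l, i) = D (l, i)" for l i
    proof (cases "l < N")
      case True
      have off: "E (l, i) = 0" if "i \<noteq> l" for i using E True that by (simp add: mats_diag_def)
      have "(\<Sum>i<N. E (l, i)) = (\<Sum>i<N. if i = l then E (l, l) else 0)"
        by (intro sum.cong refl) (use off in auto)
      also have "\<dots> = E (l, l)" using True by simp
      finally have "int (E (l, l)) = \<gamma> l"
        using E True unfolding mats_diag_def mats_def by (auto simp del: of_nat_sum)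
      then have "E (l, l) = part p l" using \<gamma>[OF True] by simp
      then show ?thesis using off True by (auto simp: D_def)
    next
      case False
      then show ?thesis using E by (auto simp: D_def mats_diag_def mats_def)
    qed
    then show "E \<in> {D}" by auto
  next
    fix E assume "E \<in> {D}"
    then show "E \<in> mats_diag N \<gamma> N"
      using rowD \<gamma> by (auto simp: mats_diag_def mats_def D_def simp del: of_nat_sum split: if_splits)
  qed
  moreover have "Gd N (bt N p) (mval N D) = Gd N (bt N p) (bt N p)"
    by (rule Gd_cong) (simp add: colD bt_def)
  ultimately show ?thesis
    using sum_mats_diag[OF p, of N \<gamma>] \<gamma> Gd_self[OF strict_inj[OF p]] by simp
qed

section \<open>The irreducible characters as determinants\<close>

lemma card_mats_permute:
  assumes \<tau>: "\<tau> permutes {..<N}"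
  shows "card {E \<in> mats N \<gamma>. \<forall>i<N. colsum N E (\<tau> i) = \<alpha> i} = card {E \<in> mats N \<gamma>. \<forall>i<N. colsum N E i = \<alpha> i}"
proof -
  have m: "(\<lambda>(l, i). E (l, \<sigma> i)) \<in> mats N \<gamma>" if \<sigma>: "\<sigma> permutes {..<N}" and E: "E \<in> mats N \<gamma>" for \<sigma> and E :: "nat \<times> nat \<Rightarrow> nat"
    using E sum_permute_Sym[OF \<sigma>, of "\<lambda>i. E (l, i)" for l] permutes_less[OF \<sigma>]
    by (auto simp: mats_def simp del: of_nat_sum)
  have c: "colsum N (\<lambda>(l, i). E (l, \<sigma> i)) i = colsum N E (\<sigma> i)" for E :: "nat \<times> nat \<Rightarrow> nat" and \<sigma> i
    by (simp add: colsum_def)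
  have [simp]: "\<tau> (inv \<tau> x) = x" "inv \<tau> (\<tau> x) = x" for x using permutes_inverses[OF \<tau>] by auto
  have "bij_betw (\<lambda>E (l, i). E (l, \<tau> i)) {E \<in> mats N \<gamma>. \<forall>i<N. colsum N E (\<tau> i) = \<alpha> i}
      {E \<in> mats N \<gamma>. \<forall>i<N. colsum N E i = \<alpha> i}"
    by (rule bij_betw_byWitness[where f' = "\<lambda>E (l, i). E (l, inv \<tau> i)"])
      (use m[OF \<tau>] m[OF permutes_inv[OF \<tau>]] c in \<open>auto simp: fun_eq_iff\<close>)
  then show ?thesis by (rule bij_betw_same_card)
qed

text \<open>Counting orbits in every term of the determinant turns its average over a Young subgroup
  into the Kostka sum over overlap matrices.\<close>

lemma sum_stab_omega:
  assumes c0: "c0 \<in> cols n N \<gamma>"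
  shows "(\<Sum>g\<in>stab n c0. omega n N \<beta> g) =
    of_nat (card (stab n c0)) * of_int (\<Sum>E\<in>mats N \<gamma>. Gd N \<beta> (mval N E))"
proof -
  let ?k = "\<lambda>\<tau>. card {E \<in> mats N \<gamma>. \<forall>i<N. colsum N E i = \<beta> i - dl N (\<tau> i)}"
  have "(\<Sum>g\<in>stab n c0. omega n N \<beta> g) =
      (\<Sum>\<tau>\<in>Sym N. of_int (sign \<tau>) * of_nat (\<Sum>g\<in>stab n c0. pc n N (\<lambda>i. \<beta> i - dl N (\<tau> i)) g))"
    unfolding omega_def by (subst sum.swap) (simp only: of_nat_sum sum_distrib_left)
  also have "\<dots> = of_nat (card (stab n c0)) * of_int (\<Sum>\<tau>\<in>Sym N. sign \<tau> * int (?k \<tau>))"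
    unfolding sum_stab_pc[OF c0] by (simp add: sum_distrib_left mult_ac)
  also have "(\<Sum>\<tau>\<in>Sym N. sign \<tau> * int (?k \<tau>)) =
      (\<Sum>\<tau>\<in>Sym N. \<Sum>E\<in>mats N \<gamma>. sign \<tau> * (if \<forall>i<N. mval N E (\<tau> i) = \<beta> i then 1 else 0))"
  proof (intro sum.cong refl)
    fix \<tau> assume \<tau>: "\<tau> \<in> Sym N"
    have "?k \<tau> = card {E \<in> mats N \<gamma>. \<forall>i<N. colsum N E (\<tau> i) = \<beta> i - dl N (\<tau> i)}"
      using card_mats_permute[of \<tau> N \<gamma> "\<lambda>i. \<beta> i - dl N (\<tau> i)"] \<tau> by simp
    also have "{E \<in> mats N \<gamma>. \<forall>i<N. colsum N E (\<tau> i) = \<beta> i - dl N (\<tau> i)} =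
        {E \<in> mats N \<gamma>. \<forall>i<N. mval N E (\<tau> i) = \<beta> i}" by (auto simp: algebra_simps)
    finally show "sign \<tau> * int (?k \<tau>) =
        (\<Sum>E\<in>mats N \<gamma>. sign \<tau> * (if \<forall>i<N. mval N E (\<tau> i) = \<beta> i then 1 else 0))"
      by (simp add: sum_distrib_left[symmetric] sum.If_cases finite_mats Int_def)
  qed
  also have "\<dots> = (\<Sum>E\<in>mats N \<gamma>. Gd N \<beta> (mval N E))"
    unfolding Gd_def by (rule sum.swap)
  finally show ?thesis .
qed

lemma part_mono: "is_partition p \<Longrightarrow> i \<le> j \<Longrightarrow> part p j \<le> part p i"
  using sorted_wrt_nth_less[of "(\<ge>)" p i j] by (cases "i = j") (auto simp: is_partition_def part_def)

lemma strict_bt: "is_partition p \<Longrightarrow> strict N (bt N p)"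
  unfolding strict_def
proof (intro allI impI)
  fix i j :: nat assume "is_partition p" "i < j" "j < N"
  then show "bt N p j < bt N p i" using part_mono[of p i j] by (simp add: bt_def dl_def)
qed

lemma sum_part: "length p \<le> N \<Longrightarrow> (\<Sum>i<N. part p i) = sum_list p"
proof -
  assume "length p \<le> N"
  then have "(\<Sum>i<N. part p i) = (\<Sum>i<length p. part p i)"
    by (intro sum.mono_neutral_right) (auto simp: part_def)
  also have "\<dots> = sum_list p" by (simp add: part_def sum_list_sum_nth atLeast0LessThan)
  finally show ?thesis .
qed

lemma part_colouring:
  assumes p: "p \<in> partitions_of n" "length p \<le> N"
  obtains c where "c \<in> cols n N (\<lambda>i. int (part p i))" "\<And>i. card {x. x < n \<and> c x = i} = part p i"
proof -
  obtain t where t: "t \<in> tableaux p" using tableaux_nonempty .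
  obtain c where c: "\<And>y. y \<in> cells p \<Longrightarrow> c (t y) = fst y" using row_labels[OF t] by metis
  define c' where "c' x = (if x < n then c x else 0)" for x
  have n: "n = sum_list p" using p by (simp add: partitions_of_def)
  have card: "card {x. x < n \<and> c' x = i} = part p i" for i
  proof -
    have "{x. x < n \<and> c' x = i} = t ` {y \<in> cells p. fst y = i}"
    proof (intro equalityI subsetI)
      fix x assume x: "x \<in> {x. x < n \<and> c' x = i}"
      then obtain y where "y \<in> cells p" "x = t y" using tableau_cell[OF t, of x] n by auto
      then show "x \<in> t ` {y \<in> cells p. fst y = i}" using x c[of y] by (auto simp: c'_def)
    qed (use tableau_less[OF t] c n in \<open>auto simp: c'_def\<close>)
    then show ?thesis
      using card_image[of t "{y \<in> cells p. fst y = i}"] tableau_eq_iff[OF t]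
      by (simp add: inj_on_def card_row_cells)
  qed
  have "c' x < N" if x: "x < n" for x
  proof -
    obtain y where y: "y \<in> cells p" "x = t y" using tableau_cell[OF t, of x] x n by blast
    then show ?thesis using c[OF y(1)] x p(2) by (auto simp: c'_def cells_def)
  qed
  then have "c' \<in> cols n N (\<lambda>i. int (part p i))" using card by (auto simp: cols_def) (simp add: c'_def)
  then show ?thesis using card by (rule that)
qed

text \<open>For \<open>\<sigma> \<noteq> id\<close> the vector \<open>p + \<sigma> - id\<close> exceeds \<open>p\<close> at the first place where it differs from \<open>p\<close>.\<close>

lemma first_moved:
  fixes \<sigma> :: "nat \<Rightarrow> nat"
  assumes \<sigma>: "\<sigma> permutes {..<N}" "\<sigma> \<noteq> id"
  obtains t where "t < N" "t < \<sigma> t" "\<forall>l<t. \<sigma> l = l"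
proof -
  obtain t where t: "\<sigma> t \<noteq> t" "\<And>l. l < t \<Longrightarrow> \<sigma> l = l"
    using \<sigma>(2) exists_least_iff[of "\<lambda>t. \<sigma> t \<noteq> t"] by (metis eq_id_iff)
  have "t < N" using t(1) permutes_not_in[OF \<sigma>(1), of t] by (cases "t < N") auto
  moreover have "\<not> \<sigma> t < t"
  proof
    assume "\<sigma> t < t"
    then have "\<sigma> (\<sigma> t) = \<sigma> t" by (rule t(2))
    then show False using t(1) permutes_inj[OF \<sigma>(1)] by (auto dest: injD)
  qed
  ultimately show ?thesis using t(1) by (intro that) (auto simp: t(2))
qed

lemma bt_minus_dl: "bt N p i - dl N (\<sigma> i) = int (part p i) + int (\<sigma> i) - int i"
  by (simp add: bt_def dl_def)

lemma sum_mult_omega: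
  "(\<Sum>g\<in>Sym n. \<Phi> g * omega n N \<beta> g) =
    (\<Sum>\<sigma>\<in>Sym N. of_int (sign \<sigma>) * (\<Sum>g\<in>Sym n. \<Phi> g * of_nat (pc n N (\<lambda>i. \<beta> i - dl N (\<sigma> i)) g)))"
  unfolding omega_def sum_distrib_left
  by (subst sum.swap) (intro sum.cong refl, simp only: mult_ac)

text \<open>Formulated for a class function \<Phi> so that it serves both \<open>irr_char\<close>
  and \<open>omega\<close> itself; \<open>zero\<close> and \<open>one\<close> state the
  triangularity of its sums over Young subgroups, which leaves only \<sigma> = id.\<close>

lemma sum_mult_omega_eq:
  assumes p: "p \<in> partitions_of n" "length p \<le> N" and \<Phi>: "class_fun n \<Phi>"
    and zero: "\<And>\<gamma> c t. c \<in> cols n N \<gamma> \<Longrightarrow> t < N \<Longrightarrow> (\<And>l. l < t \<Longrightarrow> \<gamma> l = int (part p l)) \<Longrightarrow>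
      \<gamma> t > int (part p t) \<Longrightarrow> (\<Sum>g\<in>stab n c. \<Phi> g) = 0"
    and one: "\<And>c. c \<in> cols n N (\<lambda>i. int (part p i)) \<Longrightarrow> (\<And>i. card {x. x < n \<and> c x = i} = part p i) \<Longrightarrow>
      (\<Sum>g\<in>stab n c. \<Phi> g) = of_nat (card (stab n c))"
  shows "(\<Sum>g\<in>Sym n. \<Phi> g * omega n N (bt N p) g) = fact n"
proof -
  have "(\<Sum>g\<in>Sym n. \<Phi> g * of_nat (pc n N (\<lambda>i. bt N p i - dl N (\<sigma> i)) g)) = (if \<sigma> = id then fact n else 0)"
    if \<sigma>: "\<sigma> permutes {..<N}" for \<sigma>
  proof (cases "\<sigma> = id")
    case True
    have e: "(\<lambda>i. bt N p i - dl N (\<sigma> i)) = (\<lambda>i. int (part p i))" using True by (simp add: bt_def)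
    obtain c where c: "c \<in> cols n N (\<lambda>i. int (part p i))" "\<And>i. card {x. x < n \<and> c x = i} = part p i"
      using part_colouring[OF p] by metis
    have "(\<Sum>g\<in>stab n c. \<Phi> g) = of_nat (card (stab n c))" by (rule one[OF c])
    then show ?thesis unfolding e using sum_class_fun_pc[OF \<Phi> c(1)] True stab_pos[of n c] by simp
  next
    case False
    let ?\<gamma> = "\<lambda>i. bt N p i - dl N (\<sigma> i)"
    obtain t where t: "t < N" "t < \<sigma> t" "\<forall>l<t. \<sigma> l = l" by (rule first_moved[OF \<sigma> False])
    show ?thesis
    proof (cases "cols n N ?\<gamma> = {}")
      case True
      then show ?thesis using False by (simp add: sum_class_fun_pc_empty)
    next
      case False': False
      then obtain c where c: "c \<in> cols n N ?\<gamma>" by auto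
      have "(\<Sum>g\<in>stab n c. \<Phi> g) = 0"
        by (rule zero[OF c t(1)]) (use t in \<open>auto simp: bt_def dl_def\<close>)
      then show ?thesis using sum_class_fun_pc[OF \<Phi> c] stab_pos[of n c] False by simp
    qed
  qed
  then have "(\<Sum>g\<in>Sym n. \<Phi> g * omega n N (bt N p) g) =
      (\<Sum>\<sigma>\<in>Sym N. of_int (sign \<sigma>) * (if \<sigma> = id then fact n else 0))"
    unfolding sum_mult_omega by (intro sum.cong refl) simp
  also have "\<dots> = (\<Sum>\<sigma>\<in>Sym N. if \<sigma> = id then fact n else 0)" by (intro sum.cong refl) (auto simp: sign_id)
  also have "\<dots> = fact n" by (simp add: finite_permutations)
  finally show ?thesis .
qed

lemma card_less_sum:
  fixes c :: "nat \<Rightarrow> nat"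
  shows "card {x. x < n \<and> c x < K} = (\<Sum>i<K. card {x. x < (n::nat) \<and> c x = i})"
proof -
  have "{x. x < n \<and> c x < K} = (\<Union>i<K. {x. x < n \<and> c x = i})" by auto
  then show ?thesis by (simp only:) (rule card_UN_disjoint, auto)
qed

text \<open>Both functions are real with norm 1, and their inner product is 1 (each multiplied by
  n!). Hence the difference has norm 1 - 2 + 1 = 0.\<close>

theorem irr_char_eq_omega:
  assumes p: "p \<in> partitions_of n" "length p \<le> N" and g: "g permutes {..<n}"
  shows "irr_char p g = omega n N (bt N p) g"
proof -
  have n: "sum_list p = n" and ip: "is_partition p" using p by (auto simp: partitions_of_def)
  note st = strict_bt[OF ip, of N]
  let ?w = "omega n N (bt N p)"
  have cw: "(\<Sum>g\<in>Sym n. irr_char p g * ?w g) = fact n"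
  proof (rule sum_mult_omega_eq[OF p class_fun_irr_char[OF n]])
    fix \<gamma> c t
    assume c: "c \<in> cols n N \<gamma>" and t: "t < N" and eq: "\<And>l. l < t \<Longrightarrow> \<gamma> l = int (part p l)"
      and gt: "\<gamma> t > int (part p t)"
    have cc: "int (card {x. x < n \<and> c x = i}) = \<gamma> i" if "i < N" for i using c that by (simp add: cols_def)
    have "card {x. x < n \<and> c x = i} = part p i" if "i < t" for i using cc[of i] eq[OF that] that t by simp
    moreover have "card {x. x < n \<and> c x = t} > part p t" using cc[OF t] gt by simp
    ultimately have "(\<Sum>i<Suc t. part p i) < card {x. x < n \<and> c x < Suc t}"
      unfolding card_less_sum by simp
    then show "(\<Sum>g\<in>stab n c. irr_char p g) = 0" by (rule sum_irr_char_stab_zero[OF p(1)])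
  next
    fix c assume "\<And>i. card {x. x < n \<and> c x = i} = part p i"
    then show "(\<Sum>g\<in>stab n c. irr_char p g) = of_nat (card (stab n c))"
      by (rule sum_irr_char_stab_one[OF p(1)])
  qed
  have ww: "(\<Sum>g\<in>Sym n. ?w g * ?w g) = fact n"
  proof (rule sum_mult_omega_eq[OF p class_fun_omega])
    fix \<gamma> c t
    assume c: "c \<in> cols n N \<gamma>" and t: "t < N" and eq: "\<And>l. l < t \<Longrightarrow> \<gamma> l = int (part p l)"
      and gt: "\<gamma> t > int (part p t)"
    show "(\<Sum>g\<in>stab n c. ?w g) = 0"
      by (simp only: sum_stab_omega[OF c] sum_mats_zero[OF st t eq gt] of_int_0 mult_zero_right)
  next
    fix c assume c: "c \<in> cols n N (\<lambda>i. int (part p i))"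
    show "(\<Sum>g\<in>stab n c. ?w g) = of_nat (card (stab n c))"
      by (simp only: sum_stab_omega[OF c] sum_mats_one[OF st refl] of_int_1 mult_1_right)
  qed
  have cc: "(\<Sum>g\<in>Sym n. irr_char p g * irr_char p g) = fact n" by (rule irr_char_norm[OF p(1)])
  have "(\<Sum>g\<in>Sym n. (irr_char p g - ?w g) * (irr_char p g - ?w g)) =
      (\<Sum>g\<in>Sym n. irr_char p g * irr_char p g) - 2 * (\<Sum>g\<in>Sym n. irr_char p g * ?w g) + (\<Sum>g\<in>Sym n. ?w g * ?w g)"
    unfolding sum_distrib_left sum_subtractf[symmetric] sum.distrib[symmetric]
    by (intro sum.cong refl) (simp add: algebra_simps)
  also have "\<dots> = 0" unfolding cw ww cc by simp
  finally have "irr_char p g - ?w g = 0"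
    by (rule real_sum_squares_eq_0[rotated 2])
      (use g n cnj_irr_char cnj_omega in \<open>auto simp: finite_permutations\<close>)
  then show ?thesis by simp
qed

section \<open>Completeness of the irreducible characters\<close>

lemma sum_card_le: "finite A \<Longrightarrow> (\<Sum>i<card A. i) \<le> \<Sum>(A :: nat set)"
proof (induction A rule: finite_linorder_max_induct)
  case (insert b A)
  have "A \<subseteq> {..<b}" using insert.hyps by auto
  then have "card A \<le> b" using card_mono[of "{..<b}" A] by simp
  moreover have "b \<notin> A" using insert.hyps by auto
  ultimately show ?case using insert by simp
qed simp

text \<open>Summation by parts; the induction carries the stronger bound p K times the partial sum
  of d.\<close>

lemma abel_nonneg:
  fixes p d :: "nat \<Rightarrow> int"
  assumes "\<And>K. K \<le> N \<Longrightarrow> (\<Sum>i<K. d i) \<ge> 0" "\<And>i. p (Suc i) \<le> p i" "\<And>i. 0 \<le> p i"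
  shows "(\<Sum>i<N. p i * d i) \<ge> 0"
proof (cases N)
  case (Suc M)
  have "K < N \<Longrightarrow> (\<Sum>i<Suc K. p i * d i) \<ge> p K * (\<Sum>i<Suc K. d i)" for K
  proof (induction K)
    case (Suc K)
    have "p (Suc K) * (\<Sum>i<Suc K. d i) \<le> p K * (\<Sum>i<Suc K. d i)"
      by (rule mult_right_mono[OF assms(2) assms(1)]) (use Suc.prems in simp)
    also have "\<dots> \<le> (\<Sum>i<Suc K. p i * d i)" using Suc by simp
    finally show ?case by (simp add: algebra_simps)
  qed simp
  from this[of M] have "p M * (\<Sum>i<N. d i) \<le> (\<Sum>i<N. p i * d i)" using Suc by simp
  moreover have "0 \<le> p M * (\<Sum>i<N. d i)" using assms(1)[of N] assms(3)[of M] by simp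
  ultimately show ?thesis by linarith
qed simp

text \<open>Expanding the square leaves a cross term with \<sigma> - id and a positive sum of
  squares. The cross term is nonnegative by \<open>abel_nonneg\<close>, because K distinct numbers
  sum to at least 0 + ... + (K - 1).\<close>

lemma sum_squares_less:
  assumes \<sigma>: "\<sigma> permutes {..<N}" "\<sigma> \<noteq> id" and p: "is_partition p"
  shows "(\<Sum>i<N. (int (part p i))\<^sup>2) < (\<Sum>i<N. (int (part p i) + int (\<sigma> i) - int i)\<^sup>2)"
proof -
  let ?d = "\<lambda>i. int (\<sigma> i) - int i"
  have "(\<Sum>i<K. ?d i) \<ge> 0" if "K \<le> N" for K
  proof -
    have "(\<Sum>i<K. i) \<le> (\<Sum>i<K. \<sigma> i)"
      using sum_card_le[of "\<sigma> ` {..<K}"] card_image[OF permutes_inj_on[OF \<sigma>(1), of "{..<K}"]]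
      by (simp add: sum.reindex[OF permutes_inj_on[OF \<sigma>(1)]])
    then have "int (\<Sum>i<K. i) \<le> int (\<Sum>i<K. \<sigma> i)" by (simp only: of_nat_le_iff)
    then show ?thesis by (simp add: sum_subtractf)
  qed
  then have 1: "0 \<le> (\<Sum>i<N. int (part p i) * ?d i)"
    by (rule abel_nonneg) (use part_mono[OF p] in auto)
  obtain t where t: "t < N" "t < \<sigma> t" using first_moved[OF \<sigma>] by metis
  have 2: "0 < (\<Sum>i<N. (?d i)\<^sup>2)" by (rule sum_pos2[of _ t]) (use t in auto)
  have "(\<Sum>i<N. (int (part p i) + int (\<sigma> i) - int i)\<^sup>2) =
      (\<Sum>i<N. (int (part p i))\<^sup>2 + 2 * (int (part p i) * ?d i) + (?d i)\<^sup>2)"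
    by (intro sum.cong refl) (simp add: power2_eq_square algebra_simps)
  also have "\<dots> = (\<Sum>i<N. (int (part p i))\<^sup>2) + 2 * (\<Sum>i<N. int (part p i) * ?d i) + (\<Sum>i<N. (?d i)\<^sup>2)"
    by (simp only: sum.distrib sum_distrib_left)
  finally show ?thesis using 1 2 by linarith
qed

lemma sorting_permutation:
  fixes v :: "nat \<Rightarrow> int"
  obtains \<tau> where "\<tau> permutes {..<N}" "\<forall>i j. i < j \<longrightarrow> j < N \<longrightarrow> v (\<tau> j) \<le> v (\<tau> i)"
proof -
  define xs where "xs = sort_key (\<lambda>i. - v i) [0..<N]"
  have xs: "length xs = N" "set xs = {..<N}" "distinct xs" "sorted (map (\<lambda>i. - v i) xs)"
    by (auto simp: xs_def)
  define \<tau> where "\<tau> i = (if i < N then xs ! i else i)" for i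
  have "\<tau> permutes {..<N}"
  proof (rule inj_imp_permutes)
    show "inj_on \<tau> {..<N}" using xs by (auto simp: inj_on_def \<tau>_def nth_eq_iff_index_eq)
    show "\<tau> x \<in> {..<N}" if "x \<in> {..<N}" for x using that xs nth_mem[of x xs] by (auto simp: \<tau>_def)
  qed (auto simp: \<tau>_def)
  moreover have "v (\<tau> j) \<le> v (\<tau> i)" if "i < j" "j < N" for i j
    using sorted_nth_mono[OF xs(4), of i j] that xs(1) by (simp add: \<tau>_def)
  ultimately show ?thesis by (intro that) auto
qed

lemma partition_of_fun:
  fixes f :: "nat \<Rightarrow> nat"
  assumes "\<And>i j. i < j \<Longrightarrow> j < N \<Longrightarrow> f j \<le> f i"
  obtains p where "p \<in> partitions_of (\<Sum>i<N. f i)" "length p \<le> N" "\<And>i. i < N \<Longrightarrow> part p i = f i"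
proof -
  \<comment> \<open>\<open>takeWhile\<close> strips the trailing zeros, as the parts of a partition
    are positive.\<close>
  define p where "p = takeWhile (\<lambda>a. a \<noteq> 0) (map f [0..<N])"
  have len: "length p \<le> N" unfolding p_def using length_takeWhile_le[of _ "map f [0..<N]"] by simp
  have nth: "p ! i = f i" if "i < length p" for i
    using that len takeWhile_nth[of i "\<lambda>a. a \<noteq> 0" "map f [0..<N]"] by (simp add: p_def)
  have "f i = 0" if "length p \<le> i" "i < N" for i
  proof -
    have "f (length p) = 0"
      using that nth_length_takeWhile[of "\<lambda>a. a \<noteq> 0" "map f [0..<N]"] by (simp add: p_def)
    then show ?thesis using assms[of "length p" i] that by (cases "length p = i") auto
  qed
  then have part: "part p i = f i" if "i < N" for i using that nth by (auto simp: part_def)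
  have "0 \<notin> set p" unfolding p_def by (metis (mono_tags) set_takeWhileD)
  moreover have "sorted_wrt (\<ge>) p"
    unfolding sorted_wrt_iff_nth_less using assms nth len by auto
  moreover have "sum_list p = (\<Sum>i<N. f i)" using sum_part[OF len] part by simp
  ultimately have "p \<in> partitions_of (\<Sum>i<N. f i)" by (simp add: partitions_of_def is_partition_def)
  then show ?thesis using len part by (rule that)
qed

lemma length_partition: "p \<in> partitions_of n \<Longrightarrow> length p \<le> n"
proof -
  assume p: "p \<in> partitions_of n"
  have "length p = (\<Sum>i<length p. 1)" by simp
  also have "\<dots> \<le> (\<Sum>i<length p. p ! i)"
  proof (rule sum_mono)
    fix i assume "i \<in> {..<length p}"
    then have "p ! i \<in> set p" by simp
    moreover have "0 \<notin> set p" using p by (simp add: partitions_of_def is_partition_def)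
    ultimately have "p ! i \<noteq> 0" by metis
    then show "1 \<le> p ! i" by simp
  qed
  also have "\<dots> = n" using p by (simp add: partitions_of_def sum_list_sum_nth atLeast0LessThan)
  finally show ?thesis .
qed

lemma finite_partitions_of: "finite (partitions_of n)"
proof (rule finite_subset)
  show "partitions_of n \<subseteq> {p. set p \<subseteq> {..n} \<and> length p \<le> n}"
    using length_partition member_le_sum_list by (fastforce simp: partitions_of_def)
  show "finite {p. set p \<subseteq> {..n} \<and> length p \<le> n}" by (rule finite_lists_length_le) simp
qed

text \<open>Sorting \<gamma> does not change its permutation character. The determinant for the
  sorted content expresses that character by an irreducible one and by contents with a larger sum of
  squares, and this sum is bounded as long as colourings exist.\<close>

lemma orthogonal_to_pc:
  assumes orth: "\<And>p. p \<in> partitions_of n \<Longrightarrow> (\<Sum>g\<in>Sym n. \<Phi> g * irr_char p g) = 0" and N: "n \<le> N"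
  shows "(\<Sum>g\<in>Sym n. \<Phi> g * of_nat (pc n N \<gamma> g)) = 0"
proof (induction "nat (int N * (int n)\<^sup>2 - (\<Sum>i<N. (\<gamma> i)\<^sup>2))" arbitrary: \<gamma> rule: less_induct)
  case less
  show ?case
  proof (cases "cols n N \<gamma> = {}")
    case True
    then show ?thesis by (rule sum_class_fun_pc_empty)
  next
    case False
    then obtain c where c: "c \<in> cols n N \<gamma>" by auto
    have \<gamma>: "0 \<le> \<gamma> i \<and> \<gamma> i \<le> int n" if "i < N" for i
    proof -
      have "card {x. x < n \<and> c x = i} \<le> card {..<n}" by (rule card_mono) auto
      moreover have "int (card {x. x < n \<and> c x = i}) = \<gamma> i" using c that by (simp add: cols_def)
      ultimately show ?thesis by simp
    qed
    have bound: "(\<Sum>i<N. (\<gamma> i)\<^sup>2) \<le> int N * (int n)\<^sup>2"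
      using sum_mono[of "{..<N}" "\<lambda>i. (\<gamma> i)\<^sup>2" "\<lambda>_. (int n)\<^sup>2"] \<gamma> by (simp add: power_mono)
    obtain \<tau> where \<tau>: "\<tau> permutes {..<N}" "\<forall>i j. i < j \<longrightarrow> j < N \<longrightarrow> \<gamma> (\<tau> j) \<le> \<gamma> (\<tau> i)"
      using sorting_permutation .
    have \<gamma>\<tau>: "0 \<le> \<gamma> (\<tau> i)" if "i < N" for i using \<gamma>[of "\<tau> i"] permutes_less[OF \<tau>(1), of i] that by simp
    obtain p where p: "p \<in> partitions_of (\<Sum>i<N. nat (\<gamma> (\<tau> i)))" "length p \<le> N"
      "\<And>i. i < N \<Longrightarrow> part p i = nat (\<gamma> (\<tau> i))"
      using partition_of_fun[of N "\<lambda>i. nat (\<gamma> (\<tau> i))"] \<tau>(2) nat_mono by metis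
    have "int (\<Sum>i<N. nat (\<gamma> (\<tau> i))) = (\<Sum>i<N. \<gamma> (\<tau> i))" by (simp add: \<gamma>\<tau>)
    also have "\<dots> = int n" using sum_permute_Sym[OF \<tau>(1), of \<gamma>] sum_content[OF c] by simp
    finally have "(\<Sum>i<N. nat (\<gamma> (\<tau> i))) = n" by (simp only: of_nat_eq_iff)
    then have pn: "p \<in> partitions_of n" using p(1) by simp
    have ip: "is_partition p" using pn by (simp add: partitions_of_def)
    have part: "int (part p i) = \<gamma> (\<tau> i)" if "i < N" for i using p(3)[OF that] \<gamma>\<tau>[OF that] by simp
    have sq: "(\<Sum>i<N. (int (part p i))\<^sup>2) = (\<Sum>i<N. (\<gamma> i)\<^sup>2)"
      using sum_permute_Sym[OF \<tau>(1), of "\<lambda>i. (\<gamma> i)\<^sup>2"] part by simp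
    \<comment> \<open>\<open>nat\<close> truncates at 0, so the measure surely drops only while the
      new sum of squares stays within the bound; beyond the bound there is no colouring.\<close>
    have zero: "(\<Sum>g\<in>Sym n. \<Phi> g * of_nat (pc n N (\<lambda>i. bt N p i - dl N (\<sigma> i)) g)) = 0"
      if "\<sigma> \<in> Sym N" "\<sigma> \<noteq> id" for \<sigma>
    proof (cases "(\<Sum>i<N. (bt N p i - dl N (\<sigma> i))\<^sup>2) \<le> int N * (int n)\<^sup>2")
      case True
      have "(\<Sum>i<N. (\<gamma> i)\<^sup>2) < (\<Sum>i<N. (bt N p i - dl N (\<sigma> i))\<^sup>2)"
        unfolding bt_minus_dl sq[symmetric] using that by (intro sum_squares_less ip) auto
      then show ?thesis using True by (intro less.hyps) simp
    next
      case False
      have "cols n N (\<lambda>i. bt N p i - dl N (\<sigma> i)) = {}"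
      proof (rule ccontr)
        assume "cols n N (\<lambda>i. bt N p i - dl N (\<sigma> i)) \<noteq> {}"
        then obtain d where d: "d \<in> cols n N (\<lambda>i. bt N p i - dl N (\<sigma> i))" by blast
        have "(bt N p i - dl N (\<sigma> i))\<^sup>2 \<le> (int n)\<^sup>2" if "i < N" for i
        proof -
          have "card {x. x < n \<and> d x = i} \<le> card {..<n}" by (rule card_mono) auto
          then have "(int (card {x. x < n \<and> d x = i}))\<^sup>2 \<le> (int n)\<^sup>2" by (intro power_mono) auto
          moreover have "int (card {x. x < n \<and> d x = i}) = bt N p i - dl N (\<sigma> i)"
            using d that by (simp add: cols_def)
          ultimately show ?thesis by (simp only:)
        qed
        then have "(\<Sum>i<N. (bt N p i - dl N (\<sigma> i))\<^sup>2) \<le> (\<Sum>i<N. (int n)\<^sup>2)" by (intro sum_mono) auto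
        then show False using False by simp
      qed
      then show ?thesis by (rule sum_class_fun_pc_empty)
    qed
    have "0 = (\<Sum>g\<in>Sym n. \<Phi> g * omega n N (bt N p) g)"
      using orth[OF pn] irr_char_eq_omega[OF pn p(2)] by simp
    also have "\<dots> = (\<Sum>\<sigma>\<in>Sym N. if \<sigma> = id then
        (\<Sum>g\<in>Sym n. \<Phi> g * of_nat (pc n N (\<lambda>i. bt N p i - dl N i) g)) else 0)"
      unfolding sum_mult_omega by (intro sum.cong refl) (use zero in \<open>auto simp: sign_id\<close>)
    also have "\<dots> = (\<Sum>g\<in>Sym n. \<Phi> g * of_nat (pc n N (\<lambda>i. bt N p i - dl N i) g))"
      by (simp add: finite_permutations)
    also have "\<dots> = (\<Sum>g\<in>Sym n. \<Phi> g * of_nat (pc n N \<gamma> g))"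
    proof (intro sum.cong refl)
      fix g assume g: "g \<in> Sym n"
      have "pc n N (\<lambda>i. bt N p i - dl N i) g = pc n N (\<gamma> \<circ> \<tau>) g"
        by (rule pc_cong) (simp add: bt_def part)
      then show "\<Phi> g * of_nat (pc n N (\<lambda>i. bt N p i - dl N i) g) = \<Phi> g * of_nat (pc n N \<gamma> g)"
        using pc_permute[OF \<tau>(1), of g n \<gamma>] g by simp
    qed
    finally show ?thesis ..
  qed
qed

section \<open>Cycles and conjugacy\<close>

lemma orbit_bij:
  assumes "permutation g"
  shows "bij_betw (\<lambda>i. (g ^^ i) m) {0..<card (orbit g m)} (orbit g m)"
    and "(g ^^ card (orbit g m)) m = m" and "0 < card (orbit g m)"
proof -
  obtain k0 where k0: "0 < k0" "(g ^^ k0) m = m" using permutation_self[OF assms] by metis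
  define k where "k = (LEAST k. 0 < k \<and> (g ^^ k) m = m)"
  have k: "0 < k \<and> (g ^^ k) m = m" unfolding k_def by (rule LeastI[of _ k0]) (use k0 in auto)
  have least: "(g ^^ i) m \<noteq> m" if "i < k" "0 < i" for i
    using not_less_Least[of i "\<lambda>k. 0 < k \<and> (g ^^ k) m = m"] that by (auto simp: k_def)
  have inj: "inj_on (\<lambda>i. (g ^^ i) m) {0..<k}"
    by (rule inj_on_funpow_least) (use k least in auto)
  have orb: "orbit g m = (\<lambda>i. (g ^^ i) m) ` {0..<k}"
    using orbit_altdef_bounded[of k g m] k by auto
  then have "card (orbit g m) = k" using card_image[OF inj] by simp
  then show "bij_betw (\<lambda>i. (g ^^ i) m) {0..<card (orbit g m)} (orbit g m)"
    "(g ^^ card (orbit g m)) m = m" "0 < card (orbit g m)"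
    using inj orb k by (auto simp: bij_betw_def)
qed

text \<open>On each common orbit f takes the i-th iterate under g of the least element to its i-th
  iterate under h. Both orbits have the same length, so f also commutes with the step that closes
  the cycle.\<close>

lemma same_orbits_conjugate:
  assumes g: "g permutes {..<n::nat}" and h: "h permutes {..<n}"
    and eq: "\<And>x. x < n \<Longrightarrow> orbit g x = orbit h x"
  obtains f where "f permutes {..<n}" "h = f \<circ> g \<circ> inv f"
proof -
  have pg: "permutation g" and ph: "permutation h" using g h permutes_permutation by blast+
  define m where "m x = Min (orbit g x)" for x
  define f where "f x = (if x < n then (h ^^ inv_into {0..<card (orbit g (m x))} (\<lambda>i. (g ^^ i) (m x)) x) (m x) else x)" for x
  have sub: "orbit g x \<subseteq> {..<n}" if "x < n" for x by (rule permutes_orbit_subset[OF g]) (use that in simp)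
  have fin: "finite (orbit g x)" for x by (rule finite_orbit[OF permutation_self_in_orbit[OF pg]])
  have self: "x \<in> orbit g x" for x by (rule permutation_self_in_orbit[OF pg])
  have orb_eq: "orbit g y = orbit g x" if "y \<in> orbit g x" for x y
    by (rule orbit_cyclic_eq3[OF cyclic_on_orbit'[OF pg] that])
  have min: "m x \<in> orbit g x" for x unfolding m_def by (rule Min_in[OF fin orbit_nonempty])
  have orbm: "orbit g (m x) = orbit g x" for x by (rule orb_eq[OF min])
  have mn: "m x < n" if "x < n" for x using min[of x] sub[OF that] by auto
  have main: "\<exists>i. i < card (orbit g (m x)) \<and> x = (g ^^ i) (m x) \<and> f x = (h ^^ i) (m x)" if "x < n" for x
  proof -
    let ?i = "inv_into {0..<card (orbit g (m x))} (\<lambda>i. (g ^^ i) (m x)) x"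
    have "x \<in> (\<lambda>i. (g ^^ i) (m x)) ` {0..<card (orbit g (m x))}"
      using orbit_bij(1)[OF pg, of "m x"] self[of x] orbm[of x] by (simp add: bij_betw_def)
    from inv_into_into[OF this] f_inv_into_f[OF this] that show ?thesis
      by (intro exI[of _ ?i]) (simp add: f_def)
  qed
  have fpow: "f ((g ^^ i) (m x)) = (h ^^ i) (m x)" if "x < n" "i < card (orbit g (m x))" for x i
  proof -
    let ?y = "(g ^^ i) (m x)"
    have y: "?y \<in> orbit g (m x)" using funpow_in_orbit[OF self] .
    then have yn: "?y < n" using sub[OF mn[OF that(1)]] by auto
    have oy: "orbit g ?y = orbit g x" using orb_eq[OF y] orbm by simp
    then have my: "m ?y = m x" by (simp add: m_def)
    obtain j where j: "j < card (orbit g (m x))" "?y = (g ^^ j) (m x)" "f ?y = (h ^^ j) (m x)"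
      using main[OF yn] my by auto
    have "i = j"
      using inj_onD[OF bij_betw_imp_inj_on[OF orbit_bij(1)[OF pg, of "m x"]], of i j] j that by auto
    then show ?thesis using j by simp
  qed
  have fin_orb: "f x \<in> orbit g x" if x: "x < n" for x
  proof -
    obtain i where "f x = (h ^^ i) (m x)" using main[OF x] by blast
    moreover have "(h ^^ i) (m x) \<in> orbit h (m x)"
      by (rule funpow_in_orbit[OF permutation_self_in_orbit[OF ph]])
    ultimately show ?thesis using eq[OF mn[OF x]] orbm by simp
  qed
  have "f permutes {..<n}"
  proof (rule inj_imp_permutes)
    show "inj_on f {..<n}"
    proof (rule inj_onI)
      fix x y assume "x \<in> {..<n}" "y \<in> {..<n}" and fxy: "f x = f y"
      then have x: "x < n" and y: "y < n" by auto
      have "orbit g x = orbit g y" using orb_eq[OF fin_orb[OF x]] orb_eq[OF fin_orb[OF y]] fxy by simp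
      then have m: "m x = m y" by (simp add: m_def)
      obtain i where i: "i < card (orbit g (m x))" "x = (g ^^ i) (m x)" "f x = (h ^^ i) (m x)"
        using main[OF x] by blast
      obtain j where j: "j < card (orbit g (m x))" "y = (g ^^ j) (m x)" "f y = (h ^^ j) (m x)"
        using main[OF y] unfolding m[symmetric] by blast
      have "card (orbit g (m x)) = card (orbit h (m x))" using eq[OF mn[OF x]] by simp
      moreover have "(h ^^ i) (m x) = (h ^^ j) (m x)" using i(3) j(3) fxy by simp
      ultimately have "i = j"
        using inj_onD[OF bij_betw_imp_inj_on[OF orbit_bij(1)[OF ph, of "m x"]], of i j] i(1) j(1) by simp
      have "x = (g ^^ i) (m x)" by (rule i(2))
      also have "\<dots> = y" unfolding \<open>i = j\<close> by (rule j(2)[symmetric])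
      finally show "x = y" .
    qed
    show "f x \<in> {..<n}" if "x \<in> {..<n}" for x using fin_orb[of x] sub[of x] that by auto
  qed (auto simp: f_def)
  then have fp: "f permutes {..<n}" .
  have comm: "f (g x) = h (f x)" for x
  proof (cases "x < n")
    case True
    obtain i where i: "i < card (orbit g (m x))" "x = (g ^^ i) (m x)" "f x = (h ^^ i) (m x)"
      using main[OF True] by blast
    have gx: "g x = (g ^^ Suc i) (m x)" using arg_cong[OF i(2), of g] by simp
    show ?thesis
    proof (cases "Suc i < card (orbit g (m x))")
      case lt: True
      have "f (g x) = (h ^^ Suc i) (m x)" unfolding gx by (rule fpow[OF True lt])
      then show ?thesis using i(3) by simp
    next
      case False
      then have s: "Suc i = card (orbit g (m x))" using i(1) by simp
      then have "g x = (g ^^ 0) (m x)" using gx orbit_bij(2)[OF pg, of "m x"] by simp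
      then have "f (g x) = m x" using fpow[OF True orbit_bij(3)[OF pg]] by simp
      moreover have "h (f x) = (h ^^ Suc i) (m x)" using i(3) by simp
      moreover have "Suc i = card (orbit h (m x))" using s eq[OF mn[OF True]] by simp
      ultimately show ?thesis using orbit_bij(2)[OF ph, of "m x"] by simp
    qed
  next
    case False
    then show ?thesis
      using permutes_not_in[OF g, of x] permutes_not_in[OF h, of x] by (simp add: f_def)
  qed
  have "h = f \<circ> g \<circ> inv f"
    using comm permutes_inverses[OF fp] by (auto simp: fun_eq_iff)
  with fp show ?thesis by (rule that)
qed

text \<open>Colour the points by the orbits of \<open>g\<close>. An element of the stabilizer of this colouring has
  at least as many orbits as \<open>g\<close>, and if it has equally many then it is conjugate to \<open>g\<close>.\<close>

lemma class_fun_zero: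
  assumes \<Phi>: "class_fun n \<Phi>" and N: "n \<le> N"
    and orth: "\<And>\<gamma>. (\<Sum>g\<in>Sym n. \<Phi> g * of_nat (pc n N \<gamma> g)) = 0"
  shows "g permutes {..<n} \<Longrightarrow> \<Phi> g = 0"
proof -
  define c where "c g x = (if x < n then Min (orbit g x) else 0)" for g :: "nat \<Rightarrow> nat" and x
  define orb where "orb g = card (c g ` {..<n})" for g
  have perm: "permutation g" if "g permutes {..<n}" for g using that by (rule permutes_permutation)
  have sub: "orbit g x \<subseteq> {..<n}" if "g permutes {..<n}" "x < n" for g x
    by (rule permutes_orbit_subset[OF that(1)]) (use that in simp)
  have cin: "c g x \<in> orbit g x" if "g permutes {..<n}" "x < n" for g x
    using Min_in[OF finite_orbit[OF permutation_self_in_orbit[OF perm[OF that(1)]]] orbit_nonempty] that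
    by (simp add: c_def)
  have orb_eq: "orbit g y = orbit g x" if "g permutes {..<n}" "y \<in> orbit g x" for g x y
    by (rule orbit_cyclic_eq3[OF cyclic_on_orbit'[OF perm[OF that(1)]] that(2)])
  have c_eq: "orbit g x = orbit g y" if "g permutes {..<n}" "x < n" "y < n" "c g x = c g y" for g x y
    using orb_eq[OF that(1) cin[OF that(1,2)]] orb_eq[OF that(1) cin[OF that(1,3)]] that(4) by simp
  have orb_le: "orb g \<le> n" for g using card_image_le[of "{..<n}" "c g"] by (simp add: orb_def)
  show "g permutes {..<n} \<Longrightarrow> \<Phi> g = 0"
  proof (induction "n - orb g" arbitrary: g rule: less_induct)
    case less
    note g = less.prems
    define \<gamma> where "\<gamma> i = int (card {x. x < n \<and> c g x = i})" for i
    have clt: "c g x < N" if "x < n" for x using cin[OF g that] sub[OF g that] N by auto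
    then have ccol: "c g \<in> cols n N \<gamma>" by (auto simp: cols_def \<gamma>_def) (simp add: c_def)
    have gs: "g \<in> stab n (c g)"
      using g permutation_orbit_step[OF perm[OF g]] permutes_less[OF g] by (auto simp: stab_def c_def)
    have stabprop: "\<Phi> h = (if orb h = orb g then \<Phi> g else 0)" if h: "h \<in> stab n (c g)" for h
    proof -
      have hp: "h permutes {..<n}" using h by (simp add: stab_def)
      \<comment> \<open>The orbits of h refine those of g, because h preserves the colours that tell
        the orbits of g apart.\<close>
      have const: "c g y = c g x" if "y \<in> orbit h x" "x < n" for x y
        using that
      proof induction
        case base
        then show ?case using h by (simp add: stab_def)
      next
        case (step y)
        then have "y < n" using sub[OF hp, of x] by auto
        then show ?case using step h by (simp add: stab_def)
      qed
      have ch: "c g x = c g (c h x)" if "x < n" for x using const[OF cin[OF hp that] that] by simp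
      then have img: "c g ` {..<n} = c g ` (c h ` {..<n})" by (auto simp: image_iff)
      have fin: "finite (c h ` {..<n})" by simp
      have "orb g \<le> orb h" unfolding orb_def img by (rule card_image_le[OF fin])
      show ?thesis
      proof (cases "orb h = orb g")
        case True
        have inj: "inj_on (c g) (c h ` {..<n})"
          by (rule eq_card_imp_inj_on[OF fin]) (use True img in \<open>simp add: orb_def\<close>)
        have "orbit g x = orbit h x" if x: "x < n" for x
        proof (intro equalityI subsetI)
          fix y assume y: "y \<in> orbit h x"
          then have "y < n" using sub[OF hp x] by auto
          then have "orbit g y = orbit g x" using c_eq[OF g _ x] const[OF y x] by simp
          then show "y \<in> orbit g x" using permutation_self_in_orbit[OF perm[OF g], of y] by simp
        next
          fix y assume y: "y \<in> orbit g x"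
          then have yn: "y < n" using sub[OF g x] by auto
          have "c g y = c g x" using orb_eq[OF g y] yn x by (simp add: c_def)
          then have "c g (c h y) = c g (c h x)" using ch[OF yn] ch[OF x] by simp
          then have "c h y = c h x" using inj yn x by (auto dest: inj_onD)
          then have "orbit h y = orbit h x" by (rule c_eq[OF hp yn x])
          then show "y \<in> orbit h x" using permutation_self_in_orbit[OF perm[OF hp], of y] by simp
        qed
        then obtain f where f: "f permutes {..<n}" "h = f \<circ> g \<circ> inv f"
          using same_orbits_conjugate[OF g hp] by metis
        have "\<Phi> h = \<Phi> g" using \<Phi> f g unfolding class_fun_def by auto
        then show ?thesis using True by simp
      next
        case False
        then have "orb g < orb h" using \<open>orb g \<le> orb h\<close> by simp
        then have "n - orb h < n - orb g" using orb_le[of h] by simp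
        then show ?thesis using less.hyps[OF _ hp] False by simp
      qed
    qed
    have fins: "finite (stab n (c g))" using perm_group_stab[of n "c g"] by (simp add: perm_group_def)
    have "(\<Sum>h\<in>stab n (c g). \<Phi> h) = (\<Sum>h\<in>stab n (c g). if orb h = orb g then \<Phi> g else 0)"
      by (rule sum.cong[OF refl stabprop])
    also have "\<dots> = of_nat (card {h \<in> stab n (c g). orb h = orb g}) * \<Phi> g"
      using fins by (simp add: sum.If_cases Int_def)
    finally have "of_nat (card {h \<in> stab n (c g). orb h = orb g}) * \<Phi> g = (\<Sum>h\<in>stab n (c g). \<Phi> h)" ..
    also have "\<dots> = 0" using sum_class_fun_pc[OF \<Phi> ccol] orth[of \<gamma>] by simp
    finally have "of_nat (card {h \<in> stab n (c g). orb h = orb g}) * \<Phi> g = 0" .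
    moreover have "card {h \<in> stab n (c g). orb h = orb g} \<noteq> 0" using fins gs by auto
    ultimately show "\<Phi> g = 0" by simp
  qed
qed

section \<open>Existence and uniqueness of multiplicities\<close>

lemma sum_irr_char_coefficient:
  assumes q: "q \<in> partitions_of n"
  shows "(\<Sum>g\<in>Sym n. (\<Sum>p\<in>partitions_of n. a p * irr_char p g) * irr_char q g) = fact n * a q"
proof -
  have "(\<Sum>g\<in>Sym n. (\<Sum>p\<in>partitions_of n. a p * irr_char p g) * irr_char q g) =
      (\<Sum>p\<in>partitions_of n. a p * (\<Sum>g\<in>Sym n. irr_char p g * irr_char q g))"
    unfolding sum_distrib_left sum_distrib_right by (subst sum.swap) (simp only: mult.assoc)
  also have "\<dots> = (\<Sum>p\<in>partitions_of n. if p = q then a q * fact n else 0)"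
    by (intro sum.cong refl) (use irr_char_orthogonal[OF _ q] irr_char_norm[OF q] in auto)
  also have "\<dots> = fact n * a q" using q finite_partitions_of by (simp add: mult.commute)
  finally show ?thesis .
qed

lemma irr_char_independent:
  assumes "\<And>g. g permutes {..<n} \<Longrightarrow> (\<Sum>p\<in>partitions_of n. a p * irr_char p g) = 0"
    and q: "q \<in> partitions_of n"
  shows "a q = 0"
proof -
  have "fact n * a q = (\<Sum>g\<in>Sym n. (\<Sum>p\<in>partitions_of n. a p * irr_char p g) * irr_char q g)"
    by (rule sum_irr_char_coefficient[OF q, symmetric])
  also have "\<dots> = 0" using assms(1) by simp
  finally show ?thesis by simp
qed

theorem class_fun_decomposition:
  assumes \<Phi>: "class_fun n \<Phi>"
    and m: "\<And>p. p \<in> partitions_of n \<Longrightarrow> (\<Sum>g\<in>Sym n. \<Phi> g * irr_char p g) = fact n * a p"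
    and g: "g permutes {..<n}"
  shows "\<Phi> g = (\<Sum>p\<in>partitions_of n. a p * irr_char p g)"
proof -
  define \<Psi> where "\<Psi> g = \<Phi> g - (\<Sum>p\<in>partitions_of n. a p * irr_char p g)" for g
  have \<Psi>: "class_fun n \<Psi>"
    using \<Phi> class_fun_irr_char by (auto simp: class_fun_def \<Psi>_def partitions_of_def intro!: sum.cong)
  have "(\<Sum>g\<in>Sym n. \<Psi> g * irr_char p g) = 0" if p: "p \<in> partitions_of n" for p
    unfolding \<Psi>_def left_diff_distrib sum_subtractf m[OF p] sum_irr_char_coefficient[OF p] by simp
  from orthogonal_to_pc[OF this order_refl] have "\<Psi> g = 0"
    by (rule class_fun_zero[OF \<Psi> order_refl _ g])
  then show ?thesis by (simp add: \<Psi>_def)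
qed

theorem multiplicity_in_eq:
  assumes \<Phi>: "class_fun n \<Phi>"
    and m: "\<And>p. p \<in> partitions_of n \<Longrightarrow> (\<Sum>g\<in>Sym n. \<Phi> g * irr_char p g) = fact n * of_nat (m p)"
    and q: "q \<in> partitions_of n"
  shows "multiplicity_in n q \<Phi> = m q"
proof -
  \<comment> \<open>The description demands the value 0 off the partitions of n, so its solution is
    m truncated in this way.\<close>
  let ?m = "\<lambda>p. if p \<in> partitions_of n then m p else 0"
  have "(THE m :: nat list \<Rightarrow> nat. (\<forall>p. p \<notin> partitions_of n \<longrightarrow> m p = 0) \<and>
        (\<forall>s. s permutes {..<n} \<longrightarrow> \<Phi> s = (\<Sum>p\<in>partitions_of n. of_nat (m p) * irr_char p s))) = ?m"
  proof (rule the_equality, intro conjI allI impI)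
    fix s assume s: "s permutes {..<n}"
    have "\<Phi> s = (\<Sum>p\<in>partitions_of n. of_nat (m p) * irr_char p s)"
      by (rule class_fun_decomposition[OF \<Phi> m s])
    then show "\<Phi> s = (\<Sum>p\<in>partitions_of n. of_nat (?m p) * irr_char p s)" by simp
  next
    fix m' :: "nat list \<Rightarrow> nat"
    assume m': "(\<forall>p. p \<notin> partitions_of n \<longrightarrow> m' p = 0) \<and>
        (\<forall>s. s permutes {..<n} \<longrightarrow> \<Phi> s = (\<Sum>p\<in>partitions_of n. of_nat (m' p) * irr_char p s))"
    show "m' = ?m"
    proof
      fix p
      show "m' p = ?m p"
      proof (cases "p \<in> partitions_of n")
        case True
        have "fact n * of_nat (m p) = (\<Sum>g\<in>Sym n. \<Phi> g * irr_char p g)" using m[OF True] ..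
        also have "\<dots> = (\<Sum>g\<in>Sym n. (\<Sum>p\<in>partitions_of n. of_nat (m' p) * irr_char p g) * irr_char p g)"
          by (intro sum.cong refl) (use m' in auto)
        also have "\<dots> = fact n * of_nat (m' p)" by (rule sum_irr_char_coefficient[OF True])
        finally show ?thesis using True by simp
      qed (use m' in simp)
    qed
  qed simp
  then show ?thesis using q by (simp add: multiplicity_in_def)
qed

section \<open>Multiplicities in characters that vanish on even cycles\<close>

text \<open>The function \<open>m\<close> of partitions, seen as a function of bead vectors \<open>\<alpha> = p + \<delta>\<close> and extended
  antisymmetrically.\<close>

definition mh :: "nat \<Rightarrow> (nat list \<Rightarrow> nat) \<Rightarrow> nat \<Rightarrow> (nat \<Rightarrow> int) \<Rightarrow> int" where
  "mh n m N \<alpha> = (\<Sum>p\<in>partitions_of n. int (m p) * Gd N (bt N p) \<alpha>)"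

lemma mh_cong: "(\<And>i. i < N \<Longrightarrow> \<alpha> i = \<alpha>' i) \<Longrightarrow> mh n m N \<alpha> = mh n m N \<alpha>'"
  unfolding mh_def using Gd_cong[of N \<alpha> \<alpha>'] by simp

lemma mh_permute: "\<sigma> permutes {..<N} \<Longrightarrow> mh n m N (\<alpha> \<circ> \<sigma>) = sign \<sigma> * mh n m N \<alpha>"
  unfolding mh_def by (simp add: Gd_permute sum_distrib_left mult_ac)

lemma mh_transpose:
  assumes "a < N" "b < N" "a \<noteq> b"
  shows "mh n m N (\<alpha> \<circ> transpose a b) = - mh n m N \<alpha>"
  using mh_permute[OF permutes_swap_id[of a "{..<N}" b]] assms by (simp add: sign_swap_id)

lemma mh_repeated: "a < N \<Longrightarrow> b < N \<Longrightarrow> a \<noteq> b \<Longrightarrow> \<alpha> a = \<alpha> b \<Longrightarrow> mh n m N \<alpha> = 0"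
  unfolding mh_def using Gd_repeated[of a N b \<alpha>] by simp

text \<open>Each vector is a rearrangement of the other, so \<open>rearrangement_le\<close> applies
  in both directions.\<close>

lemma strict_rearrangement_eq:
  assumes \<tau>: "\<tau> permutes {..<N}" "\<And>i. i < N \<Longrightarrow> v (\<tau> i) = b i" and v: "strict N v" and b: "strict N b"
  shows "i < N \<Longrightarrow> v i = b i"
proof (induction i rule: less_induct)
  case (less i)
  have "v i \<le> b i" by (rule rearrangement_le[OF \<tau> b]) (use less in auto)
  moreover have "b i \<le> v i"
  proof (rule rearrangement_le[OF permutes_inv[OF \<tau>(1)] _ v])
    show "b (inv \<tau> i) = v i" if "i < N" for i
      using \<tau>(2)[of "inv \<tau> i"] permutes_less[OF permutes_inv[OF \<tau>(1)], of i] permutes_inverses[OF \<tau>(1)] that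
      by simp
  qed (use less in auto)
  ultimately show ?case by simp
qed

lemma Gd_strict:
  assumes v: "strict N v" and b: "strict N b"
  shows "Gd N b v = (if \<forall>i<N. v i = b i then 1 else 0)"
proof (cases "Gd N b v = 0")
  case True
  then show ?thesis using Gd_cong[of N v b b] Gd_self[OF strict_inj[OF b]] by auto
next
  case False
  obtain \<tau> where \<tau>: "\<tau> permutes {..<N}" "\<And>i. i < N \<Longrightarrow> v (\<tau> i) = b i" using Gd_nonzero[OF False] by metis
  have "\<forall>i<N. v i = b i" using strict_rearrangement_eq[OF \<tau> v b] by simp
  then show ?thesis using Gd_cong[of N v b b] Gd_self[OF strict_inj[OF b]] by simp
qed

lemma partitions_ofD: "p \<in> partitions_of n \<Longrightarrow> is_partition p" "p \<in> partitions_of n \<Longrightarrow> sum_list p = n"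
  by (simp_all add: partitions_of_def)

lemma mh_strict_nonneg:
  assumes "strict N \<alpha>"
  shows "mh n m N \<alpha> \<ge> 0"
  unfolding mh_def
proof (rule sum_nonneg)
  fix p assume "p \<in> partitions_of n"
  then have "strict N (bt N p)" using strict_bt partitions_ofD(1) by blast
  from Gd_strict[OF assms this] show "0 \<le> int (m p) * Gd N (bt N p) \<alpha>" by simp
qed

lemma mh_eq:
  assumes p: "p \<in> partitions_of n" and N: "n \<le> N" and \<alpha>: "\<And>i. i < N \<Longrightarrow> \<alpha> i = bt N p i"
  shows "mh n m N \<alpha> = int (m p)"
proof -
  have "Gd N (bt N q) \<alpha> = (if q = p then 1 else 0)" if q: "q \<in> partitions_of n" for q
  proof -
    have s: "strict N (bt N p)" "strict N (bt N q)" using strict_bt partitions_ofD(1) p q by blast+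
    have "Gd N (bt N q) \<alpha> = Gd N (bt N q) (bt N p)" by (rule Gd_cong[OF \<alpha>])
    also have "\<dots> = (if \<forall>i<N. bt N p i = bt N q i then 1 else 0)" by (rule Gd_strict[OF s])
    also have "(\<forall>i<N. bt N p i = bt N q i) \<longleftrightarrow> q = p"
    proof
      assume eq: "\<forall>i<N. bt N p i = bt N q i"
      have "part p i = part q i" for i
      proof (cases "i < N")
        case True
        then show ?thesis using eq by (simp add: bt_def)
      next
        case False
        then have "length p \<le> i" "length q \<le> i" using length_partition[OF p] length_partition[OF q] N by auto
        then show ?thesis by (simp add: part_def)
      qed
      then show "q = p" using part_eq_imp_eq[of p q] partitions_ofD(1) p q by auto
    qed auto
    finally show ?thesis .
  qed
  then have "mh n m N \<alpha> = (\<Sum>q\<in>partitions_of n. if q = p then int (m p) else 0)"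
    unfolding mh_def by (intro sum.cong refl) auto
  also have "\<dots> = int (m p)" using p finite_partitions_of by simp
  finally show ?thesis .
qed

lemma mh_single:
  assumes "q \<in> partitions_of n"
  shows "mh n (\<lambda>p. if p = q then 1 else 0) N \<alpha> = Gd N (bt N q) \<alpha>"
proof -
  have "mh n (\<lambda>p. if p = q then 1 else 0) N \<alpha> = (\<Sum>p\<in>partitions_of n. if p = q then Gd N (bt N q) \<alpha> else 0)"
    unfolding mh_def by (intro sum.cong refl) auto
  also have "\<dots> = Gd N (bt N q) \<alpha>" using assms finite_partitions_of by simp
  finally show ?thesis .
qed

lemma sum_bt: "p \<in> partitions_of n \<Longrightarrow> length p \<le> N \<Longrightarrow> (\<Sum>i<N. bt N p i) = int n + (\<Sum>i<N. dl N i)"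
  using sum_part[of p N] partitions_ofD(2)[of p n]
  by (simp add: bt_def sum.distrib of_nat_sum[symmetric] del: of_nat_sum)

lemma mh_wrong_sum:
  assumes N: "n \<le> N" and s: "(\<Sum>i<N. \<alpha> i) \<noteq> int n + (\<Sum>i<N. dl N i)"
  shows "mh n m N \<alpha> = 0"
  unfolding mh_def
proof (intro sum.neutral ballI)
  fix p assume p: "p \<in> partitions_of n"
  have "Gd N (bt N p) \<alpha> = 0"
  proof (rule ccontr)
    assume "Gd N (bt N p) \<alpha> \<noteq> 0"
    then obtain \<tau> where \<tau>: "\<tau> permutes {..<N}" "\<And>i. i < N \<Longrightarrow> \<alpha> (\<tau> i) = bt N p i"
      using Gd_nonzero by blast
    have "(\<Sum>i<N. \<alpha> i) = (\<Sum>i<N. \<alpha> (\<tau> i))" by (rule sum_permute_Sym[OF \<tau>(1), symmetric])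
    also have "\<dots> = (\<Sum>i<N. bt N p i)" using \<tau>(2) by simp
    finally show False using s sum_bt[OF p, of N] length_partition[OF p] N by simp
  qed
  then show "int (m p) * Gd N (bt N p) \<alpha> = 0" by simp
qed

text \<open>Distinct nonnegative integers in decreasing order are at least \<delta> entry by entry,
  and their differences from \<delta> decrease weakly; these differences are the parts of q.\<close>

lemma sort_to_bt:
  assumes \<alpha>: "\<And>i. i < N \<Longrightarrow> \<alpha> i \<ge> 0" "inj_on \<alpha> {..<N}"
  obtains \<tau> q k where "\<tau> permutes {..<N}" "q \<in> partitions_of k" "length q \<le> N"
    "\<And>i. i < N \<Longrightarrow> \<alpha> (\<tau> i) = bt N q i" "(\<Sum>i<N. \<alpha> i) = int k + (\<Sum>i<N. dl N i)"
proof -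
  obtain \<tau> where \<tau>: "\<tau> permutes {..<N}" "\<forall>i j. i < j \<longrightarrow> j < N \<longrightarrow> \<alpha> (\<tau> j) \<le> \<alpha> (\<tau> i)"
    using sorting_permutation .
  let ?v = "\<lambda>i. \<alpha> (\<tau> i)"
  have lt: "?v j < ?v i" if "i < j" "j < N" for i j
  proof -
    have "\<tau> i \<noteq> \<tau> j" using permutes_inj[OF \<tau>(1)] that by (auto dest: injD)
    then have "?v i \<noteq> ?v j" using inj_onD[OF \<alpha>(2), of "\<tau> i" "\<tau> j"] permutes_less[OF \<tau>(1)] that by auto
    then show ?thesis using \<tau>(2) that by fastforce
  qed
  have ge: "?v (N - 1 - d) \<ge> int d" if "d < N" for d
    using that
  proof (induction d)
    case 0
    then show ?case using \<alpha>(1)[of "\<tau> (N - 1)"] permutes_less[OF \<tau>(1), of "N - 1"] by simp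
  next
    case (Suc d)
    have "?v (N - 1 - d) < ?v (N - 1 - Suc d)" by (rule lt) (use Suc.prems in auto)
    then show ?case using Suc by simp
  qed
  have ge': "?v i \<ge> dl N i" if "i < N" for i
    using ge[of "N - 1 - i"] that by (simp add: dl_def of_nat_diff)
  define f where "f i = nat (?v i - dl N i)" for i
  have "f j \<le> f i" if "i < j" "j < N" for i j
  proof -
    have "i + d < N \<Longrightarrow> ?v (i + d) + int d \<le> ?v i" for d
    proof (induction d)
      case (Suc d)
      have "?v (i + Suc d) < ?v (i + d)" by (rule lt) (use Suc.prems in auto)
      then show ?case using Suc by simp
    qed simp
    from this[of "j - i"] have "?v j - dl N j \<le> ?v i - dl N i" using that by (simp add: dl_def of_nat_diff)
    then show ?thesis by (simp add: f_def)
  qed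
  then obtain q where q: "q \<in> partitions_of (\<Sum>i<N. f i)" "length q \<le> N" "\<And>i. i < N \<Longrightarrow> part q i = f i"
    using partition_of_fun[of N f] by metis
  have eq: "\<alpha> (\<tau> i) = bt N q i" if "i < N" for i
    using q(3)[OF that] ge'[OF that] by (simp add: bt_def f_def)
  have "(\<Sum>i<N. \<alpha> i) = (\<Sum>i<N. bt N q i)" using sum_permute_Sym[OF \<tau>(1), of \<alpha>] eq by simp
  also have "\<dots> = int (\<Sum>i<N. f i) + (\<Sum>i<N. dl N i)" by (rule sum_bt[OF q(1,2)])
  finally show ?thesis using that \<tau>(1) q(1,2) eq by blast
qed

text \<open>Straightening: a vector with a negative or repeated entry or with the wrong sum gives 0
  on both sides; any other one is a permuted bead vector and gives an irreducible character up to
  sign.\<close>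

lemma omega_expand:
  assumes N: "k \<le> N" and g: "g permutes {..<k}"
  shows "omega k N \<alpha> g = (\<Sum>q\<in>partitions_of k. of_int (Gd N (bt N q) \<alpha>) * irr_char q g)"
proof -
  have zero: ?thesis if L: "omega k N \<alpha> g = 0" and R: "\<And>q. q \<in> partitions_of k \<Longrightarrow> Gd N (bt N q) \<alpha> = 0"
    using L R by simp
  have wit: "\<exists>\<tau>. \<tau> permutes {..<N} \<and> (\<forall>i<N. \<alpha> (\<tau> i) = bt N q i)"
    if nz: "Gd N (bt N q) \<alpha> \<noteq> 0" for q
    by (rule Gd_nonzero[OF nz]) blast
  consider i where "i < N" "\<alpha> i < 0" | "\<And>i. i < N \<Longrightarrow> \<alpha> i \<ge> 0" "\<not> inj_on \<alpha> {..<N}"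
    | "\<And>i. i < N \<Longrightarrow> \<alpha> i \<ge> 0" "inj_on \<alpha> {..<N}" by (metis not_le)
  then show ?thesis
  proof cases
    case (1 i)
    show ?thesis
    proof (rule zero)
      show "omega k N \<alpha> g = 0" using 1 by (rule omega_negative)
      fix q
      show "Gd N (bt N q) \<alpha> = 0"
      proof (rule ccontr)
        assume "Gd N (bt N q) \<alpha> \<noteq> 0"
        then obtain \<tau> where \<tau>: "\<tau> permutes {..<N}" "\<forall>i<N. \<alpha> (\<tau> i) = bt N q i" using wit by blast
        have "inv \<tau> i < N" using permutes_less[OF permutes_inv[OF \<tau>(1)]] 1 by simp
        then have "\<alpha> i = bt N q (inv \<tau> i)" using \<tau>(2) permutes_inverses(1)[OF \<tau>(1), of i] by metis
        then show False using 1 dl_nonneg[OF \<open>inv \<tau> i < N\<close>] by (simp add: bt_def)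
      qed
    qed
  next
    case 2
    then obtain a b where ab: "a < N" "b < N" "a \<noteq> b" "\<alpha> a = \<alpha> b" by (auto simp: inj_on_def)
    show ?thesis by (rule zero[OF omega_repeated[OF g ab] Gd_repeated[OF ab]])
  next
    case 3
    obtain \<tau> q k' where \<tau>: "\<tau> permutes {..<N}" "q \<in> partitions_of k'" "length q \<le> N"
      "\<And>i. i < N \<Longrightarrow> \<alpha> (\<tau> i) = bt N q i" "(\<Sum>i<N. \<alpha> i) = int k' + (\<Sum>i<N. dl N i)"
      using sort_to_bt[of N \<alpha>] 3 by metis
    have st: "strict N (bt N q)" using strict_bt partitions_ofD(1)[OF \<tau>(2)] by blast
    show ?thesis
    proof (cases "k' = k")
      case True
      note q = \<tau>(2)[unfolded True]
      have sq: "sign \<tau> * sign \<tau> = 1" by simp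
      have "irr_char q g = omega k N (bt N q) g" by (rule irr_char_eq_omega[OF q \<tau>(3) g])
      also have "\<dots> = omega k N (\<alpha> \<circ> \<tau>) g" by (rule omega_cong) (simp add: \<tau>(4))
      also have "\<dots> = of_int (sign \<tau>) * omega k N \<alpha> g" by (rule omega_permute[OF \<tau>(1) g])
      finally have om: "omega k N \<alpha> g = of_int (sign \<tau>) * irr_char q g"
        by (simp add: mult.assoc[symmetric] of_int_mult[symmetric] del: of_int_mult)
      have "Gd N (bt N q') \<alpha> = (if q' = q then sign \<tau> else 0)" if q': "q' \<in> partitions_of k" for q'
      proof -
        have "sign \<tau> * Gd N (bt N q') \<alpha> = Gd N (bt N q') (\<alpha> \<circ> \<tau>)" by (rule Gd_permute[OF \<tau>(1), symmetric])
        also have "\<dots> = mh k (\<lambda>p. if p = q' then 1 else 0) N (\<alpha> \<circ> \<tau>)"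
          by (rule mh_single[OF q', symmetric])
        also have "\<dots> = int (if q = q' then 1 else 0)"
          by (rule mh_eq[OF q N]) (simp add: \<tau>(4))
        finally have "sign \<tau> * (sign \<tau> * Gd N (bt N q') \<alpha>) = sign \<tau> * (if q' = q then 1 else 0)" by auto
        then show ?thesis by (simp add: mult.assoc[symmetric] split: if_splits)
      qed
      then have "(\<Sum>q'\<in>partitions_of k. of_int (Gd N (bt N q') \<alpha>) * irr_char q' g) =
          (\<Sum>q'\<in>partitions_of k. if q' = q then of_int (sign \<tau>) * irr_char q g else 0)"
        by (intro sum.cong refl) auto
      also have "\<dots> = of_int (sign \<tau>) * irr_char q g" using q finite_partitions_of by simp
      finally show ?thesis using om by simp
    next
      case False
      show ?thesis
      proof (rule zero)
        show "omega k N \<alpha> g = 0" by (rule omega_wrong_sum) (use False \<tau>(5) in simp)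
        fix q' assume q': "q' \<in> partitions_of k"
        have "mh k (\<lambda>p. if p = q' then 1 else 0) N \<alpha> = 0" by (rule mh_wrong_sum[OF N]) (use False \<tau>(5) in simp)
        then show "Gd N (bt N q') \<alpha> = 0" by (simp only: mh_single[OF q'])
      qed
    qed
  qed
qed

text \<open>Lowering an entry of a and raising an entry of b are adjoint: \<tau> matches a, lowered
  at \<tau> i, with b exactly if the inverse of \<tau> matches b, raised at i, with a.\<close>

lemma Gd_shift:
  "(\<Sum>i<N. Gd N b (a(i := a i - r))) = (\<Sum>i<N. Gd N a (b(i := b i + r)))"
proof -
  let ?P = "\<lambda>\<tau> i. \<forall>l<N. (a(i := a i - r)) (\<tau> l) = b l"
  let ?Q = "\<lambda>\<tau> i. \<forall>l<N. (b(i := b i + r)) (\<tau> l) = a l"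
  have eq: "?P \<tau> (\<tau> i) \<longleftrightarrow> ?Q (inv \<tau>) i" if \<tau>: "\<tau> permutes {..<N}" and i: "i < N" for \<tau> i
  proof -
    have ti: "\<tau> l = \<tau> i \<longleftrightarrow> l = i" for l using permutes_inj[OF \<tau>] by (auto dest: injD)
    have "?P \<tau> (\<tau> i) \<longleftrightarrow> (\<forall>l<N. a (\<tau> l) = (b(i := b i + r)) l)"
      by (auto simp: ti algebra_simps)
    also have "\<dots> \<longleftrightarrow> (\<forall>l<N. a l = (b(i := b i + r)) (inv \<tau> l))"
      using permutes_inverses[OF \<tau>] permutes_less[OF \<tau>] permutes_less[OF permutes_inv[OF \<tau>]] by metis
    also have "\<dots> \<longleftrightarrow> ?Q (inv \<tau>) i" by (metis (no_types, lifting))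
    finally show ?thesis .
  qed
  have "(\<Sum>i<N. Gd N b (a(i := a i - r))) = (\<Sum>\<tau>\<in>Sym N. \<Sum>i<N. sign \<tau> * (if ?P \<tau> i then 1 else 0))"
    unfolding Gd_def by (rule sum.swap)
  also have "\<dots> = (\<Sum>\<tau>\<in>Sym N. \<Sum>i<N. sign \<tau> * (if ?P \<tau> (\<tau> i) then 1 else 0))"
    by (intro sum.cong refl sum_permute_Sym[symmetric]) simp
  also have "\<dots> = (\<Sum>\<tau>\<in>Sym N. \<Sum>i<N. sign (inv \<tau>) * (if ?Q (inv \<tau>) i then 1 else 0))"
  proof (intro sum.cong refl)
    fix \<tau> i assume \<tau>: "\<tau> \<in> Sym N" and i: "i \<in> {..<N}"
    have "sign (inv \<tau>) = sign \<tau>" using \<tau> by (intro sign_inverse permutes_permutation) auto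
    then show "sign \<tau> * (if ?P \<tau> (\<tau> i) then 1 else 0) = sign (inv \<tau>) * (if ?Q (inv \<tau>) i then 1 else 0)"
      using eq[of \<tau> i] \<tau> i by (simp only: mem_Collect_eq lessThan_iff)
  qed
  also have "\<dots> = (\<Sum>\<tau>\<in>Sym N. \<Sum>i<N. sign \<tau> * (if ?Q \<tau> i then 1 else 0))"
  proof (rule sum.reindex_bij_betw[where h = inv])
    show "bij_betw inv (Sym N) (Sym N)"
      by (rule bij_betw_byWitness[where f' = inv]) (auto simp: permutes_inv_inv permutes_inv)
  qed
  also have "\<dots> = (\<Sum>i<N. Gd N a (b(i := b i + r)))" unfolding Gd_def by (rule sum.swap)
  finally show ?thesis .
qed

definition add_cycle :: "nat \<Rightarrow> nat \<Rightarrow> (nat \<Rightarrow> nat) \<Rightarrow> nat \<Rightarrow> nat" where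
  "add_cycle k n g x = (if x < k then g x else if x < n - 1 then Suc x else if x = n - 1 then k else x)"

lemma add_cycle:
  assumes g: "g permutes {..<k}" and kn: "k < n"
  shows "add_cycle k n g permutes {..<n}" "\<And>x. x < k \<Longrightarrow> add_cycle k n g x = g x"
    "\<And>x. k \<le> x \<Longrightarrow> x < n - 1 \<Longrightarrow> add_cycle k n g x = Suc x" "add_cycle k n g (n - 1) = k"
proof -
  have gl: "g x < k" if "x < k" for x using permutes_less[OF g] that by simp
  show "add_cycle k n g permutes {..<n}"
  proof (rule inj_imp_permutes)
    show "inj_on (add_cycle k n g) {..<n}"
    proof (rule inj_onI)
      fix x y assume "x \<in> {..<n}" "y \<in> {..<n}" "add_cycle k n g x = add_cycle k n g y"
      then show "x = y"
        using gl[of x] gl[of y] permutes_inj[OF g] kn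
        by (auto simp: add_cycle_def inj_eq split: if_splits)
    qed
    show "add_cycle k n g x \<in> {..<n}" if "x \<in> {..<n}" for x
      using that gl[of x] kn by (auto simp: add_cycle_def)
  qed (use kn in \<open>auto simp: add_cycle_def\<close>)
qed (use kn in \<open>auto simp: add_cycle_def\<close>)

text \<open>If a character vanishes on the elements with a cycle of length \<open>r\<close>, then its multiplicities
  satisfy the relation adjoint to the removal of that cycle.\<close>

lemma mh_relation_bt:
  assumes N: "n \<le> N" and n: "n = k + r" "r \<ge> 1"
    and dec: "\<And>g. g permutes {..<n} \<Longrightarrow> \<Phi> g = (\<Sum>p\<in>partitions_of n. of_nat (m p) * irr_char p g)"
    and van: "\<And>g. g permutes {..<k} \<Longrightarrow> \<Phi> (add_cycle k n g) = 0"
    and q: "q \<in> partitions_of k"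
  shows "(\<Sum>i<N. mh n m N ((bt N q)(i := bt N q i + int r))) = 0"
proof -
  define a where "a q = (\<Sum>p\<in>partitions_of n. \<Sum>i<N. int (m p) * Gd N (bt N q) ((bt N p)(i := bt N p i - int r)))" for q
  have kN: "k \<le> N" and kn: "k < n" using N n by auto
  have "(\<Sum>q\<in>partitions_of k. of_int (a q) * irr_char q g) = 0" if g: "g permutes {..<k}" for g
  proof -
    note ac = add_cycle[OF g kn]
    have "irr_char p (add_cycle k n g) = (\<Sum>i<N. \<Sum>q\<in>partitions_of k.
        of_int (Gd N (bt N q) ((bt N p)(i := bt N p i - int r))) * irr_char q g)"
      if p: "p \<in> partitions_of n" for p
    proof -
      have "length p \<le> N" using length_partition[OF p] N by simp
      then have "irr_char p (add_cycle k n g) = omega n N (bt N p) (add_cycle k n g)"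
        by (rule irr_char_eq_omega[OF p _ ac(1)])
      also have "\<dots> = (\<Sum>i<N. omega k N ((bt N p)(i := bt N p i - int r)) g)"
        by (rule omega_remove_cycle[OF n g ac(2,3,4,1)])
      finally show ?thesis by (simp only: omega_expand[OF kN g])
    qed
    then have "\<Phi> (add_cycle k n g) = (\<Sum>p\<in>partitions_of n. of_nat (m p) * (\<Sum>i<N. \<Sum>q\<in>partitions_of k.
        of_int (Gd N (bt N q) ((bt N p)(i := bt N p i - int r))) * irr_char q g))"
      unfolding dec[OF ac(1)] by (intro sum.cong refl) simp
    also have "\<dots> = (\<Sum>p\<in>partitions_of n. \<Sum>i<N. \<Sum>q\<in>partitions_of k.
        of_int (int (m p) * Gd N (bt N q) ((bt N p)(i := bt N p i - int r))) * irr_char q g)"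
      by (simp add: sum_distrib_left mult.assoc)
    also have "\<dots> = (\<Sum>p\<in>partitions_of n. \<Sum>q\<in>partitions_of k. \<Sum>i<N.
        of_int (int (m p) * Gd N (bt N q) ((bt N p)(i := bt N p i - int r))) * irr_char q g)"
      by (intro sum.cong refl sum.swap)
    also have "\<dots> = (\<Sum>q\<in>partitions_of k. \<Sum>p\<in>partitions_of n. \<Sum>i<N.
        of_int (int (m p) * Gd N (bt N q) ((bt N p)(i := bt N p i - int r))) * irr_char q g)"
      by (rule sum.swap)
    also have "\<dots> = (\<Sum>q\<in>partitions_of k. of_int (a q) * irr_char q g)"
      by (simp only: a_def of_int_sum sum_distrib_right)
    finally show ?thesis using van[OF g] by simp
  qed
  \<comment> \<open>A combination of irreducible characters of S_k that vanishes everywhere has zero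
    coefficients.\<close>
  then have "(of_int (a q) :: complex) = 0" by (rule irr_char_independent[OF _ q])
  then have "0 = a q" by simp
  also have "a q = (\<Sum>p\<in>partitions_of n. int (m p) * (\<Sum>i<N. Gd N (bt N p) ((bt N q)(i := bt N q i + int r))))"
    unfolding a_def sum_distrib_left[symmetric] Gd_shift by (rule refl)
  also have "\<dots> = (\<Sum>i<N. mh n m N ((bt N q)(i := bt N q i + int r)))"
    unfolding mh_def sum_distrib_left by (rule sum.swap)
  finally show ?thesis ..
qed

text \<open>Vectors with distinct entries are sorted into bead vectors. If two entries agree, only
  the terms that move one of these two can survive, and a transposition makes them cancel.\<close>

lemma mh_relation:
  assumes N: "n \<le> N" and r: "r \<ge> 1"
    and dec: "\<And>g. g permutes {..<n} \<Longrightarrow> \<Phi> g = (\<Sum>p\<in>partitions_of n. of_nat (m p) * irr_char p g)"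
    and van: "\<And>k g. n = k + r \<Longrightarrow> g permutes {..<k} \<Longrightarrow> \<Phi> (add_cycle k n g) = 0"
    and \<alpha>: "\<And>i. i < N \<Longrightarrow> \<alpha> i \<ge> 0"
  shows "(\<Sum>i<N. mh n m N (\<alpha>(i := \<alpha> i + int r))) = 0"
proof (cases "inj_on \<alpha> {..<N}")
  case False
  then obtain a b where ab: "a < N" "b < N" "a \<noteq> b" "\<alpha> a = \<alpha> b" by (auto simp: inj_on_def)
  let ?f = "\<lambda>i. mh n m N (\<alpha>(i := \<alpha> i + int r))"
  have "?f i = 0" if "i \<noteq> a" "i \<noteq> b" for i
    by (rule mh_repeated[OF ab(1-3)]) (use ab(4) that in simp)
  then have "(\<Sum>i<N. ?f i) = (\<Sum>i\<in>{a, b}. ?f i)"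
    by (intro sum.mono_neutral_right) (use ab in auto)
  also have "\<dots> = ?f a + ?f b" using ab(3) by simp
  finally have 1: "(\<Sum>i<N. ?f i) = ?f a + ?f b" .
  have "\<alpha>(b := \<alpha> b + int r) = (\<alpha>(a := \<alpha> a + int r)) \<circ> transpose a b"
    using ab by (auto simp: fun_eq_iff transpose_def)
  then have 2: "?f b = - ?f a" by (simp only: mh_transpose[OF ab(1-3)])
  show ?thesis unfolding 1 2 by (rule right_minus)
next
  case True
  obtain \<tau> q k where \<tau>: "\<tau> permutes {..<N}" "q \<in> partitions_of k" "length q \<le> N"
    "\<And>i. i < N \<Longrightarrow> \<alpha> (\<tau> i) = bt N q i" "(\<Sum>i<N. \<alpha> i) = int k + (\<Sum>i<N. dl N i)"
    using sort_to_bt[of N \<alpha>] True \<alpha> by metis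
  show ?thesis
  proof (cases "n = k + r")
    case nk: True
    have "mh n m N (\<alpha>(\<tau> i := \<alpha> (\<tau> i) + int r)) = sign \<tau> * mh n m N ((bt N q)(i := bt N q i + int r))"
      if i: "i < N" for i
    proof -
      have "mh n m N ((bt N q)(i := bt N q i + int r)) = mh n m N (\<alpha>(\<tau> i := \<alpha> (\<tau> i) + int r) \<circ> \<tau>)"
        by (rule mh_cong) (use \<tau>(4) i permutes_inj[OF \<tau>(1)] in \<open>auto simp: inj_eq\<close>)
      also have "\<dots> = sign \<tau> * mh n m N (\<alpha>(\<tau> i := \<alpha> (\<tau> i) + int r))" by (rule mh_permute[OF \<tau>(1)])
      finally show ?thesis by (simp add: mult.assoc[symmetric])
    qed
    then have "(\<Sum>i<N. mh n m N (\<alpha>(\<tau> i := \<alpha> (\<tau> i) + int r))) =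
        sign \<tau> * (\<Sum>i<N. mh n m N ((bt N q)(i := bt N q i + int r)))"
      by (simp add: sum_distrib_left)
    also have "\<dots> = 0" using mh_relation_bt[OF N nk r dec van[OF nk] \<tau>(2)] by simp
    finally show ?thesis using sum_permute_Sym[OF \<tau>(1), of "\<lambda>i. mh n m N (\<alpha>(i := \<alpha> i + int r))"] by simp
  next
    case False
    have "mh n m N (\<alpha>(i := \<alpha> i + int r)) = 0" if i: "i < N" for i
    proof (rule mh_wrong_sum[OF N])
      have "(\<Sum>l<N. (\<alpha>(i := \<alpha> i + int r)) l) = (\<Sum>l<N. \<alpha> l + (if l = i then int r else 0))"
        by (intro sum.cong refl) auto
      also have "\<dots> = (\<Sum>l<N. \<alpha> l) + int r" using i by (simp add: sum.distrib)
      finally show "(\<Sum>l<N. (\<alpha>(i := \<alpha> i + int r)) l) \<noteq> int n + (\<Sum>i<N. dl N i)"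
        using \<tau>(5) False by simp
    qed
    then show ?thesis by simp
  qed
qed

section \<open>Staircases and even cycles\<close>

lemma part_staircase: "part (staircase J) i = J - i"
  by (auto simp: part_def staircase_def rev_nth nth_upt simp del: upt_Suc)

lemma staircase_partition: "is_partition (staircase J)"
  by (auto simp: is_partition_def staircase_def sorted_wrt_rev sorted_wrt_iff_nth_less rev_nth nth_upt simp del: upt_Suc)

lemma sum_list_staircase: "sum_list (staircase J) = J * (J + 1) div 2"
proof -
  have "sum_list (staircase J) = \<Sum>{1..<Suc J}" by (simp add: staircase_def interv_sum_list_conv_sum_set_nat del: upt_Suc)
  also have "{1..<Suc J} = {1..J}" by auto
  finally show ?thesis using gauss_sum_from_Suc_0[of J, where 'a = nat] by simp
qed

lemma length_staircase: "length (staircase J) = J"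
  by (simp add: staircase_def)

text \<open>A staircase has no hook of even length.\<close>

lemma irr_char_staircase_zero:
  assumes n: "n = sum_list (staircase J)" "n = k + r" and r: "even r" "r \<ge> 1" and g: "g permutes {..<k}"
  shows "irr_char (staircase J) (add_cycle k n g) = 0"
proof -
  let ?\<beta> = "bt J (staircase J)"
  have kn: "k < n" using n r by simp
  note ac = add_cycle[OF g kn]
  have p: "staircase J \<in> partitions_of n" using n(1) staircase_partition by (simp add: partitions_of_def)
  have "omega k J (?\<beta>(i := ?\<beta> i - int r)) g = 0" if i: "i < J" for i
  proof (cases "?\<beta> i - int r < 0")
    case True
    then show ?thesis by (intro omega_negative[OF i]) simp
  next
    case False
    obtain s where s: "r = 2 * s" using r(1) by (elim evenE)
    \<comment> \<open>Bead i stands at the odd number 2(J - i) - 1. Lowered by 2s without becoming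
      negative it lands on bead i + s.\<close>
    have "i + s < J" using False i s by (simp add: bt_def dl_def part_staircase of_nat_diff)
    show ?thesis
      by (rule omega_repeated[OF g i \<open>i + s < J\<close>])
        (use r s i \<open>i + s < J\<close> in \<open>auto simp: bt_def dl_def part_staircase of_nat_diff\<close>)
  qed
  then have "(\<Sum>i<J. omega k J (?\<beta>(i := ?\<beta> i - int r)) g) = 0" by simp
  then show ?thesis
    using irr_char_eq_omega[OF p _ ac(1), of J] omega_remove_cycle[OF n(2) r(2) g ac(2,3,4,1), of J ?\<beta>]
    by (simp add: length_staircase)
qed

section \<open>Newton's identities for shift operators\<close>

text \<open>The exponent vector of the monomial x_i^s, where x_i acts on functions as the shift of
  coordinate i by 1.\<close>

definition sg :: "nat \<Rightarrow> nat \<Rightarrow> nat \<Rightarrow> nat" where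
  "sg i s = (\<lambda>j. if j = i then s else 0)"

definition ind :: "nat set \<Rightarrow> nat \<Rightarrow> nat" where
  "ind S = (\<lambda>j. if j \<in> S then 1 else 0)"

definition subs :: "nat set \<Rightarrow> nat \<Rightarrow> nat set set" where
  "subs A k = {S. S \<subseteq> A \<and> card S = k}"

definition comps :: "nat set \<Rightarrow> nat \<Rightarrow> (nat \<Rightarrow> nat) set" where
  "comps A k = {f. (\<forall>i. i \<notin> A \<longrightarrow> f i = 0) \<and> sum f A = k}"

text \<open>The elementary symmetric polynomial in the commuting shifts of the coordinates in A,
  applied to G and evaluated at z; \<open>hk\<close> is its complete homogeneous
  counterpart.\<close>

definition ek :: "((nat \<Rightarrow> nat) \<Rightarrow> int) \<Rightarrow> nat set \<Rightarrow> nat \<Rightarrow> (nat \<Rightarrow> nat) \<Rightarrow> int" where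
  "ek G A k z = (\<Sum>S\<in>subs A k. G (z + ind S))"

definition hk :: "((nat \<Rightarrow> nat) \<Rightarrow> int) \<Rightarrow> nat set \<Rightarrow> nat \<Rightarrow> (nat \<Rightarrow> nat) \<Rightarrow> int" where
  "hk G A k z = (\<Sum>f\<in>comps A k. G (z + f))"

lemma finite_subs: "finite A \<Longrightarrow> finite (subs A k)"
  unfolding subs_def by simp

lemma comps_le: "finite A \<Longrightarrow> f \<in> comps A k \<Longrightarrow> f i \<le> k"
  by (cases "i \<in> A") (auto simp: comps_def intro: member_le_sum)

lemma finite_comps:
  assumes "finite A" shows "finite (comps A k)"
proof (rule finite_subset)
  show "comps A k \<subseteq> {f. \<forall>x. (x \<in> A \<longrightarrow> f x \<in> {..k}) \<and> (x \<notin> A \<longrightarrow> f x = 0)}"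
    using comps_le[OF assms] by (auto simp: comps_def)
  show "finite {f. \<forall>x. (x \<in> A \<longrightarrow> f x \<in> {..k}) \<and> (x \<notin> A \<longrightarrow> f x = (0::nat))}"
    by (rule finite_set_of_finite_funs) (use assms in auto)
qed

lemma comps_zero: "finite A \<Longrightarrow> comps A 0 = {0}"
  unfolding comps_def by (auto simp: fun_eq_iff) metis

lemma sum_sg: "finite A \<Longrightarrow> i \<in> A \<Longrightarrow> sum (f + sg i s) A = sum f A + s"
  by (simp add: sg_def sum.distrib)

lemma hk_shift:
  assumes A: "finite A" "i \<in> A" and s: "s \<le> k"
  shows "hk G A (k - s) (z + sg i s) = (\<Sum>f\<in>comps A k. if s \<le> f i then G (z + f) else 0)"
proof -
  have "bij_betw (\<lambda>f. sg i s + f) (comps A (k - s)) {f \<in> comps A k. s \<le> f i}"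
  proof (rule bij_betw_byWitness[where f' = "\<lambda>f. f(i := f i - s)"])
    show "\<forall>f\<in>comps A (k - s). (sg i s + f)(i := (sg i s + f) i - s) = f" by (auto simp: fun_eq_iff sg_def)
    show "\<forall>f\<in>{f \<in> comps A k. s \<le> f i}. sg i s + f(i := f i - s) = f" by (auto simp: fun_eq_iff sg_def)
    show "(\<lambda>f. sg i s + f) ` comps A (k - s) \<subseteq> {f \<in> comps A k. s \<le> f i}"
    proof clarify
      fix f assume f: "f \<in> comps A (k - s)"
      have "sum (sg i s + f) A = k" using sum_sg[OF A, of f s] f s by (simp add: comps_def add.commute)
      then show "sg i s + f \<in> comps A k \<and> s \<le> (sg i s + f) i" using f A(2) by (auto simp: comps_def sg_def)
    qed
    show "(\<lambda>f. f(i := f i - s)) ` {f \<in> comps A k. s \<le> f i} \<subseteq> comps A (k - s)"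
    proof clarify
      fix f assume f: "f \<in> comps A k" "s \<le> f i"
      have "f = f(i := f i - s) + sg i s" using f(2) by (auto simp: fun_eq_iff sg_def)
      then have "sum f A = sum (f(i := f i - s)) A + s" using sum_sg[OF A, of "f(i := f i - s)" s] by simp
      then show "f(i := f i - s) \<in> comps A (k - s)" using f by (auto simp: comps_def)
    qed
  qed
  from sum.reindex_bij_betw[OF this, of "\<lambda>f. G (z + f)"]
  have "hk G A (k - s) (z + sg i s) = (\<Sum>f\<in>{f \<in> comps A k. s \<le> f i}. G (z + f))"
    unfolding hk_def by (simp add: add.assoc)
  also have "\<dots> = (\<Sum>f\<in>comps A k. if s \<le> f i then G (z + f) else 0)"
    by (rule sum.inter_filter[OF finite_comps[OF A(1)]])
  finally show ?thesis .
qed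

text \<open>A monomial f of degree k is x_i^s times a monomial of degree k - s for exactly f i
  values of s \<ge> 1 at each i, so it is counted k times in all.\<close>

lemma hk_newton:
  assumes A: "finite A"
  shows "int k * hk G A k z = (\<Sum>s=1..k. \<Sum>i\<in>A. hk G A (k - s) (z + sg i s))"
proof -
  have "(\<Sum>s=1..k. \<Sum>i\<in>A. hk G A (k - s) (z + sg i s)) =
      (\<Sum>s=1..k. \<Sum>i\<in>A. \<Sum>f\<in>comps A k. if s \<le> f i then G (z + f) else 0)"
    by (intro sum.cong refl hk_shift A) auto
  also have "\<dots> = (\<Sum>s=1..k. \<Sum>f\<in>comps A k. \<Sum>i\<in>A. if s \<le> f i then G (z + f) else 0)"
    by (intro sum.cong refl sum.swap)
  also have "\<dots> = (\<Sum>f\<in>comps A k. \<Sum>s=1..k. \<Sum>i\<in>A. if s \<le> f i then G (z + f) else 0)"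
    by (rule sum.swap)
  also have "\<dots> = (\<Sum>f\<in>comps A k. \<Sum>i\<in>A. \<Sum>s=1..k. if s \<le> f i then G (z + f) else 0)"
    by (intro sum.cong refl sum.swap)
  also have "\<dots> = (\<Sum>f\<in>comps A k. \<Sum>i\<in>A. int (f i) * G (z + f))"
  proof (intro sum.cong refl)
    fix f i assume f: "f \<in> comps A k"
    have "{s \<in> {1..k}. s \<le> f i} = {1..f i}" using comps_le[OF A f, of i] by auto
    then show "(\<Sum>s=1..k. if s \<le> f i then G (z + f) else 0) = int (f i) * G (z + f)"
      by (subst sum.inter_filter[symmetric]) auto
  qed
  also have "\<dots> = (\<Sum>f\<in>comps A k. int k * G (z + f))"
    by (intro sum.cong refl) (auto simp: comps_def sum_distrib_right[symmetric] of_nat_sum[symmetric] simp del: of_nat_sum)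
  finally show ?thesis by (simp add: hk_def sum_distrib_left)
qed

lemma subs_insert:
  assumes A: "finite A" "i \<in> A"
  shows "(\<Sum>S\<in>{S \<in> subs A (Suc c). i \<in> S}. F S) = (\<Sum>S\<in>subs (A - {i}) c. F (insert i S))"
proof -
  have fin: "finite S" if "S \<subseteq> A" for S using that A(1) finite_subset by blast
  have "bij_betw (insert i) (subs (A - {i}) c) {S \<in> subs A (Suc c). i \<in> S}"
  proof (rule bij_betw_byWitness[where f' = "\<lambda>S. S - {i}"])
    show "insert i ` subs (A - {i}) c \<subseteq> {S \<in> subs A (Suc c). i \<in> S}"
    proof clarify
      fix S assume S: "S \<in> subs (A - {i}) c"
      then have "finite S" "i \<notin> S" using fin[of S] by (auto simp: subs_def)
      then show "insert i S \<in> subs A (Suc c) \<and> i \<in> insert i S" using S A by (auto simp: subs_def)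
    qed
    show "(\<lambda>S. S - {i}) ` {S \<in> subs A (Suc c). i \<in> S} \<subseteq> subs (A - {i}) c"
      using fin by (auto simp: subs_def)
  qed (auto simp: subs_def)
  then show ?thesis by (rule sum.reindex_bij_betw[symmetric])
qed

lemma subs_split:
  assumes A: "finite A" "i \<in> A"
  shows "(\<Sum>S\<in>subs A c. F S) = (\<Sum>S\<in>subs (A - {i}) c. F S) + (\<Sum>S\<in>{S \<in> subs A c. i \<in> S}. F S)"
proof -
  have "subs A c = subs (A - {i}) c \<union> {S \<in> subs A c. i \<in> S}" by (auto simp: subs_def)
  moreover have "(\<Sum>S\<in>subs (A - {i}) c \<union> {S \<in> subs A c. i \<in> S}. F S) =
      (\<Sum>S\<in>subs (A - {i}) c. F S) + (\<Sum>S\<in>{S \<in> subs A c. i \<in> S}. F S)"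
    by (rule sum.union_disjoint) (use A finite_subs[of A] finite_subs[of "A - {i}"] in \<open>auto simp: subs_def\<close>)
  ultimately show ?thesis by simp
qed

text \<open>\<open>U s\<close> is the sum of x_i^s x_S over the S of size k - s that avoid i. The
  product of the power sum of degree s with e_{k - s} is U s + U (s + 1), according to whether S
  contains i, and the alternating sum telescopes to U 1 = k e_k.\<close>

lemma ek_newton:
  assumes A: "finite A"
  shows "int k * ek G A k z = (\<Sum>s=1..k. (-1) ^ (s - 1) * (\<Sum>i\<in>A. ek G A (k - s) (z + sg i s)))"
proof (cases "k = 0")
  case False
  define U where "U s = (if s \<le> k then \<Sum>i\<in>A. \<Sum>S\<in>subs (A - {i}) (k - s). G (z + ind S + sg i s) else 0)" for s
  have step: "(\<Sum>i\<in>A. ek G A (k - s) (z + sg i s)) = U s + U (Suc s)" if s: "1 \<le> s" "s \<le> k" for s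
  proof -
    have "(\<Sum>S\<in>{S \<in> subs A (k - s). i \<in> S}. G (z + sg i s + ind S)) =
        (if Suc s \<le> k then \<Sum>S\<in>subs (A - {i}) (k - Suc s). G (z + ind S + sg i (Suc s)) else 0)"
      if i: "i \<in> A" for i
    proof (cases "Suc s \<le> k")
      case True
      then have "k - s = Suc (k - Suc s)" by simp
      then have "(\<Sum>S\<in>{S \<in> subs A (k - s). i \<in> S}. G (z + sg i s + ind S)) =
          (\<Sum>S\<in>subs (A - {i}) (k - Suc s). G (z + sg i s + ind (insert i S)))"
        using subs_insert[OF A i, where c = "k - Suc s"] by simp
      also have "\<dots> = (\<Sum>S\<in>subs (A - {i}) (k - Suc s). G (z + ind S + sg i (Suc s)))"
        by (intro sum.cong refl arg_cong[of _ _ G]) (auto simp: fun_eq_iff sg_def ind_def subs_def)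
      finally show ?thesis using True by simp
    next
      case False
      then have "{S \<in> subs A (k - s). i \<in> S} = {}"
        using s A finite_subset by (fastforce simp: subs_def)
      then have "(\<Sum>S\<in>{S \<in> subs A (k - s). i \<in> S}. G (z + sg i s + ind S)) = 0" by (simp only: sum.empty)
      then show ?thesis using False by (simp only: if_False)
    qed
    then have "ek G A (k - s) (z + sg i s) = (\<Sum>S\<in>subs (A - {i}) (k - s). G (z + ind S + sg i s)) +
        (if Suc s \<le> k then \<Sum>S\<in>subs (A - {i}) (k - Suc s). G (z + ind S + sg i (Suc s)) else 0)"
      if "i \<in> A" for i
      using that unfolding ek_def by (subst subs_split[OF A that]) (simp add: add_ac)
    then show ?thesis using s by (simp add: U_def sum.distrib)
  qed
  have tele: "(\<Sum>s=1..K. (-1) ^ (s - 1) * (U s + U (Suc s))) = U 1 - (-1) ^ K * U (Suc K)" for K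
    by (induction K) (auto simp: algebra_simps)
  have "(\<Sum>s=1..k. (-1) ^ (s - 1) * (\<Sum>i\<in>A. ek G A (k - s) (z + sg i s))) =
      (\<Sum>s=1..k. (-1) ^ (s - 1) * (U s + U (Suc s)))"
    by (intro sum.cong refl) (simp add: step)
  also have "\<dots> = U 1" unfolding tele by (simp add: U_def)
  also have "\<dots> = (\<Sum>i\<in>A. \<Sum>S\<in>subs (A - {i}) (k - 1). G (z + ind (insert i S)))"
    using False unfolding U_def
    by (auto intro!: sum.cong arg_cong[of _ _ G] simp: fun_eq_iff sg_def ind_def subs_def)
  also have "\<dots> = (\<Sum>i\<in>A. \<Sum>S\<in>{S \<in> subs A k. i \<in> S}. G (z + ind S))"
  proof (rule sum.cong[OF refl])
    fix i assume i: "i \<in> A"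
    have "Suc (k - 1) = k" using False by simp
    then show "(\<Sum>S\<in>subs (A - {i}) (k - 1). G (z + ind (insert i S))) = (\<Sum>S\<in>{S \<in> subs A k. i \<in> S}. G (z + ind S))"
      using subs_insert[OF A i, where c = "k - 1" and F = "\<lambda>S. G (z + ind S)"] by (simp only:)
  qed
  also have "\<dots> = (\<Sum>i\<in>A. \<Sum>S\<in>subs A k. if i \<in> S then G (z + ind S) else 0)"
    by (intro sum.cong refl sum.inter_filter finite_subs A)
  also have "\<dots> = (\<Sum>S\<in>subs A k. \<Sum>i\<in>A. if i \<in> S then G (z + ind S) else 0)" by (rule sum.swap)
  also have "\<dots> = (\<Sum>S\<in>subs A k. int k * G (z + ind S))"
  proof (intro sum.cong refl)
    fix S assume "S \<in> subs A k"
    then have "{i \<in> A. i \<in> S} = S" "card S = k" by (auto simp: subs_def)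
    then show "(\<Sum>i\<in>A. if i \<in> S then G (z + ind S) else 0) = int k * G (z + ind S)"
      using A by (simp add: sum.inter_filter[symmetric])
  qed
  finally show ?thesis by (simp add: ek_def sum_distrib_left)
qed simp

text \<open>On G the power sums over B are minus those over A, also after further shifts, since
  shifts commute. Newton's recursion for the complete sums over B thereby becomes, up to (-1)^k, the
  recursion for the elementary sums over A.\<close>

theorem hk_eq_ek:
  assumes A: "finite A" and B: "finite B"
    and rel: "\<And>z s. s \<ge> 1 \<Longrightarrow> (\<Sum>i\<in>A. G (z + sg i s)) + (\<Sum>i\<in>B. G (z + sg i s)) = 0"
  shows "hk G B k z = (-1) ^ k * ek G A k z"
proof (induction k arbitrary: z rule: less_induct)
  case (less k)
  show ?case
  proof (cases "k = 0")
    case True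
    have "subs A 0 = {{}}" by (auto simp: subs_def card_eq_0_iff dest: finite_subset[OF _ A])
    moreover have "ind {} = 0" by (auto simp: ind_def)
    ultimately show ?thesis using True comps_zero[OF B] by (simp add: hk_def ek_def)
  next
    case False
    have swap: "(\<Sum>i\<in>B. hk G B c (z + sg i s)) = - (\<Sum>i\<in>A. hk G B c (z + sg i s))" if "s \<ge> 1" for c s
    proof -
      have "(\<Sum>i\<in>A. hk G B c (z + sg i s)) + (\<Sum>i\<in>B. hk G B c (z + sg i s)) =
          (\<Sum>f\<in>comps B c. (\<Sum>i\<in>A. G (z + f + sg i s)) + (\<Sum>i\<in>B. G (z + f + sg i s)))"
        unfolding hk_def sum.distrib by (simp add: sum.swap[of _ "comps B c"] add_ac)
      also have "\<dots> = 0" using rel[OF that] by simp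
      finally show ?thesis by simp
    qed
    have sgn: "- ((-1) ^ (k - s)) = (-1) ^ k * ((-1) ^ (s - 1) :: int)" if "s \<in> {1..k}" for s
    proof -
      have "k = (k - s) + s" "s = Suc (s - 1)" using that by auto
      then have "(-1) ^ k = ((-1) ^ (k - s) * (-1) ^ Suc (s - 1) :: int)" by (metis power_add)
      then show ?thesis by (simp add: mult.assoc power_mult_distrib[symmetric])
    qed
    have "int k * hk G B k z = (\<Sum>s=1..k. - (\<Sum>i\<in>A. hk G B (k - s) (z + sg i s)))"
      unfolding hk_newton[OF B] by (intro sum.cong refl swap) auto
    also have "\<dots> = (\<Sum>s=1..k. - ((-1) ^ (k - s)) * (\<Sum>i\<in>A. ek G A (k - s) (z + sg i s)))"
    proof (intro sum.cong refl)
      fix s assume "s \<in> {1..k}"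
      then have "hk G B (k - s) (z + sg i s) = (-1) ^ (k - s) * ek G A (k - s) (z + sg i s)" for i
        by (intro less.IH) auto
      then show "- (\<Sum>i\<in>A. hk G B (k - s) (z + sg i s)) =
          - ((-1) ^ (k - s)) * (\<Sum>i\<in>A. ek G A (k - s) (z + sg i s))"
        by (simp only: sum_distrib_left mult_minus_left sum_negf)
    qed
    also have "\<dots> = (\<Sum>s=1..k. (-1) ^ k * ((-1) ^ (s - 1) * (\<Sum>i\<in>A. ek G A (k - s) (z + sg i s))))"
      by (intro sum.cong refl) (simp only: sgn mult.assoc)
    also have "\<dots> = int k * ((-1) ^ k * ek G A k z)"
      unfolding sum_distrib_left[symmetric] ek_newton[OF A, symmetric] by (rule mult.left_commute)
    finally show ?thesis using False by simp
  qed
qed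

text \<open>Pieri's rule for one row: the exchange of two neighbouring entries reverses the sign of all
  terms except the one where everything is added to the first entry.\<close>

lemma hk_first:
  fixes y :: "nat \<Rightarrow> nat"
  assumes L: "L \<ge> 1" and y: "inj_on y {..<L}"
    and anti: "\<And>b f. Suc b < L \<Longrightarrow> f (y (Suc b)) \<ge> 1 \<Longrightarrow>
      G (z + f(y b := f (y (Suc b)) - 1, y (Suc b) := f (y b) + 1)) = - G (z + f)"
  shows "hk G (y ` {..<L}) k z = G (z + sg (y 0) k)"
proof -
  let ?B = "y ` {..<L}"
  define A where "A = {f \<in> comps ?B k. \<exists>b. 1 \<le> b \<and> b < L \<and> f (y b) \<noteq> 0}"
  define mx where "mx f = Max {b. 1 \<le> b \<and> b < L \<and> f (y b) \<noteq> 0}" for f :: "nat \<Rightarrow> nat"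
  define sw where "sw f = (let b = mx f in f(y (b - 1) := f (y b) - 1, y b := f (y (b - 1)) + 1))" for f
  have yeq: "y a = y b \<longleftrightarrow> a = b" if "a < L" "b < L" for a b using y that by (auto dest: inj_onD)
  have main: "sw f \<in> A \<and> sw (sw f) = f \<and> G (z + sw f) = - G (z + f)" if f: "f \<in> A" for f
  proof -
    let ?S = "{b. 1 \<le> b \<and> b < L \<and> f (y b) \<noteq> 0}"
    have fin: "finite ?S" by simp
    have "mx f \<in> ?S" unfolding mx_def by (rule Max_in[OF fin]) (use f in \<open>auto simp: A_def\<close>)
    then obtain b where b: "mx f = Suc b" "Suc b < L" "f (y (Suc b)) \<noteq> 0" by (cases "mx f") auto
    have above: "f (y c) = 0" if "Suc b < c" "c < L" for c
    proof (rule ccontr)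
      assume "f (y c) \<noteq> 0"
      then have "c \<le> mx f" unfolding mx_def using that by (intro Max_ge[OF fin]) simp
      then show False using that b(1) by simp
    qed
    have swf: "sw f = f(y b := f (y (Suc b)) - 1, y (Suc b) := f (y b) + 1)"
      by (simp add: sw_def b(1) Let_def)
    have ne: "y b \<noteq> y (Suc b)" using yeq[of b "Suc b"] b(2) by simp
    have vals: "sw f (y b) = f (y (Suc b)) - 1" "sw f (y (Suc b)) = f (y b) + 1"
      "\<And>j. j \<noteq> y b \<Longrightarrow> j \<noteq> y (Suc b) \<Longrightarrow> sw f j = f j"
      using ne by (simp_all add: swf)
    have "sum (sw f) ?B = sum f ?B"
    proof -
      have split: "sum g ?B = g (y b) + (g (y (Suc b)) + sum g (?B - {y b} - {y (Suc b)}))" for g :: "nat \<Rightarrow> nat"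
      proof -
        have "sum g ?B = g (y b) + sum g (?B - {y b})" using b(2) by (intro sum.remove) auto
        also have "sum g (?B - {y b}) = g (y (Suc b)) + sum g (?B - {y b} - {y (Suc b)})"
          using b(2) ne by (intro sum.remove) auto
        finally show ?thesis .
      qed
      have "sum (sw f) (?B - {y b} - {y (Suc b)}) = sum f (?B - {y b} - {y (Suc b)})"
        by (intro sum.cong refl vals(3)) auto
      then show ?thesis unfolding split[of "sw f"] split[of f] vals(1,2) using b(3) by simp
    qed
    moreover have "sw f i = 0" if "i \<notin> ?B" for i
    proof -
      have "i \<noteq> y b" "i \<noteq> y (Suc b)" using that b(2) by auto
      then show ?thesis using vals(3)[of i] f that by (auto simp: A_def comps_def)
    qed
    ultimately have c: "sw f \<in> comps ?B k" using f by (simp add: A_def comps_def)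
    have swA: "sw f \<in> A" unfolding A_def using c b(2) vals(2) by (auto intro!: exI[of _ "Suc b"])
    have mx': "mx (sw f) = Suc b" unfolding mx_def
    proof (rule Max_eqI)
      show "c \<le> Suc b" if "c \<in> {b. 1 \<le> b \<and> b < L \<and> sw f (y b) \<noteq> 0}" for c
      proof (rule ccontr)
        assume "\<not> c \<le> Suc b"
        then have "y c \<noteq> y b" "y c \<noteq> y (Suc b)" "f (y c) = 0" using yeq[of c] that b(2) above[of c] by auto
        then show False using vals(3)[of "y c"] that by simp
      qed
    qed (use vals(2) b(2) in auto)
    have "sw (sw f) = (sw f)(y b := sw f (y (Suc b)) - 1, y (Suc b) := sw f (y b) + 1)"
      by (simp add: sw_def[of "sw f"] mx' Let_def)
    also have "\<dots> = f"
    proof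
      fix j
      show "((sw f)(y b := sw f (y (Suc b)) - 1, y (Suc b) := sw f (y b) + 1)) j = f j"
        using vals ne b(3) by (cases "j = y b"; cases "j = y (Suc b)"; simp)
    qed
    finally have "sw (sw f) = f" .
    moreover have "G (z + sw f) = - G (z + f)" unfolding swf by (rule anti[OF b(2)]) (use b(3) in simp)
    ultimately show ?thesis using swA by simp
  qed
  have finB: "finite ?B" by simp
  have finA: "finite A" by (rule finite_subset[OF _ finite_comps[OF finB, of k]]) (auto simp: A_def)
  have "bij_betw sw A A" by (rule bij_betw_byWitness[where f' = sw]) (use main in auto)
  then have "(\<Sum>f\<in>A. G (z + f)) = (\<Sum>f\<in>A. G (z + sw f))" by (rule sum.reindex_bij_betw[symmetric])
  also have "\<dots> = - (\<Sum>f\<in>A. G (z + f))" using main by (simp add: sum_negf)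
  finally have A0: "(\<Sum>f\<in>A. G (z + f)) = 0" by simp
  have "comps ?B k - A = {sg (y 0) k}"
  proof (intro equalityI subsetI)
    fix f assume f: "f \<in> comps ?B k - A"
    then have z: "f (y b) = 0" if "1 \<le> b" "b < L" for b using that by (auto simp: A_def)
    have off: "f i = 0" if "i \<noteq> y 0" for i
    proof (cases "i \<in> ?B")
      case True
      then obtain b where "i = y b" "b < L" by auto
      then show ?thesis using z[of b] that by (cases b) auto
    qed (use f in \<open>auto simp: comps_def\<close>)
    have "sum f ?B = f (y 0) + sum f (?B - {y 0})" using L by (intro sum.remove) auto
    also have "sum f (?B - {y 0}) = 0" using off by (intro sum.neutral) auto
    finally have "f (y 0) = k" using f by (simp add: comps_def)
    then show "f \<in> {sg (y 0) k}" using off by (auto simp: sg_def fun_eq_iff)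
  next
    fix f assume "f \<in> {sg (y 0) k}"
    then have f: "f = sg (y 0) k" by simp
    have "y 0 \<in> ?B" using L by auto
    then have "f \<in> comps ?B k" unfolding f comps_def by (auto simp: sg_def)
    moreover have "f (y b) = 0" if "1 \<le> b" "b < L" for b
      using that yeq[of b 0] L by (auto simp: f sg_def)
    ultimately show "f \<in> comps ?B k - A" by (auto simp: A_def)
  qed
  moreover have "hk G ?B k z = (\<Sum>f\<in>A. G (z + f)) + (\<Sum>f\<in>comps ?B k - A. G (z + f))"
    unfolding hk_def by (subst sum.subset_diff[of A "comps ?B k"]) (auto simp: A_def finite_comps)
  ultimately show ?thesis using A0 by simp
qed

text \<open>Adding a vertical strip of size \<open>k - 1\<close> and then a box, minus adding a vertical strip of size
  \<open>k\<close>; \<open>St\<close> says that the strip can be added.\<close>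

lemma strip_inequality:
  assumes A: "finite A" and k: "k \<ge> 1"
    and P0: "\<And>S. S \<in> subs A (k - 1) \<Longrightarrow> \<not> St S \<Longrightarrow> (\<Sum>i\<in>A. G (z + ind S + sg i 1)) = 0"
    and P1: "\<And>S i. S \<in> subs A (k - 1) \<Longrightarrow> St S \<Longrightarrow> i \<in> A \<Longrightarrow> G (z + ind S + sg i 1) \<ge> 0"
    and P2: "\<And>S. S \<in> subs A k \<Longrightarrow> G (z + ind S) \<noteq> 0 \<Longrightarrow> G (z + ind S) \<ge> 0 \<and> (\<exists>i\<in>S. St (S - {i}))"
    and P3: "K \<in> subs A k" "\<And>i. i \<in> K \<Longrightarrow> St (K - {i})"
  shows "(\<Sum>i\<in>A. ek G A (k - 1) (z + sg i 1)) - ek G A k z \<ge> (int k - 1) * G (z + ind K)"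
proof -
  \<comment> \<open>The number of ways in which S arises by adding a box to a strip of size k -
    1.\<close>
  define c where "c S = card {i \<in> S. St (S - {i})}" for S
  have finS: "finite S" if "S \<in> subs A k" for S using that A finite_subset by (auto simp: subs_def)
  have "(\<Sum>S\<in>subs A k. int (c S) * G (z + ind S)) =
      (\<Sum>S\<in>subs A k. \<Sum>i\<in>A. if i \<in> S then (if St (S - {i}) then G (z + ind S) else 0) else 0)"
  proof (intro sum.cong refl)
    fix S assume S: "S \<in> subs A k"
    then have "{i \<in> A. i \<in> S} = S" by (auto simp: subs_def)
    then have "(\<Sum>i\<in>A. if i \<in> S then (if St (S - {i}) then G (z + ind S) else 0) else 0) =
        (\<Sum>i\<in>S. if St (S - {i}) then G (z + ind S) else 0)"
      using sum.inter_filter[OF A, of "\<lambda>i. if St (S - {i}) then G (z + ind S) else 0" "\<lambda>i. i \<in> S"] by simp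
    also have "\<dots> = int (c S) * G (z + ind S)"
      using sum.inter_filter[OF finS[OF S], of "\<lambda>i. G (z + ind S)" "\<lambda>i. St (S - {i})"] by (simp add: c_def)
    finally show "int (c S) * G (z + ind S) =
        (\<Sum>i\<in>A. if i \<in> S then (if St (S - {i}) then G (z + ind S) else 0) else 0)" ..
  qed
  also have "\<dots> = (\<Sum>i\<in>A. \<Sum>S\<in>subs A k. if i \<in> S then (if St (S - {i}) then G (z + ind S) else 0) else 0)"
    by (rule sum.swap)
  also have "\<dots> = (\<Sum>i\<in>A. \<Sum>S\<in>{S \<in> subs A k. i \<in> S}. if St (S - {i}) then G (z + ind S) else 0)"
    by (intro sum.cong refl sum.inter_filter[symmetric] finite_subs A)
  also have "\<dots> = (\<Sum>i\<in>A. \<Sum>S\<in>subs (A - {i}) (k - 1). if St S then G (z + ind S + sg i 1) else 0)"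
  proof (rule sum.cong[OF refl])
    fix i assume i: "i \<in> A"
    have "(\<Sum>S\<in>{S \<in> subs A k. i \<in> S}. if St (S - {i}) then G (z + ind S) else 0) =
        (\<Sum>S\<in>subs (A - {i}) (k - 1). if St (insert i S - {i}) then G (z + ind (insert i S)) else 0)"
    proof -
      have "Suc (k - 1) = k" using k by simp
      then show ?thesis
        using subs_insert[OF A i, where c = "k - 1" and F = "\<lambda>S. if St (S - {i}) then G (z + ind S) else 0"]
        by (simp only:)
    qed
    also have "\<dots> = (\<Sum>S\<in>subs (A - {i}) (k - 1). if St S then G (z + ind S + sg i 1) else 0)"
    proof (intro sum.cong refl)
      fix S assume S: "S \<in> subs (A - {i}) (k - 1)"
      then have "insert i S - {i} = S" by (auto simp: subs_def)
      moreover have "z + ind (insert i S) = z + ind S + sg i 1"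
        using S by (auto simp: fun_eq_iff ind_def sg_def subs_def)
      ultimately show "(if St (insert i S - {i}) then G (z + ind (insert i S)) else 0) =
          (if St S then G (z + ind S + sg i 1) else 0)" by simp
    qed
    finally show "(\<Sum>S\<in>{S \<in> subs A k. i \<in> S}. if St (S - {i}) then G (z + ind S) else 0) =
        (\<Sum>S\<in>subs (A - {i}) (k - 1). if St S then G (z + ind S + sg i 1) else 0)" .
  qed
  \<comment> \<open>From here on the box may also be added at an element of S; these extra terms are
    nonnegative by \<open>P1\<close>.\<close>
  also have "\<dots> \<le> (\<Sum>i\<in>A. \<Sum>S\<in>subs A (k - 1). if St S then G (z + ind S + sg i 1) else 0)"
    by (intro sum_mono sum_mono2 finite_subs A) (use P1 in \<open>auto simp: subs_def\<close>)
  also have "\<dots> = (\<Sum>S\<in>subs A (k - 1). \<Sum>i\<in>A. if St S then G (z + ind S + sg i 1) else 0)"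
    by (rule sum.swap)
  also have "\<dots> = (\<Sum>S\<in>subs A (k - 1). \<Sum>i\<in>A. G (z + ind S + sg i 1))"
  proof (rule sum.cong[OF refl])
    fix S assume S: "S \<in> subs A (k - 1)"
    show "(\<Sum>i\<in>A. if St S then G (z + ind S + sg i 1) else 0) = (\<Sum>i\<in>A. G (z + ind S + sg i 1))"
      using P0[OF S] by (cases "St S") simp_all
  qed
  also have "\<dots> = (\<Sum>i\<in>A. ek G A (k - 1) (z + sg i 1))"
    unfolding ek_def by (subst sum.swap) (simp add: add_ac)
  finally have le: "(\<Sum>S\<in>subs A k. int (c S) * G (z + ind S)) \<le> (\<Sum>i\<in>A. ek G A (k - 1) (z + sg i 1))" .
  have nonneg: "(int (c S) - 1) * G (z + ind S) \<ge> 0" if S: "S \<in> subs A k" for S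
  proof (cases "G (z + ind S) = 0")
    case False
    obtain i where "i \<in> S" "St (S - {i})" "G (z + ind S) \<ge> 0" using P2[OF S False] by blast
    moreover from this have "c S \<noteq> 0" unfolding c_def using finS[OF S] by auto
    ultimately show ?thesis by simp
  qed simp
  have cK: "c K = k"
  proof -
    have "{i \<in> K. St (K - {i})} = K" using P3(2) by auto
    then show ?thesis using P3(1) by (simp add: c_def subs_def)
  qed
  \<comment> \<open>Only the term of K is kept, where all k elements can be taken away last.\<close>
  have "(int k - 1) * G (z + ind K) \<le> (\<Sum>S\<in>subs A k. (int (c S) - 1) * G (z + ind S))"
    using member_le_sum[of K "subs A k" "\<lambda>S. (int (c S) - 1) * G (z + ind S)"] nonneg P3(1) finite_subs[OF A] cK
    by simp
  also have "\<dots> = (\<Sum>S\<in>subs A k. int (c S) * G (z + ind S)) - ek G A k z"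
    by (simp add: ek_def left_diff_distrib sum_subtractf)
  finally show ?thesis using le by simp
qed

section \<open>Constituents of the square of the staircase character\<close>

definition triple_space :: "nat list \<Rightarrow> nat list \<Rightarrow> nat list \<Rightarrow> ((nat set list \<times> nat set list) \<times> nat set list \<Rightarrow> complex) set" where
  "triple_space p q r = fixed_space (Sym (sum_list r)) (pact (pact tab_act tab_act) tab_act)
     (tens (tens (specht p) (specht q)) (specht r))"

lemma sum_irr_char_triple:
  assumes n: "sum_list p = n" "sum_list q = n" "sum_list r = n"
  shows "(\<Sum>g\<in>Sym n. (irr_char p g * irr_char q g) * irr_char r g) =
    fact n * of_nat (cfun.dim (triple_space p q r))"
proof -
  let ?V = "tens (specht p) (specht q)" and ?a = "pact tab_act tab_act"
  have V: "cfun.subspace ?V" "fin_dim ?V"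
    by (rule subspace_tens, rule fin_dim_tens[OF subspace_specht fin_dim_specht subspace_specht fin_dim_specht])
  have st: "lift ?a g f \<in> ?V" if "g \<in> Sym n" "f \<in> ?V" for g f
    by (rule tens_stable[OF _ _ that(2)]) (use that n specht_stable in auto)
  have "(\<Sum>g\<in>Sym n. (irr_char p g * irr_char q g) * irr_char r g) =
      (\<Sum>g\<in>Sym n. trace_on (tens ?V (specht r)) (lift (pact ?a tab_act) g))"
  proof (intro sum.cong refl)
    fix g assume g: "g \<in> Sym n"
    have "trace_on (tens ?V (specht r)) (lift (pact ?a tab_act) g) =
        trace_on ?V (lift ?a g) * trace_on (specht r) (lift tab_act g)"
      by (intro trace_tens V subspace_specht fin_dim_specht lin_lift lift_tp st g specht_stable) (use g n in auto)
    also have "trace_on ?V (lift ?a g) = trace_on (specht p) (lift tab_act g) * trace_on (specht q) (lift tab_act g)"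
      by (intro trace_tens subspace_specht fin_dim_specht lin_lift lift_tp specht_stable) (use g n in auto)
    finally show "irr_char p g * irr_char q g * irr_char r g =
        trace_on (tens ?V (specht r)) (lift (pact ?a tab_act) g)" by (simp only: irr_char_lift)
  qed
  also have "\<dots> = of_nat (card (Sym n)) * of_nat (cfun.dim (fixed_space (Sym n) (pact ?a tab_act) (tens ?V (specht r))))"
  proof (rule sum_trace_lift[OF perm_group_Sym perm_action_pact[OF perm_action_pact[OF perm_action_tab_act perm_action_tab_act] perm_action_tab_act]])
    show "cfun.subspace (tens ?V (specht r))" by (rule subspace_tens)
    show "fin_dim (tens ?V (specht r))" by (rule fin_dim_tens[OF V subspace_specht fin_dim_specht])
    show "lift (pact ?a tab_act) g f \<in> tens ?V (specht r)" if "g \<in> Sym n" "f \<in> tens ?V (specht r)" for g f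
      by (rule tens_stable[OF _ _ that(2)]) (use that n specht_stable st in auto)
  qed
  finally show ?thesis by (simp add: card_Sym triple_space_def n)
qed

theorem kronecker_eq_dim:
  assumes "p \<in> partitions_of n" "q \<in> partitions_of n" "r \<in> partitions_of n"
  shows "kronecker n p q r = cfun.dim (triple_space p q r)"
  unfolding kronecker_def
proof (rule multiplicity_in_eq[OF _ _ assms(3)])
  show "class_fun n (\<lambda>s. irr_char p s * irr_char q s)"
    using class_fun_irr_char assms partitions_ofD(2) unfolding class_fun_def by metis
  show "(\<Sum>g\<in>Sym n. irr_char p g * irr_char q g * irr_char r' g) = fact n * of_nat (cfun.dim (triple_space p q r'))"
    if "r' \<in> partitions_of n" for r'
    by (rule sum_irr_char_triple) (use assms that partitions_ofD(2) in auto)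
qed

section \<open>Coefficients of polytabloids at the tabloid of a labelling\<close>

lemma polytabloid_self:
  assumes p: "is_partition p" and u: "u \<in> tableaux p"
  shows "polytabloid p u (tabloid p u) = 1"
proof -
  obtain c where c: "\<And>y. y \<in> cells p \<Longrightarrow> c (u y) = fst y" using row_labels[OF u] by metis
  have st: "colstrict p u c"
    unfolding colstrict_def using c cells_up[OF p] by (metis fst_conv le_add2 lessI plus_1_eq_Suc)
  have idH: "id \<in> stab (sum_list p) c" using perm_group_stab[of "sum_list p" c] by (simp add: perm_group_def)
  have "polytabloid p u (tabloid p u) = (\<Sum>s\<in>column_stabilizer p u. if s = id then 1 else 0)"
    unfolding polytabloid_tab_act
  proof (intro sum.cong refl)
    fix s assume s: "s \<in> column_stabilizer p u"
    show "of_int (sign s) * (if tabloid p u = tab_act s (tabloid p u) then 1 else 0) = (if s = id then 1 else (0::complex))"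
      using colstrict_rigid[OF p u st s idH] by (auto simp: sign_id tab_act_id)
  qed
  also have "\<dots> = 1" using perm_group_column_stabilizer[of p u] by (simp add: perm_group_def)
  finally show ?thesis .
qed

definition label_tabloid :: "nat \<Rightarrow> nat list \<Rightarrow> (nat \<Rightarrow> nat) \<Rightarrow> nat set list" where
  "label_tabloid n p c = map (\<lambda>i. {x. x < n \<and> c x = i}) [0..<length p]"

lemma tabloid_eq_label_tabloid:
  assumes u: "u \<in> tableaux p" and c: "\<And>y. y \<in> cells p \<Longrightarrow> c (u y) = fst y"
  shows "tabloid p u = label_tabloid (sum_list p) p c"
  unfolding tabloid_def label_tabloid_def
proof (intro map_cong refl equalityI subsetI)
  fix i x assume x: "x \<in> {x. x < sum_list p \<and> c x = i}"
  then obtain y where "y \<in> cells p" "x = u y" using tableau_cell[OF u, of x] by auto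
  then show "x \<in> u ` {y \<in> cells p. fst y = i}" using x c by auto
qed (use tableau_less[OF u] c in auto)

lemma label_tabloid_stab:
  assumes "h \<in> stab n c" shows "tab_act h (label_tabloid n p c) = label_tabloid n p c"
proof -
  have hp: "h permutes {..<n}" using assms by (simp add: stab_def)
  have "h ` {x. x < n \<and> c x = i} = {x. x < n \<and> c x = i}" for i
  proof (intro equalityI subsetI)
    fix x assume "x \<in> h ` {x. x < n \<and> c x = i}"
    then show "x \<in> {x. x < n \<and> c x = i}" using assms permutes_less[OF hp] by (auto simp: stab_def)
  next
    fix x assume x: "x \<in> {x. x < n \<and> c x = i}"
    have "inv h \<in> stab n c" by (rule perm_group_inv[OF perm_group_stab assms])
    then have "inv h x \<in> {x. x < n \<and> c x = i}"
      using x permutes_less[OF permutes_inv[OF hp], of x] by (auto simp: stab_def)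
    then show "x \<in> h ` {x. x < n \<and> c x = i}"
      using permutes_inverses(1)[OF hp, of x] by (intro image_eqI[of _ _ "inv h x"]) auto
  qed
  then show ?thesis by (simp add: tab_act_def label_tabloid_def)
qed

lemma cells_staircase: "(i, j) \<in> cells (staircase J) \<longleftrightarrow> i + j < J"
proof -
  have "(i, j) \<in> cells (staircase J) \<longleftrightarrow> j < part (staircase J) i" by (auto simp: cells_def part_def)
  then show ?thesis by (auto simp: part_staircase)
qed

text \<open>If the tabloid of c occurs in the polytabloid, a column permutation turns the labels
  into row indices. So column j of u carries each row index of that column exactly once.\<close>

lemma polytabloid_support_labels:
  assumes p: "is_partition p" and u: "u \<in> tableaux p" and nz: "polytabloid p u (label_tabloid (sum_list p) p c) \<noteq> 0"
    and ij: "(i, j) \<in> cells p"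
  obtains i' where "(i', j) \<in> cells p" "c (u (i, j)) = i'" "\<forall>i2. (i2, j) \<in> cells p \<longrightarrow> c (u (i2, j)) = i' \<longrightarrow> i2 = i"
proof -
  obtain s where s: "s \<in> column_stabilizer p u" "label_tabloid (sum_list p) p c = tabloid p (s \<circ> u)"
    using polytabloid_support[OF u nz] by metis
  have lab: "c (s (u y)) = fst y" if y: "y \<in> cells p" for y
  proof -
    have l: "fst y < length p" using y by (auto simp: cells_def)
    have "s (u y) \<in> tabloid p (s \<circ> u) ! fst y" using y l by (auto simp: nth_tabloid)
    then show ?thesis using l unfolding s(2)[symmetric] by (simp add: label_tabloid_def)
  qed
  have pre: "\<exists>a. (a, j) \<in> cells p \<and> u (b, j) = s (u (a, j))" if "(b, j) \<in> cells p" for b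
  proof -
    have "u (b, j) \<in> u ` {y \<in> cells p. snd y = j}" using that by auto
    also have "\<dots> = s ` u ` {y \<in> cells p. snd y = j}" using s(1) by (simp add: column_stabilizer_def)
    finally show ?thesis by auto
  qed
  obtain i' where i': "(i', j) \<in> cells p" "u (i, j) = s (u (i', j))" using pre[OF ij] by blast
  show ?thesis
  proof (rule that[OF i'(1)])
    show "c (u (i, j)) = i'" using lab[OF i'(1)] i'(2) by simp
    show "\<forall>i2. (i2, j) \<in> cells p \<longrightarrow> c (u (i2, j)) = i' \<longrightarrow> i2 = i"
    proof (intro allI impI)
      fix i2 assume i2: "(i2, j) \<in> cells p" "c (u (i2, j)) = i'"
      obtain a where a: "(a, j) \<in> cells p" "u (i2, j) = s (u (a, j))" using pre[OF i2(1)] by blast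
      have "a = i'" using lab[OF a(1)] a(2) i2(2) by simp
      then have "u (i2, j) = u (i, j)" using a i' by simp
      then show "i2 = i" using tableau_eq_iff[OF u i2(1) ij] by simp
    qed
  qed
qed

text \<open>Staircases are self-conjugate, so transposing keeps the shape. The columns of the
  transposed tableau are the rows of t, which lets a second tensor factor constrain the
  rows.\<close>

definition transposed :: "(nat \<times> nat \<Rightarrow> nat) \<Rightarrow> nat \<times> nat \<Rightarrow> nat" where
  "transposed t = (\<lambda>(i, j). t (j, i))"

lemma transposed_tableau:
  assumes "t \<in> tableaux (staircase J)" shows "transposed t \<in> tableaux (staircase J)"
proof -
  have "bij_betw (\<lambda>(i, j). (j, i)) (cells (staircase J)) (cells (staircase J))"
    by (rule bij_betw_byWitness[where f' = "\<lambda>(i, j). (j, i)"]) (auto simp: cells_staircase add.commute)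
  then have "bij_betw (t \<circ> (\<lambda>(i, j). (j, i))) (cells (staircase J)) {..<sum_list (staircase J)}"
    using assms unfolding tableaux_def by (auto intro: bij_betw_trans)
  moreover have "t \<circ> (\<lambda>(i, j). (j, i)) = transposed t" by (auto simp: transposed_def)
  ultimately show ?thesis by (simp add: tableaux_def)
qed

text \<open>If the labels of every row and every column of a staircase tableau form an initial segment, then
  they are constant on the diagonals: the largest label can only be at the corner, and so on.\<close>

lemma staircase_labels_forced:
  fixes lab :: "nat \<Rightarrow> nat \<Rightarrow> nat"
  assumes col: "\<And>i j. i + j < J \<Longrightarrow> lab i j < J - j" and row: "\<And>i j. i + j < J \<Longrightarrow> lab i j < J - i"
    and cold: "\<And>i i' j. i + j < J \<Longrightarrow> i' + j < J \<Longrightarrow> lab i j = lab i' j \<Longrightarrow> i = i'"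
    and rowd: "\<And>i j j'. i + j < J \<Longrightarrow> i + j' < J \<Longrightarrow> lab i j = lab i j' \<Longrightarrow> j = j'"
  shows "i + j < J \<Longrightarrow> lab i j = J - 1 - (i + j)"
proof (induction "i + j" arbitrary: i j rule: less_induct)
  case less
  define d where "d = i + j"
  have dJ: "d < J" using less.prems by (simp add: d_def)
  have "b \<le> d \<Longrightarrow> lab (d - b) b = J - 1 - d" for b
  proof (induction b rule: less_induct)
    case inner: (less b)
    have "J - 1 - d \<in> (\<lambda>i. lab i b) ` {..<J - b}"
    proof -
      have inj: "inj_on (\<lambda>i. lab i b) {..<J - b}" using cold[of _ b] by (auto simp: inj_on_def)
      have "(\<lambda>i. lab i b) ` {..<J - b} = {..<J - b}"
        by (rule card_subset_eq) (use col[of _ b] card_image[OF inj] in auto)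
      then show ?thesis using inner.prems dJ by auto
    qed
    then obtain a where "a < J - b" "lab a b = J - 1 - d" by fastforce
    then have a: "a + b < J" "lab a b = J - 1 - d" by auto
    have "a \<le> d" using row[OF a(1)] a(2) dJ by simp
    moreover have "\<not> a + b < d"
    proof
      assume lt: "a + b < d"
      then have "lab a b = J - 1 - (a + b)" using less.hyps[of a b] a(1) by (simp add: d_def)
      then show False using a(2) lt dJ by simp
    qed
    moreover have "\<not> d < a + b"
    proof
      assume gt: "d < a + b"
      then have b': "d - a < b" "d - (d - a) = a" using \<open>a \<le> d\<close> by auto
      then have "lab a (d - a) = J - 1 - d" using inner.IH[of "d - a"] inner.prems by simp
      then have "d - a = b" using rowd[of a "d - a" b] a dJ \<open>a \<le> d\<close> by simp
      then show False using b' by simp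
    qed
    ultimately have "a = d - b" by simp
    then show ?case using a by simp
  qed
  from this[of j] show ?case by (simp add: d_def)
qed

text \<open>Labels constant on diagonals are distinct in each column. After sorting the columns row
  i carries the label i, and a polytabloid has coefficient 1 at the tabloid of its own
  tableau.\<close>

lemma polytabloid_nonzero_staircase:
  assumes s: "s \<in> tableaux (staircase J)" and lab: "\<And>i j. i + j < J \<Longrightarrow> c (s (i, j)) = J - 1 - (i + j)"
    and cnt: "\<And>r. card {x. x < sum_list (staircase J) \<and> c x = r} = J - r"
  shows "polytabloid (staircase J) s (label_tabloid (sum_list (staircase J)) (staircase J) c) \<noteq> 0"
proof -
  let ?p = "staircase J"
  have ip: "is_partition ?p" by (rule staircase_partition)
  have "coldist ?p s c" unfolding coldist_def cells_staircase using lab by auto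
  then obtain \<sigma> where \<sigma>: "\<sigma> \<in> column_stabilizer ?p s" "colstrict ?p (\<sigma> \<circ> s) c"
    using sort_columns[OF ip s] by metis
  let ?u = "\<sigma> \<circ> s"
  have u: "?u \<in> tableaux ?p" by (rule tableaux_comp[OF s column_stabilizer_permutes[OF \<sigma>(1)]])
  obtain t0 where t0: "t0 \<in> tableaux ?p" "\<And>y. y \<in> cells ?p \<Longrightarrow> c (t0 y) = fst y"
    using exists_tableau[of ?p c fst] cnt card_row_cells[of ?p] part_staircase[of J] by metis
  have "c (?u y) = fst y" if "y \<in> cells ?p" for y
    using colstrict_row_labels[OF ip u t0(1) _ \<sigma>(2), of "fst y" "snd y"] t0(2) that by auto
  then have "tabloid ?p ?u = label_tabloid (sum_list ?p) ?p c" by (rule tabloid_eq_label_tabloid[OF u])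
  then have "polytabloid ?p ?u (label_tabloid (sum_list ?p) ?p c) = 1" using polytabloid_self[OF ip u] by simp
  then show ?thesis unfolding polytabloid_column[OF \<sigma>(1)] by (auto simp: cscale_def)
qed

text \<open>The invariant is the sum of all translates of e_s \<otimes> e_s' \<otimes> z, with s'
  the transpose of s and z the symmetrised polytabloid of the filling. At the coordinate
  \<open>((?D, ?D), ?T)\<close> only the stabilizer of c contributes, each element with the same
  nonzero value.\<close>

theorem triple_space_staircase:
  assumes n: "n = sum_list (staircase J)" and r: "r \<in> partitions_of n" and t: "t \<in> tableaux r"
    and st: "colstrict r t c" and cnt: "\<And>l. card {x. x < n \<and> c x = l} = J - l"
  shows "cfun.dim (triple_space (staircase J) (staircase J) r) \<ge> 1"
proof -
  let ?p = "staircase J" and ?D = "label_tabloid n (staircase J) c" and ?T = "tabloid r t"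
  let ?a = "pact (pact tab_act tab_act) tab_act"
  let ?W = "tens (tens (specht ?p) (specht ?p)) (specht r)"
  have ip: "is_partition ?p" by (rule staircase_partition)
  have rn: "sum_list r = n" "is_partition r" using r partitions_ofD by auto
  have pn: "sum_list ?p = n" using n by simp
  \<comment> \<open>The diagonal i + j = J - 1 - l has J - l cells, so labels constant on diagonals
    have the content prescribed by \<open>cnt\<close>.\<close>
  have diag: "card {y \<in> cells ?p. J - 1 - (fst y + snd y) = l} = J - l" for l
  proof (cases "l < J")
    case True
    have "{y \<in> cells ?p. J - 1 - (fst y + snd y) = l} = (\<lambda>i. (i, J - 1 - l - i)) ` {..<J - l}"
      using True by (auto simp: cells_staircase image_iff)
    then show ?thesis by (simp add: card_image inj_on_def)
  next
    case False
    then have "{y \<in> cells ?p. J - 1 - (fst y + snd y) = l} = {}" by (auto simp: cells_staircase)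
    then have "card {y \<in> cells ?p. J - 1 - (fst y + snd y) = l} = 0" by (simp only: card.empty)
    then show ?thesis using False by simp
  qed
  obtain s where s: "s \<in> tableaux ?p" "\<And>y. y \<in> cells ?p \<Longrightarrow> c (s y) = J - 1 - (fst y + snd y)"
    using exists_tableau[of ?p c "\<lambda>y. J - 1 - (fst y + snd y)"] cnt diag n by metis
  have slab: "c (s (i, j)) = J - 1 - (i + j)" if "i + j < J" for i j
    using s(2)[of "(i, j)"] that by (simp add: cells_staircase)
  let ?s' = "transposed s"
  have s': "?s' \<in> tableaux ?p" by (rule transposed_tableau[OF s(1)])
  have s'lab: "c (?s' (i, j)) = J - 1 - (i + j)" if "i + j < J" for i j
    using slab[of j i] that by (simp add: transposed_def add.commute)
  define z where "z = (\<Sum>h\<in>stab n c. lift tab_act h (polytabloid r t))"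
  have zT: "z ?T \<noteq> 0" using sum_lift_nonzero[OF rn(2) t st] rn(1) by (simp add: z_def)
  have zin: "z \<in> specht r" unfolding z_def
    by (intro cfun.subspace_sum[OF subspace_specht] specht_stable polytabloid_in_specht t)
      (auto simp: stab_def rn)
  have zfix: "lift tab_act h z = z" if "h \<in> stab n c" for h
    unfolding z_def by (rule lift_sum_fixed[OF perm_group_stab perm_action_tab_act that])
  let ?e = "polytabloid ?p s" and ?e' = "polytabloid ?p ?s'"
  let ?Y = "tp (tp ?e ?e') z"
  define X where "X = (\<Sum>g\<in>Sym n. lift ?a g ?Y)"
  have act: "perm_action ?a" by (intro perm_action_pact perm_action_tab_act)
  have sW: "cfun.subspace ?W" by (rule subspace_tens)
  have "lift ?a g ?Y \<in> ?W" if g: "g \<in> Sym n" for g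
    unfolding lift_tp using g pn rn
    by (intro tp_in_tens specht_stable polytabloid_in_specht s(1) s' zin) auto
  then have "X \<in> ?W" unfolding X_def by (rule cfun.subspace_sum[OF sW])
  then have Xin: "X \<in> triple_space ?p ?p r"
    unfolding triple_space_def fixed_space_def rn(1) X_def
    using lift_sum_fixed[OF perm_group_Sym act] by blast
  have val: "lift ?a g ?Y ((?D, ?D), ?T) = (if g \<in> stab n c then ?e ?D * ?e' ?D * z ?T else 0)"
    if g: "g \<in> Sym n" for g
  proof -
    have gp: "g permutes {..<sum_list ?p}" using g pn by simp
    have split: "lift ?a g ?Y ((?D, ?D), ?T) =
        lift tab_act g ?e ?D * lift tab_act g ?e' ?D * lift tab_act g z ?T"
      unfolding lift_tp by (simp add: tp_def)
    show ?thesis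
    proof (cases "g \<in> stab n c")
      case True
      have "tab_act (inv g) ?D = ?D"
        by (rule label_tabloid_stab[OF perm_group_inv[OF perm_group_stab True]])
      then show ?thesis unfolding split zfix[OF True] using True by (simp add: lift_def)
    next
      case False
      \<comment> \<open>Otherwise the columns of g \<circ> s and, through s', its rows carry initial
        segments of labels; \<open>staircase_labels_forced\<close> then shows that g preserves the
        labels.\<close>
      have "lift tab_act g ?e ?D = 0 \<or> lift tab_act g ?e' ?D = 0"
      proof (rule ccontr)
        assume "\<not> ?thesis"
        then have nz: "polytabloid ?p (g \<circ> s) ?D \<noteq> 0" "polytabloid ?p (g \<circ> ?s') ?D \<noteq> 0"
          unfolding lift_polytabloid[OF gp] by auto
        have gs: "g \<circ> s \<in> tableaux ?p" "g \<circ> ?s' \<in> tableaux ?p" using tableaux_comp s(1) s' gp by auto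
        have gs': "(g \<circ> ?s') (i, j) = (g \<circ> s) (j, i)" for i j by (simp add: transposed_def)
        let ?lab = "\<lambda>i j. c (g (s (i, j)))"
        have A: "?lab i j < J - j \<and> (\<forall>i2. i2 + j < J \<longrightarrow> ?lab i2 j = ?lab i j \<longrightarrow> i2 = i)" if ij: "i + j < J" for i j
        proof -
          have cell: "(i, j) \<in> cells ?p" using ij by (simp add: cells_staircase)
          obtain i' where "(i', j) \<in> cells ?p" "c ((g \<circ> s) (i, j)) = i'"
            "\<forall>i2. (i2, j) \<in> cells ?p \<longrightarrow> c ((g \<circ> s) (i2, j)) = i' \<longrightarrow> i2 = i"
            by (rule polytabloid_support_labels[OF ip gs(1) nz(1)[folded pn] cell])
          then show ?thesis by (auto simp: cells_staircase)
        qed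
        have B: "?lab i j < J - i \<and> (\<forall>j2. i + j2 < J \<longrightarrow> ?lab i j2 = ?lab i j \<longrightarrow> j2 = j)" if ij: "i + j < J" for i j
        proof -
          have cell: "(j, i) \<in> cells ?p" using ij by (simp add: cells_staircase add.commute)
          obtain j' where "(j', i) \<in> cells ?p" "c ((g \<circ> ?s') (j, i)) = j'"
            "\<forall>j2. (j2, i) \<in> cells ?p \<longrightarrow> c ((g \<circ> ?s') (j2, i)) = j' \<longrightarrow> j2 = j"
            by (rule polytabloid_support_labels[OF ip gs(2) nz(2)[folded pn] cell])
          then show ?thesis unfolding gs' by (auto simp: cells_staircase add.commute)
        qed
        have "?lab i j = J - 1 - (i + j)" if ij: "i + j < J" for i j
        proof (rule staircase_labels_forced[where lab = ?lab])
          show "?lab i j < J - j" if "i + j < J" for i j using A[OF that] by blast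
          show "?lab i j < J - i" if "i + j < J" for i j using B[OF that] by blast
          show "i = i'" if "i + j < J" "i' + j < J" "?lab i j = ?lab i' j" for i i' j
            using A[OF that(2)] that(1,3) by blast
          show "j = j'" if "i + j < J" "i + j' < J" "?lab i j = ?lab i j'" for i j j'
            using B[OF that(2)] that(1,3) by blast
        qed (rule ij)
        then have "c (g (s y)) = c (s y)" if "y \<in> cells ?p" for y
          using slab that by (cases y) (simp add: cells_staircase)
        then have "c (g x) = c x" if "x < n" for x using tableau_cell[OF s(1), of x] that pn by auto
        then have "g \<in> stab n c" using g by (simp add: stab_def)
        then show False using False by simp
      qed
      then show ?thesis unfolding split using False by auto
    qed
  qed
  have "X ((?D, ?D), ?T) = (\<Sum>g\<in>Sym n. if g \<in> stab n c then ?e ?D * ?e' ?D * z ?T else 0)"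
    unfolding X_def sum_fun_apply by (intro sum.cong refl val)
  also have "\<dots> = of_nat (card (stab n c)) * (?e ?D * ?e' ?D * z ?T)"
  proof -
    have "{g \<in> Sym n. g \<in> stab n c} = stab n c" by (auto simp: stab_def)
    then show ?thesis by (simp add: sum.inter_filter[symmetric] finite_permutations)
  qed
  also have "\<dots> \<noteq> 0"
    using polytabloid_nonzero_staircase[OF s(1) slab] polytabloid_nonzero_staircase[OF s' s'lab] cnt zT stab_pos[of n c]
    by (simp add: n)
  finally have "X \<noteq> 0" by auto
  have "fin_dim ?W"
    by (rule fin_dim_tens[OF subspace_tens fin_dim_tens[OF subspace_specht fin_dim_specht subspace_specht fin_dim_specht]
          subspace_specht fin_dim_specht])
  then have "fin_dim (triple_space ?p ?p r)"
    by (rule fin_dim_mono) (auto simp: triple_space_def fixed_space_def)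
  from dim_pos[OF this Xin \<open>X \<noteq> 0\<close>] show ?thesis .
qed

section \<open>The partitions with core \<open>\<rho>(2w - 1)\<close>\<close>

lemma cells_iff_part: "(i, j) \<in> cells p \<longleftrightarrow> j < part p i"
  by (auto simp: cells_def part_def)

text \<open>The filling moves one box of each of the rows \<open>k, \<dots>, J - 1\<close> of \<open>\<rho>(J)\<close>, with its label, to the
  first \<open>k\<close> rows; row \<open>i\<close> receives \<open>2 (k - i) - 1\<close> of these boxes.\<close>

lemma staircase_filling:
  assumes p: "p \<in> partitions_of n" and n: "n = sum_list (staircase J)" and J: "J = k * k + k"
    and part: "\<And>i. part p i = (J - 1 - i) + 2 * (k - i)"
  obtains t c where "t \<in> tableaux p" "colstrict p t c" "\<And>l. card {x. x < n \<and> c x = l} = J - l"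
proof -
  \<comment> \<open>\<open>off i\<close> is the sum of 2(k - i') - 1 over i' < i, the number of
    boxes received by the rows above row i. Since off k = k^2 = J - k, the labels of the moved boxes
    run through k, ..., J - 1.\<close>
  define off where "off i = i * (2 * k - i)" for i
  define lab where "lab i j = (if i < k \<and> J - i \<le> j then k + off i + (j - (J - i)) else i)" for i j
  have off_Suc: "off (Suc i) = off i + 2 * (k - i) - 1" if i: "i < k" for i
  proof -
    obtain d where d: "k = Suc (i + d)" using less_imp_Suc_add[OF i] by blast
    have "2 * k - Suc i = i + 2 * d + 1" "2 * k - i = i + 2 * d + 2" "k - i = Suc d" by (simp_all add: d)
    then show ?thesis by (simp add: off_def algebra_simps)
  qed
  have off_mono: "i \<le> i' \<Longrightarrow> i' \<le> k \<Longrightarrow> off i \<le> off i'" for i i'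
  proof (induction i' rule: dec_induct)
    case (step i')
    then show ?case using off_Suc[of i'] by simp
  qed simp
  have off_k: "off k = k * k" by (simp add: off_def)
  have extra: "lab i j < k + off (Suc i)" "k + off i \<le> lab i j"
    if "i < k" "J - i \<le> j" "(i, j) \<in> cells p" for i j
    using that off_Suc[of i] J by (auto simp: lab_def cells_iff_part part)
  have labJ: "lab i j < J" if "(i, j) \<in> cells p" for i j
  proof (cases "i < k \<and> J - i \<le> j")
    case True
    then have "lab i j < k + off (Suc i)" using extra that by blast
    also have "\<dots> \<le> k + off k" using off_mono[of "Suc i" k] True by simp
    finally show ?thesis using off_k J by simp
  next
    case False
    then show ?thesis using that J by (auto simp: lab_def cells_iff_part part split: if_splits)
  qed
  have inj: "i = i' \<and> j = j'"
    if a: "i < k" "J - i \<le> j" "(i, j) \<in> cells p" and b: "i' < k" "J - i' \<le> j'" "(i', j') \<in> cells p"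
      and eq: "lab i j = lab i' j'" for i j i' j'
  proof -
    have "\<not> i < i'" using extra(1)[OF a] extra(2)[OF b] eq off_mono[of "Suc i" i'] b(1) by auto
    moreover have "\<not> i' < i" using extra(1)[OF b] extra(2)[OF a] eq off_mono[of "Suc i'" i] a(1) by auto
    ultimately have "i = i'" by simp
    then show ?thesis using eq a b by (simp add: lab_def)
  qed
  have fin: "finite {y \<in> cells p. lab (fst y) (snd y) = l}" for l using finite_cells by simp
  have le: "card {y \<in> cells p. lab (fst y) (snd y) = l} \<le> J - l" if l: "l < J" for l
  proof (cases "l < k")
    case True
    have "{y \<in> cells p. lab (fst y) (snd y) = l} \<subseteq> Pair l ` {..<J - l}"
      using True by (auto simp: lab_def split: if_splits)
    then have "card {y \<in> cells p. lab (fst y) (snd y) = l} \<le> card (Pair l ` {..<J - l})"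
      by (rule card_mono[rotated]) simp
    then show ?thesis by (simp add: card_image inj_on_def)
  next
    case False
    let ?X = "{y \<in> cells p. fst y < k \<and> J - fst y \<le> snd y \<and> lab (fst y) (snd y) = l}"
    have X1: "card ?X \<le> 1"
    proof (rule ccontr)
      assume "\<not> card ?X \<le> 1"
      then obtain y y' where "y \<in> ?X" "y' \<in> ?X" "y \<noteq> y'"
        by (metis (no_types, lifting) card_le_Suc0_iff_eq One_nat_def card.infinite zero_le)
      then show False using inj[of "fst y" "snd y" "fst y'" "snd y'"] by (auto simp: prod_eq_iff)
    qed
    have "{y \<in> cells p. lab (fst y) (snd y) = l} \<subseteq> Pair l ` {..<J - 1 - l} \<union> ?X"
    proof
      fix y assume y: "y \<in> {y \<in> cells p. lab (fst y) (snd y) = l}"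
      obtain i' j' where ij: "y = (i', j')" by (cases y)
      show "y \<in> Pair l ` {..<J - 1 - l} \<union> ?X"
      proof (cases "y \<in> ?X")
        case new: False
        then have "i' = l" using y by (auto simp: ij lab_def split: if_splits)
        then show ?thesis using y False by (auto simp: ij cells_iff_part part)
      qed simp
    qed
    then have "card {y \<in> cells p. lab (fst y) (snd y) = l} \<le> card (Pair l ` {..<J - 1 - l} \<union> ?X)"
      by (rule card_mono[rotated]) (simp add: finite_cells)
    also have "\<dots> \<le> card (Pair l ` {..<J - 1 - l}) + card ?X" by (rule card_Un_le)
    finally show ?thesis using l X1 by (simp add: card_image inj_on_def)
  qed
  \<comment> \<open>No label exceeds its prescribed number, so equality of the totals makes every
    bound sharp.\<close>
  have tot: "(\<Sum>l<J. card {y \<in> cells p. lab (fst y) (snd y) = l}) = (\<Sum>l<J. J - l)"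
  proof -
    have "(\<Union>l<J. {y \<in> cells p. lab (fst y) (snd y) = l}) = cells p" using labJ by auto
    moreover have "card (\<Union>l<J. {y \<in> cells p. lab (fst y) (snd y) = l}) =
        (\<Sum>l<J. card {y \<in> cells p. lab (fst y) (snd y) = l})"
      by (rule card_UN_disjoint) (use fin in auto)
    ultimately have "(\<Sum>l<J. card {y \<in> cells p. lab (fst y) (snd y) = l}) = n"
      using card_cells[of p] p by (simp add: partitions_of_def)
    also have "n = (\<Sum>l<J. J - l)"
      using sum_part[of "staircase J" J] n by (simp add: length_staircase part_staircase)
    finally show ?thesis .
  qed
  have cnt: "card {y \<in> cells p. lab (fst y) (snd y) = l} = J - l" for l
  proof (cases "l < J")
    case True
    show ?thesis by (rule sum_mono_inv[OF tot _ _ finite_lessThan]) (use le True in auto)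
  next
    case False
    then have "{y \<in> cells p. lab (fst y) (snd y) = l} = {}" using labJ by force
    then have "card {y \<in> cells p. lab (fst y) (snd y) = l} = 0" by (simp only: card.empty)
    then show ?thesis using False by simp
  qed
  obtain t where t: "t \<in> tableaux p" using tableaux_nonempty .
  define c where "c x = (let y = inv_into (cells p) t x in lab (fst y) (snd y))" for x
  have c: "c (t y) = lab (fst y) (snd y)" if "y \<in> cells p" for y
    using t that by (simp add: c_def tableaux_def bij_betw_def)
  have pn: "n = sum_list p" using p by (simp add: partitions_of_def)
  have "card {x. x < n \<and> c x = l} = J - l" for l
  proof -
    have "{x. x < n \<and> c x = l} = t ` {y \<in> cells p. lab (fst y) (snd y) = l}"
    proof (intro equalityI subsetI)
      fix x assume x: "x \<in> {x. x < n \<and> c x = l}"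
      then obtain y where "y \<in> cells p" "x = t y" using tableau_cell[OF t, of x] pn by auto
      then show "x \<in> t ` {y \<in> cells p. lab (fst y) (snd y) = l}" using x c by auto
    qed (use tableau_less[OF t] c pn in auto)
    moreover have "inj_on t {y \<in> cells p. lab (fst y) (snd y) = l}"
      using tableau_eq_iff[OF t] by (auto simp: inj_on_def)
    ultimately show ?thesis using cnt by (simp add: card_image)
  qed
  moreover have "colstrict p t c"
    unfolding colstrict_def
  proof (intro allI impI)
    fix i j assume b: "(Suc i, j) \<in> cells p"
    have a: "(i, j) \<in> cells p" using cells_up[OF partitions_ofD(1)[OF p] b] by simp
    \<comment> \<open>Below an added box there can only be an added box, because row k is too short;
      its label belongs to a later block. Below any other box of row i the label exceeds i.\<close>
    have "lab i j < lab (Suc i) j"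
    proof (cases "i < k \<and> J - i \<le> j")
      case True
      then have "Suc i < k" using b J by (cases "Suc i < k") (auto simp: cells_iff_part part)
      then show ?thesis using True off_Suc[of i] by (auto simp: lab_def)
    next
      case False
      then show ?thesis by (auto simp: lab_def)
    qed
    then show "c (t (i, j)) < c (t (Suc i, j))" using c[OF a] c[OF b] by simp
  qed
  ultimately show ?thesis using t by (intro that[of t c])
qed

lemma part_partition_add: "part (partition_add p q) i = part p i + part q i"
  by (auto simp: partition_add_def part_def)

lemma part_double: "part (map ((*) 2) p) i = 2 * part p i"
  by (simp add: part_def)

lemma part_conjugate:
  assumes "\<And>i. part p i \<le> part p 0"
  shows "part (conjugate p) i = card {c. i < part p c}"
proof (cases "i < part p 0")
  case True
  then show ?thesis by (simp add: conjugate_def part_def[of "map _ _"])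
next
  case False
  then have "{c. i < part p c} = {}" using assms by (auto simp: not_less intro: order_trans)
  then have "card {c. i < part p c} = 0" by (simp only: card.empty)
  then show ?thesis using False by (simp add: conjugate_def part_def[of "map _ _"])
qed

lemma length_conjugate: "length (conjugate p) = part p 0"
  by (simp add: conjugate_def)

text \<open>\<open>t\<close> lists the column lengths of \<rho>(j) + 2\<mu>^T for \<mu> = (k - 1,
  1). As \<mu>^T = (2, 1, ..., 1) has k - 1 parts, row 0 gains 4 and the rows 1 to k - 2 gain 2;
  columns beyond j - k + 1 meet only these rows, and from j + 1 on only row 0.\<close>

lemma part_core_extension:
  assumes k: "k \<ge> 2" and j: "j \<ge> 2 * k"
  defines "\<tau> \<equiv> core_extension j (staircase (k - 1)) [k - 1, 1]"
  defines "t \<equiv> \<lambda>i. if i \<le> j - k + 1 then j - i else if i \<le> j + 3 then max 1 (min (k - 1) (j + 2 - i)) else 0"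
  shows "part \<tau> i = t i + 2 * (k - 1 - i)" "length \<tau> = j + 4" "is_partition \<tau>"
proof -
  define \<mu> where "\<mu> = [k - 1, 1]"
  have \<mu>: "part \<mu> c = (if c = 0 then k - 1 else if c = 1 then 1 else 0)" for c
    by (auto simp: \<mu>_def part_def nth_Cons split: nat.splits)
  have conj\<mu>: "part (conjugate \<mu>) i = (if i = 0 then 2 else if i < k - 1 then 1 else 0)" for i
  proof -
    have "{c. i < part \<mu> c} = (if i = 0 then {0, 1} else if i < k - 1 then {0} else {})"
      unfolding \<mu> using k by (auto split: if_splits)
    moreover have "part (conjugate \<mu>) i = card {c. i < part \<mu> c}"
      by (rule part_conjugate) (use k in \<open>auto simp: \<mu>\<close>)
    ultimately show ?thesis by auto
  qed
  define q where "q = partition_add (staircase j) (map ((*) 2) (conjugate \<mu>))"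
  have q: "part q c = (j - c) + 2 * (if c = 0 then 2 else if c < k - 1 then 1 else 0)" for c
    by (simp add: q_def part_partition_add part_double part_staircase conj\<mu>)
  have setq: "{c. i < part q c} = {..<t i}" for i
  proof (rule set_eqI)
    fix c
    consider "c = 0" | "1 \<le> c" "c < k - 1" | "c \<ge> k - 1" "c \<noteq> 0" by linarith
    then show "c \<in> {c. i < part q c} \<longleftrightarrow> c \<in> {..<t i}"
    proof cases
      case 1
      then show ?thesis using k j by (auto simp: q t_def)
    next
      case 2
      then have "part q c = j - c + 2" by (simp add: q)
      then have q': "i < part q c \<longleftrightarrow> i + c < j + 2" using 2 j k by auto
      consider "i \<le> j - k + 1" | "j - k + 1 < i" "i \<le> j + 3" | "j + 3 < i" by linarith
      then have "c < t i \<longleftrightarrow> i + c < j + 2"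
      proof cases
        case 1
        have "i + c < j + 2" "c < j - i" using 1 2 j k by arith+
        then show ?thesis using 1 by (simp add: t_def)
      next
        case b: 2
        have "\<not> c < 1" "c < k - 1" "c < j + 2 - i \<longleftrightarrow> i + c < j + 2" using 2 b by arith+
        then show ?thesis using b by (simp add: t_def less_max_iff_disj)
      next
        case 3
        then show ?thesis by (simp add: t_def)
      qed
      then show ?thesis using q' by simp
    next
      case 3
      then have "part q c = j - c" by (simp add: q)
      then show ?thesis using 3 k j by (auto simp: t_def)
    qed
  qed
  have "part (conjugate q) i = card {c. i < part q c}" for i
    by (rule part_conjugate) (use k j in \<open>auto simp: q\<close>)
  then have conjq: "part (conjugate q) i = t i" for i by (simp add: setq)
  have \<tau>: "\<tau> = partition_add (conjugate q) (map ((*) 2) (staircase (k - 1)))"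
    by (simp add: \<tau>_def core_extension_def q_def \<mu>_def)
  show part: "part \<tau> i = t i + 2 * (k - 1 - i)" for i
    by (simp add: \<tau> part_partition_add part_double part_staircase conjq)
  show len: "length \<tau> = j + 4"
    using k j by (simp add: \<tau> partition_add_def length_conjugate q length_staircase)
  have anti: "t b \<le> t a" if "a \<le> b" for a b
  proof -
    have "{..<t b} \<subseteq> {..<t a}" using that unfolding setq[symmetric] by auto
    then show ?thesis by simp
  qed
  have pos: "t a \<ge> 1" if "a < j + 4" for a
    using that k j by (cases "a \<le> j - k + 1") (simp_all add: t_def)
  have nth: "\<tau> ! a = part \<tau> a" if "a < j + 4" for a using that len by (simp add: part_def)
  show "is_partition \<tau>"
    unfolding is_partition_def
  proof
    show "sorted_wrt (\<ge>) \<tau>"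
      unfolding sorted_wrt_iff_nth_less
    proof (intro allI impI)
      fix a b assume "a < b" "b < length \<tau>"
      then show "\<tau> ! b \<le> \<tau> ! a" using nth[of a] nth[of b] len anti[of a b] by (simp add: part add_mono)
    qed
    show "0 \<notin> set \<tau>"
    proof
      assume "0 \<in> set \<tau>"
      then obtain a where "a < j + 4" "\<tau> ! a = 0" using len by (auto simp: in_set_conv_nth)
      then show False using nth[of a] pos[of a] by (simp add: part)
    qed
  qed
qed

section \<open>Moving one bead to its place\<close>

definition rot :: "nat \<Rightarrow> nat \<Rightarrow> nat \<Rightarrow> nat" where
  "rot a b i = (if i = a then b else if a < i \<and> i \<le> b then i - 1 else i)"

text \<open>The rotation of the positions a, ..., b is a product of b - a transpositions of
  neighbours.\<close>

lemma mh_rot: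
  assumes "a \<le> b" "b < N"
  shows "mh n m N (\<alpha> \<circ> rot a b) = (-1) ^ (b - a) * mh n m N \<alpha>"
  using assms
proof (induction b arbitrary: \<alpha> rule: dec_induct)
  case base
  have "\<alpha> \<circ> rot a a = \<alpha>" by (auto simp: rot_def fun_eq_iff)
  then show ?case by simp
next
  case (step b)
  have "\<alpha> \<circ> rot a (Suc b) = (\<alpha> \<circ> transpose b (Suc b)) \<circ> rot a b"
    using step.hyps by (auto simp: rot_def fun_eq_iff transpose_def)
  then have "mh n m N (\<alpha> \<circ> rot a (Suc b)) = (-1) ^ (b - a) * mh n m N (\<alpha> \<circ> transpose b (Suc b))"
    by (simp only: step.IH[OF Suc_lessD[OF step.prems]])
  also have "mh n m N (\<alpha> \<circ> transpose b (Suc b)) = - mh n m N \<alpha>" by (rule mh_transpose) (use step.prems in auto)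
  finally show ?case using step.hyps by (simp add: Suc_diff_le)
qed

lemma rot_permutes:
  assumes "a \<le> b" "b < N"
  shows "rot a b permutes {..<N}"
  using assms
proof (induction b rule: dec_induct)
  case base
  have "rot a a = id" by (auto simp: rot_def fun_eq_iff)
  then show ?case by (simp only: permutes_id)
next
  case (step b)
  have "rot a (Suc b) = transpose b (Suc b) \<circ> rot a b"
    using step.hyps by (auto simp: rot_def fun_eq_iff transpose_def)
  moreover have "transpose b (Suc b) permutes {..<N}" using step.prems by (intro permutes_swap_id) auto
  ultimately show ?case using permutes_compose[OF step.IH] step.prems by (simp only: Suc_lessD)
qed

lemma sum_staircase:
  fixes J :: nat
  assumes "J \<le> N"
  shows "2 * (\<Sum>i<N. J - i) = J * (J + 1)"
proof -
  have "(\<Sum>i<N. J - i) = sum_list (staircase J)"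
    using sum_part[of "staircase J" N] assms by (simp add: length_staircase part_staircase)
  then show ?thesis by (simp add: sum_list_staircase)
qed

section \<open>Moving beads on the abacus of \<open>\<rho>(j)\<close>\<close>

text \<open>Only the terms that move a or b can be nonzero, and a transposition makes them opposite.
  Both beads lie in A, so the odd beads alone already give a vanishing sum.\<close>

lemma mh_collision:
  assumes A: "A \<subseteq> {..<N}" and ab: "a \<in> A" "b \<in> A" "a \<noteq> b" "\<alpha> a = \<alpha> b"
  shows "(\<Sum>i\<in>A. mh n m N (\<alpha>(i := \<alpha> i + c))) = 0"
proof -
  let ?f = "\<lambda>i. mh n m N (\<alpha>(i := \<alpha> i + c))"
  have N: "a < N" "b < N" using A ab by auto
  have "?f i = 0" if "i \<noteq> a" "i \<noteq> b" for i
    by (rule mh_repeated[OF N ab(3)]) (use ab(4) that in simp)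
  then have "(\<Sum>i\<in>A. ?f i) = (\<Sum>i\<in>{a, b}. ?f i)"
    using ab A finite_subset[OF A] by (intro sum.mono_neutral_right) auto
  also have "\<dots> = ?f a + ?f b" using ab(3) by simp
  finally have split: "(\<Sum>i\<in>A. ?f i) = ?f a + ?f b" .
  have swap: "\<alpha>(a := \<alpha> a + c) = \<alpha>(b := \<alpha> b + c) \<circ> transpose a b"
    using ab(3,4) by (auto simp: fun_eq_iff transpose_def)
  have "?f a = - ?f b" unfolding swap by (rule mh_transpose[OF N ab(3)])
  then show ?thesis using split by linarith
qed

text \<open>The beads of \<open>\<rho>(j)\<close> are \<open>B 0 > B 1 > \<dots>\<close>; the indices of the odd ones form \<open>Od\<close>, and the even ones
  are \<open>B (y 0) > B (y 1) > \<dots>\<close>. The value \<open>G z\<close> is the coefficient found after moving every bead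
  \<open>B i\<close> by \<open>2 z i\<close>, and \<open>zl\<close> moves the odd beads according to \<open>\<rho>(k - 1)\<close>.\<close>

locale core_beads =
  fixes n k j :: nat and m :: "nat list \<Rightarrow> nat"
  assumes k: "k \<ge> 2" and j: "j + 1 = k * k + k" and n: "n \<ge> 2"
    and rel: "\<And>\<alpha> s. s \<ge> 1 \<Longrightarrow> (\<And>i. i < j + 2 * n \<Longrightarrow> \<alpha> i \<ge> 0) \<Longrightarrow>
      (\<Sum>i<j + 2 * n. mh n m (j + 2 * n) (\<alpha>(i := \<alpha> i + int (2 * s)))) = 0"
begin

text \<open>With j + 2n beads those from index j on stand at 2n - 1, ..., 1, 0, which provides
  exactly n even beads. N is also large enough for all partitions of n.\<close>

definition N :: nat where "N = j + 2 * n"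

definition B :: "nat \<Rightarrow> int" where "B = bt N (staircase j)"

definition G :: "(nat \<Rightarrow> nat) \<Rightarrow> int" where "G z = mh n m N (\<lambda>i. B i + 2 * int (z i))"

definition Od :: "nat set" where "Od = {i. i < N \<and> (i < j \<or> odd i)}"

definition y :: "nat \<Rightarrow> nat" where "y b = j + 1 + 2 * b"

definition zl :: "nat \<Rightarrow> nat" where "zl i = k - 1 - i"

lemma B: "B i = int (j - i) + int N - 1 - int i"
  by (simp add: B_def bt_def dl_def part_staircase)

lemma kk: "k * k \<ge> 2 * k" using k by simp

lemma kj: "2 * k \<le> j" "k < j"
proof -
  show "2 * k \<le> j" using kk j k by linarith
  then show "k < j" using k by linarith
qed

lemma odd_j: "odd j"
proof -
  have "even (k * k + k)" by simp
  then show ?thesis unfolding j[symmetric] by simp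
qed

lemma Od_Ev: "{..<N} = Od \<union> y ` {..<n}" "Od \<inter> y ` {..<n} = {}"
proof -
  have "i \<in> y ` {..<n}" if "i < N" "i \<notin> Od" for i
  proof -
    have "even i" "j \<le> i" using that by (auto simp: Od_def)
    then have "j < i" using odd_j by (cases "i = j") auto
    then obtain d where d: "i = j + 1 + d" by (metis add.commute add_Suc_right less_imp_Suc_add plus_1_eq_Suc)
    then obtain b where "d = 2 * b" using \<open>even i\<close> odd_j by auto
    then show ?thesis using d that by (auto simp: y_def N_def)
  qed
  moreover have "y b < N" if "b < n" for b using that by (simp add: y_def N_def)
  ultimately show "{..<N} = Od \<union> y ` {..<n}" by (auto simp: Od_def)
  show "Od \<inter> y ` {..<n} = {}" using odd_j by (auto simp: Od_def y_def)
qed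

lemma finite_Od: "finite Od" by (simp add: Od_def)

lemma y_less: "b < n \<Longrightarrow> y b < N" by (simp add: y_def N_def)

lemma B_y: "b < n \<Longrightarrow> B (y b) = 2 * (int n - 1 - int b)"
  by (simp add: B y_def N_def)

lemma G_shift: "G (z + sg i s) = mh n m N ((\<lambda>l. B l + 2 * int (z l))(i := B i + 2 * int (z i) + int (2 * s)))"
  unfolding G_def by (intro mh_cong) (simp add: sg_def)

lemma G_relation:
  assumes "s \<ge> 1"
  shows "(\<Sum>i\<in>Od. G (z + sg i s)) + (\<Sum>i\<in>y ` {..<n}. G (z + sg i s)) = 0"
proof -
  have "(\<Sum>i\<in>Od. G (z + sg i s)) + (\<Sum>i\<in>y ` {..<n}. G (z + sg i s)) = (\<Sum>i<N. G (z + sg i s))"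
    unfolding Od_Ev(1) by (rule sum.union_disjoint[symmetric]) (use finite_Od Od_Ev(2) in auto)
  also have "\<dots> = 0"
    unfolding G_shift N_def by (rule rel[OF assms]) (simp add: B N_def)
  finally show ?thesis .
qed

text \<open>The even beads are consecutive even numbers, so the exchange in \<open>hk_first\<close>
  swaps two entries of the bead vector, and the complete sum collapses to moves of the largest even
  bead. \<open>hk_eq_ek\<close> transfers it to the odd beads.\<close>

lemma G_even_beads:
  assumes z: "\<And>i. i > j \<Longrightarrow> even i \<Longrightarrow> z i = 0"
  shows "G (z + sg (y 0) c) = (-1) ^ c * ek G Od c z"
proof -
  have zy: "z (y b) = 0" for b by (rule z) (use odd_j in \<open>auto simp: y_def\<close>)
  have "G (z + f(y b := f (y (Suc b)) - 1, y (Suc b) := f (y b) + 1)) = - G (z + f)"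
    if b: "Suc b < n" "f (y (Suc b)) \<ge> 1" for b f
  proof -
    have lt: "y b < N" "y (Suc b) < N" "y b \<noteq> y (Suc b)" using b y_less[of b] y_less[of "Suc b"] by (auto simp: y_def)
    have "G (z + f(y b := f (y (Suc b)) - 1, y (Suc b) := f (y b) + 1)) =
        mh n m N ((\<lambda>i. B i + 2 * int ((z + f) i)) \<circ> transpose (y b) (y (Suc b)))"
      unfolding G_def
    proof (rule mh_cong)
      fix i
      consider "i = y b" | "i = y (Suc b)" | "i \<noteq> y b" "i \<noteq> y (Suc b)" by blast
      then show "B i + 2 * int ((z + f(y b := f (y (Suc b)) - 1, y (Suc b) := f (y b) + 1)) i) =
          ((\<lambda>i. B i + 2 * int ((z + f) i)) \<circ> transpose (y b) (y (Suc b))) i"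
      proof cases
        case 1
        have "int (f (y (Suc b)) - 1) = int (f (y (Suc b))) - 1" using b(2) by (simp add: of_nat_diff)
        then show ?thesis using 1 lt(3) B_y[of b] B_y[of "Suc b"] b(1) zy by simp
      next
        case 2
        then show ?thesis using lt(3) B_y[of b] B_y[of "Suc b"] b(1) zy by simp
      next
        case 3
        then show ?thesis by simp
      qed
    qed
    also have "\<dots> = - G (z + f)" unfolding G_def by (rule mh_transpose[OF lt])
    finally show ?thesis .
  qed
  then have "hk G (y ` {..<n}) c z = G (z + sg (y 0) c)"
    by (intro hk_first) (use n in \<open>auto simp: inj_on_def y_def\<close>)
  moreover have "hk G (y ` {..<n}) c z = (-1) ^ c * ek G Od c z"
    by (rule hk_eq_ek) (use finite_Od G_relation in auto)
  ultimately show ?thesis by simp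
qed

lemma zl_high: "i \<ge> k - 1 \<Longrightarrow> zl i = 0" by (simp add: zl_def)

text \<open>The relation for the move of length \<open>2\<close>, applied when the largest even bead has been moved
  \<open>k - 1\<close> times.\<close>

lemma G_target:
  "(-1) ^ k * G (zl + sg (y 0) (k - 1) + sg (y 1) 1) =
    (\<Sum>i\<in>Od. ek G Od (k - 1) (zl + sg i 1)) - ek G Od k zl"
proof -
  let ?z = "zl + sg (y 0) (k - 1)"
  have zl0: "zl i = 0" if "i > j" for i by (rule zl_high) (use that kj in simp)
  have odd_part: "G (?z + sg i 1) = (-1) ^ (k - 1) * ek G Od (k - 1) (zl + sg i 1)" if i: "i \<in> Od" for i
  proof -
    have "G (zl + sg i 1 + sg (y 0) (k - 1)) = (-1) ^ (k - 1) * ek G Od (k - 1) (zl + sg i 1)"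
      by (rule G_even_beads) (use zl0 i in \<open>auto simp: sg_def Od_def\<close>)
    then show ?thesis by (simp add: add_ac)
  qed
  have y0: "G (?z + sg (y 0) 1) = (-1) ^ k * ek G Od k zl"
  proof -
    have "?z + sg (y 0) 1 = zl + sg (y 0) k" using k by (auto simp: sg_def fun_eq_iff)
    then show ?thesis using G_even_beads[of zl k] zl0 by simp
  qed
  \<comment> \<open>From b = 2 on, one move puts bead y b onto bead y (b - 1), which has not been
    moved.\<close>
  have yb: "G (?z + sg (y b) 1) = 0" if b: "b < n" "b \<ge> 2" for b
  proof -
    define b' where "b' = b - 1"
    have b': "b = Suc b'" "b' \<ge> 1" using b by (auto simp: b'_def)
    have "y b' < N" "y b < N" "y b \<noteq> y b'" using b b' y_less[of b] y_less[of b'] by (auto simp: y_def)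
    moreover have "y b' \<noteq> y 0" "y b \<noteq> y 0" using b b' by (auto simp: y_def)
    moreover have "zl (y b) = 0" "zl (y b') = 0" using zl0 by (auto simp: y_def)
    ultimately show ?thesis
      unfolding G_def using B_y[of b] B_y[of b'] b(1) b'(1)
      by (intro mh_repeated[of "y b'" N "y b"]) (auto simp: sg_def)
  qed
  have inj: "inj_on y {..<n}" by (auto simp: inj_on_def y_def)
  have "(\<Sum>i\<in>y ` {..<n}. G (?z + sg i 1)) = (\<Sum>b<n. G (?z + sg (y b) 1))"
    using sum.reindex[OF inj] by simp
  also have "\<dots> = (\<Sum>b\<in>{0, 1}. G (?z + sg (y b) 1))"
    by (rule sum.mono_neutral_right) (use n yb in auto)
  finally have "(\<Sum>i\<in>y ` {..<n}. G (?z + sg i 1)) = (-1) ^ k * ek G Od k zl + G (?z + sg (y 1) 1)"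
    using y0 by simp
  moreover have "(\<Sum>i\<in>Od. G (?z + sg i 1)) = (-1) ^ (k - 1) * (\<Sum>i\<in>Od. ek G Od (k - 1) (zl + sg i 1))"
    using odd_part by (simp add: sum_distrib_left)
  ultimately have "(-1) ^ (k - 1) * (\<Sum>i\<in>Od. ek G Od (k - 1) (zl + sg i 1)) +
      ((-1) ^ k * ek G Od k zl + G (?z + sg (y 1) 1)) = 0"
    using G_relation[of 1 ?z] by simp
  moreover have "(-1) ^ k = - ((-1) ^ (k - 1) :: int)" using k by (cases k) auto
  ultimately show ?thesis by (cases "even (k - 1)") auto
qed

section \<open>Strips on the odd beads\<close>

definition al :: "(nat \<Rightarrow> nat) \<Rightarrow> nat \<Rightarrow> int" where "al u i = B i + 2 * int (zl i) + 2 * int (u i)"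

lemma G_al: "G (zl + u) = mh n m N (al u)"
  unfolding G_def by (intro mh_cong) (simp add: al_def)

lemma Od_gap: "a \<in> Od \<Longrightarrow> b \<in> Od \<Longrightarrow> a < b \<Longrightarrow> B b + 2 * int (zl b) + 2 \<le> B a + 2 * int (zl a)"
proof -
  assume ab: "a \<in> Od" "b \<in> Od" "a < b"
  have "B b + 2 \<le> B a"
  proof (cases "a < j")
    case True
    then show ?thesis using ab by (simp add: B)
  next
    case False
    then have "odd a" "odd b" "a \<ge> j" using ab by (auto simp: Od_def)
    then have "a + 1 \<noteq> b" by auto
    then show ?thesis using ab by (simp add: B)
  qed
  moreover have "zl b \<le> zl a" using ab(3) by (simp add: zl_def)
  ultimately show ?thesis by simp
qed

text \<open>Read along the odd beads, \<rho>(k - 1) enlarged by u is still a partition.\<close>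

definition St :: "(nat \<Rightarrow> nat) \<Rightarrow> bool" where
  "St u \<longleftrightarrow> (\<forall>a\<in>Od. \<forall>b\<in>Od. a < b \<longrightarrow> al u b < al u a)"

text \<open>After the moves by \<open>zl\<close> odd beads are at least 2 apart, and a vertical
  strip moves a bead by at most 2, so their order can fail only through a coincidence.\<close>

lemma not_St_ind:
  assumes "\<not> St (ind S)"
  obtains a b where "a \<in> Od" "b \<in> Od" "a \<noteq> b" "al (ind S) a = al (ind S) b"
proof -
  obtain a b where ab: "a \<in> Od" "b \<in> Od" "a < b" "\<not> al (ind S) b < al (ind S) a"
    using assms by (auto simp: St_def)
  have "al (ind S) a = al (ind S) b"
    using ab(4) Od_gap[OF ab(1-3)] by (auto simp: al_def ind_def split: if_splits)
  then show ?thesis using ab by (intro that[of a b]) auto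
qed

text \<open>The beads from k - 1 on are not moved by \<open>zl\<close> and stand tightly. Moving one
  of index j or later forces all of k - 1, ..., j - 1 to move as well, and these are more than k
  beads because j is at least 2k.\<close>

lemma St_low:
  assumes St: "St u" and sum: "sum u Od \<le> k" and i: "i \<in> Od" "i \<ge> j"
  shows "u i = 0"
proof (rule ccontr)
  assume ui: "u i \<noteq> 0"
  \<comment> \<open>The enumeration of the odd beads: all indices up to j, afterwards every second
    one.\<close>
  define e where "e q = (if q \<le> j then q else 2 * q - j)" for q
  have e_step: "u (e (Suc q)) \<le> u (e q)" if q: "k - 1 \<le> q" "e (Suc q) < N" for q
  proof -
    have lt: "e q < e (Suc q)" by (auto simp: e_def)
    have "e q \<in> Od" "e (Suc q) \<in> Od"
      using odd_j q lt by (cases "Suc q = j"; auto simp: e_def Od_def)+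
    then have "al u (e (Suc q)) < al u (e q)" using St lt by (auto simp: St_def)
    moreover have "zl (e q) = 0" "zl (e (Suc q)) = 0" using q by (auto intro!: zl_high simp: e_def)
    moreover have "B (e q) = B (e (Suc q)) + 2" by (auto simp: B e_def)
    ultimately show ?thesis by (simp add: al_def)
  qed
  have mono: "e q' < N \<Longrightarrow> u (e q') \<le> u (e q)" if "q \<le> q'" "k - 1 \<le> q" for q q'
    using that(1)
  proof (induction q' rule: dec_induct)
    case (step q')
    have "e q' < N" using step.prems by (auto simp: e_def split: if_splits)
    moreover have "u (e (Suc q')) \<le> u (e q')"
      by (rule e_step) (use step.hyps that(2) step.prems in auto)
    ultimately show ?case using step.IH by simp
  qed simp
  have ei: "e ((i + j) div 2) = i"
  proof -
    have "odd i" using i odd_j by (cases "i = j") (auto simp: Od_def)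
    then have "even (i + j)" using odd_j by simp
    then obtain h where h: "i + j = 2 * h" ..
    then have "2 * h - j = i" "h \<le> j \<Longrightarrow> h = i" using i(2) by linarith+
    then show ?thesis by (simp add: e_def h)
  qed
  have iN: "i < N" using i by (simp add: Od_def)
  have "u q \<ge> 1" if q: "q \<in> {k - 1..<j}" for q
  proof -
    have "e q = q" "q \<le> (i + j) div 2" using q i(2) by (auto simp: e_def)
    then show ?thesis using mono[of q "(i + j) div 2"] q ei iN ui by simp
  qed
  then have "card {k - 1..<j} \<le> sum u {k - 1..<j}"
    using sum_mono[of "{k - 1..<j}" "\<lambda>_. 1" u] by simp
  also have "\<dots> \<le> sum u Od" by (rule sum_mono2) (use finite_Od in \<open>auto simp: Od_def N_def\<close>)
  finally have "j - (k - 1) \<le> k" using sum by simp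
  moreover have "k * k \<ge> 2 * k" by (rule kk)
  ultimately show False using j k by linarith
qed

text \<open>The even beads stand among odd beads of index at least j, which have not moved by
  \<open>St_low\<close>. So the whole vector is strictly decreasing, and \<open>mh\<close> is
  nonnegative there.\<close>

lemma G_nonneg:
  assumes St: "St u" and sum: "sum u Od \<le> k" and u: "\<And>i. i \<notin> Od \<Longrightarrow> u i = 0"
  shows "G (zl + u) \<ge> 0"
proof -
  have "strict N (al u)"
    unfolding strict_def
  proof (intro allI impI)
    fix a b assume ab: "a < b" "b < N"
    show "al u b < al u a"
    proof (cases "a \<in> Od \<and> b \<in> Od")
      case True
      then show ?thesis using St ab by (auto simp: St_def)
    next
      case False
      then have bj: "b \<ge> j" using ab by (auto simp: Od_def)
      then have "u b = 0" using St_low[OF St sum] u by (cases "b \<in> Od") auto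
      moreover have "zl b = 0" using bj kj by (intro zl_high) simp
      ultimately show ?thesis using ab bj by (simp add: al_def B)
    qed
  qed
  then show ?thesis unfolding G_al by (rule mh_strict_nonneg)
qed

lemma subs_sum: "S \<in> subs Od c \<Longrightarrow> sum (ind S) Od = c"
proof -
  assume S: "S \<in> subs Od c"
  have "sum (ind S) Od = (\<Sum>i\<in>{i \<in> Od. i \<in> S}. 1)"
    unfolding ind_def by (rule sum.inter_filter[OF finite_Od, symmetric])
  also have "{i \<in> Od. i \<in> S} = S" using S by (auto simp: subs_def)
  finally show ?thesis using S by (simp add: subs_def)
qed

lemma odd_al: "i \<in> Od \<Longrightarrow> odd (al u i)"
  using odd_j by (auto simp: al_def B Od_def N_def of_nat_diff)

theorem G_target_ge:
  "(-1) ^ k * G (zl + sg (y 0) (k - 1) + sg (y 1) 1) \<ge> (int k - 1) * G (zl + ind {..<k})"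
  unfolding G_target
proof (rule strip_inequality[where St = "\<lambda>S. St (ind S)"])
  show "finite Od" by (rule finite_Od)
  show "1 \<le> k" using k by simp
  fix S assume "\<not> St (ind S)"
  then obtain a b where ab: "a \<in> Od" "b \<in> Od" "a \<noteq> b" "al (ind S) a = al (ind S) b"
    by (rule not_St_ind)
  have "G (zl + ind S + sg i 1) = mh n m N ((al (ind S))(i := al (ind S) i + 2))" for i
    unfolding G_shift by (intro mh_cong) (simp add: al_def)
  then show "(\<Sum>i\<in>Od. G (zl + ind S + sg i 1)) = 0"
    using mh_collision[OF _ ab] by (simp add: Od_def subset_iff)
next
  fix S i assume S: "S \<in> subs Od (k - 1)" "St (ind S)" and i: "i \<in> Od"
  let ?u = "ind S + sg i 1"
  have al: "al ?u a = al (ind S) a + (if a = i then 2 else 0)" for a by (simp add: al_def sg_def)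
  \<comment> \<open>Odd beads differ by even amounts, so bead i moved by 2 either meets a preceding
    bead, which gives 0, or stays below all of them.\<close>
  show "G (zl + ind S + sg i 1) \<ge> 0"
  proof (cases "\<exists>a\<in>Od. a < i \<and> al ?u a = al ?u i")
    case True
    then obtain a where "a \<in> Od" "a < i" "al ?u a = al ?u i" by blast
    then have "mh n m N (al ?u) = 0" using i by (intro mh_repeated[of a N i]) (auto simp: Od_def)
    then show ?thesis using G_al[of ?u] by (simp add: add.assoc)
  next
    case False
    have "St ?u"
      unfolding St_def
    proof (intro ballI impI)
      fix a b assume ab: "a \<in> Od" "b \<in> Od" "a < b"
      then have lt: "al (ind S) b < al (ind S) a" using S(2) by (auto simp: St_def)
      show "al ?u b < al ?u a"
      proof (cases "b = i")
        case True
        have "odd (al (ind S) a)" "odd (al (ind S) b)" using ab odd_al by auto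
        then have "al (ind S) a \<noteq> al (ind S) b + 1" by auto
        then show ?thesis using False lt ab True al[of a] al[of b] by force
      qed (use lt al in auto)
    qed
    then have "G (zl + ?u) \<ge> 0"
    proof (rule G_nonneg)
      show "sum ?u Od \<le> k" using sum_sg[OF finite_Od i] subs_sum[OF S(1)] k by simp
      show "?u a = 0" if "a \<notin> Od" for a using that S(1) i by (auto simp: subs_def ind_def sg_def)
    qed
    then show ?thesis by (simp add: add.assoc)
  qed
next
  fix S assume S: "S \<in> subs Od k" and nz: "G (zl + ind S) \<noteq> 0"
  have St: "St (ind S)"
  proof (rule ccontr)
    assume "\<not> St (ind S)"
    then obtain a b where ab: "a \<in> Od" "b \<in> Od" "a \<noteq> b" "al (ind S) a = al (ind S) b"
      by (rule not_St_ind)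
    then have "mh n m N (al (ind S)) = 0" by (intro mh_repeated[of a N b]) (auto simp: Od_def)
    then show False using nz G_al by simp
  qed
  have fin: "finite S" "S \<noteq> {}" using S k finite_subset[OF _ finite_Od] by (auto simp: subs_def)
  \<comment> \<open>Taking back the move of the lowest moved bead causes no collision, since all odd
    beads below it are unmoved.\<close>
  let ?i = "Max S"
  have "St (ind (S - {?i}))"
    unfolding St_def
  proof (intro ballI impI)
    fix a b assume ab: "a \<in> Od" "b \<in> Od" "a < b"
    show "al (ind (S - {?i})) b < al (ind (S - {?i})) a"
    proof (cases "a = ?i")
      case True
      then have "b \<notin> S" using ab fin Max_ge[of S b] by auto
      then show ?thesis using Od_gap[OF ab] by (simp add: al_def ind_def)
    next
      case False
      then have "al (ind (S - {?i})) a = al (ind S) a" "al (ind (S - {?i})) b \<le> al (ind S) b"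
        by (auto simp: al_def ind_def)
      then show ?thesis using St ab by (force simp: St_def)
    qed
  qed
  moreover have "G (zl + ind S) \<ge> 0"
    by (rule G_nonneg[OF St]) (use subs_sum[OF S] S in \<open>auto simp: subs_def ind_def\<close>)
  ultimately show "G (zl + ind S) \<ge> 0 \<and> (\<exists>i\<in>S. St (ind (S - {i})))" using Max_in[OF fin] by blast
next
  show "{..<k} \<in> subs Od k" using kj by (auto simp: subs_def Od_def N_def)
next
  fix i assume "i \<in> {..<k}"
  \<comment> \<open>The first k entries k - 1, ..., 0 of \<open>zl\<close> are strictly decreasing,
    so adding 1 to any of them leaves a partition.\<close>
  show "St (ind ({..<k} - {i}))"
    unfolding St_def
  proof (intro ballI impI)
    fix a b assume ab: "a \<in> Od" "b \<in> Od" "a < b"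
    show "al (ind ({..<k} - {i})) b < al (ind ({..<k} - {i})) a"
    proof (cases "b < k")
      case True
      then have "B b + 2 \<le> B a" "int (zl b) + 1 \<le> int (zl a)" using ab(3) kj by (simp_all add: B zl_def)
      then show ?thesis by (auto simp: al_def ind_def)
    next
      case False
      then show ?thesis using Od_gap[OF ab] by (simp add: al_def ind_def)
    qed
  qed
qed

text \<open>Here the value of w enters: \<rho>(j + 1) exceeds \<rho>(j) by j + 1 = k(k + 1) boxes,
  which is the size of 2\<rho>(k).\<close>

lemma target_size:
  assumes n: "n = sum_list (staircase (j + 1))"
  shows "2 * n = j * (j + 1) + 2 * (k * (k + 1))"
proof -
  have "2 * n = (j + 1) * (j + 2)" by (simp add: n sum_list_staircase)
  also have "\<dots> = j * (j + 1) + 2 * (j + 1)" by (simp add: algebra_simps)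
  also have "2 * (j + 1) = 2 * (k * (k + 1))" using j by simp
  finally show ?thesis .
qed

text \<open>Together \<open>zl\<close> and \<open>ind {..<k}\<close> move bead i by k - i steps of
  length 2, which adds 2\<rho>(k) to \<rho>(j).\<close>

lemma G_ind_eq:
  assumes n: "n = sum_list (staircase (j + 1))"
  obtains \<nu> where "\<nu> \<in> partitions_of n" "\<forall>i. part \<nu> i = (j - i) + 2 * (k - i)" "G (zl + ind {..<k}) = int (m \<nu>)"
proof -
  define f where "f i = (j - i) + 2 * (k - i)" for i
  have kN: "k \<le> N" "j \<le> N" using kj by (simp_all add: N_def)
  obtain \<nu> where \<nu>: "\<nu> \<in> partitions_of (\<Sum>i<N. f i)" "length \<nu> \<le> N" "\<And>i. i < N \<Longrightarrow> part \<nu> i = f i"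
  proof (rule partition_of_fun[of N f])
    show "f b \<le> f a" if "a < b" "b < N" for a b using that by (auto simp: f_def intro!: add_mono)
  qed blast
  have "2 * (\<Sum>i<N. f i) = 2 * n"
    using sum_staircase[OF kN(1)] sum_staircase[OF kN(2)] target_size[OF n]
    by (simp add: f_def sum.distrib sum_distrib_left[symmetric])
  then have \<nu>n: "\<nu> \<in> partitions_of n" using \<nu>(1) by simp
  have part: "part \<nu> i = f i" for i
    using \<nu>(2,3) kN by (cases "i < N") (auto simp: part_def f_def)
  have "G (zl + ind {..<k}) = int (m \<nu>)"
    unfolding G_def
  proof (rule mh_eq[OF \<nu>n])
    show "n \<le> N" by (simp add: N_def)
    show "B i + 2 * int ((zl + ind {..<k}) i) = bt N \<nu> i" for i
      by (auto simp: B bt_def dl_def part f_def zl_def ind_def)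
  qed
  then show ?thesis using \<nu>n part by (intro that[of \<nu>]) (auto simp: f_def)
qed

lemma G_target_eq:
  assumes n': "n = sum_list (staircase (j + 1))"
  defines "\<tau> \<equiv> core_extension j (staircase (k - 1)) [k - 1, 1]"
  shows "\<tau> \<in> partitions_of n" "(-1) ^ k * G (zl + sg (y 0) (k - 1) + sg (y 1) 1) = int (m \<tau>)"
proof -
  note \<tau> = part_core_extension[OF k kj(1), folded \<tau>_def]
  define T where "T i = B i + 2 * int ((zl + sg (y 0) (k - 1) + sg (y 1) 1) i)" for i
  \<comment> \<open>The largest even bead, moved k - 1 times, passes k - 1 odd beads; the second
    one, moved once, passes one. \<pi> restores the order by k exchanges of neighbours, whence the
    sign (-1)^k.\<close>
  define \<pi> where "\<pi> = rot (j + 2 - k) (j + 1) \<circ> rot (j + 2) (j + 3)"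
  have lt: "j + 3 < N" using n by (simp add: N_def)
  have T\<pi>: "T (\<pi> i) = bt N \<tau> i" for i
  proof -
    have yv: "y 0 = j + 1" "y (Suc 0) = j + 3" by (simp_all add: y_def)
    consider "i \<le> j - k + 1" | "i = j + 2 - k" | "j + 2 - k < i" "i \<le> j + 1" | "i = j + 2" | "i = j + 3" | "i \<ge> j + 4"
      by linarith
    then show ?thesis
    proof cases
      case 1
      then have "\<pi> i = i" using kj k by (auto simp: \<pi>_def rot_def)
      moreover have "i \<noteq> j + 1" "i \<noteq> j + 3" using 1 kj k by linarith+
      ultimately show ?thesis using 1
        by (simp add: T_def B bt_def dl_def \<tau>(1) yv sg_def zl_def)
    next
      case 2
      then have "\<pi> i = j + 1" using kj k by (auto simp: \<pi>_def rot_def)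
      moreover have "max 1 (min (k - 1) (j + 2 - i)) = k - 1" "\<not> i \<le> j - k + 1" "i \<le> j + 3" "k - 1 - i = 0"
        "zl (j + 1) = 0" "int i = int j + 2 - int k"
        using 2 kj k by (auto simp: zl_def)
      ultimately show ?thesis using k by (simp add: T_def B bt_def dl_def \<tau>(1) yv sg_def of_nat_diff)
    next
      case 3
      then have \<pi>: "\<pi> i = i - 1" using kj k by (auto simp: \<pi>_def rot_def)
      have "max 1 (min (k - 1) (j + 2 - i)) = j + 2 - i" "\<not> i \<le> j - k + 1" "i \<le> j + 3" "k - 1 - i = 0"
        "zl (i - 1) = 0" "j - (i - 1) = j + 1 - i" "i - 1 \<noteq> j + 1" "i - 1 \<noteq> j + 3"
        using 3 kj k by (auto simp: zl_def)
      then show ?thesis using 3 by (simp add: T_def B bt_def dl_def \<tau>(1) yv sg_def \<pi> of_nat_diff)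
    next
      case 4
      then have "\<pi> i = j + 3" using kj k by (auto simp: \<pi>_def rot_def)
      then show ?thesis using 4 kj k
        by (simp add: T_def B bt_def dl_def \<tau>(1) yv sg_def zl_def)
    next
      case 5
      then have "\<pi> i = j + 2" using kj k by (auto simp: \<pi>_def rot_def)
      then show ?thesis using 5 kj k
        by (simp add: T_def B bt_def dl_def \<tau>(1) yv sg_def zl_def)
    next
      case 6
      then have "\<pi> i = i" using kj k by (auto simp: \<pi>_def rot_def)
      then show ?thesis using 6 kj k
        by (simp add: T_def B bt_def dl_def \<tau>(1) yv sg_def zl_def)
    qed
  qed
  have ab: "j + 2 - k \<le> j + 1" "j + 1 < N" "j + 2 \<le> j + 3" using k lt by auto
  have \<pi>p: "\<pi> permutes {..<N}"
    unfolding \<pi>_def by (rule permutes_compose[OF rot_permutes[OF ab(3) lt] rot_permutes[OF ab(1,2)]])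
  have "(\<Sum>i<N. bt N \<tau> i) = (\<Sum>i<N. T i)" unfolding T\<pi>[symmetric] by (rule sum_permute_Sym[OF \<pi>p])
  also have "\<dots> = (\<Sum>i<N. dl N i) + int ((\<Sum>i<N. j - i) + 2 * (\<Sum>i<N. k - 1 - i) + 2 * k)"
  proof -
    have "(\<Sum>i<N. sg (y 0) (k - 1) i) = k - 1" "(\<Sum>i<N. sg (y 1) 1 i) = 1"
      using y_less[of 0] y_less[of 1] n by (auto simp: sg_def)
    moreover have "T i = dl N i + int ((j - i) + 2 * (k - 1 - i) + 2 * (sg (y 0) (k - 1) i) + 2 * sg (y 1) 1 i)" for i
      by (simp add: T_def B dl_def zl_def)
    ultimately show ?thesis
      using k by (simp add: sum.distrib sum_distrib_left[symmetric] of_nat_sum[symmetric] del: of_nat_sum)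
  qed
  finally have "(\<Sum>i<N. part \<tau> i) = (\<Sum>i<N. j - i) + 2 * (\<Sum>i<N. k - 1 - i) + 2 * k"
    by (simp add: bt_def sum.distrib of_nat_sum[symmetric] del: of_nat_sum)
  then have "2 * sum_list \<tau> = 2 * (\<Sum>i<N. j - i) + 2 * (2 * (\<Sum>i<N. k - 1 - i)) + 4 * k"
    using sum_part[of \<tau> N] \<tau>(2) lt by simp
  also have "\<dots> = j * (j + 1) + 2 * ((k - 1) * k) + 4 * k"
    using sum_staircase[of j N] sum_staircase[of "k - 1" N] kj k by (simp add: N_def)
  also have "\<dots> = 2 * n" unfolding target_size[OF n'] using k by (cases k) (auto simp: algebra_simps)
  finally show \<tau>n: "\<tau> \<in> partitions_of n" using \<tau>(3) by (simp add: partitions_of_def)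
  have "int (m \<tau>) = mh n m N (T \<circ> \<pi>)"
    by (rule mh_eq[OF \<tau>n, symmetric]) (simp_all add: N_def T\<pi>[unfolded N_def])
  also have "T \<circ> \<pi> = (T \<circ> rot (j + 2 - k) (j + 1)) \<circ> rot (j + 2) (j + 3)" by (simp add: \<pi>_def comp_assoc)
  also have "mh n m N \<dots> = - mh n m N (T \<circ> rot (j + 2 - k) (j + 1))"
    using mh_rot[OF ab(3) lt] by simp
  also have "mh n m N (T \<circ> rot (j + 2 - k) (j + 1)) = (-1) ^ (k - 1) * mh n m N T"
    using mh_rot[OF ab(1,2)] kj k by simp
  also have "mh n m N T = G (zl + sg (y 0) (k - 1) + sg (y 1) 1)"
    unfolding G_def by (rule mh_cong) (simp add: T_def)
  finally show "(-1) ^ k * G (zl + sg (y 0) (k - 1) + sg (y 1) 1) = int (m \<tau>)"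
    using k by (cases k) auto
qed

end

theorem corollary5p12:
  fixes k w n :: nat
  assumes "k \<ge> 2" and "w = k * (k + 1) div 2" and "n = w * (2 * w + 1)"
  shows "kronecker n (staircase (2 * w)) (staircase (2 * w))
           (core_extension (2 * w - 1) (staircase (k - 1)) [k - 1, 1]) \<ge> k - 1"
proof -
  define J where "J = 2 * w"
  define j where "j = J - 1"
  let ?\<rho> = "staircase J"
  \<comment> \<open>Multiplicities are taken as dimensions of invariants, so that the positivity at
    \<nu> can be shown by exhibiting one invariant.\<close>
  define m where "m p = cfun.dim (triple_space ?\<rho> ?\<rho> p)" for p
  define \<Phi> where "\<Phi> g = irr_char ?\<rho> g * irr_char ?\<rho> g" for g
  have J: "J = k * k + k" unfolding J_def assms(2) by simp
  have kk2: "k * k \<ge> 2 * k" using assms(1) by simp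
  have jJ: "j + 1 = J" "j + 1 = k * k + k" using kk2 assms(1) J by (auto simp: j_def)
  have size: "n = sum_list ?\<rho>" by (simp add: assms(3) J_def sum_list_staircase)
  have w: "w \<ge> 2" using J kk2 assms(1) unfolding J_def by linarith
  then have n2: "n \<ge> 2" using assms(3) mult_le_mono[of 2 w 1 "2 * w + 1"] by simp
  have \<rho>: "?\<rho> \<in> partitions_of n" using staircase_partition size by (simp add: partitions_of_def)
  have dec: "\<Phi> g = (\<Sum>p\<in>partitions_of n. of_nat (m p) * irr_char p g)" if g: "g permutes {..<n}" for g
  proof (rule class_fun_decomposition[OF _ _ g])
    show "class_fun n \<Phi>"
      using class_fun_irr_char[of ?\<rho> n] size unfolding class_fun_def \<Phi>_def by simp
    fix p assume "p \<in> partitions_of n"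
    then show "(\<Sum>g\<in>Sym n. \<Phi> g * irr_char p g) = fact n * of_nat (m p)"
      unfolding \<Phi>_def m_def by (intro sum_irr_char_triple) (use size partitions_ofD(2) in auto)
  qed
  interpret core_beads n k j m
  proof
    fix \<alpha> :: "nat \<Rightarrow> int" and s :: nat
    assume s: "s \<ge> 1" and \<alpha>: "\<And>i. i < j + 2 * n \<Longrightarrow> \<alpha> i \<ge> 0"
    show "(\<Sum>i<j + 2 * n. mh n m (j + 2 * n) (\<alpha>(i := \<alpha> i + int (2 * s)))) = 0"
    proof (rule mh_relation[OF _ _ dec _ \<alpha>])
      fix l g assume "n = l + 2 * s" "g permutes {..<l}"
      then have "irr_char ?\<rho> (add_cycle l n g) = 0"
        using s by (intro irr_char_staircase_zero[OF size, of l "2 * s"]) auto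
      then show "\<Phi> (add_cycle l n g) = 0" by (simp add: \<Phi>_def)
    qed (use s in auto)
  qed (use assms(1) jJ n2 in auto)
  have nj: "n = sum_list (staircase (j + 1))" using size unfolding jJ(1) .
  obtain \<nu> where \<nu>: "\<nu> \<in> partitions_of n" "\<forall>i. part \<nu> i = (j - i) + 2 * (k - i)"
    "G (zl + ind {..<k}) = int (m \<nu>)"
    by (rule G_ind_eq[OF nj])
  have "m \<nu> \<ge> 1"
  proof -
    have "part \<nu> i = (J - 1 - i) + 2 * (k - i)" for i using \<nu>(2) by (simp add: j_def)
    then obtain t c where "t \<in> tableaux \<nu>" "colstrict \<nu> t c" "\<And>l. card {x. x < n \<and> c x = l} = J - l"
      using staircase_filling[OF \<nu>(1) size J] by metis
    then show ?thesis unfolding m_def by (rule triple_space_staircase[OF size \<nu>(1)])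
  qed
  then have "(int k - 1) * 1 \<le> (int k - 1) * int (m \<nu>)"
    using assms(1) by (intro mult_left_mono) auto
  also have "\<dots> \<le> int (m (core_extension j (staircase (k - 1)) [k - 1, 1]))"
    using G_target_ge unfolding \<nu>(3) G_target_eq(2)[OF nj] .
  also have "m (core_extension j (staircase (k - 1)) [k - 1, 1]) =
      kronecker n ?\<rho> ?\<rho> (core_extension j (staircase (k - 1)) [k - 1, 1])"
    unfolding m_def by (rule kronecker_eq_dim[symmetric]) (use \<rho> G_target_eq(1)[OF nj] in auto)
  finally show ?thesis unfolding J_def j_def by simp
qed

end
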